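(* Let $\Bbbk$ be a commutative ring of characteristic not equal to two and $z\in\Bbbk$. Let $X=X_1\otimes\dotsb\otimes X_m$ be an object of $\mathcal{Q}(z)$ with $X_i\in\{\uparrow,\downarrow\}$. If $r$ is the number of $i\in\{1,\dots,m\}$ such that $X_i=\uparrow$, then $\mathrm{End}_{\mathcal{Q}(z)}(X)\cong\mathrm{BC}_{r,m-r}(z)$ as associative superalgebras.
   Context: Everything is $\Bbbk$-linear. A supercategory is a category enriched in vector superspaces ($\mathbb{Z}/2$-graded $\Bbbk$-modules) with parity-preserving maps; $\bar f$ is the parity of a homogeneous $f$. In a strict monoidal supercategory (unit $\mathbb{1}$, identities $1_X$) the super interchange law holds: $(f'\otimes g)\circ(f\otimes g')=(-1)^{\bar f\bar g}(f'\circ f)\otimes(g\circ g')$. **The supercategory $\mathcal{Q}(z)$** (quantum isomeric supercategory). It is the strict monoidal supercategory generated by objects $\uparrow,\downarrow$; even morphisms $u^+,u^-\colon\uparrow\otimes\uparrow\to\uparrow\otimes\uparrow$, $r^-\colon\uparrow\otimes\downarrow\to\downarrow\otimes\uparrow$, $\mathrm{cap}_L\colon\downarrow\otimes\uparrow\to\mathbb{1}$, $\mathrm{cup}_L\colon\mathbb{1}\to\uparrow\otimes\downarrow$; and an odd morphism $c\colon\uparrow\to\uparrow$; subject to: $u^-u^+=1=u^+u^-$; $l^+r^-=1_{\uparrow\otimes\downarrow}$; $r^-l^+=1_{\downarrow\otimes\uparrow}$; $(u^+\otimes1_\uparrow)(1_\uparrow\otimes u^+)(u^+\otimes1_\uparrow)=(1_\uparrow\otimes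 u^+)(u^+\otimes1_\uparrow)(1_\uparrow\otimes u^+)$; $u^+-u^-=z\,1_{\uparrow\otimes\uparrow}$; $c^2=-1_\uparrow$; $u^+(c\otimes1_\uparrow)=(1_\uparrow\otimes c)u^+$; $\mathrm{cap}_R(c\otimes1_\downarrow)\mathrm{cup}_L=0=\mathrm{cap}_R\,\mathrm{cup}_L$; $(1_\uparrow\otimes\mathrm{cap}_L)(\mathrm{cup}_L\otimes1_\uparrow)=1_\uparrow$; $(\mathrm{cap}_L\otimes1_\downarrow)(1_\downarrow\otimes\mathrm{cup}_L)=1_\downarrow$, where $l^+:=(\mathrm{cap}_L\otimes1_\uparrow\otimes1_\downarrow)(1_\downarrow\otimes u^+\otimes1_\downarrow)(1_\downarrow\otimes1_\uparrow\otimes\mathrm{cup}_L)\colon\downarrow\otimes\uparrow\to\uparrow\otimes\downarrow$ and $\mathrm{cap}_R:=\mathrm{cap}_L\circ r^-\colon\uparrow\otimes\downarrow\to\mathbb{1}$. **The superalgebra $\mathrm{BC}_{r,s}(z)$** (quantum walled Brauer--Clifford superalgebra). For $r,s>0$ it is the associative superalgebra generated by even elements $t_1,\dots,t_{r-1},t_1^*,\dots,t_{s-1}^*,e$ and odd elements $\pi_1,\dots,\pi_r,\pi_1^*,\dots,\pi_s^*$ subject to (for $i,j$ in the allowable range): - $t_i^2=zt_i+1$; $(t_i^* )^2=zt_i^*+1$; $t_it_{i+1}t_i=t_{i+1}t_it_{i+1}$; $t_i^*t_{i+1}^*t_i^*=t_{i+1}^*t_i^*t_{i+1}^*$; $t_it_j=t_jt_i$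 and $t_i^*t_j^*=t_j^*t_i^*$ for $|i-j|>1$; $t_it_j^*=t_j^*t_i$; - $\pi_i^2=-1$; $\pi_i\pi_j=-\pi_j\pi_i$ for $i\ne j$; $(\pi_i^* )^2=1$; $\pi_i^*\pi_j^*=-\pi_j^*\pi_i^*$ for $i\ne j$; $\pi_i\pi_j^*=-\pi_j^*\pi_i$; - $t_i\pi_i=\pi_{i+1}t_i$; $t_i^*\pi_i^*=\pi_{i+1}^*t_i^*$; $t_i\pi_j=\pi_jt_i$ and $t_i^*\pi_j^*=\pi_j^*t_i^*$ for $j\ne i,i+1$; $t_i\pi_j^*=\pi_j^*t_i$; $t_i^*\pi_j=\pi_jt_i^*$; - $e^2=0$; $et_{r-1}e=e$; $et_j=t_je$ for $j\ne r-1$; $et_1^*e=e$; $et_j^*=t_j^*e$ for $j\ne1$; - $\pi_re=\pi_1^*e$; $e\pi_r=e\pi_1^*$; $\pi_je=e\pi_j$ for $j\ne r$; $\pi_j^*e=e\pi_j^*$ for $j\ne1$; - $et_{r-1}^{-1}t_1^*et_1^*t_{r-1}^{-1}=t_{r-1}^{-1}t_1^*et_1^*t_{r-1}^{-1}e$; $e\pi_re=0$. (Note $t_i^{-1}=t_i-z$.) For $r>0$, $\mathrm{BC}_{r,0}(z)$ is the associative superalgebra generated by even elements $t_1,\dots,t_{r-1}$ and odd elements $\pi_1,\dots,\pi_r$ subject to the relations (for $i,j$ in the allowable range) $t_i^2=zt_i+1$; $t_it_{i+1}t_i=t_{i+1}t_it_{i+1}$; $t_it_j=t_jt_i$ for $|i-j|>1$;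 $\pi_i^2=-1$; $\pi_i\pi_j=-\pi_j\pi_i$ for $i\ne j$; $t_i\pi_i=\pi_{i+1}t_i$; $t_i\pi_j=\pi_jt_i$ for $j\ne i,i+1$. For $s>0$, $\mathrm{BC}_{0,s}(z)$ is the associative superalgebra generated by even elements $t_1^*,\dots,t_{s-1}^*$ and odd elements $\pi_1^*,\dots,\pi_s^*$ subject to the relations (for $i,j$ in the allowable range) $(t_i^* )^2=zt_i^*+1$; $t_i^*t_{i+1}^*t_i^*=t_{i+1}^*t_i^*t_{i+1}^*$; $t_i^*t_j^*=t_j^*t_i^*$ for $|i-j|>1$; $(\pi_i^* )^2=1$; $\pi_i^*\pi_j^*=-\pi_j^*\pi_i^*$ for $i\ne j$; $t_i^*\pi_i^*=\pi_{i+1}^*t_i^*$; $t_i^*\pi_j^*=\pi_j^*t_i^*$ for $j\ne i,i+1$. Finally, $\mathrm{BC}_{0,0}(z)=\Bbbk$. *)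

theory Defs
  imports "HOL-Algebra.QuotRing" "HOL-Algebra.Module" "HOL-Library.Z2"
begin

section \<open>Superalgebras\<close>

text \<open>
  The ground ring is a type \<open>'k :: comm_ring_1\<close>.  Parities are elements of \<^typ>\<open>bit\<close>,
  with \<open>0\<close> even and \<open>1\<close> odd; \<open>part A p\<close> is the submodule of homogeneous elements of
  parity \<open>p\<close> (in particular it contains zero).
\<close>

record ('k, 'a) superalg = "('k, 'a) module" +
  part :: "bit \<Rightarrow> 'a set"

definition ground_superalgebra :: "('k::comm_ring_1, 'k) superalg" where
  "ground_superalgebra =
     \<lparr>carrier = UNIV, monoid.mult = (*), one = 1, ring.zero = 0, add = (+),
      smult = (*), part = (\<lambda>p. if p = 0 then UNIV else {0})\<rparr>"

definition superalgebra :: "('k::comm_ring_1, 'a) superalg \<Rightarrow> bool" where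
  "superalgebra A \<longleftrightarrow>
     ring A \<and> module (ground_superalgebra :: ('k, 'k) superalg) A \<and>
     (\<forall>c. \<forall>x\<in>carrier A. \<forall>y\<in>carrier A.
        (c \<odot>\<^bsub>A\<^esub> x) \<otimes>\<^bsub>A\<^esub> y = c \<odot>\<^bsub>A\<^esub> (x \<otimes>\<^bsub>A\<^esub> y) \<and>
        x \<otimes>\<^bsub>A\<^esub> (c \<odot>\<^bsub>A\<^esub> y) = c \<odot>\<^bsub>A\<^esub> (x \<otimes>\<^bsub>A\<^esub> y)) \<and>
     (\<forall>p. submodule (part A p) (ground_superalgebra :: ('k, 'k) superalg) A) \<and>
     (\<forall>x\<in>carrier A. \<exists>!(y0, y1). y0 \<in> part A 0 \<and> y1 \<in> part A 1 \<and> x = y0 \<oplus>\<^bsub>A\<^esub> y1) \<and>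
     \<one>\<^bsub>A\<^esub> \<in> part A 0 \<and>
     (\<forall>p q. \<forall>x\<in>part A p. \<forall>y\<in>part A q. x \<otimes>\<^bsub>A\<^esub> y \<in> part A (p + q))"

definition superalg_iso ::
    "('k::comm_ring_1, 'a) superalg \<Rightarrow> ('k, 'b) superalg \<Rightarrow> ('a \<Rightarrow> 'b) set" where
  "superalg_iso A B = {h \<in> ring_iso A B.
     (\<forall>c. \<forall>x\<in>carrier A. h (c \<odot>\<^bsub>A\<^esub> x) = c \<odot>\<^bsub>B\<^esub> h x) \<and>
     (\<forall>p. h ` part A p = part B p)}"

definition is_superalg_iso ::
    "('k::comm_ring_1, 'a) superalg \<Rightarrow> ('k, 'b) superalg \<Rightarrow> bool" (infixr \<open>\<cong>\<^sub>s\<close> 60) where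
  "A \<cong>\<^sub>s B \<longleftrightarrow> superalg_iso A B \<noteq> {}"

text \<open>
  The superalgebra of \<open>r\<close>-classes of terms in \<open>T\<close>, with operations induced by operations
  on terms; \<open>hg p\<close> is the set of terms that are homogeneous of parity \<open>p\<close>.
\<close>

definition quotient_superalgebra ::
    "'t set \<Rightarrow> ('t \<times> 't) set \<Rightarrow> ('t \<Rightarrow> 't \<Rightarrow> 't) \<Rightarrow> 't \<Rightarrow> ('k \<Rightarrow> 't \<Rightarrow> 't) \<Rightarrow>
     ('t \<Rightarrow> 't \<Rightarrow> 't) \<Rightarrow> 't \<Rightarrow> (bit \<Rightarrow> 't set) \<Rightarrow> ('k::comm_ring_1, 't set) superalg" where
  "quotient_superalgebra T r pl ze sc mu on hg =
     \<lparr>carrier = T // r,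
      monoid.mult = (\<lambda>a b. \<Union>x\<in>a. \<Union>y\<in>b. r `` {mu x y}),
      one = r `` {on},
      ring.zero = r `` {ze},
      add = (\<lambda>a b. \<Union>x\<in>a. \<Union>y\<in>b. r `` {pl x y}),
      smult = (\<lambda>c a. \<Union>x\<in>a. r `` {sc c x}),
      part = (\<lambda>p. (\<lambda>x. r `` {x}) ` hg p)\<rparr>"


section \<open>Superalgebras given by generators and relations\<close>

datatype (dead 'k, agens: 'g) aterm =
    AGen 'g
  | AOne
  | AZero
  | AAdd "('k, 'g) aterm" "('k, 'g) aterm"
  | AScale 'k "('k, 'g) aterm"
  | AMult "('k, 'g) aterm" "('k, 'g) aterm"  (infixr \<open>\<bullet>\<close> 75)

definition aterms :: "'g set \<Rightarrow> ('k, 'g) aterm set" where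
  "aterms G = {t. agens t \<subseteq> G}"

inductive ahomog :: "('g \<Rightarrow> bit) \<Rightarrow> bit \<Rightarrow> ('k, 'g) aterm \<Rightarrow> bool" for par where
  "ahomog par (par g) (AGen g)"
| "ahomog par 0 AOne"
| "ahomog par p AZero"
| "ahomog par p s \<Longrightarrow> ahomog par p t \<Longrightarrow> ahomog par p (AAdd s t)"
| "ahomog par p t \<Longrightarrow> ahomog par p (AScale c t)"
| "ahomog par p s \<Longrightarrow> ahomog par q t \<Longrightarrow> ahomog par (p + q) (s \<bullet> t)"

text \<open>
  The smallest congruence on the terms over \<open>G\<close> that contains \<open>R\<close> and makes the terms an
  associative unital algebra.  A pair of \<open>R\<close> is imposed only if both of its sides are terms
  over \<open>G\<close>.
\<close>

inductive acong ::
    "'g set \<Rightarrow> (('k::comm_ring_1, 'g) aterm \<Rightarrow> ('k, 'g) aterm \<Rightarrow> bool) \<Rightarrow>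
     ('k, 'g) aterm \<Rightarrow> ('k, 'g) aterm \<Rightarrow> bool" for G R where
  acong_rel: "R s t \<Longrightarrow> s \<in> aterms G \<Longrightarrow> t \<in> aterms G \<Longrightarrow> acong G R s t"
| acong_refl: "s \<in> aterms G \<Longrightarrow> acong G R s s"
| acong_sym: "acong G R s t \<Longrightarrow> acong G R t s"
| acong_trans: "acong G R s t \<Longrightarrow> acong G R t u \<Longrightarrow> acong G R s u"
| acong_add_cong: "acong G R s s' \<Longrightarrow> acong G R t t' \<Longrightarrow> acong G R (AAdd s t) (AAdd s' t')"
| acong_scale_cong: "acong G R s s' \<Longrightarrow> acong G R (AScale c s) (AScale c s')"
| acong_mult_cong: "acong G R s s' \<Longrightarrow> acong G R t t' \<Longrightarrow> acong G R (s \<bullet> t) (s' \<bullet> t')"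
| acong_add_assoc: "s \<in> aterms G \<Longrightarrow> t \<in> aterms G \<Longrightarrow> u \<in> aterms G \<Longrightarrow>
    acong G R (AAdd (AAdd s t) u) (AAdd s (AAdd t u))"
| acong_add_commute: "s \<in> aterms G \<Longrightarrow> t \<in> aterms G \<Longrightarrow> acong G R (AAdd s t) (AAdd t s)"
| acong_add_zero: "s \<in> aterms G \<Longrightarrow> acong G R (AAdd AZero s) s"
| acong_add_neg: "s \<in> aterms G \<Longrightarrow> acong G R (AAdd (AScale (- 1) s) s) AZero"
| acong_scale_add_left: "s \<in> aterms G \<Longrightarrow>
    acong G R (AScale (a + b) s) (AAdd (AScale a s) (AScale b s))"
| acong_scale_add_right: "s \<in> aterms G \<Longrightarrow> t \<in> aterms G \<Longrightarrow>
    acong G R (AScale a (AAdd s t)) (AAdd (AScale a s) (AScale a t))"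
| acong_scale_scale: "s \<in> aterms G \<Longrightarrow> acong G R (AScale (a * b) s) (AScale a (AScale b s))"
| acong_scale_one: "s \<in> aterms G \<Longrightarrow> acong G R (AScale 1 s) s"
| acong_mult_add_left: "s \<in> aterms G \<Longrightarrow> t \<in> aterms G \<Longrightarrow> u \<in> aterms G \<Longrightarrow>
    acong G R (AAdd s t \<bullet> u) (AAdd (s \<bullet> u) (t \<bullet> u))"
| acong_mult_add_right: "s \<in> aterms G \<Longrightarrow> t \<in> aterms G \<Longrightarrow> u \<in> aterms G \<Longrightarrow>
    acong G R (u \<bullet> AAdd s t) (AAdd (u \<bullet> s) (u \<bullet> t))"
| acong_mult_scale_left: "s \<in> aterms G \<Longrightarrow> t \<in> aterms G \<Longrightarrow>
    acong G R (AScale a s \<bullet> t) (AScale a (s \<bullet> t))"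
| acong_mult_scale_right: "s \<in> aterms G \<Longrightarrow> t \<in> aterms G \<Longrightarrow>
    acong G R (s \<bullet> AScale a t) (AScale a (s \<bullet> t))"
| acong_mult_assoc: "s \<in> aterms G \<Longrightarrow> t \<in> aterms G \<Longrightarrow> u \<in> aterms G \<Longrightarrow>
    acong G R ((s \<bullet> t) \<bullet> u) (s \<bullet> (t \<bullet> u))"
| acong_mult_one_left: "s \<in> aterms G \<Longrightarrow> acong G R (AOne \<bullet> s) s"
| acong_mult_one_right: "s \<in> aterms G \<Longrightarrow> acong G R (s \<bullet> AOne) s"

definition presented_superalgebra ::
    "'g set \<Rightarrow> ('g \<Rightarrow> bit) \<Rightarrow> (('k::comm_ring_1, 'g) aterm \<Rightarrow> ('k, 'g) aterm \<Rightarrow> bool) \<Rightarrow>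
     ('k, ('k, 'g) aterm set) superalg" where
  "presented_superalgebra G par R =
     quotient_superalgebra (aterms G) {(s, t). acong G R s t}
       AAdd AZero AScale AMult AOne (\<lambda>p. {t \<in> aterms G. ahomog par p t})"


section \<open>Strict monoidal supercategories given by generators and relations\<close>

text \<open>
  Objects are words in the generating objects \<open>'o\<close>, the tensor product of objects is
  concatenation and the unit object is \<open>[]\<close>.  Morphisms are classes of typed terms.
\<close>

record ('o, 'g) supersig =
  gdom :: "'g \<Rightarrow> 'o list"
  gcod :: "'g \<Rightarrow> 'o list"
  gpar :: "'g \<Rightarrow> bit"

datatype ('k, 'o, 'g) mor =
    MGen 'g
  | MId "'o list"
  | MZero "'o list" "'o list"
  | MAdd "('k, 'o, 'g) mor" "('k, 'o, 'g) mor"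
  | MScale 'k "('k, 'o, 'g) mor"
  | MComp "('k, 'o, 'g) mor" "('k, 'o, 'g) mor"  (infixr \<open>\<^bold>\<circ>\<close> 70)
  | MTens "('k, 'o, 'g) mor" "('k, 'o, 'g) mor"  (infixr \<open>\<^bold>\<otimes>\<close> 75)

inductive mor_type ::
    "('o, 'g) supersig \<Rightarrow> 'o list \<Rightarrow> 'o list \<Rightarrow> ('k, 'o, 'g) mor \<Rightarrow> bool" for S where
  "mor_type S (gdom S g) (gcod S g) (MGen g)"
| "mor_type S X X (MId X)"
| "mor_type S X Y (MZero X Y)"
| "mor_type S X Y f \<Longrightarrow> mor_type S X Y g \<Longrightarrow> mor_type S X Y (MAdd f g)"
| "mor_type S X Y f \<Longrightarrow> mor_type S X Y (MScale c f)"
| "mor_type S Y Z f \<Longrightarrow> mor_type S X Y g \<Longrightarrow> mor_type S X Z (f \<^bold>\<circ> g)"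
| "mor_type S X Y f \<Longrightarrow> mor_type S X' Y' g \<Longrightarrow> mor_type S (X @ X') (Y @ Y') (f \<^bold>\<otimes> g)"

inductive mor_homog ::
    "('o, 'g) supersig \<Rightarrow> bit \<Rightarrow> 'o list \<Rightarrow> 'o list \<Rightarrow> ('k, 'o, 'g) mor \<Rightarrow> bool" for S where
  "mor_homog S (gpar S g) (gdom S g) (gcod S g) (MGen g)"
| "mor_homog S 0 X X (MId X)"
| "mor_homog S p X Y (MZero X Y)"
| "mor_homog S p X Y f \<Longrightarrow> mor_homog S p X Y g \<Longrightarrow> mor_homog S p X Y (MAdd f g)"
| "mor_homog S p X Y f \<Longrightarrow> mor_homog S p X Y (MScale c f)"
| "mor_homog S p Y Z f \<Longrightarrow> mor_homog S q X Y g \<Longrightarrow> mor_homog S (p + q) X Z (f \<^bold>\<circ> g)"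
| "mor_homog S p X Y f \<Longrightarrow> mor_homog S q X' Y' g \<Longrightarrow>
    mor_homog S (p + q) (X @ X') (Y @ Y') (f \<^bold>\<otimes> g)"

text \<open>
  The smallest family of congruences on the sets of terms \<open>X \<rightarrow> Y\<close> that contains \<open>R\<close> and
  makes the terms a strict monoidal supercategory.
\<close>

inductive mor_cong ::
    "('o, 'g) supersig \<Rightarrow> (('k::comm_ring_1, 'o, 'g) mor \<Rightarrow> ('k, 'o, 'g) mor \<Rightarrow> bool) \<Rightarrow>
     'o list \<Rightarrow> 'o list \<Rightarrow> ('k, 'o, 'g) mor \<Rightarrow> ('k, 'o, 'g) mor \<Rightarrow> bool" for S R where
  mor_cong_rel: "R f g \<Longrightarrow> mor_type S X Y f \<Longrightarrow> mor_type S X Y g \<Longrightarrow> mor_cong S R X Y f g"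
| mor_cong_refl: "mor_type S X Y f \<Longrightarrow> mor_cong S R X Y f f"
| mor_cong_sym: "mor_cong S R X Y f g \<Longrightarrow> mor_cong S R X Y g f"
| mor_cong_trans: "mor_cong S R X Y f g \<Longrightarrow> mor_cong S R X Y g h \<Longrightarrow> mor_cong S R X Y f h"
| mor_cong_add_cong: "mor_cong S R X Y f f' \<Longrightarrow> mor_cong S R X Y g g' \<Longrightarrow>
    mor_cong S R X Y (MAdd f g) (MAdd f' g')"
| mor_cong_scale_cong: "mor_cong S R X Y f f' \<Longrightarrow> mor_cong S R X Y (MScale c f) (MScale c f')"
| mor_cong_comp_cong: "mor_cong S R Y Z f f' \<Longrightarrow> mor_cong S R X Y g g' \<Longrightarrow>
    mor_cong S R X Z (f \<^bold>\<circ> g) (f' \<^bold>\<circ> g')"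
| mor_cong_tens_cong: "mor_cong S R X Y f f' \<Longrightarrow> mor_cong S R X' Y' g g' \<Longrightarrow>
    mor_cong S R (X @ X') (Y @ Y') (f \<^bold>\<otimes> g) (f' \<^bold>\<otimes> g')"
| mor_cong_add_assoc: "mor_type S X Y f \<Longrightarrow> mor_type S X Y g \<Longrightarrow> mor_type S X Y h \<Longrightarrow>
    mor_cong S R X Y (MAdd (MAdd f g) h) (MAdd f (MAdd g h))"
| mor_cong_add_commute: "mor_type S X Y f \<Longrightarrow> mor_type S X Y g \<Longrightarrow>
    mor_cong S R X Y (MAdd f g) (MAdd g f)"
| mor_cong_add_zero: "mor_type S X Y f \<Longrightarrow> mor_cong S R X Y (MAdd (MZero X Y) f) f"
| mor_cong_add_neg: "mor_type S X Y f \<Longrightarrow> mor_cong S R X Y (MAdd (MScale (- 1) f) f) (MZero X Y)"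
| mor_cong_scale_add_left: "mor_type S X Y f \<Longrightarrow>
    mor_cong S R X Y (MScale (a + b) f) (MAdd (MScale a f) (MScale b f))"
| mor_cong_scale_add_right: "mor_type S X Y f \<Longrightarrow> mor_type S X Y g \<Longrightarrow>
    mor_cong S R X Y (MScale a (MAdd f g)) (MAdd (MScale a f) (MScale a g))"
| mor_cong_scale_scale: "mor_type S X Y f \<Longrightarrow>
    mor_cong S R X Y (MScale (a * b) f) (MScale a (MScale b f))"
| mor_cong_scale_one: "mor_type S X Y f \<Longrightarrow> mor_cong S R X Y (MScale 1 f) f"
| mor_cong_comp_add_left: "mor_type S Y Z f \<Longrightarrow> mor_type S Y Z g \<Longrightarrow> mor_type S X Y h \<Longrightarrow>
    mor_cong S R X Z (MAdd f g \<^bold>\<circ> h) (MAdd (f \<^bold>\<circ> h) (g \<^bold>\<circ> h))"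
| mor_cong_comp_add_right: "mor_type S X Y f \<Longrightarrow> mor_type S X Y g \<Longrightarrow> mor_type S Y Z h \<Longrightarrow>
    mor_cong S R X Z (h \<^bold>\<circ> MAdd f g) (MAdd (h \<^bold>\<circ> f) (h \<^bold>\<circ> g))"
| mor_cong_comp_scale_left: "mor_type S Y Z f \<Longrightarrow> mor_type S X Y g \<Longrightarrow>
    mor_cong S R X Z (MScale a f \<^bold>\<circ> g) (MScale a (f \<^bold>\<circ> g))"
| mor_cong_comp_scale_right: "mor_type S Y Z f \<Longrightarrow> mor_type S X Y g \<Longrightarrow>
    mor_cong S R X Z (f \<^bold>\<circ> MScale a g) (MScale a (f \<^bold>\<circ> g))"
| mor_cong_tens_add_left: "mor_type S X Y f \<Longrightarrow> mor_type S X Y g \<Longrightarrow> mor_type S X' Y' h \<Longrightarrow>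
    mor_cong S R (X @ X') (Y @ Y') (MAdd f g \<^bold>\<otimes> h) (MAdd (f \<^bold>\<otimes> h) (g \<^bold>\<otimes> h))"
| mor_cong_tens_add_right: "mor_type S X' Y' f \<Longrightarrow> mor_type S X' Y' g \<Longrightarrow> mor_type S X Y h \<Longrightarrow>
    mor_cong S R (X @ X') (Y @ Y') (h \<^bold>\<otimes> MAdd f g) (MAdd (h \<^bold>\<otimes> f) (h \<^bold>\<otimes> g))"
| mor_cong_tens_scale_left: "mor_type S X Y f \<Longrightarrow> mor_type S X' Y' g \<Longrightarrow>
    mor_cong S R (X @ X') (Y @ Y') (MScale a f \<^bold>\<otimes> g) (MScale a (f \<^bold>\<otimes> g))"
| mor_cong_tens_scale_right: "mor_type S X Y f \<Longrightarrow> mor_type S X' Y' g \<Longrightarrow>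
    mor_cong S R (X @ X') (Y @ Y') (f \<^bold>\<otimes> MScale a g) (MScale a (f \<^bold>\<otimes> g))"
| mor_cong_comp_assoc: "mor_type S Y Z f \<Longrightarrow> mor_type S X Y g \<Longrightarrow> mor_type S W X h \<Longrightarrow>
    mor_cong S R W Z ((f \<^bold>\<circ> g) \<^bold>\<circ> h) (f \<^bold>\<circ> (g \<^bold>\<circ> h))"
| mor_cong_comp_id_left: "mor_type S X Y f \<Longrightarrow> mor_cong S R X Y (MId Y \<^bold>\<circ> f) f"
| mor_cong_comp_id_right: "mor_type S X Y f \<Longrightarrow> mor_cong S R X Y (f \<^bold>\<circ> MId X) f"
| mor_cong_tens_assoc: "mor_type S X Y f \<Longrightarrow> mor_type S X' Y' g \<Longrightarrow> mor_type S X'' Y'' h \<Longrightarrow>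
    mor_cong S R (X @ X' @ X'') (Y @ Y' @ Y'') ((f \<^bold>\<otimes> g) \<^bold>\<otimes> h) (f \<^bold>\<otimes> (g \<^bold>\<otimes> h))"
| mor_cong_tens_unit_left: "mor_type S X Y f \<Longrightarrow> mor_cong S R X Y (MId [] \<^bold>\<otimes> f) f"
| mor_cong_tens_unit_right: "mor_type S X Y f \<Longrightarrow> mor_cong S R X Y (f \<^bold>\<otimes> MId []) f"
| mor_cong_tens_id: "mor_cong S R (X @ Y) (X @ Y) (MId X \<^bold>\<otimes> MId Y) (MId (X @ Y))"
| mor_cong_super_interchange:
    "mor_homog S p X Y f \<Longrightarrow> mor_homog S q V W g \<Longrightarrow>
     mor_type S Y Z f' \<Longrightarrow> mor_type S U V g' \<Longrightarrow>
     mor_cong S R (X @ U) (Z @ W) ((f' \<^bold>\<otimes> g) \<^bold>\<circ> (f \<^bold>\<otimes> g'))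
       (MScale (if p = 1 \<and> q = 1 then - 1 else 1) ((f' \<^bold>\<circ> f) \<^bold>\<otimes> (g \<^bold>\<circ> g')))"

definition End_superalgebra ::
    "('o, 'g) supersig \<Rightarrow> (('k::comm_ring_1, 'o, 'g) mor \<Rightarrow> ('k, 'o, 'g) mor \<Rightarrow> bool) \<Rightarrow>
     'o list \<Rightarrow> ('k, ('k, 'o, 'g) mor set) superalg" where
  "End_superalgebra S R X =
     quotient_superalgebra {f. mor_type S X X f} {(f, g). mor_cong S R X X f g}
       MAdd (MZero X X) MScale MComp (MId X) (\<lambda>p. {f. mor_homog S p X X f})"


section \<open>The quantum isomeric supercategory\<close>

datatype Q_obj = Up | Down

datatype Q_gen = UPlus | UMinus | RMinus | CapL | CupL | Cl

fun Q_dom :: "Q_gen \<Rightarrow> Q_obj list" where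
  "Q_dom UPlus = [Up, Up]"
| "Q_dom UMinus = [Up, Up]"
| "Q_dom RMinus = [Up, Down]"
| "Q_dom CapL = [Down, Up]"
| "Q_dom CupL = []"
| "Q_dom Cl = [Up]"

fun Q_cod :: "Q_gen \<Rightarrow> Q_obj list" where
  "Q_cod UPlus = [Up, Up]"
| "Q_cod UMinus = [Up, Up]"
| "Q_cod RMinus = [Down, Up]"
| "Q_cod CapL = []"
| "Q_cod CupL = [Up, Down]"
| "Q_cod Cl = [Up]"

definition Q_sig :: "(Q_obj, Q_gen) supersig" where
  "Q_sig = \<lparr>gdom = Q_dom, gcod = Q_cod, gpar = (\<lambda>g. if g = Cl then 1 else 0)\<rparr>"

type_synonym 'k Q_mor = "('k, Q_obj, Q_gen) mor"

abbreviation uplus :: "'k Q_mor" (\<open>u\<^sup>+\<close>) where "u\<^sup>+ \<equiv> MGen UPlus"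
abbreviation uminus :: "'k Q_mor" (\<open>u\<^sup>-\<close>) where "u\<^sup>- \<equiv> MGen UMinus"
abbreviation rminus :: "'k Q_mor" (\<open>r\<^sup>-\<close>) where "r\<^sup>- \<equiv> MGen RMinus"
abbreviation capL :: "'k Q_mor" where "capL \<equiv> MGen CapL"
abbreviation cupL :: "'k Q_mor" where "cupL \<equiv> MGen CupL"
abbreviation cl :: "'k Q_mor" where "cl \<equiv> MGen Cl"
abbreviation id_Up :: "'k Q_mor" (\<open>1\<^sub>\<up>\<close>) where "1\<^sub>\<up> \<equiv> MId [Up]"
abbreviation id_Down :: "'k Q_mor" (\<open>1\<^sub>\<down>\<close>) where "1\<^sub>\<down> \<equiv> MId [Down]"

definition lplus :: "'k Q_mor" (\<open>l\<^sup>+\<close>) where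
  "l\<^sup>+ = (capL \<^bold>\<otimes> 1\<^sub>\<up> \<^bold>\<otimes> 1\<^sub>\<down>) \<^bold>\<circ> (1\<^sub>\<down> \<^bold>\<otimes> u\<^sup>+ \<^bold>\<otimes> 1\<^sub>\<down>) \<^bold>\<circ> (1\<^sub>\<down> \<^bold>\<otimes> 1\<^sub>\<up> \<^bold>\<otimes> cupL)"

definition capR :: "'k Q_mor" where
  "capR = capL \<^bold>\<circ> r\<^sup>-"

inductive Q_rel :: "'k::comm_ring_1 \<Rightarrow> 'k Q_mor \<Rightarrow> 'k Q_mor \<Rightarrow> bool" for z where
  "Q_rel z (u\<^sup>- \<^bold>\<circ> u\<^sup>+) (MId [Up, Up])"
| "Q_rel z (u\<^sup>+ \<^bold>\<circ> u\<^sup>-) (MId [Up, Up])"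
| "Q_rel z (l\<^sup>+ \<^bold>\<circ> r\<^sup>-) (MId [Up, Down])"
| "Q_rel z (r\<^sup>- \<^bold>\<circ> l\<^sup>+) (MId [Down, Up])"
| "Q_rel z ((u\<^sup>+ \<^bold>\<otimes> 1\<^sub>\<up>) \<^bold>\<circ> (1\<^sub>\<up> \<^bold>\<otimes> u\<^sup>+) \<^bold>\<circ> (u\<^sup>+ \<^bold>\<otimes> 1\<^sub>\<up>))
           ((1\<^sub>\<up> \<^bold>\<otimes> u\<^sup>+) \<^bold>\<circ> (u\<^sup>+ \<^bold>\<otimes> 1\<^sub>\<up>) \<^bold>\<circ> (1\<^sub>\<up> \<^bold>\<otimes> u\<^sup>+))"
| "Q_rel z (MAdd u\<^sup>+ (MScale (- 1) u\<^sup>-)) (MScale z (MId [Up, Up]))"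
| "Q_rel z (cl \<^bold>\<circ> cl) (MScale (- 1) 1\<^sub>\<up>)"
| "Q_rel z (u\<^sup>+ \<^bold>\<circ> (cl \<^bold>\<otimes> 1\<^sub>\<up>)) ((1\<^sub>\<up> \<^bold>\<otimes> cl) \<^bold>\<circ> u\<^sup>+)"
| "Q_rel z (capR \<^bold>\<circ> (cl \<^bold>\<otimes> 1\<^sub>\<down>) \<^bold>\<circ> cupL) (MZero [] [])"
| "Q_rel z (capR \<^bold>\<circ> cupL) (MZero [] [])"
| "Q_rel z ((1\<^sub>\<up> \<^bold>\<otimes> capL) \<^bold>\<circ> (cupL \<^bold>\<otimes> 1\<^sub>\<up>)) 1\<^sub>\<up>"
| "Q_rel z ((capL \<^bold>\<otimes> 1\<^sub>\<down>) \<^bold>\<circ> (1\<^sub>\<down> \<^bold>\<otimes> cupL)) 1\<^sub>\<down>"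

definition End_Q :: "'k::comm_ring_1 \<Rightarrow> Q_obj list \<Rightarrow> ('k, 'k Q_mor set) superalg" where
  "End_Q z X = End_superalgebra Q_sig (Q_rel z) X"


section \<open>The quantum walled Brauer--Clifford superalgebras\<close>

datatype BC_gen = GT nat | GTs nat | GE | GPi nat | GPis nat

definition BC_gens :: "nat \<Rightarrow> nat \<Rightarrow> BC_gen set" where
  "BC_gens r s =
     {GT i | i. 1 \<le> i \<and> i < r} \<union> {GTs i | i. 1 \<le> i \<and> i < s} \<union>
     (if r > 0 \<and> s > 0 then {GE} else {}) \<union>
     {GPi i | i. 1 \<le> i \<and> i \<le> r} \<union> {GPis i | i. 1 \<le> i \<and> i \<le> s}"

fun BC_par :: "BC_gen \<Rightarrow> bit" where
  "BC_par (GPi i) = 1"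
| "BC_par (GPis i) = 1"
| "BC_par _ = 0"

type_synonym 'k BC_term = "('k, BC_gen) aterm"

abbreviation bc_t :: "nat \<Rightarrow> 'k BC_term" (\<open>\<t>\<close>) where "\<t> i \<equiv> AGen (GT i)"
abbreviation bc_ts :: "nat \<Rightarrow> 'k BC_term" (\<open>\<t>\<^sup>*\<close>) where "\<t>\<^sup>* i \<equiv> AGen (GTs i)"
abbreviation bc_e :: "'k BC_term" (\<open>\<e>\<close>) where "\<e> \<equiv> AGen GE"
abbreviation bc_pi :: "nat \<Rightarrow> 'k BC_term" (\<open>\<pp>\<close>) where "\<pp> i \<equiv> AGen (GPi i)"
abbreviation bc_pis :: "nat \<Rightarrow> 'k BC_term" (\<open>\<pp>\<^sup>*\<close>) where "\<pp>\<^sup>* i \<equiv> AGen (GPis i)"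

abbreviation bc_tinv :: "'k::comm_ring_1 \<Rightarrow> nat \<Rightarrow> 'k BC_term" where
  "bc_tinv z i \<equiv> AAdd (\<t> i) (AScale (- z) AOne)"

text \<open>
  No index ranges are stated: \<^const>\<open>acong\<close> imposes a relation only if all generators
  occurring in it belong to \<^const>\<open>BC_gens\<close>.  In particular the relations involving
  \<open>\<e>\<close> are imposed only for \<open>r, s > 0\<close>, and those involving \<open>\<t> (r - 1)\<close> only for \<open>r > 1\<close>.
  For \<open>r = s = 0\<close> there are no generators, and one obtains the ground ring
  (lemma \<open>BC_0_0\<close> below).
\<close>

inductive BC_rel :: "'k::comm_ring_1 \<Rightarrow> nat \<Rightarrow> 'k BC_term \<Rightarrow> 'k BC_term \<Rightarrow> bool" for z r where
  "BC_rel z r (\<t> i \<bullet> \<t> i) (AAdd (AScale z (\<t> i)) AOne)"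
| "BC_rel z r (\<t>\<^sup>* i \<bullet> \<t>\<^sup>* i) (AAdd (AScale z (\<t>\<^sup>* i)) AOne)"
| "BC_rel z r (\<t> i \<bullet> \<t> (i + 1) \<bullet> \<t> i) (\<t> (i + 1) \<bullet> \<t> i \<bullet> \<t> (i + 1))"
| "BC_rel z r (\<t>\<^sup>* i \<bullet> \<t>\<^sup>* (i + 1) \<bullet> \<t>\<^sup>* i) (\<t>\<^sup>* (i + 1) \<bullet> \<t>\<^sup>* i \<bullet> \<t>\<^sup>* (i + 1))"
| "\<bar>int i - int j\<bar> > 1 \<Longrightarrow> BC_rel z r (\<t> i \<bullet> \<t> j) (\<t> j \<bullet> \<t> i)"
| "\<bar>int i - int j\<bar> > 1 \<Longrightarrow> BC_rel z r (\<t>\<^sup>* i \<bullet> \<t>\<^sup>* j) (\<t>\<^sup>* j \<bullet> \<t>\<^sup>* i)"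
| "BC_rel z r (\<t> i \<bullet> \<t>\<^sup>* j) (\<t>\<^sup>* j \<bullet> \<t> i)"
| "BC_rel z r (\<pp> i \<bullet> \<pp> i) (AScale (- 1) AOne)"
| "i \<noteq> j \<Longrightarrow> BC_rel z r (\<pp> i \<bullet> \<pp> j) (AScale (- 1) (\<pp> j \<bullet> \<pp> i))"
| "BC_rel z r (\<pp>\<^sup>* i \<bullet> \<pp>\<^sup>* i) AOne"
| "i \<noteq> j \<Longrightarrow> BC_rel z r (\<pp>\<^sup>* i \<bullet> \<pp>\<^sup>* j) (AScale (- 1) (\<pp>\<^sup>* j \<bullet> \<pp>\<^sup>* i))"
| "BC_rel z r (\<pp> i \<bullet> \<pp>\<^sup>* j) (AScale (- 1) (\<pp>\<^sup>* j \<bullet> \<pp> i))"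
| "BC_rel z r (\<t> i \<bullet> \<pp> i) (\<pp> (i + 1) \<bullet> \<t> i)"
| "BC_rel z r (\<t>\<^sup>* i \<bullet> \<pp>\<^sup>* i) (\<pp>\<^sup>* (i + 1) \<bullet> \<t>\<^sup>* i)"
| "j \<noteq> i \<Longrightarrow> j \<noteq> i + 1 \<Longrightarrow> BC_rel z r (\<t> i \<bullet> \<pp> j) (\<pp> j \<bullet> \<t> i)"
| "j \<noteq> i \<Longrightarrow> j \<noteq> i + 1 \<Longrightarrow> BC_rel z r (\<t>\<^sup>* i \<bullet> \<pp>\<^sup>* j) (\<pp>\<^sup>* j \<bullet> \<t>\<^sup>* i)"
| "BC_rel z r (\<t> i \<bullet> \<pp>\<^sup>* j) (\<pp>\<^sup>* j \<bullet> \<t> i)"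
| "BC_rel z r (\<t>\<^sup>* i \<bullet> \<pp> j) (\<pp> j \<bullet> \<t>\<^sup>* i)"
| "BC_rel z r (\<e> \<bullet> \<e>) AZero"
| "BC_rel z r (\<e> \<bullet> \<t> (r - 1) \<bullet> \<e>) \<e>"
| "j \<noteq> r - 1 \<Longrightarrow> BC_rel z r (\<e> \<bullet> \<t> j) (\<t> j \<bullet> \<e>)"
| "BC_rel z r (\<e> \<bullet> \<t>\<^sup>* 1 \<bullet> \<e>) \<e>"
| "j \<noteq> 1 \<Longrightarrow> BC_rel z r (\<e> \<bullet> \<t>\<^sup>* j) (\<t>\<^sup>* j \<bullet> \<e>)"
| "BC_rel z r (\<pp> r \<bullet> \<e>) (\<pp>\<^sup>* 1 \<bullet> \<e>)"
| "BC_rel z r (\<e> \<bullet> \<pp> r) (\<e> \<bullet> \<pp>\<^sup>* 1)"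
| "j \<noteq> r \<Longrightarrow> BC_rel z r (\<pp> j \<bullet> \<e>) (\<e> \<bullet> \<pp> j)"
| "j \<noteq> 1 \<Longrightarrow> BC_rel z r (\<pp>\<^sup>* j \<bullet> \<e>) (\<e> \<bullet> \<pp>\<^sup>* j)"
| "BC_rel z r (\<e> \<bullet> bc_tinv z (r - 1) \<bullet> \<t>\<^sup>* 1 \<bullet> \<e> \<bullet> \<t>\<^sup>* 1 \<bullet> bc_tinv z (r - 1))
              (bc_tinv z (r - 1) \<bullet> \<t>\<^sup>* 1 \<bullet> \<e> \<bullet> \<t>\<^sup>* 1 \<bullet> bc_tinv z (r - 1) \<bullet> \<e>)"
| "BC_rel z r (\<e> \<bullet> \<pp> r \<bullet> \<e>) AZero"

definition BC :: "'k::comm_ring_1 \<Rightarrow> nat \<Rightarrow> nat \<Rightarrow> ('k, 'k BC_term set) superalg" where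
  "BC z r s = presented_superalgebra (BC_gens r s) BC_par (BC_rel z r)"

section \<open>Both sides are superalgebras\<close>

text \<open>
  The relations are homogeneous, so \<^const>\<open>part\<close> is a grading on the quotients;
  moreover, the presentation without generators is the ground ring.
\<close>

declare add_bit_eq_xor [simp del] mult_bit_eq_and [simp del]

lemma bit_add_simps [simp]: "(p :: bit) + p = 0" "(p :: bit) + (p + q) = q" "(p :: bit) + q + q = p"
  by (cases p; cases q; simp add: add_bit_eq_xor)+

lemma bit_cases [case_names even odd]:
  obtains "(p :: bit) = 0" | "p = 1"
  by (cases p) auto

locale graded_congruence =
  fixes T :: "'t set" and r pl ze and sc :: "'k::comm_ring_1 \<Rightarrow> 't \<Rightarrow> 't" and mu on and hg :: "bit \<Rightarrow> 't set"
  assumes equiv: "equiv T r"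
    and ze: "ze \<in> T" and on: "on \<in> T"
    and pl: "\<And>x x' y y'. (x, x') \<in> r \<Longrightarrow> (y, y') \<in> r \<Longrightarrow> (pl x y, pl x' y') \<in> r"
    and mu: "\<And>x x' y y'. (x, x') \<in> r \<Longrightarrow> (y, y') \<in> r \<Longrightarrow> (mu x y, mu x' y') \<in> r"
    and sc: "\<And>c x x'. (x, x') \<in> r \<Longrightarrow> (sc c x, sc c x') \<in> r"
    and pl_assoc: "\<And>x y w. x \<in> T \<Longrightarrow> y \<in> T \<Longrightarrow> w \<in> T \<Longrightarrow> (pl (pl x y) w, pl x (pl y w)) \<in> r"
    and pl_commute: "\<And>x y. x \<in> T \<Longrightarrow> y \<in> T \<Longrightarrow> (pl x y, pl y x) \<in> r"
    and pl_ze: "\<And>x. x \<in> T \<Longrightarrow> (pl ze x, x) \<in> r"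
    and pl_neg: "\<And>x. x \<in> T \<Longrightarrow> (pl (sc (- 1) x) x, ze) \<in> r"
    and sc_add: "\<And>a b x. x \<in> T \<Longrightarrow> (sc (a + b) x, pl (sc a x) (sc b x)) \<in> r"
    and sc_pl: "\<And>a x y. x \<in> T \<Longrightarrow> y \<in> T \<Longrightarrow> (sc a (pl x y), pl (sc a x) (sc a y)) \<in> r"
    and sc_sc: "\<And>a b x. x \<in> T \<Longrightarrow> (sc (a * b) x, sc a (sc b x)) \<in> r"
    and sc_1: "\<And>x. x \<in> T \<Longrightarrow> (sc 1 x, x) \<in> r"
    and mu_pl: "\<And>x y w. x \<in> T \<Longrightarrow> y \<in> T \<Longrightarrow> w \<in> T \<Longrightarrow> (mu (pl x y) w, pl (mu x w) (mu y w)) \<in> r"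
    and pl_mu: "\<And>x y w. x \<in> T \<Longrightarrow> y \<in> T \<Longrightarrow> w \<in> T \<Longrightarrow> (mu w (pl x y), pl (mu w x) (mu w y)) \<in> r"
    and mu_sc: "\<And>a x y. x \<in> T \<Longrightarrow> y \<in> T \<Longrightarrow> (mu (sc a x) y, sc a (mu x y)) \<in> r"
    and sc_mu: "\<And>a x y. x \<in> T \<Longrightarrow> y \<in> T \<Longrightarrow> (mu x (sc a y), sc a (mu x y)) \<in> r"
    and mu_assoc: "\<And>x y w. x \<in> T \<Longrightarrow> y \<in> T \<Longrightarrow> w \<in> T \<Longrightarrow> (mu (mu x y) w, mu x (mu y w)) \<in> r"
    and mu_on: "\<And>x. x \<in> T \<Longrightarrow> (mu x on, x) \<in> r"
    and on_mu: "\<And>x. x \<in> T \<Longrightarrow> (mu on x, x) \<in> r"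
    and hg_T: "\<And>p x. x \<in> hg p \<Longrightarrow> x \<in> T"
    and hg_ze: "\<And>p. ze \<in> hg p"
    and hg_on: "on \<in> hg 0"
    and hg_pl: "\<And>p x y. x \<in> hg p \<Longrightarrow> y \<in> hg p \<Longrightarrow> pl x y \<in> hg p"
    and hg_sc: "\<And>p a x. x \<in> hg p \<Longrightarrow> sc a x \<in> hg p"
    and hg_mu: "\<And>p q x y. x \<in> hg p \<Longrightarrow> y \<in> hg q \<Longrightarrow> mu x y \<in> hg (p + q)"
    and split: "\<And>x. x \<in> T \<Longrightarrow> \<exists>x0\<in>hg 0. \<exists>x1\<in>hg 1. (x, pl x0 x1) \<in> r"
    and indep: "\<And>x0 x1. x0 \<in> hg 0 \<Longrightarrow> x1 \<in> hg 1 \<Longrightarrow> (pl x0 x1, ze) \<in> r \<Longrightarrow>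
      (x0, ze) \<in> r \<and> (x1, ze) \<in> r"
begin

definition A where "A = quotient_superalgebra T r pl ze sc mu on hg"
definition cl where "cl x = r `` {x}"

lemma r_T: "(x, y) \<in> r \<Longrightarrow> x \<in> T \<and> y \<in> T"
  using equiv by (meson equiv_class_eq_iff)

lemma r_refl: "x \<in> T \<Longrightarrow> (x, x) \<in> r"
  using equiv by (auto simp: equiv_def refl_on_def)

lemma pl_T [simp]: "x \<in> T \<Longrightarrow> y \<in> T \<Longrightarrow> pl x y \<in> T"
  and mu_T [simp]: "x \<in> T \<Longrightarrow> y \<in> T \<Longrightarrow> mu x y \<in> T"
  and sc_T [simp]: "x \<in> T \<Longrightarrow> sc a x \<in> T"
  using r_T[OF pl[OF r_refl r_refl]] r_T[OF mu[OF r_refl r_refl]] r_T[OF sc[OF r_refl]] by auto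

lemma cl_eqI: "(x, y) \<in> r \<Longrightarrow> cl x = cl y"
  unfolding cl_def using equiv by (rule equiv_class_eq)

lemma cl_eq_iff: "x \<in> T \<Longrightarrow> y \<in> T \<Longrightarrow> cl x = cl y \<longleftrightarrow> (x, y) \<in> r"
  unfolding cl_def using equiv by (simp add: eq_equiv_class_iff)

lemma carrier_A: "carrier A = cl ` T"
  by (auto simp: A_def quotient_superalgebra_def cl_def quotient_def)

lemma UN2:
  assumes "\<And>x x' y y'. (x, x') \<in> r \<Longrightarrow> (y, y') \<in> r \<Longrightarrow> (f x y, f x' y') \<in> r" "x \<in> T" "y \<in> T"
  shows "(\<Union>u\<in>cl x. \<Union>v\<in>cl y. r `` {f u v}) = cl (f x y)"
proof -
  have "r `` {f u v} = cl (f x y)" if "u \<in> cl x" "v \<in> cl y" for u v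
    using that assms(1)[of x u y v] cl_eqI[of "f x y" "f u v"] by (auto simp: cl_def)
  moreover have "x \<in> cl x" "y \<in> cl y" using assms r_refl by (auto simp: cl_def)
  ultimately show ?thesis by auto
qed

lemma UN1:
  assumes "\<And>x x'. (x, x') \<in> r \<Longrightarrow> (f x, f x') \<in> r" "x \<in> T"
  shows "(\<Union>u\<in>cl x. r `` {f u}) = cl (f x)"
proof -
  have "r `` {f u} = cl (f x)" if "u \<in> cl x" for u
    using that assms(1)[of x u] cl_eqI[of "f x" "f u"] by (auto simp: cl_def)
  moreover have "x \<in> cl x" using assms r_refl by (auto simp: cl_def)
  ultimately show ?thesis by auto
qed

lemma add_A [simp]: "x \<in> T \<Longrightarrow> y \<in> T \<Longrightarrow> cl x \<oplus>\<^bsub>A\<^esub> cl y = cl (pl x y)"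
  using UN2[of pl, OF pl] by (simp add: A_def quotient_superalgebra_def)
lemma mult_A [simp]: "x \<in> T \<Longrightarrow> y \<in> T \<Longrightarrow> cl x \<otimes>\<^bsub>A\<^esub> cl y = cl (mu x y)"
  using UN2[of mu, OF mu] by (simp add: A_def quotient_superalgebra_def)
lemma smult_A [simp]: "x \<in> T \<Longrightarrow> c \<odot>\<^bsub>A\<^esub> cl x = cl (sc c x)"
  using UN1[of "sc c", OF sc] by (simp add: A_def quotient_superalgebra_def)
lemma zero_A: "\<zero>\<^bsub>A\<^esub> = cl ze" and one_A: "\<one>\<^bsub>A\<^esub> = cl on" and part_A: "part A p = cl ` hg p"
  by (simp_all add: A_def quotient_superalgebra_def cl_def)

lemma cring_ground: "cring (ground_superalgebra :: ('k, 'k) superalg)"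
proof -
  have "\<exists>y. y + x = 0" "\<exists>y. x + y = 0" for x :: 'k
    by (metis add.left_inverse) (metis add.right_inverse)
  then show ?thesis
    unfolding ground_superalgebra_def
    by unfold_locales (auto simp: algebra_simps Units_def)
qed

lemma abelian_group_A: "abelian_group A"
proof (rule abelian_groupI)
  fix x assume "x \<in> carrier A"
  then obtain u where u: "u \<in> T" "x = cl u" by (auto simp: carrier_A)
  show "\<exists>y\<in>carrier A. y \<oplus>\<^bsub>A\<^esub> x = \<zero>\<^bsub>A\<^esub>"
    using u by (intro bexI[of _ "cl (sc (- 1) u)"]) (auto simp: carrier_A zero_A simp: pl_neg[THEN cl_eqI])
next
  show "x \<oplus>\<^bsub>A\<^esub> y = y \<oplus>\<^bsub>A\<^esub> x" if "x \<in> carrier A" "y \<in> carrier A" for x y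
    using that pl_commute[THEN cl_eqI] unfolding carrier_A by (elim imageE) simp
qed (auto simp: carrier_A zero_A ze pl_assoc[THEN cl_eqI] pl_ze[THEN cl_eqI])

lemma ring_A: "ring A"
  by (intro ringI abelian_group_A monoidI)
    (auto simp: carrier_A one_A on mu_assoc[THEN cl_eqI] mu_on[THEN cl_eqI] on_mu[THEN cl_eqI]
      mu_pl[THEN cl_eqI] pl_mu[THEN cl_eqI])

lemma module_A: "module (ground_superalgebra :: ('k, 'k) superalg) A"
  by (intro moduleI cring_ground abelian_group_A)
    (auto simp: carrier_A ground_superalgebra_def sc_add[THEN cl_eqI] sc_pl[THEN cl_eqI]
      sc_sc[THEN cl_eqI] sc_1[THEN cl_eqI])

lemma decomp_unique:
  assumes "x0 \<in> hg 0" "y0 \<in> hg 0" "x1 \<in> hg 1" "y1 \<in> hg 1"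
    and eq: "cl (pl x0 x1) = cl (pl y0 y1)"
  shows "cl x0 = cl y0 \<and> cl x1 = cl y1"
proof -
  interpret ring A by (rule ring_A)
  have T: "x0 \<in> T" "x1 \<in> T" "y0 \<in> T" "y1 \<in> T" using assms by (auto intro: hg_T)
  have neg: "cl (sc (- 1) u) = \<ominus>\<^bsub>A\<^esub> cl u" if "u \<in> T" for u
  proof -
    have "cl (sc (- 1) u) \<oplus>\<^bsub>A\<^esub> cl u = \<zero>\<^bsub>A\<^esub>" using that by (simp add: zero_A cl_eqI pl_neg)
    then show ?thesis using that by (intro minus_equality[symmetric]) (auto simp: carrier_A)
  qed
  let ?d0 = "pl x0 (sc (- 1) y0)" and ?d1 = "pl x1 (sc (- 1) y1)"
  have C: "cl x0 \<in> carrier A" "cl x1 \<in> carrier A" "cl y0 \<in> carrier A" "cl y1 \<in> carrier A"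
    using T by (auto simp: carrier_A)
  have e: "cl x0 \<oplus>\<^bsub>A\<^esub> cl x1 = cl y0 \<oplus>\<^bsub>A\<^esub> cl y1" using eq T by simp
  have "cl (pl ?d0 ?d1) = (cl x0 \<oplus>\<^bsub>A\<^esub> (\<ominus>\<^bsub>A\<^esub> cl y0)) \<oplus>\<^bsub>A\<^esub> (cl x1 \<oplus>\<^bsub>A\<^esub> (\<ominus>\<^bsub>A\<^esub> cl y1))"
    using T by (simp flip: neg)
  also have "\<dots> = (cl x0 \<oplus>\<^bsub>A\<^esub> cl x1) \<oplus>\<^bsub>A\<^esub> (\<ominus>\<^bsub>A\<^esub> (cl y0 \<oplus>\<^bsub>A\<^esub> cl y1))"
    using C by (simp add: minus_add a_ac)
  also have "\<dots> = \<zero>\<^bsub>A\<^esub>" unfolding e using C by (intro r_neg) auto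
  finally have "(pl ?d0 ?d1, ze) \<in> r" using T ze by (simp add: zero_A cl_eq_iff)
  then have "(?d0, ze) \<in> r \<and> (?d1, ze) \<in> r"
    by (intro indep hg_pl hg_sc assms)
  then have "cl ?d0 = \<zero>\<^bsub>A\<^esub>" "cl ?d1 = \<zero>\<^bsub>A\<^esub>" by (auto simp: zero_A cl_eqI)
  then have "cl x0 \<oplus>\<^bsub>A\<^esub> (\<ominus>\<^bsub>A\<^esub> cl y0) = \<zero>\<^bsub>A\<^esub>" "cl x1 \<oplus>\<^bsub>A\<^esub> (\<ominus>\<^bsub>A\<^esub> cl y1) = \<zero>\<^bsub>A\<^esub>"
    using T by (simp_all flip: neg)
  then show ?thesis using C by (metis a_inv_closed minus_equality minus_minus)
qed

lemma superalgebra_A: "superalgebra A"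
  unfolding superalgebra_def
proof (intro conjI allI ballI)
  show "ring A" "module (ground_superalgebra :: ('k, 'k) superalg) A"
    by (rule ring_A module_A)+
  show "submodule (part A p) (ground_superalgebra :: ('k, 'k) superalg) A" for p
  proof (rule module.submoduleI[OF module_A])
    show "\<ominus>\<^bsub>A\<^esub> a \<in> part A p" if "a \<in> part A p" for a
    proof -
      interpret ring A by (rule ring_A)
      from that obtain u where u: "u \<in> hg p" "a = cl u" by (auto simp: part_A)
      have "cl (sc (- 1) u) \<oplus>\<^bsub>A\<^esub> a = \<zero>\<^bsub>A\<^esub>" using u hg_T by (simp add: zero_A cl_eqI pl_neg)
      then have "\<ominus>\<^bsub>A\<^esub> a = cl (sc (- 1) u)"
        using u hg_T by (intro minus_equality) (auto simp: carrier_A)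
      then show ?thesis using u hg_sc by (auto simp: part_A)
    qed
  qed (use hg_T hg_ze hg_pl hg_sc in \<open>auto simp: part_A carrier_A zero_A\<close>)
  show "\<exists>!(y0, y1). y0 \<in> part A 0 \<and> y1 \<in> part A 1 \<and> x = y0 \<oplus>\<^bsub>A\<^esub> y1" if "x \<in> carrier A" for x
  proof -
    from that obtain u where u: "u \<in> T" "x = cl u" by (auto simp: carrier_A)
    from split[OF u(1)] obtain u0 u1 where s: "u0 \<in> hg 0" "u1 \<in> hg 1" "(u, pl u0 u1) \<in> r" by blast
    have x: "x = cl (pl u0 u1)" using s u cl_eqI by simp
    show ?thesis
    proof (rule ex1I[of _ "(cl u0, cl u1)"])
      show "case (cl u0, cl u1) of (y0, y1) \<Rightarrow> y0 \<in> part A 0 \<and> y1 \<in> part A 1 \<and> x = y0 \<oplus>\<^bsub>A\<^esub> y1"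
        using s x hg_T by (auto simp: part_A)
    next
      fix y assume "case y of (y0, y1) \<Rightarrow> y0 \<in> part A 0 \<and> y1 \<in> part A 1 \<and> x = y0 \<oplus>\<^bsub>A\<^esub> y1"
      then obtain v0 v1 where v: "y = (cl v0, cl v1)" "v0 \<in> hg 0" "v1 \<in> hg 1" "x = cl v0 \<oplus>\<^bsub>A\<^esub> cl v1"
        by (auto simp: part_A)
      then have "x = cl (pl v0 v1)" using hg_T by simp
      with x have "cl (pl v0 v1) = cl (pl u0 u1)" by simp
      from decomp_unique[OF v(2) s(1) v(3) s(2) this] show "y = (cl u0, cl u1)" using v by simp
    qed
  qed
  show "x \<otimes>\<^bsub>A\<^esub> y \<in> part A (p + q)" if "x \<in> part A p" "y \<in> part A q" for p q x y
  proof -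
    from that obtain u v where uv: "x = cl u" "y = cl v" "u \<in> hg p" "v \<in> hg q"
      unfolding part_A by blast
    then have "x \<otimes>\<^bsub>A\<^esub> y = cl (mu u v)" by (simp add: hg_T)
    then show ?thesis unfolding part_A using hg_mu[OF uv(3,4)] by (rule image_eqI)
  qed
qed (use hg_T hg_on in \<open>auto simp: carrier_A part_A one_A mu_sc[THEN cl_eqI] sc_mu[THEN cl_eqI]\<close>)

end

lemma aterms_simps [simp]:
  "AGen g \<in> aterms G \<longleftrightarrow> g \<in> G" "AOne \<in> aterms G" "AZero \<in> aterms G"
  "AAdd s t \<in> aterms G \<longleftrightarrow> s \<in> aterms G \<and> t \<in> aterms G"
  "AScale c s \<in> aterms G \<longleftrightarrow> s \<in> aterms G"
  "s \<bullet> t \<in> aterms G \<longleftrightarrow> s \<in> aterms G \<and> t \<in> aterms G"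
  by (auto simp: aterms_def)

lemma acong_aterms: "acong G R s t \<Longrightarrow> s \<in> aterms G \<and> t \<in> aterms G"
  by (induction rule: acong.induct) auto


primrec apart :: "('g \<Rightarrow> bit) \<Rightarrow> ('k, 'g) aterm \<Rightarrow> bit \<Rightarrow> ('k, 'g) aterm" where
  "apart par (AGen g) p = (if p = par g then AGen g else AZero)"
| "apart par AOne p = (if p = 0 then AOne else AZero)"
| "apart par AZero p = AZero"
| "apart par (AAdd s t) p = AAdd (apart par s p) (apart par t p)"
| "apart par (AScale c s) p = AScale c (apart par s p)"
| "apart par (s \<bullet> t) p =
     AAdd (apart par s 0 \<bullet> apart par t p) (apart par s 1 \<bullet> apart par t (p + 1))"

context
  fixes G :: "'g set" and R :: "('k::comm_ring_1, 'g) aterm \<Rightarrow> ('k, 'g) aterm \<Rightarrow> bool"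
begin

abbreviation aeq (infix \<open>\<approx>\<close> 50) where "s \<approx> t \<equiv> acong G R s t"

lemmas [trans] = acong_trans
lemmas acong_ax = acong_refl acong_add_cong acong_scale_cong acong_mult_cong acong_add_assoc
  acong_add_commute acong_add_zero acong_add_neg acong_scale_add_left acong_scale_add_right
  acong_scale_scale acong_scale_one acong_mult_add_left acong_mult_add_right acong_mult_scale_left
  acong_mult_scale_right acong_mult_assoc acong_mult_one_left acong_mult_one_right
lemmas acongs = acong_add_cong acong_scale_cong acong_mult_cong

lemma acong_add_zero_right: "s \<in> aterms G \<Longrightarrow> AAdd s AZero \<approx> s"
  by (rule acong_trans[OF acong_add_commute acong_add_zero]) auto

lemma acong_add_zero_cong: "s \<approx> AZero \<Longrightarrow> t \<approx> t' \<Longrightarrow> AAdd s t \<approx> t'"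
  by (rule acong_trans[OF acong_add_cong acong_add_zero]) (auto dest: acong_aterms)

lemma acong_add_zero_right_cong: "s \<approx> s' \<Longrightarrow> t \<approx> AZero \<Longrightarrow> AAdd s t \<approx> s'"
  by (rule acong_trans[OF acong_add_cong acong_add_zero_right]) (auto dest: acong_aterms)

lemma acong_add_left_cancel:
  assumes "AAdd s t \<approx> s" "s \<in> aterms G" "t \<in> aterms G"
  shows "t \<approx> AZero"
proof -
  let ?n = "AScale (- 1) s"
  have "t \<approx> AAdd AZero t" by (simp add: acong_sym acong_add_zero assms)
  also have "\<dots> \<approx> AAdd (AAdd ?n s) t"
    by (intro acongs acong_refl acong_sym[OF acong_add_neg] assms)
  also have "\<dots> \<approx> AAdd ?n (AAdd s t)" by (rule acong_add_assoc) (use assms in auto)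
  also have "\<dots> \<approx> AAdd ?n s" by (intro acongs acong_refl) (use assms in auto)
  also have "\<dots> \<approx> AZero" by (rule acong_add_neg) fact
  finally show ?thesis .
qed

lemma acong_scale_zero: "AScale c AZero \<approx> AZero"
proof (rule acong_add_left_cancel)
  have "AAdd (AScale c AZero) (AScale c AZero) \<approx> AScale c (AAdd AZero AZero)"
    by (intro acong_sym[OF acong_scale_add_right]) auto
  also have "\<dots> \<approx> AScale c AZero" by (intro acongs acong_add_zero) auto
  finally show "AAdd (AScale c AZero) (AScale c AZero) \<approx> AScale c AZero" .
qed auto

lemma acong_mult_zero_left: "s \<in> aterms G \<Longrightarrow> AZero \<bullet> s \<approx> AZero"
proof (rule acong_add_left_cancel)
  assume s: "s \<in> aterms G"
  have "AAdd (AZero \<bullet> s) (AZero \<bullet> s) \<approx> AAdd AZero AZero \<bullet> s"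
    by (intro acong_sym[OF acong_mult_add_left]) (use s in auto)
  also have "\<dots> \<approx> AZero \<bullet> s" by (intro acongs acong_refl acong_add_zero) (use s in auto)
  finally show "AAdd (AZero \<bullet> s) (AZero \<bullet> s) \<approx> AZero \<bullet> s" .
qed auto

lemma acong_mult_zero_right: "s \<in> aterms G \<Longrightarrow> s \<bullet> AZero \<approx> AZero"
proof (rule acong_add_left_cancel)
  assume s: "s \<in> aterms G"
  have "AAdd (s \<bullet> AZero) (s \<bullet> AZero) \<approx> s \<bullet> AAdd AZero AZero"
    by (intro acong_sym[OF acong_mult_add_right]) (use s in auto)
  also have "\<dots> \<approx> s \<bullet> AZero" by (intro acongs acong_refl acong_add_zero) (use s in auto)
  finally show "AAdd (s \<bullet> AZero) (s \<bullet> AZero) \<approx> s \<bullet> AZero" .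
qed auto

lemma acong_add_swap:
  assumes "s \<in> aterms G" "t \<in> aterms G" "u \<in> aterms G" "v \<in> aterms G"
  shows "AAdd (AAdd s t) (AAdd u v) \<approx> AAdd (AAdd s u) (AAdd t v)"
proof -
  have "AAdd (AAdd s t) (AAdd u v) \<approx> AAdd s (AAdd t (AAdd u v))"
    by (rule acong_add_assoc) (use assms in auto)
  also have "\<dots> \<approx> AAdd s (AAdd (AAdd t u) v)"
    by (intro acongs acong_refl acong_sym[OF acong_add_assoc]) (use assms in auto)
  also have "\<dots> \<approx> AAdd s (AAdd (AAdd u t) v)"
    by (intro acongs acong_refl acong_add_commute) (use assms in auto)
  also have "\<dots> \<approx> AAdd s (AAdd u (AAdd t v))"
    by (intro acongs acong_refl acong_add_assoc) (use assms in auto)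
  also have "\<dots> \<approx> AAdd (AAdd s u) (AAdd t v)"
    by (intro acong_sym[OF acong_add_assoc]) (use assms in auto)
  finally show ?thesis .
qed

lemma acong_zero_zero: "AAdd AZero AZero \<approx> AZero"
  by (rule acong_add_zero) simp

lemma apart_aterms [simp]: "s \<in> aterms G \<Longrightarrow> apart par s p \<in> aterms G"
  by (induction s arbitrary: p) auto

lemma apart_homog:
  assumes "ahomog par p s" "s \<in> aterms G"
  shows "apart par s q \<approx> (if q = p then s else AZero)"
  using assms
proof (induction arbitrary: q rule: ahomog.induct)
  case (1 g) then show ?case by (auto intro!: acong_refl)
next
  case 2 then show ?case by (auto intro!: acong_refl)
next
  case (3 p) then show ?case by (auto intro!: acong_refl)
next
  case (4 p s t)
  then show ?case
    using acong_add_cong[OF "4.IH"(1)[of q] "4.IH"(2)[of q]] acong_trans[OF _ acong_zero_zero]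
    by (auto split: if_splits)
next
  case (5 p s c)
  then show ?case
    using acong_scale_cong[OF "5.IH"[of q], of c] acong_trans[OF _ acong_scale_zero]
    by (auto split: if_splits)
next
  case (6 p s p' t)
  have T: "s \<in> aterms G" "t \<in> aterms G" using 6 by auto
  have z: "apart par s a \<bullet> apart par t b \<approx> AZero" if "a \<noteq> p \<or> b \<noteq> p'" for a b
    using that
  proof
    assume "a \<noteq> p"
    with "6.IH"(1)[of a] T have "apart par s a \<approx> AZero" by simp
    from acong_mult_cong[OF this acong_refl] show ?thesis
      by (rule acong_trans) (use T in \<open>auto intro: acong_mult_zero_left\<close>)
  next
    assume "b \<noteq> p'"
    with "6.IH"(2)[of b] T have "apart par t b \<approx> AZero" by simp
    from acong_mult_cong[OF acong_refl this] show ?thesis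
      by (rule acong_trans) (use T in \<open>auto intro: acong_mult_zero_right\<close>)
  qed
  have n: "apart par s p \<bullet> apart par t p' \<approx> s \<bullet> t"
    using acong_mult_cong[OF "6.IH"(1)[of p] "6.IH"(2)[of p']] T by simp
  show ?case
  proof (cases "q = p + p'")
    case True
    show ?thesis
    proof (cases p rule: bit_cases)
      case even
      then show ?thesis using True z n by (auto intro!: acong_add_zero_right_cong)
    next
      case odd
      then show ?thesis using True z n by (auto intro!: acong_add_zero_cong simp: add.commute add.left_commute)
    qed
  next
    case False
    then have "0 \<noteq> p \<or> q \<noteq> p'" "1 \<noteq> p \<or> q + 1 \<noteq> p'"
      by (cases p; cases q; cases p'; simp add: add_bit_eq_xor)+
    with False z show ?thesis by (auto intro!: acong_add_zero_cong)
  qed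
qed

lemma apart_split: "s \<in> aterms G \<Longrightarrow> s \<approx> AAdd (apart par s 0) (apart par s 1)"
proof (induction s)
  case (AGen g) then show ?case
    by (cases "par g") (auto intro!: acong_sym[OF acong_add_zero_right] acong_sym[OF acong_add_zero])
next
  case AOne then show ?case by (auto intro!: acong_sym[OF acong_add_zero_right])
next
  case AZero then show ?case by (auto intro!: acong_sym[OF acong_add_zero_right])
next
  case (AAdd s t)
  have "AAdd s t \<approx> AAdd (AAdd (apart par s 0) (apart par s 1)) (AAdd (apart par t 0) (apart par t 1))"
    using AAdd by (auto intro: acongs)
  also have "\<dots> \<approx> AAdd (apart par (AAdd s t) 0) (apart par (AAdd s t) 1)"
    using AAdd by (auto intro!: acong_add_swap)
  finally show ?case .
next
  case (AScale c s)
  have "AScale c s \<approx> AScale c (AAdd (apart par s 0) (apart par s 1))"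
    using AScale by (auto intro: acongs)
  also have "\<dots> \<approx> AAdd (apart par (AScale c s) 0) (apart par (AScale c s) 1)"
    using AScale by (auto intro!: acong_scale_add_right)
  finally show ?case .
next
  case (AMult s t)
  let ?s = "apart par s" and ?t = "apart par t"
  have T: "s \<in> aterms G" "t \<in> aterms G" using AMult by auto
  have "s \<bullet> t \<approx> AAdd (?s 0) (?s 1) \<bullet> AAdd (?t 0) (?t 1)"
    using AMult by (auto intro: acongs)
  also have "\<dots> \<approx> AAdd (?s 0 \<bullet> AAdd (?t 0) (?t 1)) (?s 1 \<bullet> AAdd (?t 0) (?t 1))"
    using T by (auto intro!: acong_mult_add_left)
  also have "\<dots> \<approx> AAdd (?s 0 \<bullet> AAdd (?t 0) (?t 1)) (?s 1 \<bullet> AAdd (?t 1) (?t 0))"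
    using T by (auto intro!: acongs acong_refl acong_add_commute)
  also have "\<dots> \<approx> AAdd (AAdd (?s 0 \<bullet> ?t 0) (?s 0 \<bullet> ?t 1)) (AAdd (?s 1 \<bullet> ?t 1) (?s 1 \<bullet> ?t 0))"
    using T by (auto intro!: acongs acong_mult_add_right)
  also have "\<dots> \<approx> AAdd (apart par (s \<bullet> t) 0) (apart par (s \<bullet> t) 1)"
    using T by (auto intro!: acong_add_swap)
  finally show ?case .
qed

lemma apart_is_homog: "ahomog par p (apart par s p)"
proof (induction s arbitrary: p)
  case (AMult s t)
  have "ahomog par (0 + p) (apart par s 0 \<bullet> apart par t p)"
    "ahomog par (1 + (p + 1)) (apart par s 1 \<bullet> apart par t (p + 1))"
    using AMult by (blast intro: ahomog.intros)+
  moreover have "1 + (p + 1) = p" by (simp add: add.commute)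
  ultimately show ?case by (auto intro: ahomog.intros)
qed (auto intro: ahomog.intros)

lemma acong_mult_sum_cong:
  assumes "a \<approx> a'" "b \<approx> b'" "c \<approx> c'" "d \<approx> d'"
  shows "AAdd (a \<bullet> b) (c \<bullet> d) \<approx> AAdd (a' \<bullet> b') (c' \<bullet> d')"
  using assms by (intro acongs)

lemma apart_acong:
  assumes hom: "\<And>s t. R s t \<Longrightarrow> \<exists>p. ahomog par p s \<and> ahomog par p t"
  assumes "s \<approx> t"
  shows "apart par s p \<approx> apart par t p"
  using assms(2)
proof (induction arbitrary: p rule: acong.induct)
  case c: (acong_rel s t)
  from hom[OF c(1)] obtain q where q: "ahomog par q s" "ahomog par q t" by blast
  have "apart par s p \<approx> (if p = q then s else AZero)" by (rule apart_homog) (use c q in auto)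
  also have "\<dots> \<approx> (if p = q then t else AZero)" using c by (auto intro: acong_rel acong_refl)
  also have "\<dots> \<approx> apart par t p" by (rule acong_sym, rule apart_homog) (use c q in auto)
  finally show ?case .
next
  case c: (acong_trans s t u) show ?case by (rule acong_trans) fact+
next
  case c: (acong_sym s t) show ?case by (rule acong_sym) fact
next
  case c: (acong_mult_add_left s t u)
  have "apart par (AAdd s t \<bullet> u) p \<approx>
    AAdd (AAdd (apart par s 0 \<bullet> apart par u p) (apart par t 0 \<bullet> apart par u p))
         (AAdd (apart par s 1 \<bullet> apart par u (p + 1)) (apart par t 1 \<bullet> apart par u (p + 1)))"
    using c by (auto intro!: acongs acong_mult_add_left)
  also have "\<dots> \<approx> apart par (AAdd (s \<bullet> u) (t \<bullet> u)) p"
    using c by (auto intro!: acong_add_swap)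
  finally show ?case .
next
  case c: (acong_mult_add_right s t u)
  have "apart par (u \<bullet> AAdd s t) p \<approx>
    AAdd (AAdd (apart par u 0 \<bullet> apart par s p) (apart par u 0 \<bullet> apart par t p))
         (AAdd (apart par u 1 \<bullet> apart par s (p + 1)) (apart par u 1 \<bullet> apart par t (p + 1)))"
    using c by (auto intro!: acongs acong_mult_add_right)
  also have "\<dots> \<approx> apart par (AAdd (u \<bullet> s) (u \<bullet> t)) p"
    using c by (auto intro!: acong_add_swap)
  finally show ?case .
next
  case c: (acong_mult_scale_left s t a)
  have "apart par (AScale a s \<bullet> t) p \<approx>
    AAdd (AScale a (apart par s 0 \<bullet> apart par t p)) (AScale a (apart par s 1 \<bullet> apart par t (p + 1)))"
    using c by (auto intro!: acongs acong_mult_scale_left)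
  also have "\<dots> \<approx> apart par (AScale a (s \<bullet> t)) p"
    using c by (auto intro!: acong_sym[OF acong_scale_add_right])
  finally show ?case .
next
  case c: (acong_mult_scale_right s t a)
  have "apart par (s \<bullet> AScale a t) p \<approx>
    AAdd (AScale a (apart par s 0 \<bullet> apart par t p)) (AScale a (apart par s 1 \<bullet> apart par t (p + 1)))"
    using c by (auto intro!: acongs acong_mult_scale_right)
  also have "\<dots> \<approx> apart par (AScale a (s \<bullet> t)) p"
    using c by (auto intro!: acong_sym[OF acong_scale_add_right])
  finally show ?case .
next
  case c: (acong_mult_assoc s t u)
  let ?s = "apart par s" and ?t = "apart par t" and ?u = "apart par u"
  note T = c
  have "apart par ((s \<bullet> t) \<bullet> u) p \<approx>
    AAdd (AAdd ((?s 0 \<bullet> ?t 0) \<bullet> ?u p) ((?s 1 \<bullet> ?t 1) \<bullet> ?u p))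
         (AAdd ((?s 0 \<bullet> ?t 1) \<bullet> ?u (p + 1)) ((?s 1 \<bullet> ?t 0) \<bullet> ?u (p + 1)))"
    using T by (auto intro!: acongs acong_mult_add_left)
  also have "\<dots> \<approx>
    AAdd (AAdd (?s 0 \<bullet> ?t 0 \<bullet> ?u p) (?s 1 \<bullet> ?t 1 \<bullet> ?u p))
         (AAdd (?s 0 \<bullet> ?t 1 \<bullet> ?u (p + 1)) (?s 1 \<bullet> ?t 0 \<bullet> ?u (p + 1)))"
    using T by (auto intro!: acong_add_cong acong_mult_assoc)
  also have "\<dots> \<approx>
    AAdd (AAdd (?s 0 \<bullet> ?t 0 \<bullet> ?u p) (?s 0 \<bullet> ?t 1 \<bullet> ?u (p + 1)))
         (AAdd (?s 1 \<bullet> ?t 1 \<bullet> ?u p) (?s 1 \<bullet> ?t 0 \<bullet> ?u (p + 1)))"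
    using T by (auto intro!: acong_add_swap)
  also have "\<dots> \<approx>
    AAdd (AAdd (?s 0 \<bullet> ?t 0 \<bullet> ?u p) (?s 0 \<bullet> ?t 1 \<bullet> ?u (p + 1)))
         (AAdd (?s 1 \<bullet> ?t 0 \<bullet> ?u (p + 1)) (?s 1 \<bullet> ?t 1 \<bullet> ?u p))"
    using T by (intro acong_add_cong acong_refl acong_add_commute) auto
  also have "\<dots> \<approx> apart par (s \<bullet> t \<bullet> u) p"
    using T by (auto intro!: acong_add_cong acong_sym[OF acong_mult_add_right])
  finally show ?case .
next
  case c: (acong_mult_one_left s)
  have "apart par (AOne \<bullet> s) p \<approx> AAdd (AOne \<bullet> apart par s p) (AZero \<bullet> apart par s (p + 1))"
    using c by (auto intro: acong_refl)
  also have "\<dots> \<approx> apart par s p"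
    using c by (intro acong_add_zero_right_cong acong_mult_zero_left acong_mult_one_left) auto
  finally show ?case .
next
  case c: (acong_mult_one_right s)
  show ?case
  proof (cases p rule: bit_cases)
    case even
    then show ?thesis using c
      by (auto intro!: acong_add_zero_right_cong acong_mult_zero_right acong_mult_one_right)
  next
    case odd
    then show ?thesis using c
      by (auto intro!: acong_add_zero_cong acong_mult_zero_right acong_mult_one_right)
  qed
qed (auto intro: acong_ax)

lemma graded_congruence_acong:
  assumes hom: "\<And>s t. R s t \<Longrightarrow> \<exists>p. ahomog par p s \<and> ahomog par p t"
  shows "graded_congruence (aterms G) {(s, t). s \<approx> t} AAdd AZero AScale AMult AOne
    (\<lambda>p. {t \<in> aterms G. ahomog par p t})"
proof
  show "equiv (aterms G) {(s, t). s \<approx> t}"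
    by (rule equivI) (auto simp: refl_on_def sym_def trans_def dest: acong_aterms intro: acong_refl acong_sym, blast intro: acong_trans)
  show "\<exists>x0\<in>{t \<in> aterms G. ahomog par 0 t}. \<exists>x1\<in>{t \<in> aterms G. ahomog par 1 t}.
      (x, AAdd x0 x1) \<in> {(s, t). s \<approx> t}" if "x \<in> aterms G" for x
    using that apart_split[OF that, of par]
    by (intro bexI[of _ "apart par x 0"] bexI[of _ "apart par x 1"]) (simp_all add: apart_is_homog)
  show "(x0, AZero) \<in> {(s, t). s \<approx> t} \<and> (x1, AZero) \<in> {(s, t). s \<approx> t}"
    if "x0 \<in> {t \<in> aterms G. ahomog par 0 t}" "x1 \<in> {t \<in> aterms G. ahomog par 1 t}"
      "(AAdd x0 x1, AZero) \<in> {(s, t). s \<approx> t}" for x0 x1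
  proof -
    from that have T: "x0 \<in> aterms G" "x1 \<in> aterms G" "ahomog par 0 x0" "ahomog par 1 x1" by auto
    have z: "AAdd (apart par x0 q) (apart par x1 q) \<approx> AZero" for q
      using apart_acong[OF hom, of "AAdd x0 x1" AZero q] that by simp
    note h0 = apart_homog[OF T(3,1)] and h1 = apart_homog[OF T(4,2)]
    have "AAdd (apart par x0 0) (apart par x1 0) \<approx> x0"
      using h0[of 0] h1[of 0] by (auto intro!: acong_add_zero_right_cong)
    moreover have "AAdd (apart par x0 1) (apart par x1 1) \<approx> x1"
      using h0[of 1] h1[of 1] by (auto intro!: acong_add_zero_cong)
    ultimately show ?thesis using z by (blast intro: acong_sym acong_trans)
  qed
qed (auto intro: acong_ax ahomog.intros)

lemma superalgebra_presented:
  assumes hom: "\<And>s t. R s t \<Longrightarrow> \<exists>p. ahomog par p s \<and> ahomog par p t"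
  shows "superalgebra (presented_superalgebra G par R)"
proof -
  interpret graded_congruence "aterms G" "{(s, t). s \<approx> t}" AAdd AZero AScale AMult AOne
    "\<lambda>p. {t \<in> aterms G. ahomog par p t}"
    using graded_congruence_acong[OF hom] .
  show ?thesis using superalgebra_A by (simp add: A_def presented_superalgebra_def)
qed

end

lemma ahomogI:
  "p = par g \<Longrightarrow> ahomog par p (AGen g)"
  "p = 0 \<Longrightarrow> ahomog par p AOne"
  "ahomog par p AZero"
  "ahomog par p s \<Longrightarrow> ahomog par p t \<Longrightarrow> ahomog par p (AAdd s t)"
  "ahomog par p t \<Longrightarrow> ahomog par p (AScale c t)"
  "ahomog par p s \<Longrightarrow> ahomog par q t \<Longrightarrow> p' = p + q \<Longrightarrow> ahomog par p' (s \<bullet> t)"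
  by (auto intro: ahomog.intros)

lemma BC_rel_homog: "BC_rel z r s t \<Longrightarrow> \<exists>p. ahomog BC_par p s \<and> ahomog BC_par p t"
  by (induction rule: BC_rel.induct;
      ((rule exI[of _ 0], rule conjI; ((rule ahomogI | rule refl | (simp; fail))+; fail))
      | (rule exI[of _ 1], rule conjI; ((rule ahomogI | rule refl | (simp; fail))+; fail))))

lemma superalgebra_BC: "superalgebra (BC z r s)"
  unfolding BC_def by (rule superalgebra_presented) (rule BC_rel_homog)

primrec mpart :: "('o, 'g) supersig \<Rightarrow> ('k, 'o, 'g) mor \<Rightarrow> bit \<Rightarrow> ('k, 'o, 'g) mor" where
  "mpart S (MGen g) p = (if p = gpar S g then MGen g else MZero (gdom S g) (gcod S g))"
| "mpart S (MId X) p = (if p = 0 then MId X else MZero X X)"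
| "mpart S (MZero X Y) p = MZero X Y"
| "mpart S (MAdd f g) p = MAdd (mpart S f p) (mpart S g p)"
| "mpart S (MScale c f) p = MScale c (mpart S f p)"
| "mpart S (f \<^bold>\<circ> g) p =
     MAdd (mpart S f 0 \<^bold>\<circ> mpart S g p) (mpart S f 1 \<^bold>\<circ> mpart S g (p + 1))"
| "mpart S (f \<^bold>\<otimes> g) p =
     MAdd (mpart S f 0 \<^bold>\<otimes> mpart S g p) (mpart S f 1 \<^bold>\<otimes> mpart S g (p + 1))"

lemma mor_homog_type: "mor_homog S p X Y f \<Longrightarrow> mor_type S X Y f"
  by (induction rule: mor_homog.induct) (auto intro: mor_type.intros)

lemma mor_type_tens:
  "mor_type S X Y f \<Longrightarrow> mor_type S X' Y' g \<Longrightarrow> U = X @ X' \<Longrightarrow> V = Y @ Y' \<Longrightarrow>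
   mor_type S U V (f \<^bold>\<otimes> g)"
  by (auto intro: mor_type.intros)

inductive_cases mor_typeEs: "mor_type S X Y (MGen g)" "mor_type S X Y (MId Z)"
  "mor_type S X Y (MZero U V)" "mor_type S X Y (MAdd f g)" "mor_type S X Y (MScale c f)"

lemma mor_type_unique: "mor_type S X Y f \<Longrightarrow> mor_type S X' Y' f \<Longrightarrow> X = X' \<and> Y = Y'"
proof (induction arbitrary: X' Y' rule: mor_type.induct)
  case (6 Y Z f X g)
  from "6.prems" obtain V where "mor_type S V Y' f" "mor_type S X' V g"
    by (cases rule: mor_type.cases) auto
  with "6.IH" show ?case by blast
next
  case (7 X Y f U V g)
  from "7.prems" obtain A B C D where "mor_type S A B f" "mor_type S C D g" "X' = A @ C" "Y' = B @ D"
    by (cases rule: mor_type.cases) auto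
  with "7.IH" show ?case by blast
qed (blast elim: mor_typeEs)+

lemmas mor_types = mor_type.intros(1-6) mor_type_tens

lemma mor_cong_type: "mor_cong S R X Y f g \<Longrightarrow> mor_type S X Y f \<and> mor_type S X Y g"
proof (induction rule: mor_cong.induct)
  case c: (mor_cong_super_interchange p X Y f q V W g Z f' U g')
  then have "mor_type S X Y f" "mor_type S V W g" by (auto dest: mor_homog_type)
  with c show ?case by (blast intro: mor_type.intros)
next
  case c: (mor_cong_tens_assoc X Y f X' Y' g X'' Y'' h)
  show ?case
    by (intro conjI mor_type_tens[OF mor_type_tens[OF c(1,2) refl refl] c(3)]
      mor_type_tens[OF c(1) mor_type_tens[OF c(2,3) refl refl]]) auto
next
  case c: (mor_cong_tens_unit_left X Y f)
  then show ?case by (intro conjI mor_type_tens[of S "[]" "[]" _ X Y]) (auto intro: mor_types)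
next
  case c: (mor_cong_tens_unit_right X Y f)
  then show ?case by (intro conjI mor_type_tens[of S X Y _ "[]" "[]"]) (auto intro: mor_types)
qed (blast intro: mor_type.intros)+

lemma mpart_is_homog: "mor_type S X Y f \<Longrightarrow> mor_homog S p X Y (mpart S f p)"
proof (induction arbitrary: p rule: mor_type.induct)
  case (6 Y Z f X g)
  have "mor_homog S (0 + p) X Z (mpart S f 0 \<^bold>\<circ> mpart S g p)"
    "mor_homog S (1 + (p + 1)) X Z (mpart S f 1 \<^bold>\<circ> mpart S g (p + 1))"
    using 6 by (blast intro: mor_homog.intros)+
  moreover have "1 + (p + 1) = p" by (simp add: add.commute)
  ultimately show ?case by (auto intro: mor_homog.intros)
next
  case (7 X Y f X' Y' g)
  have "mor_homog S (0 + p) (X @ X') (Y @ Y') (mpart S f 0 \<^bold>\<otimes> mpart S g p)"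
    "mor_homog S (1 + (p + 1)) (X @ X') (Y @ Y') (mpart S f 1 \<^bold>\<otimes> mpart S g (p + 1))"
    using 7 by (blast intro: mor_homog.intros)+
  moreover have "1 + (p + 1) = p" by (simp add: add.commute)
  ultimately show ?case by (auto intro: mor_homog.intros)
qed (auto intro: mor_homog.intros)

lemma mpart_type: "mor_type S X Y f \<Longrightarrow> mor_type S X Y (mpart S f p)"
  by (rule mor_homog_type[OF mpart_is_homog])

context
  fixes S :: "('o, 'g) supersig"
    and R :: "('k::comm_ring_1, 'o, 'g) mor \<Rightarrow> ('k, 'o, 'g) mor \<Rightarrow> bool"
begin

abbreviation meq (\<open>_ \<approx>[_, _] _\<close> [50, 0, 0, 50] 50) where "f \<approx>[X, Y] g \<equiv> mor_cong S R X Y f g"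
abbreviation mty (\<open>_ \<turnstile>[_, _]\<close> [50, 0, 0] 50) where "f \<turnstile>[X, Y] \<equiv> mor_type S X Y f"

lemmas [trans] = mor_cong_trans

lemma m_tens_cong:
  "f \<approx>[X, Y] f' \<Longrightarrow> g \<approx>[X', Y'] g' \<Longrightarrow> U = X @ X' \<Longrightarrow> V = Y @ Y' \<Longrightarrow> f \<^bold>\<otimes> g \<approx>[U, V] f' \<^bold>\<otimes> g'"
  by (auto intro: mor_cong_tens_cong)

lemmas mcong = mor_cong_add_cong mor_cong_scale_cong mor_cong_comp_cong m_tens_cong
lemmas mcong_ax = mor_cong_refl mor_cong_add_cong mor_cong_scale_cong mor_cong_add_assoc
  mor_cong_add_commute mor_cong_add_zero mor_cong_add_neg mor_cong_scale_add_left
  mor_cong_scale_add_right mor_cong_scale_scale mor_cong_scale_one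

lemma m_add_zero_right: "f \<turnstile>[X, Y] \<Longrightarrow> MAdd f (MZero X Y) \<approx>[X, Y] f"
  by (rule mor_cong_trans[OF mor_cong_add_commute mor_cong_add_zero]) (auto intro: mor_types)

lemma m_add_zero_cong: "f \<approx>[X, Y] MZero X Y \<Longrightarrow> g \<approx>[X, Y] g' \<Longrightarrow> MAdd f g \<approx>[X, Y] g'"
  by (rule mor_cong_trans[OF mor_cong_add_cong mor_cong_add_zero]) (auto dest: mor_cong_type)

lemma m_add_zero_right_cong: "f \<approx>[X, Y] f' \<Longrightarrow> g \<approx>[X, Y] MZero X Y \<Longrightarrow> MAdd f g \<approx>[X, Y] f'"
  by (rule mor_cong_trans[OF mor_cong_add_cong m_add_zero_right]) (auto dest: mor_cong_type)

lemma m_add_left_cancel: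
  assumes "MAdd f g \<approx>[X, Y] f" "f \<turnstile>[X, Y]" "g \<turnstile>[X, Y]"
  shows "g \<approx>[X, Y] MZero X Y"
proof -
  let ?n = "MScale (- 1) f"
  have n: "?n \<turnstile>[X, Y]" using assms by (auto intro: mor_types)
  have "g \<approx>[X, Y] MAdd (MZero X Y) g" by (rule mor_cong_sym, rule mor_cong_add_zero, fact)
  also have "\<dots> \<approx>[X, Y] MAdd (MAdd ?n f) g"
    by (intro mcong mor_cong_refl mor_cong_sym[OF mor_cong_add_neg] assms)
  also have "\<dots> \<approx>[X, Y] MAdd ?n (MAdd f g)" by (intro mor_cong_add_assoc assms n)
  also have "\<dots> \<approx>[X, Y] MAdd ?n f" by (intro mor_cong_add_cong mor_cong_refl assms n)
  also have "\<dots> \<approx>[X, Y] MZero X Y" by (rule mor_cong_add_neg) fact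
  finally show ?thesis .
qed

lemma m_zero_zero: "MAdd (MZero X Y) (MZero X Y) \<approx>[X, Y] MZero X Y"
  by (rule mor_cong_add_zero) (rule mor_types)

lemma m_scale_zero: "MScale c (MZero X Y) \<approx>[X, Y] MZero X Y"
proof (rule m_add_left_cancel)
  have "MAdd (MScale c (MZero X Y)) (MScale c (MZero X Y)) \<approx>[X, Y]
      MScale c (MAdd (MZero X Y) (MZero X Y))"
    by (intro mor_cong_sym[OF mor_cong_scale_add_right] mor_types)
  also have "\<dots> \<approx>[X, Y] MScale c (MZero X Y)" by (intro mcong m_zero_zero)
  finally show "MAdd (MScale c (MZero X Y)) (MScale c (MZero X Y)) \<approx>[X, Y] MScale c (MZero X Y)" .
qed (auto intro: mor_types)

lemma m_comp_zero_left:
  assumes f: "f \<turnstile>[X, Y]"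
  shows "MZero Y Z \<^bold>\<circ> f \<approx>[X, Z] MZero X Z"
proof (rule m_add_left_cancel)
  let ?z = "MZero Y Z"
  have "MAdd (?z \<^bold>\<circ> f) (?z \<^bold>\<circ> f) \<approx>[X, Z] MAdd ?z ?z \<^bold>\<circ> f"
    by (rule mor_cong_sym[OF mor_cong_comp_add_left[OF mor_type.intros(3) mor_type.intros(3) f]])
  also have "\<dots> \<approx>[X, Z] ?z \<^bold>\<circ> f"
    by (rule mor_cong_comp_cong[OF m_zero_zero mor_cong_refl[OF f]])
  finally show "MAdd (?z \<^bold>\<circ> f) (?z \<^bold>\<circ> f) \<approx>[X, Z] ?z \<^bold>\<circ> f" .
qed (use f in \<open>auto intro: mor_types\<close>)

lemma m_comp_zero_right:
  assumes f: "f \<turnstile>[Y, Z]"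
  shows "f \<^bold>\<circ> MZero X Y \<approx>[X, Z] MZero X Z"
proof (rule m_add_left_cancel)
  let ?z = "MZero X Y"
  have "MAdd (f \<^bold>\<circ> ?z) (f \<^bold>\<circ> ?z) \<approx>[X, Z] f \<^bold>\<circ> MAdd ?z ?z"
    by (rule mor_cong_sym[OF mor_cong_comp_add_right[OF mor_type.intros(3) mor_type.intros(3) f]])
  also have "\<dots> \<approx>[X, Z] f \<^bold>\<circ> ?z"
    by (rule mor_cong_comp_cong[OF mor_cong_refl[OF f] m_zero_zero])
  finally show "MAdd (f \<^bold>\<circ> ?z) (f \<^bold>\<circ> ?z) \<approx>[X, Z] f \<^bold>\<circ> ?z" .
qed (use f in \<open>auto intro: mor_types\<close>)

lemma m_tens_zero_left:
  assumes f: "f \<turnstile>[X, Y]"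
  shows "MZero U V \<^bold>\<otimes> f \<approx>[U @ X, V @ Y] MZero (U @ X) (V @ Y)"
proof (rule m_add_left_cancel)
  let ?z = "MZero U V"
  have "MAdd (?z \<^bold>\<otimes> f) (?z \<^bold>\<otimes> f) \<approx>[U @ X, V @ Y] MAdd ?z ?z \<^bold>\<otimes> f"
    by (rule mor_cong_sym[OF mor_cong_tens_add_left[OF mor_type.intros(3) mor_type.intros(3) f]])
  also have "\<dots> \<approx>[U @ X, V @ Y] ?z \<^bold>\<otimes> f"
    by (rule mor_cong_tens_cong[OF m_zero_zero mor_cong_refl[OF f]])
  finally show "MAdd (?z \<^bold>\<otimes> f) (?z \<^bold>\<otimes> f) \<approx>[U @ X, V @ Y] ?z \<^bold>\<otimes> f" .
qed (use f in \<open>auto intro: mor_type.intros\<close>)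

lemma m_tens_zero_right:
  assumes f: "f \<turnstile>[U, V]"
  shows "f \<^bold>\<otimes> MZero X Y \<approx>[U @ X, V @ Y] MZero (U @ X) (V @ Y)"
proof (rule m_add_left_cancel)
  let ?z = "MZero X Y"
  have "MAdd (f \<^bold>\<otimes> ?z) (f \<^bold>\<otimes> ?z) \<approx>[U @ X, V @ Y] f \<^bold>\<otimes> MAdd ?z ?z"
    by (rule mor_cong_sym[OF mor_cong_tens_add_right[OF mor_type.intros(3) mor_type.intros(3) f]])
  also have "\<dots> \<approx>[U @ X, V @ Y] f \<^bold>\<otimes> ?z"
    by (rule mor_cong_tens_cong[OF mor_cong_refl[OF f] m_zero_zero])
  finally show "MAdd (f \<^bold>\<otimes> ?z) (f \<^bold>\<otimes> ?z) \<approx>[U @ X, V @ Y] f \<^bold>\<otimes> ?z" .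
qed (use f in \<open>auto intro: mor_type.intros\<close>)

lemma m_add_swap:
  assumes "f \<turnstile>[X, Y]" "g \<turnstile>[X, Y]" "h \<turnstile>[X, Y]" "k \<turnstile>[X, Y]"
  shows "MAdd (MAdd f g) (MAdd h k) \<approx>[X, Y] MAdd (MAdd f h) (MAdd g k)"
proof -
  note [intro] = assms mor_type.intros(4)
  have "MAdd (MAdd f g) (MAdd h k) \<approx>[X, Y] MAdd f (MAdd g (MAdd h k))"
    by (rule mor_cong_add_assoc) auto
  also have "\<dots> \<approx>[X, Y] MAdd f (MAdd (MAdd g h) k)"
    by (intro mor_cong_add_cong mor_cong_refl mor_cong_sym[OF mor_cong_add_assoc]) auto
  also have "\<dots> \<approx>[X, Y] MAdd f (MAdd (MAdd h g) k)"
    by (intro mor_cong_add_cong mor_cong_refl mor_cong_add_commute) auto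
  also have "\<dots> \<approx>[X, Y] MAdd f (MAdd h (MAdd g k))"
    by (intro mor_cong_add_cong mor_cong_refl mor_cong_add_assoc) auto
  also have "\<dots> \<approx>[X, Y] MAdd (MAdd f h) (MAdd g k)"
    by (intro mor_cong_sym[OF mor_cong_add_assoc]) auto
  finally show ?thesis .
qed

lemma m_comp_zero:
  assumes "f \<turnstile>[Y, Z]" "g \<turnstile>[X, Y]" "f \<approx>[Y, Z] MZero Y Z \<or> g \<approx>[X, Y] MZero X Y"
  shows "f \<^bold>\<circ> g \<approx>[X, Z] MZero X Z"
  using assms(3)
proof
  assume "f \<approx>[Y, Z] MZero Y Z"
  from mor_cong_comp_cong[OF this mor_cong_refl[OF assms(2)]] m_comp_zero_left[OF assms(2)]
  show ?thesis by (rule mor_cong_trans)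
next
  assume "g \<approx>[X, Y] MZero X Y"
  from mor_cong_comp_cong[OF mor_cong_refl[OF assms(1)] this] m_comp_zero_right[OF assms(1)]
  show ?thesis by (rule mor_cong_trans)
qed

lemma m_tens_zero:
  assumes "f \<turnstile>[U, V]" "g \<turnstile>[X, Y]" "f \<approx>[U, V] MZero U V \<or> g \<approx>[X, Y] MZero X Y"
  shows "f \<^bold>\<otimes> g \<approx>[U @ X, V @ Y] MZero (U @ X) (V @ Y)"
  using assms(3)
proof
  assume "f \<approx>[U, V] MZero U V"
  from mor_cong_tens_cong[OF this mor_cong_refl[OF assms(2)]] m_tens_zero_left[OF assms(2)]
  show ?thesis by (rule mor_cong_trans)
next
  assume "g \<approx>[X, Y] MZero X Y"
  from mor_cong_tens_cong[OF mor_cong_refl[OF assms(1)] this] m_tens_zero_right[OF assms(1)]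
  show ?thesis by (rule mor_cong_trans)
qed

text \<open>The statement that the homogeneous parts of \<open>f\<close> are \<open>f\<close> and zero.\<close>

definition mhom :: "bit \<Rightarrow> 'o list \<Rightarrow> 'o list \<Rightarrow> ('k, 'o, 'g) mor \<Rightarrow> bool" where
  "mhom p X Y f \<longleftrightarrow> f \<turnstile>[X, Y] \<and> mpart S f p \<approx>[X, Y] f \<and> mpart S f (p + 1) \<approx>[X, Y] MZero X Y"

lemma mhom_other: "mhom p X Y f \<Longrightarrow> q \<noteq> p \<Longrightarrow> mpart S f q \<approx>[X, Y] MZero X Y"
  by (cases p; cases q) (auto simp: mhom_def)

lemma mhom_same: "mhom p X Y f \<Longrightarrow> mpart S f p \<approx>[X, Y] f"
  by (auto simp: mhom_def)

lemma sum_parity_cong: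
  fixes F G :: "bit \<Rightarrow> ('k, 'o, 'g) mor"
  assumes "F a \<approx>[X, Y] H" "F (a + 1) \<approx>[X, Y] MZero X Y"
  shows "MAdd (F 0) (F 1) \<approx>[X, Y] H"
  using assms by (cases a) (auto intro: m_add_zero_cong m_add_zero_right_cong)

lemma mpart_comp_right:
  assumes "mhom q X Y g" "f \<turnstile>[Y, Z]"
  shows "mpart S (f \<^bold>\<circ> g) s \<approx>[X, Z] mpart S f (s + q) \<^bold>\<circ> g"
proof -
  have g: "g \<turnstile>[X, Y]" using assms by (simp add: mhom_def)
  have "MAdd (mpart S f 0 \<^bold>\<circ> mpart S g (s + 0)) (mpart S f 1 \<^bold>\<circ> mpart S g (s + 1))
      \<approx>[X, Z] mpart S f (s + q) \<^bold>\<circ> g"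
  proof (rule sum_parity_cong[where F = "\<lambda>a. mpart S f a \<^bold>\<circ> mpart S g (s + a)" and a = "s + q"])
    show "mpart S f (s + q) \<^bold>\<circ> mpart S g (s + (s + q)) \<approx>[X, Z] mpart S f (s + q) \<^bold>\<circ> g"
      using assms by (auto intro!: mor_cong_comp_cong mor_cong_refl mpart_type mhom_same)
    have ne: "s + (s + q + 1) \<noteq> q" by (cases s; cases q) auto
    show "mpart S f (s + q + 1) \<^bold>\<circ> mpart S g (s + (s + q + 1)) \<approx>[X, Z] MZero X Z"
      by (rule m_comp_zero[OF mpart_type[OF assms(2)] mpart_type[OF g] disjI2[OF mhom_other[OF assms(1) ne]]])
  qed
  then show ?thesis by simp
qed

lemma mpart_comp_left:
  assumes "mhom p Y Z f" "g \<turnstile>[X, Y]"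
  shows "mpart S (f \<^bold>\<circ> g) s \<approx>[X, Z] f \<^bold>\<circ> mpart S g (s + p)"
proof -
  have f: "f \<turnstile>[Y, Z]" using assms by (simp add: mhom_def)
  have "MAdd (mpart S f 0 \<^bold>\<circ> mpart S g (s + 0)) (mpart S f 1 \<^bold>\<circ> mpart S g (s + 1))
      \<approx>[X, Z] f \<^bold>\<circ> mpart S g (s + p)"
  proof (rule sum_parity_cong[where F = "\<lambda>a. mpart S f a \<^bold>\<circ> mpart S g (s + a)" and a = p])
    show "mpart S f p \<^bold>\<circ> mpart S g (s + p) \<approx>[X, Z] f \<^bold>\<circ> mpart S g (s + p)"
      using assms by (auto intro!: mor_cong_comp_cong mor_cong_refl mpart_type mhom_same)
    show "mpart S f (p + 1) \<^bold>\<circ> mpart S g (s + (p + 1)) \<approx>[X, Z] MZero X Z"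
      by (rule m_comp_zero[OF mpart_type[OF f] mpart_type[OF assms(2)] disjI1[OF mhom_other[OF assms(1)]]]) (cases p; auto)
  qed
  then show ?thesis by simp
qed

lemma mpart_tens_right:
  assumes "mhom q X Y g" "f \<turnstile>[U, V]"
  shows "mpart S (f \<^bold>\<otimes> g) s \<approx>[U @ X, V @ Y] mpart S f (s + q) \<^bold>\<otimes> g"
proof -
  have g: "g \<turnstile>[X, Y]" using assms by (simp add: mhom_def)
  have "MAdd (mpart S f 0 \<^bold>\<otimes> mpart S g (s + 0)) (mpart S f 1 \<^bold>\<otimes> mpart S g (s + 1))
      \<approx>[U @ X, V @ Y] mpart S f (s + q) \<^bold>\<otimes> g"
  proof (rule sum_parity_cong[where F = "\<lambda>a. mpart S f a \<^bold>\<otimes> mpart S g (s + a)" and a = "s + q"])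
    show "mpart S f (s + q) \<^bold>\<otimes> mpart S g (s + (s + q)) \<approx>[U @ X, V @ Y] mpart S f (s + q) \<^bold>\<otimes> g"
      using assms by (auto intro!: mor_cong_tens_cong mor_cong_refl mpart_type mhom_same)
    have ne: "s + (s + q + 1) \<noteq> q" by (cases s; cases q) auto
    show "mpart S f (s + q + 1) \<^bold>\<otimes> mpart S g (s + (s + q + 1)) \<approx>[U @ X, V @ Y] MZero (U @ X) (V @ Y)"
      by (rule m_tens_zero[OF mpart_type[OF assms(2)] mpart_type[OF g] disjI2[OF mhom_other[OF assms(1) ne]]])
  qed
  then show ?thesis by simp
qed

lemma mpart_tens_left:
  assumes "mhom p U V f" "g \<turnstile>[X, Y]"
  shows "mpart S (f \<^bold>\<otimes> g) s \<approx>[U @ X, V @ Y] f \<^bold>\<otimes> mpart S g (s + p)"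
proof -
  have f: "f \<turnstile>[U, V]" using assms by (simp add: mhom_def)
  have "MAdd (mpart S f 0 \<^bold>\<otimes> mpart S g (s + 0)) (mpart S f 1 \<^bold>\<otimes> mpart S g (s + 1))
      \<approx>[U @ X, V @ Y] f \<^bold>\<otimes> mpart S g (s + p)"
  proof (rule sum_parity_cong[where F = "\<lambda>a. mpart S f a \<^bold>\<otimes> mpart S g (s + a)" and a = p])
    show "mpart S f p \<^bold>\<otimes> mpart S g (s + p) \<approx>[U @ X, V @ Y] f \<^bold>\<otimes> mpart S g (s + p)"
      using assms by (auto intro!: mor_cong_tens_cong mor_cong_refl mpart_type mhom_same)
    show "mpart S f (p + 1) \<^bold>\<otimes> mpart S g (s + (p + 1)) \<approx>[U @ X, V @ Y] MZero (U @ X) (V @ Y)"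
      by (rule m_tens_zero[OF mpart_type[OF f] mpart_type[OF assms(2)] disjI1[OF mhom_other[OF assms(1)]]]) (cases p; auto)
  qed
  then show ?thesis by simp
qed

lemma mor_homog_mhom: "mor_homog S p X Y f \<Longrightarrow> mhom p X Y f"
proof (induction rule: mor_homog.induct)
  case (4 p X Y f g)
  then show ?case
    by (auto simp: mhom_def intro: mor_types mor_cong_add_cong m_add_zero_cong)
next
  case (5 p X Y f c)
  then show ?case
    by (auto simp: mhom_def intro: mor_types mor_cong_scale_cong
      mor_cong_trans[OF mor_cong_scale_cong m_scale_zero])
next
  case (6 p Y Z f q X g)
  have T: "f \<turnstile>[Y, Z]" "g \<turnstile>[X, Y]" using 6 by (auto simp: mhom_def)
  have "mpart S (f \<^bold>\<circ> g) (p + q) \<approx>[X, Z] mpart S f (p + q + q) \<^bold>\<circ> g"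
    by (rule mpart_comp_right) (use 6 T in auto)
  also have "\<dots> \<approx>[X, Z] f \<^bold>\<circ> g"
    using mhom_same[OF "6.IH"(1)] mor_cong_refl[OF T(2)] by (simp add: mor_cong_comp_cong)
  finally have 1: "mpart S (f \<^bold>\<circ> g) (p + q) \<approx>[X, Z] f \<^bold>\<circ> g" .
  have "mpart S (f \<^bold>\<circ> g) (p + q + 1) \<approx>[X, Z] mpart S f (p + q + 1 + q) \<^bold>\<circ> g"
    by (rule mpart_comp_right) (use 6 T in auto)
  also have "\<dots> \<approx>[X, Z] MZero X Z"
  proof (rule m_comp_zero[OF mpart_type[OF T(1)] T(2) disjI1[OF mhom_other[OF "6.IH"(1)]]])
    show "p + q + 1 + q \<noteq> p" by (cases p; cases q) auto
  qed
  finally show ?case using 1 T by (auto simp: mhom_def simp del: mpart.simps intro: mor_types)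
next
  case (7 p X Y f q X' Y' g)
  have T: "f \<turnstile>[X, Y]" "g \<turnstile>[X', Y']" using 7 by (auto simp: mhom_def)
  have "mpart S (f \<^bold>\<otimes> g) (p + q) \<approx>[X @ X', Y @ Y'] mpart S f (p + q + q) \<^bold>\<otimes> g"
    by (rule mpart_tens_right) (use 7 T in auto)
  also have "\<dots> \<approx>[X @ X', Y @ Y'] f \<^bold>\<otimes> g"
    using mhom_same[OF "7.IH"(1)] mor_cong_refl[OF T(2)] by (simp add: mor_cong_tens_cong)
  finally have 1: "mpart S (f \<^bold>\<otimes> g) (p + q) \<approx>[X @ X', Y @ Y'] f \<^bold>\<otimes> g" .
  have "mpart S (f \<^bold>\<otimes> g) (p + q + 1) \<approx>[X @ X', Y @ Y'] mpart S f (p + q + 1 + q) \<^bold>\<otimes> g"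
    by (rule mpart_tens_right) (use 7 T in auto)
  also have "\<dots> \<approx>[X @ X', Y @ Y'] MZero (X @ X') (Y @ Y')"
  proof (rule m_tens_zero[OF mpart_type[OF T(1)] T(2) disjI1[OF mhom_other[OF "7.IH"(1)]]])
    show "p + q + 1 + q \<noteq> p" by (cases p; cases q) auto
  qed
  finally show ?case using 1 T by (auto simp: mhom_def simp del: mpart.simps intro: mor_type.intros)
qed (auto simp: mhom_def intro: mor_types mor_cong_refl)

lemma mpart_split: "f \<turnstile>[X, Y] \<Longrightarrow> f \<approx>[X, Y] MAdd (mpart S f 0) (mpart S f 1)"
proof (induction rule: mor_type.induct)
  case (1 g)
  then show ?case
    by (cases "gpar S g") (auto intro!: mor_types mor_cong_sym[OF m_add_zero_right]
      mor_cong_sym[OF mor_cong_add_zero])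
next
  case (2 X) then show ?case by (auto intro!: mor_types mor_cong_sym[OF m_add_zero_right])
next
  case (3 X Y) then show ?case by (auto intro!: mor_types mor_cong_sym[OF m_add_zero_right])
next
  case (4 X Y f g)
  have "MAdd f g \<approx>[X, Y]
      MAdd (MAdd (mpart S f 0) (mpart S f 1)) (MAdd (mpart S g 0) (mpart S g 1))"
    using 4 by (intro mor_cong_add_cong)
  also have "\<dots> \<approx>[X, Y] MAdd (mpart S (MAdd f g) 0) (mpart S (MAdd f g) 1)"
    using 4 by (simp, intro m_add_swap mpart_type)
  finally show ?case .
next
  case (5 X Y f c)
  have "MScale c f \<approx>[X, Y] MScale c (MAdd (mpart S f 0) (mpart S f 1))"
    using 5 by (intro mor_cong_scale_cong)
  also have "\<dots> \<approx>[X, Y] MAdd (mpart S (MScale c f) 0) (mpart S (MScale c f) 1)"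
    using 5 by (simp, intro mor_cong_scale_add_right mpart_type)
  finally show ?case .
next
  case (6 Y Z f X g)
  let ?f = "mpart S f" and ?g = "mpart S g"
  have T: "?f a \<turnstile>[Y, Z]" "?g a \<turnstile>[X, Y]" for a using 6 by (auto intro: mpart_type)
  have "f \<^bold>\<circ> g \<approx>[X, Z] MAdd (?f 0) (?f 1) \<^bold>\<circ> MAdd (?g 0) (?g 1)"
    using 6 by (intro mor_cong_comp_cong)
  also have "\<dots> \<approx>[X, Z] MAdd (?f 0 \<^bold>\<circ> MAdd (?g 0) (?g 1)) (?f 1 \<^bold>\<circ> MAdd (?g 0) (?g 1))"
    by (rule mor_cong_comp_add_left mor_types T)+
  also have "\<dots> \<approx>[X, Z] MAdd (?f 0 \<^bold>\<circ> MAdd (?g 0) (?g 1)) (?f 1 \<^bold>\<circ> MAdd (?g 1) (?g 0))"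
    by (rule mor_cong_add_cong mor_cong_comp_cong mor_cong_add_commute T mor_cong_refl mor_types)+
  also have "\<dots> \<approx>[X, Z] MAdd (MAdd (?f 0 \<^bold>\<circ> ?g 0) (?f 0 \<^bold>\<circ> ?g 1)) (MAdd (?f 1 \<^bold>\<circ> ?g 1) (?f 1 \<^bold>\<circ> ?g 0))"
    by (rule mor_cong_add_cong mor_cong_comp_add_right T)+
  also have "\<dots> \<approx>[X, Z] MAdd (mpart S (f \<^bold>\<circ> g) 0) (mpart S (f \<^bold>\<circ> g) 1)"
    by (simp, (rule m_add_swap mor_types(6) T)+)
  finally show ?case .
next
  case (7 X Y f X' Y' g)
  let ?f = "mpart S f" and ?g = "mpart S g" and ?X = "X @ X'" and ?Y = "Y @ Y'"
  have T: "?f a \<turnstile>[X, Y]" "?g a \<turnstile>[X', Y']" for a using 7 by (auto intro: mpart_type)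
  have "f \<^bold>\<otimes> g \<approx>[?X, ?Y] MAdd (?f 0) (?f 1) \<^bold>\<otimes> MAdd (?g 0) (?g 1)"
    using 7 by (intro mor_cong_tens_cong)
  also have "\<dots> \<approx>[?X, ?Y] MAdd (?f 0 \<^bold>\<otimes> MAdd (?g 0) (?g 1)) (?f 1 \<^bold>\<otimes> MAdd (?g 0) (?g 1))"
    by (rule mor_cong_tens_add_left mor_types T)+
  also have "\<dots> \<approx>[?X, ?Y] MAdd (?f 0 \<^bold>\<otimes> MAdd (?g 0) (?g 1)) (?f 1 \<^bold>\<otimes> MAdd (?g 1) (?g 0))"
    by (rule mor_cong_add_cong mor_cong_tens_cong mor_cong_add_commute T mor_cong_refl mor_types)+
  also have "\<dots> \<approx>[?X, ?Y] MAdd (MAdd (?f 0 \<^bold>\<otimes> ?g 0) (?f 0 \<^bold>\<otimes> ?g 1)) (MAdd (?f 1 \<^bold>\<otimes> ?g 1) (?f 1 \<^bold>\<otimes> ?g 0))"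
    by (rule mor_cong_add_cong mor_cong_tens_add_right T)+
  also have "\<dots> \<approx>[?X, ?Y] MAdd (mpart S (f \<^bold>\<otimes> g) 0) (mpart S (f \<^bold>\<otimes> g) 1)"
    by (simp, (rule m_add_swap mor_type.intros(7) T)+)
  finally show ?case .
qed

lemma m_tens_add_left: "f \<turnstile>[X, Y] \<Longrightarrow> g \<turnstile>[X, Y] \<Longrightarrow> h \<turnstile>[X', Y'] \<Longrightarrow> U = X @ X' \<Longrightarrow> V = Y @ Y' \<Longrightarrow>
    MAdd f g \<^bold>\<otimes> h \<approx>[U, V] MAdd (f \<^bold>\<otimes> h) (g \<^bold>\<otimes> h)"
  by (auto intro: mor_cong_tens_add_left)

lemma m_tens_add_right: "h \<turnstile>[X, Y] \<Longrightarrow> f \<turnstile>[X', Y'] \<Longrightarrow> g \<turnstile>[X', Y'] \<Longrightarrow> U = X @ X' \<Longrightarrow> V = Y @ Y' \<Longrightarrow>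
    h \<^bold>\<otimes> MAdd f g \<approx>[U, V] MAdd (h \<^bold>\<otimes> f) (h \<^bold>\<otimes> g)"
  by (auto intro: mor_cong_tens_add_right)

lemma mpart_cong:
  assumes hom: "\<And>f g. R f g \<Longrightarrow> \<exists>p X Y. mor_homog S p X Y f \<and> mor_homog S p X Y g"
  assumes "f \<approx>[X, Y] g"
  shows "mpart S f p \<approx>[X, Y] mpart S g p"
  using assms(2)
proof (induction arbitrary: p rule: mor_cong.induct)
  case c: (mor_cong_rel f g X Y)
  from hom[OF c(1)] obtain q X' Y' where h: "mor_homog S q X' Y' f" "mor_homog S q X' Y' g" by blast
  with mor_type_unique[OF mor_homog_type[OF h(1)] c(2)]
  have "mor_homog S q X Y f" "mor_homog S q X Y g" by auto
  then have q: "mhom q X Y f" "mhom q X Y g" by (auto intro: mor_homog_mhom)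
  show ?case
  proof (cases "p = q")
    case True
    have "mpart S f p \<approx>[X, Y] f" unfolding True by (rule mhom_same) fact
    also have "\<dots> \<approx>[X, Y] g" by (rule mor_cong.mor_cong_rel) fact+
    also have "\<dots> \<approx>[X, Y] mpart S g p" unfolding True by (rule mor_cong.mor_cong_sym, rule mhom_same) fact
    finally show ?thesis .
  next
    case False
    show ?thesis
      by (rule mor_cong.mor_cong_trans[OF _ mor_cong.mor_cong_sym]; rule mhom_other; fact)
  qed
next
  case c: (mor_cong_refl X Y f) then show ?case by (auto intro: mor_cong.mor_cong_refl mpart_type)
next
  case c: (mor_cong_sym X Y f g) show ?case by (rule mor_cong.mor_cong_sym) fact
next
  case c: (mor_cong_trans X Y f g h) show ?case by (rule mor_cong.mor_cong_trans) fact+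
next
  case c: (mor_cong_comp_cong Y Z f f' X g g')
  then show ?case by (auto intro!: mor_cong.mor_cong_add_cong mor_cong.mor_cong_comp_cong)
next
  case c: (mor_cong_tens_cong X Y f f' X' Y' g g')
  then show ?case by (auto intro!: mor_cong.mor_cong_add_cong mor_cong.mor_cong_tens_cong)
next
  case c: (mor_cong_comp_add_left Y Z f g X h)
  let ?f = "mpart S f" and ?g = "mpart S g" and ?h = "mpart S h"
  have T: "?f a \<turnstile>[Y, Z]" "?g a \<turnstile>[Y, Z]" "?h a \<turnstile>[X, Y]" for a using c by (auto intro: mpart_type)
  have "mpart S (MAdd f g \<^bold>\<circ> h) p \<approx>[X, Z]
      MAdd (MAdd (?f 0 \<^bold>\<circ> ?h p) (?g 0 \<^bold>\<circ> ?h p)) (MAdd (?f 1 \<^bold>\<circ> ?h (p + 1)) (?g 1 \<^bold>\<circ> ?h (p + 1)))"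
    by (simp, (rule mor_cong.mor_cong_add_cong mor_cong.mor_cong_comp_add_left T)+)
  also have "\<dots> \<approx>[X, Z] mpart S (MAdd (f \<^bold>\<circ> h) (g \<^bold>\<circ> h)) p"
    by (simp, (rule m_add_swap mor_types(6) T)+)
  finally show ?case .
next
  case c: (mor_cong_comp_add_right X Y f g Z h)
  let ?f = "mpart S f" and ?g = "mpart S g" and ?h = "mpart S h"
  have T: "?f a \<turnstile>[X, Y]" "?g a \<turnstile>[X, Y]" "?h a \<turnstile>[Y, Z]" for a using c by (auto intro: mpart_type)
  have "mpart S (h \<^bold>\<circ> MAdd f g) p \<approx>[X, Z]
      MAdd (MAdd (?h 0 \<^bold>\<circ> ?f p) (?h 0 \<^bold>\<circ> ?g p)) (MAdd (?h 1 \<^bold>\<circ> ?f (p + 1)) (?h 1 \<^bold>\<circ> ?g (p + 1)))"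
    by (simp, (rule mor_cong.mor_cong_add_cong mor_cong.mor_cong_comp_add_right T)+)
  also have "\<dots> \<approx>[X, Z] mpart S (MAdd (h \<^bold>\<circ> f) (h \<^bold>\<circ> g)) p"
    by (simp, (rule m_add_swap mor_types(6) T)+)
  finally show ?case .
next
  case c: (mor_cong_comp_scale_left Y Z f X g a)
  let ?f = "mpart S f" and ?g = "mpart S g"
  have T: "?f a \<turnstile>[Y, Z]" "?g a \<turnstile>[X, Y]" for a using c by (auto intro: mpart_type)
  have "mpart S (MScale a f \<^bold>\<circ> g) p \<approx>[X, Z]
      MAdd (MScale a (?f 0 \<^bold>\<circ> ?g p)) (MScale a (?f 1 \<^bold>\<circ> ?g (p + 1)))"
    by (simp, (rule mor_cong.mor_cong_add_cong mor_cong.mor_cong_comp_scale_left T)+)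
  also have "\<dots> \<approx>[X, Z] mpart S (MScale a (f \<^bold>\<circ> g)) p"
    by (simp, rule mor_cong.mor_cong_sym, (rule mor_cong.mor_cong_scale_add_right mor_types(6) T)+)
  finally show ?case .
next
  case c: (mor_cong_comp_scale_right Y Z f X g a)
  let ?f = "mpart S f" and ?g = "mpart S g"
  have T: "?f a \<turnstile>[Y, Z]" "?g a \<turnstile>[X, Y]" for a using c by (auto intro: mpart_type)
  have "mpart S (f \<^bold>\<circ> MScale a g) p \<approx>[X, Z]
      MAdd (MScale a (?f 0 \<^bold>\<circ> ?g p)) (MScale a (?f 1 \<^bold>\<circ> ?g (p + 1)))"
    by (simp, (rule mor_cong.mor_cong_add_cong mor_cong.mor_cong_comp_scale_right T)+)
  also have "\<dots> \<approx>[X, Z] mpart S (MScale a (f \<^bold>\<circ> g)) p"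
    by (simp, rule mor_cong.mor_cong_sym, (rule mor_cong.mor_cong_scale_add_right mor_types(6) T)+)
  finally show ?case .
next
  case c: (mor_cong_tens_add_left X Y f g X' Y' h)
  let ?f = "mpart S f" and ?g = "mpart S g" and ?h = "mpart S h"
  have T: "?f a \<turnstile>[X, Y]" "?g a \<turnstile>[X, Y]" "?h a \<turnstile>[X', Y']" for a using c by (auto intro: mpart_type)
  have "mpart S (MAdd f g \<^bold>\<otimes> h) p \<approx>[X @ X', Y @ Y']
      MAdd (MAdd (?f 0 \<^bold>\<otimes> ?h p) (?g 0 \<^bold>\<otimes> ?h p)) (MAdd (?f 1 \<^bold>\<otimes> ?h (p + 1)) (?g 1 \<^bold>\<otimes> ?h (p + 1)))"
    by (simp, (rule mor_cong.mor_cong_add_cong mor_cong.mor_cong_tens_add_left T)+)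
  also have "\<dots> \<approx>[X @ X', Y @ Y'] mpart S (MAdd (f \<^bold>\<otimes> h) (g \<^bold>\<otimes> h)) p"
    by (simp, (rule m_add_swap mor_type.intros(7) T)+)
  finally show ?case .
next
  case c: (mor_cong_tens_add_right X' Y' f g X Y h)
  let ?f = "mpart S f" and ?g = "mpart S g" and ?h = "mpart S h"
  have T: "?f a \<turnstile>[X', Y']" "?g a \<turnstile>[X', Y']" "?h a \<turnstile>[X, Y]" for a using c by (auto intro: mpart_type)
  have "mpart S (h \<^bold>\<otimes> MAdd f g) p \<approx>[X @ X', Y @ Y']
      MAdd (MAdd (?h 0 \<^bold>\<otimes> ?f p) (?h 0 \<^bold>\<otimes> ?g p)) (MAdd (?h 1 \<^bold>\<otimes> ?f (p + 1)) (?h 1 \<^bold>\<otimes> ?g (p + 1)))"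
    by (simp, (rule mor_cong.mor_cong_add_cong mor_cong.mor_cong_tens_add_right T)+)
  also have "\<dots> \<approx>[X @ X', Y @ Y'] mpart S (MAdd (h \<^bold>\<otimes> f) (h \<^bold>\<otimes> g)) p"
    by (simp, (rule m_add_swap mor_type.intros(7) T)+)
  finally show ?case .
next
  case c: (mor_cong_tens_scale_left X Y f X' Y' g a)
  let ?f = "mpart S f" and ?g = "mpart S g"
  have T: "?f a \<turnstile>[X, Y]" "?g a \<turnstile>[X', Y']" for a using c by (auto intro: mpart_type)
  have "mpart S (MScale a f \<^bold>\<otimes> g) p \<approx>[X @ X', Y @ Y']
      MAdd (MScale a (?f 0 \<^bold>\<otimes> ?g p)) (MScale a (?f 1 \<^bold>\<otimes> ?g (p + 1)))"
    by (simp, (rule mor_cong.mor_cong_add_cong mor_cong.mor_cong_tens_scale_left T)+)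
  also have "\<dots> \<approx>[X @ X', Y @ Y'] mpart S (MScale a (f \<^bold>\<otimes> g)) p"
    by (simp, rule mor_cong.mor_cong_sym, (rule mor_cong.mor_cong_scale_add_right mor_type.intros(7) T)+)
  finally show ?case .
next
  case c: (mor_cong_tens_scale_right X Y f X' Y' g a)
  let ?f = "mpart S f" and ?g = "mpart S g"
  have T: "?f a \<turnstile>[X, Y]" "?g a \<turnstile>[X', Y']" for a using c by (auto intro: mpart_type)
  have "mpart S (f \<^bold>\<otimes> MScale a g) p \<approx>[X @ X', Y @ Y']
      MAdd (MScale a (?f 0 \<^bold>\<otimes> ?g p)) (MScale a (?f 1 \<^bold>\<otimes> ?g (p + 1)))"
    by (simp, (rule mor_cong.mor_cong_add_cong mor_cong.mor_cong_tens_scale_right T)+)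
  also have "\<dots> \<approx>[X @ X', Y @ Y'] mpart S (MScale a (f \<^bold>\<otimes> g)) p"
    by (simp, rule mor_cong.mor_cong_sym, (rule mor_cong.mor_cong_scale_add_right mor_type.intros(7) T)+)
  finally show ?case .
next
  case c: (mor_cong_comp_assoc Y Z f X g W h)
  let ?f = "mpart S f" and ?g = "mpart S g" and ?h = "mpart S h"
  have T: "?f a \<turnstile>[Y, Z]" "?g a \<turnstile>[X, Y]" "?h a \<turnstile>[W, X]" for a using c by (auto intro: mpart_type)
  have T': "?f a \<^bold>\<circ> ?g b \<turnstile>[X, Z]" "?g b \<^bold>\<circ> ?h d \<turnstile>[W, Y]" "?f a \<^bold>\<circ> ?g b \<^bold>\<circ> ?h d \<turnstile>[W, Z]" for a b d
    by (rule mor_types(6) | rule T)+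
  have "mpart S ((f \<^bold>\<circ> g) \<^bold>\<circ> h) p \<approx>[W, Z]
    MAdd (MAdd ((?f 0 \<^bold>\<circ> ?g 0) \<^bold>\<circ> ?h p) ((?f 1 \<^bold>\<circ> ?g 1) \<^bold>\<circ> ?h p))
         (MAdd ((?f 0 \<^bold>\<circ> ?g 1) \<^bold>\<circ> ?h (p + 1)) ((?f 1 \<^bold>\<circ> ?g 0) \<^bold>\<circ> ?h (p + 1)))"
    by (simp, (rule mor_cong.mor_cong_add_cong mor_cong.mor_cong_comp_add_left[OF T'(1) T'(1) T(3)])+)
  also have "\<dots> \<approx>[W, Z]
    MAdd (MAdd (?f 0 \<^bold>\<circ> ?g 0 \<^bold>\<circ> ?h p) (?f 1 \<^bold>\<circ> ?g 1 \<^bold>\<circ> ?h p))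
         (MAdd (?f 0 \<^bold>\<circ> ?g 1 \<^bold>\<circ> ?h (p + 1)) (?f 1 \<^bold>\<circ> ?g 0 \<^bold>\<circ> ?h (p + 1)))"
    by (rule mor_cong.mor_cong_add_cong mor_cong.mor_cong_comp_assoc[OF T])+
  also have "\<dots> \<approx>[W, Z]
    MAdd (MAdd (?f 0 \<^bold>\<circ> ?g 0 \<^bold>\<circ> ?h p) (?f 0 \<^bold>\<circ> ?g 1 \<^bold>\<circ> ?h (p + 1)))
         (MAdd (?f 1 \<^bold>\<circ> ?g 1 \<^bold>\<circ> ?h p) (?f 1 \<^bold>\<circ> ?g 0 \<^bold>\<circ> ?h (p + 1)))"
    by (intro m_add_swap T')
  also have "\<dots> \<approx>[W, Z]
    MAdd (MAdd (?f 0 \<^bold>\<circ> ?g 0 \<^bold>\<circ> ?h p) (?f 0 \<^bold>\<circ> ?g 1 \<^bold>\<circ> ?h (p + 1)))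
         (MAdd (?f 1 \<^bold>\<circ> ?g 0 \<^bold>\<circ> ?h (p + 1)) (?f 1 \<^bold>\<circ> ?g 1 \<^bold>\<circ> ?h p))"
    by (rule mor_cong.mor_cong_add_cong[OF mor_cong.mor_cong_refl] mor_cong.mor_cong_add_commute
      mor_types(4) T')+
  also have "\<dots> \<approx>[W, Z] mpart S (f \<^bold>\<circ> g \<^bold>\<circ> h) p"
    by (simp, (rule mor_cong.mor_cong_add_cong
      mor_cong.mor_cong_sym[OF mor_cong.mor_cong_comp_add_right[OF T'(2) T'(2) T(1)]])+)
  finally show ?case .
next
  case c: (mor_cong_comp_id_left X Y f)
  have T: "mpart S f a \<turnstile>[X, Y]" for a using c by (rule mpart_type)
  show ?case
    by (simp, (rule m_add_zero_right_cong mor_cong.mor_cong_comp_id_left m_comp_zero_left T)+)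
next
  case c: (mor_cong_comp_id_right X Y f)
  have T: "mpart S f a \<turnstile>[X, Y]" for a using c by (rule mpart_type)
  show ?case
    by (cases p rule: bit_cases; simp;
      intro m_add_zero_right_cong m_add_zero_cong mor_cong.mor_cong_comp_id_right m_comp_zero_right T)
next
  case c: (mor_cong_tens_assoc X Y f X' Y' g X'' Y'' h)
  let ?f = "mpart S f" and ?g = "mpart S g" and ?h = "mpart S h"
  let ?U = "X @ X' @ X''" and ?V = "Y @ Y' @ Y''"
  have T: "?f a \<turnstile>[X, Y]" "?g a \<turnstile>[X', Y']" "?h a \<turnstile>[X'', Y'']" for a using c by (auto intro: mpart_type)
  have T': "?f a \<^bold>\<otimes> ?g b \<turnstile>[X @ X', Y @ Y']" "?g b \<^bold>\<otimes> ?h d \<turnstile>[X' @ X'', Y' @ Y'']"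
    "?f a \<^bold>\<otimes> ?g b \<^bold>\<otimes> ?h d \<turnstile>[?U, ?V]" for a b d
    by (rule mor_type.intros(7) | rule T)+
  have "mpart S ((f \<^bold>\<otimes> g) \<^bold>\<otimes> h) p \<approx>[?U, ?V]
    MAdd (MAdd ((?f 0 \<^bold>\<otimes> ?g 0) \<^bold>\<otimes> ?h p) ((?f 1 \<^bold>\<otimes> ?g 1) \<^bold>\<otimes> ?h p))
         (MAdd ((?f 0 \<^bold>\<otimes> ?g 1) \<^bold>\<otimes> ?h (p + 1)) ((?f 1 \<^bold>\<otimes> ?g 0) \<^bold>\<otimes> ?h (p + 1)))"
    by (simp, (rule mor_cong.mor_cong_add_cong m_tens_add_left[OF T'(1) T'(1) T(3) append_assoc[symmetric] append_assoc[symmetric]])+)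
  also have "\<dots> \<approx>[?U, ?V]
    MAdd (MAdd (?f 0 \<^bold>\<otimes> ?g 0 \<^bold>\<otimes> ?h p) (?f 1 \<^bold>\<otimes> ?g 1 \<^bold>\<otimes> ?h p))
         (MAdd (?f 0 \<^bold>\<otimes> ?g 1 \<^bold>\<otimes> ?h (p + 1)) (?f 1 \<^bold>\<otimes> ?g 0 \<^bold>\<otimes> ?h (p + 1)))"
    by (rule mor_cong.mor_cong_add_cong mor_cong.mor_cong_tens_assoc[OF T])+
  also have "\<dots> \<approx>[?U, ?V]
    MAdd (MAdd (?f 0 \<^bold>\<otimes> ?g 0 \<^bold>\<otimes> ?h p) (?f 0 \<^bold>\<otimes> ?g 1 \<^bold>\<otimes> ?h (p + 1)))
         (MAdd (?f 1 \<^bold>\<otimes> ?g 1 \<^bold>\<otimes> ?h p) (?f 1 \<^bold>\<otimes> ?g 0 \<^bold>\<otimes> ?h (p + 1)))"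
    by (intro m_add_swap T')
  also have "\<dots> \<approx>[?U, ?V]
    MAdd (MAdd (?f 0 \<^bold>\<otimes> ?g 0 \<^bold>\<otimes> ?h p) (?f 0 \<^bold>\<otimes> ?g 1 \<^bold>\<otimes> ?h (p + 1)))
         (MAdd (?f 1 \<^bold>\<otimes> ?g 0 \<^bold>\<otimes> ?h (p + 1)) (?f 1 \<^bold>\<otimes> ?g 1 \<^bold>\<otimes> ?h p))"
    by (rule mor_cong.mor_cong_add_cong[OF mor_cong.mor_cong_refl] mor_cong.mor_cong_add_commute
      mor_types(4) T')+
  also have "\<dots> \<approx>[?U, ?V] mpart S (f \<^bold>\<otimes> g \<^bold>\<otimes> h) p"
    by (simp, (rule mor_cong.mor_cong_add_cong
      mor_cong.mor_cong_sym[OF m_tens_add_right[OF T(1) T'(2) T'(2) refl refl]])+)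
  finally show ?case .
next
  case c: (mor_cong_tens_unit_left X Y f)
  have T: "mpart S f a \<turnstile>[X, Y]" for a using c by (rule mpart_type)
  have z: "MZero [] [] \<^bold>\<otimes> mpart S f (p + 1) \<approx>[X, Y] MZero X Y"
    using m_tens_zero_left[OF T, of "[]" "[]" "p + 1"] by simp
  show ?case
    by (simp, (rule m_add_zero_right_cong mor_cong.mor_cong_tens_unit_left T z)+)
next
  case c: (mor_cong_tens_unit_right X Y f)
  have T: "mpart S f a \<turnstile>[X, Y]" for a using c by (rule mpart_type)
  have z: "mpart S f a \<^bold>\<otimes> MZero [] [] \<approx>[X, Y] MZero X Y" for a
    using m_tens_zero_right[OF T, of "[]" "[]" a] by simp
  show ?case
  proof (cases p rule: bit_cases)
    case even
    then show ?thesis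
      by (simp add: m_add_zero_right_cong[OF mor_cong.mor_cong_tens_unit_right[OF T] z])
  next
    case odd
    then show ?thesis
      by (simp add: m_add_zero_cong[OF z mor_cong.mor_cong_tens_unit_right[OF T]])
  qed
next
  case c: (mor_cong_tens_id X Y)
  have "mor_homog S 0 (X @ Y) (X @ Y) (MId X \<^bold>\<otimes> MId Y)"
    using mor_homog.intros(7)[OF mor_homog.intros(2) mor_homog.intros(2), of S X Y] by simp
  then have q: "mhom 0 (X @ Y) (X @ Y) (MId X \<^bold>\<otimes> MId Y)" by (rule mor_homog_mhom)
  show ?case
  proof (cases p rule: bit_cases)
    case even
    have "mpart S (MId X \<^bold>\<otimes> MId Y) p \<approx>[X @ Y, X @ Y] MId X \<^bold>\<otimes> MId Y"
      unfolding even by (rule mhom_same[OF q])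
    also have "\<dots> \<approx>[X @ Y, X @ Y] MId (X @ Y)" by (rule mor_cong.mor_cong_tens_id)
    finally show ?thesis using even by simp
  next
    case odd
    have "mpart S (MId X \<^bold>\<otimes> MId Y) p \<approx>[X @ Y, X @ Y] MZero (X @ Y) (X @ Y)"
      by (rule mhom_other[OF q]) (simp add: odd)
    then show ?thesis using odd by simp
  qed
next
  case c: (mor_cong_super_interchange a X Y f b V W g Z f' U g')
  let ?F = "\<lambda>x. (mpart S f' x \<^bold>\<circ> f) \<^bold>\<otimes> (g \<^bold>\<circ> mpart S g' (p + a + b + x))"
  let ?A = "X @ U" and ?B = "Z @ W" and ?e = "if a = 1 \<and> b = 1 then - 1 else 1 :: 'k"
  have f: "mhom a X Y f" and g: "mhom b V W g" using c by (auto intro: mor_homog_mhom)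
  have T: "f \<turnstile>[X, Y]" "g \<turnstile>[V, W]" "f' \<turnstile>[Y, Z]" "g' \<turnstile>[U, V]"
    "mpart S f' x \<turnstile>[Y, Z]" "mpart S g' x \<turnstile>[U, V]" for x
    using f g c by (auto simp: mhom_def intro: mpart_type)
  have TF: "?F x \<turnstile>[?A, ?B]" for x by (rule mor_types(6) mor_type.intros(7) T)+
  have b: "p + x + a = p + a + b + (x + b)" "p + x + b = p + a + b + (x + a)" for x
    by (cases p; cases a; cases b; cases x; simp)+
  have L: "mpart S (f' \<^bold>\<otimes> g) x \<^bold>\<circ> mpart S (f \<^bold>\<otimes> g') (p + x) \<approx>[?A, ?B] MScale ?e (?F (x + b))" for x
  proof -
    have "mpart S (f' \<^bold>\<otimes> g) x \<^bold>\<circ> mpart S (f \<^bold>\<otimes> g') (p + x) \<approx>[?A, ?B]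
        (mpart S f' (x + b) \<^bold>\<otimes> g) \<^bold>\<circ> (f \<^bold>\<otimes> mpart S g' (p + x + a))"
      by (rule mor_cong.mor_cong_comp_cong[OF mpart_tens_right[OF g] mpart_tens_left[OF f]] T)+
    also have "\<dots> \<approx>[?A, ?B] MScale ?e (?F (x + b))"
      unfolding b(1) by (rule mor_cong.mor_cong_super_interchange c T)+
    finally show ?thesis .
  qed
  have R: "mpart S (f' \<^bold>\<circ> f) x \<^bold>\<otimes> mpart S (g \<^bold>\<circ> g') (p + x) \<approx>[?A, ?B] ?F (x + a)" for x
    unfolding b(2)[symmetric]
    by (rule mor_cong.mor_cong_tens_cong mpart_comp_right[OF f] mpart_comp_left[OF g] T)+
  have swap: "MAdd (?F (0 + x)) (?F (1 + x)) \<approx>[?A, ?B] MAdd (?F 0) (?F 1)" for x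
  proof (cases x rule: bit_cases)
    case even
    show ?thesis unfolding even using mor_types(4)[OF TF[of 0] TF[of 1]]
      by (simp only: add_0_right) (rule mor_cong.mor_cong_refl)
  next
    case odd
    show ?thesis unfolding odd using mor_cong.mor_cong_add_commute[OF TF[of 1] TF[of 0]]
      by (simp only: add_0_left bit_add_simps)
  qed
  have "mpart S ((f' \<^bold>\<otimes> g) \<^bold>\<circ> (f \<^bold>\<otimes> g')) p \<approx>[?A, ?B] MAdd (MScale ?e (?F (0 + b))) (MScale ?e (?F (1 + b)))"
    using mor_cong.mor_cong_add_cong[OF L[of 0] L[of 1]] by (simp only: mpart.simps(6) add_0_right)
  also have "\<dots> \<approx>[?A, ?B] MScale ?e (MAdd (?F (0 + b)) (?F (1 + b)))"
    by (rule mor_cong.mor_cong_sym, rule mor_cong.mor_cong_scale_add_right[OF TF TF])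
  also have "\<dots> \<approx>[?A, ?B] MScale ?e (MAdd (?F 0) (?F 1))"
    by (rule mor_cong.mor_cong_scale_cong[OF swap])
  also have "\<dots> \<approx>[?A, ?B] MScale ?e (MAdd (?F (0 + a)) (?F (1 + a)))"
    by (rule mor_cong.mor_cong_scale_cong[OF mor_cong.mor_cong_sym[OF swap]])
  also have "\<dots> \<approx>[?A, ?B] mpart S (MScale ?e ((f' \<^bold>\<circ> f) \<^bold>\<otimes> (g \<^bold>\<circ> g'))) p"
    using mor_cong.mor_cong_scale_cong[OF mor_cong.mor_cong_sym[OF mor_cong.mor_cong_add_cong[OF R[of 0] R[of 1]]], of ?e]
    by (simp only: mpart.simps(5,7) add_0_right)
  finally show ?case .
next
  case c: (mor_cong_add_assoc X Y f g h)
  then show ?case by (simp add: mor_cong.mor_cong_add_assoc mpart_type)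
qed (auto intro!: mcong_ax mpart_type)

lemma graded_congruence_mor:
  assumes hom: "\<And>f g. R f g \<Longrightarrow> \<exists>p X Y. mor_homog S p X Y f \<and> mor_homog S p X Y g"
  shows "graded_congruence {f. f \<turnstile>[X, X]} {(f, g). f \<approx>[X, X] g} MAdd (MZero X X) MScale MComp (MId X)
    (\<lambda>p. {f. mor_homog S p X X f})"
proof
  show "equiv {f. f \<turnstile>[X, X]} {(f, g). f \<approx>[X, X] g}"
    by (rule equivI) (auto simp: refl_on_def sym_def trans_def dest: mor_cong_type
      intro: mor_cong_refl mor_cong_sym, blast intro: mor_cong_trans)
  show "\<exists>x0\<in>{f. mor_homog S 0 X X f}. \<exists>x1\<in>{f. mor_homog S 1 X X f}.
      (x, MAdd x0 x1) \<in> {(f, g). f \<approx>[X, X] g}" if "x \<in> {f. f \<turnstile>[X, X]}" for x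
    using that mpart_split[of X X x]
    by (intro bexI[of _ "mpart S x 0"] bexI[of _ "mpart S x 1"]) (simp_all add: mpart_is_homog)
  show "(x0, MZero X X) \<in> {(f, g). f \<approx>[X, X] g} \<and> (x1, MZero X X) \<in> {(f, g). f \<approx>[X, X] g}"
    if "x0 \<in> {f. mor_homog S 0 X X f}" "x1 \<in> {f. mor_homog S 1 X X f}"
      "(MAdd x0 x1, MZero X X) \<in> {(f, g). f \<approx>[X, X] g}" for x0 x1
  proof -
    from that have h: "mhom 0 X X x0" "mhom 1 X X x1" by (auto intro: mor_homog_mhom)
    have z: "MAdd (mpart S x0 q) (mpart S x1 q) \<approx>[X, X] MZero X X" for q
      using mpart_cong[OF hom, where f = "MAdd x0 x1" and g = "MZero X X" and X = X and Y = X and p = q] that by simp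
    have "MAdd (mpart S x0 0) (mpart S x1 0) \<approx>[X, X] x0"
      by (rule m_add_zero_right_cong[OF mhom_same[OF h(1)] mhom_other[OF h(2)]]) simp
    moreover have "MAdd (mpart S x0 1) (mpart S x1 1) \<approx>[X, X] x1"
      by (rule m_add_zero_cong[OF mhom_other[OF h(1)] mhom_same[OF h(2)]]) simp
    ultimately show ?thesis using z by (blast intro: mor_cong_sym mor_cong_trans)
  qed
qed (auto intro: mor_cong.intros(5-31) mor_cong_refl mor_types mor_homog.intros dest: mor_homog_type)

lemma superalgebra_End:
  assumes hom: "\<And>f g. R f g \<Longrightarrow> \<exists>p X Y. mor_homog S p X Y f \<and> mor_homog S p X Y g"
  shows "superalgebra (End_superalgebra S R X)"
proof -
  interpret graded_congruence "{f. f \<turnstile>[X, X]}" "{(f, g). f \<approx>[X, X] g}" MAdd "MZero X X" MScale MComp "MId X"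
    "\<lambda>p. {f. mor_homog S p X X f}"
    using graded_congruence_mor[OF hom] .
  show ?thesis using superalgebra_A by (simp add: A_def End_superalgebra_def)
qed

end

lemma mor_homogI:
  "p = gpar S a \<Longrightarrow> X = gdom S a \<Longrightarrow> Y = gcod S a \<Longrightarrow> mor_homog S p X Y (MGen a)"
  "p = 0 \<Longrightarrow> Y = X \<Longrightarrow> Z = X \<Longrightarrow> mor_homog S p Y Z (MId X)"
  "mor_homog S q Y Z f \<Longrightarrow> mor_homog S r X Y g \<Longrightarrow> p = q + r \<Longrightarrow> mor_homog S p X Z (f \<^bold>\<circ> g)"
  "mor_homog S q X Y f \<Longrightarrow> mor_homog S r X' Y' g \<Longrightarrow> p = q + r \<Longrightarrow> U = X @ X' \<Longrightarrow> V = Y @ Y' \<Longrightarrow>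
   mor_homog S p U V (f \<^bold>\<otimes> g)"
  "U = X \<Longrightarrow> V = Y \<Longrightarrow> mor_homog S p U V (MZero X Y)"
  by (auto intro: mor_homog.intros)

lemma Q_sig_simps [simp]:
  "gdom Q_sig = Q_dom" "gcod Q_sig = Q_cod" "gpar Q_sig g = (if g = Cl then 1 else 0)"
  by (simp_all add: Q_sig_def)

lemma Q_rel_homog: "Q_rel z f g \<Longrightarrow> \<exists>p X Y. mor_homog Q_sig p X Y f \<and> mor_homog Q_sig p X Y g"
  apply (induction rule: Q_rel.induct)
  apply (unfold lplus_def capR_def)
  apply (intro exI conjI, (rule mor_homogI mor_homog.intros(4,5) refl | (simp; fail))+)+
  done

theorem superalgebra_End_Q: "superalgebra (End_Q z X)"
  unfolding End_Q_def by (rule superalgebra_End) (rule Q_rel_homog)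


primrec aeval :: "('k::comm_ring_1, 'g) aterm \<Rightarrow> 'k" where
  "aeval (AGen g) = 0"
| "aeval AOne = 1"
| "aeval AZero = 0"
| "aeval (AAdd s t) = aeval s + aeval t"
| "aeval (AScale c s) = c * aeval s"
| "aeval (s \<bullet> t) = aeval s * aeval t"

lemma BC_rel_gen: "BC_rel z r s t \<Longrightarrow> s \<notin> aterms {}"
  by (induction rule: BC_rel.induct) auto

lemma acong_aeval: "acong {} (BC_rel z r) s t \<Longrightarrow> aeval s = aeval t"
proof (induction rule: acong.induct)
  case (acong_rel s t)
  then show ?case using BC_rel_gen by blast
qed (auto simp: algebra_simps)

lemma acong_scalar:
  assumes "s \<in> aterms {}"
  shows "acong {} R s (AScale (aeval s) AOne)"
  using assms
proof (induction s)
  case AOne show ?case by (simp, rule acong.acong_sym, rule acong.acong_scale_one) simp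
next
  case AZero
  have "acong {} R (AAdd (AScale 0 AOne) (AScale 0 AOne)) (AScale 0 AOne)"
    using acong_sym[OF acong_scale_add_left[of AOne "{}" R 0 0]] by simp
  then have "acong {} R (AScale 0 AOne) AZero"
    by (rule acong_add_left_cancel) auto
  then show ?case by (simp add: acong_sym)
next
  case (AAdd s t)
  have "acong {} R (AAdd s t) (AAdd (AScale (aeval s) AOne) (AScale (aeval t) AOne))"
    using AAdd by (auto intro: acong_add_cong)
  also have "acong {} R \<dots> (AScale (aeval s + aeval t) AOne)"
    by (rule acong_sym, rule acong_scale_add_left) simp
  finally show ?case by simp
next
  case (AScale c s)
  have "acong {} R (AScale c s) (AScale c (AScale (aeval s) AOne))"
    using AScale by (auto intro: acong_scale_cong)
  also have "acong {} R \<dots> (AScale (c * aeval s) AOne)"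
    by (rule acong_sym, rule acong_scale_scale) simp
  finally show ?case by simp
next
  case (AMult s t)
  let ?s = "aeval s" and ?t = "aeval t"
  have "acong {} R (s \<bullet> t) (AScale ?s AOne \<bullet> AScale ?t AOne)"
    using AMult by (auto intro: acong_mult_cong)
  also have "acong {} R \<dots> (AScale ?s (AOne \<bullet> AScale ?t AOne))"
    by (rule acong_mult_scale_left) auto
  also have "acong {} R \<dots> (AScale ?s (AScale ?t AOne))"
    by (intro acong_scale_cong acong_mult_one_left) auto
  also have "acong {} R \<dots> (AScale (?s * ?t) AOne)"
    by (rule acong_sym, rule acong_scale_scale) simp
  finally show ?case by simp
qed auto

lemma aeval_odd: "ahomog par p s \<Longrightarrow> p = 1 \<Longrightarrow> aeval s = 0"
proof (induction rule: ahomog.induct)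
  case (6 p s q t)
  then have "p = 1 \<or> q = 1" by (cases p; cases q) auto
  with 6 show ?case by auto
qed auto

theorem BC_0_0: "ground_superalgebra \<cong>\<^sub>s BC (z :: 'k::comm_ring_1) 0 0"
proof -
  let ?R = "BC_rel z 0"
  interpret graded_congruence "aterms {}" "{(s, t). acong {} ?R s t}" AAdd AZero AScale AMult AOne
    "\<lambda>p. {t \<in> aterms {}. ahomog BC_par p t}"
    by (rule graded_congruence_acong) (rule BC_rel_homog)
  have G: "BC_gens 0 0 = {}" by (auto simp: BC_gens_def)
  have BC: "BC z 0 0 = A"
    unfolding A_def BC_def presented_superalgebra_def G ..
  define h where "h c = cl (AScale c AOne)" for c :: 'k
  have cl: "cl s = h (aeval s)" if "s \<in> aterms {}" for s
    unfolding h_def using acong_scalar[OF that] by (intro cl_eqI) simp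
  have inj: "inj h"
  proof (rule injI)
    fix a b assume "h a = h b"
    then have "acong {} ?R (AScale a AOne) (AScale b AOne)"
      by (simp add: h_def cl_eq_iff)
    from acong_aeval[OF this] show "a = b" by simp
  qed
  have hA: "h c \<in> carrier A" for c by (auto simp: h_def carrier_A)
  have hom: "h (a * b) = h a \<otimes>\<^bsub>A\<^esub> h b" "h (a + b) = h a \<oplus>\<^bsub>A\<^esub> h b" "h (a * b) = a \<odot>\<^bsub>A\<^esub> h b"
    "h 1 = \<one>\<^bsub>A\<^esub>" for a b
    
  proof -
    have 1: "h a \<otimes>\<^bsub>A\<^esub> h b = h (a * b)" "h a \<oplus>\<^bsub>A\<^esub> h b = h (a + b)" "a \<odot>\<^bsub>A\<^esub> h b = h (a * b)"
      using cl[of "AScale a AOne \<bullet> AScale b AOne"] cl[of "AAdd (AScale a AOne) (AScale b AOne)"]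
        cl[of "AScale a (AScale b AOne)"]
      by (simp_all add: h_def[of a] h_def[of b])
    show "h (a * b) = h a \<otimes>\<^bsub>A\<^esub> h b" "h (a + b) = h a \<oplus>\<^bsub>A\<^esub> h b" "h (a * b) = a \<odot>\<^bsub>A\<^esub> h b"
      using 1 by simp_all
    show "h 1 = \<one>\<^bsub>A\<^esub>" by (simp add: one_A cl)
  qed
  have surj: "carrier A = range h"
    using hA by (auto simp: carrier_A cl)
  have "h \<in> ring_iso ground_superalgebra A"
    unfolding ring_iso_def using inj hA hom
    by (auto intro!: ring_hom_memI simp: ground_superalgebra_def bij_betw_def surj)
  moreover have "part A 0 = range h"
  proof -
    have "AScale c AOne \<in> {t \<in> aterms {}. ahomog BC_par 0 t}" for c :: 'k
      by (auto intro: ahomog.intros)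
    then have "h c \<in> part A 0" for c unfolding part_A h_def by blast
    moreover have "part A 0 \<subseteq> range h" by (auto simp: part_A cl)
    ultimately show ?thesis by auto
  qed
  moreover have "part A 1 = {h 0}"
  proof -
    have "AZero \<in> {t \<in> aterms {}. ahomog BC_par 1 t}" by (auto intro: ahomog.intros)
    then have "cl AZero \<in> part A 1" unfolding part_A by blast
    then have "h 0 \<in> part A 1" by (simp add: cl)
    moreover have "cl x = h 0" if "x \<in> aterms {}" "ahomog BC_par 1 x" for x
      using cl[OF that(1)] aeval_odd[OF that(2)] by simp
    ultimately show ?thesis unfolding part_A by auto
  qed
  ultimately have "h \<in> superalg_iso ground_superalgebra A"
    unfolding superalg_iso_def using hom(3)
    by (auto simp: ground_superalgebra_def split: if_splits)
  then show ?thesis unfolding BC is_superalg_iso_def by blast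
qed

end

theory Submission
 imports Complex_Main Defs "Jordan_Normal_Form.Determinant"
begin

text \<open>
 The crossings identify every word with a sorted word \<open>\<up>\<^sup>r \<down>\<^sup>s\<close>, and the generators of \<open>BC\<^sub>r\<^sub>,\<^sub>s\<close> act by diagrams
 on the morphisms into \<open>\<up>\<^sup>r \<down>\<^sup>s\<close>.  Surjectivity: enlarge the orbit of the identity by cups, caps and
 crossings, level by level; the result is stable under all generating morphisms and contains no
 endomorphism of \<open>\<up>\<^sup>r \<down>\<^sup>s\<close> outside the orbit.  Injectivity: with \<open>m = r + s\<close>, straightening shows that
 \<open>2\<^sup>m m!\<close> elements span \<open>BC\<^sub>r\<^sub>,\<^sub>s\<close>, while a matrix representation of the category over
 \<open>k[q] / (q\<^sup>2 - z q - 1)\<close> gives \<open>2\<^sup>m m!\<close> endomorphisms of \<open>\<up>\<^sup>m\<close> with a dual family of linear functionals,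
 and bending strands carries these over to \<open>\<up>\<^sup>r \<down>\<^sup>s\<close>.  Hence the matrix that expresses these
 endomorphisms in the spanning elements is invertible, and no combination of the latter acts as zero.
\<close>

text \<open>The ground ring is arbitrary, so neither dimension nor freeness is available, and the
  two sides are compared by counting. If \<open>N\<close> elements span and \<open>N\<close> of
  their combinations have a dual family of functionals, the square matrix of coefficients has a
  one-sided, hence a two-sided inverse; independence of the spanning elements is then a consequence.
  The delicate point of surjectivity is that an endomorphism of a sorted word may factor through
  words of any length: the spaces attached to the other words must be closed under cups and caps and
  yet send nothing new back to the sorted word. The matrices come from the action of the quantum
  isomeric superalgebra on tensor powers of its natural module. There the crossing satisfies
  \<open>(u - q) (u + 1/q) = 0\<close> with \<open>z = q - 1/q\<close>, which is why a root of
  \<open>q^2 = z q + 1\<close> is adjoined; the coefficient of 1 turns values in the extension back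
  into functionals over \<open>'k\<close>.\<close>

section \<open>Hecke--Clifford modules\<close>

text \<open>The parameters \<open>z\<close> and \<open>a\<close> stay free because the same
  relations occur with squares \<open>- 1\<close> and \<open>1\<close> of the Clifford generators
  and, after inversion of the crossings, with \<open>- z\<close>. They are demanded on
  \<open>C\<close> only: operators on the space of all morphisms satisfy them only where the strands
  have the right orientation.\<close>

locale hecke_clifford_module = Modules.module scale
 for scale :: "'k::comm_ring_1 => 'm::ab_group_add => 'm" (infixr \<open>*\<^sub>r\<close> 75) +
 fixes C :: "'m set" and T P :: "nat => 'm => 'm" and z a :: 'k and n :: nat
 assumes C: "subspace C"
  and TC: "\<And>i x. 1 \<le> i ==> i < n ==> x \<in> C ==> T i x \<in> C"
  and PC: "\<And>i x. 1 \<le> i ==> i \<le> n ==> x \<in> C ==> P i x \<in> C"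
  and T_hom: "\<And>i. module_hom scale scale (T i)"
  and P_hom: "\<And>i. module_hom scale scale (P i)"
  and TT: "\<And>i x. 1 \<le> i ==> i < n ==> x \<in> C ==> T i (T i x) = z *\<^sub>r T i x + x"
  and braid: "\<And>i x. 1 \<le> i ==> i + 1 < n ==> x \<in> C ==>
   T i (T (i + 1) (T i x)) = T (i + 1) (T i (T (i + 1) x))"
  and T_far: "\<And>i j x. 1 \<le> i ==> i + 1 < j ==> j < n ==> x \<in> C ==> T i (T j x) = T j (T i x)"
  and PP: "\<And>i x. 1 \<le> i ==> i \<le> n ==> x \<in> C ==> P i (P i x) = a *\<^sub>r x"
  and P_anti: "\<And>i j x. 1 \<le> i ==> i \<le> n ==> 1 \<le> j ==> j \<le> n ==> i \<noteq> j ==> x \<in> C ==>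
   P i (P j x) = - P j (P i x)"
  and TP: "\<And>i x. 1 \<le> i ==> i < n ==> x \<in> C ==> T i (P i x) = P (i + 1) (T i x)"
  and TP_far: "\<And>i j x. 1 \<le> i ==> i < n ==> 1 \<le> j ==> j \<le> n ==> j \<noteq> i ==> j \<noteq> i + 1 ==> x \<in> C ==>
   T i (P j x) = P j (T i x)"
begin

lemma lin [simp]:
 "T i (x + y) = T i x + T i y" "P i (x + y) = P i x + P i y"
 "T i (c *\<^sub>r x) = c *\<^sub>r T i x" "P i (c *\<^sub>r x) = c *\<^sub>r P i x"
 "T i 0 = 0" "P i 0 = 0" "T i (- x) = - T i x" "P i (- x) = - P i x"
 "T i (x - y) = T i x - T i y" "P i (x - y) = P i x - P i y"
 using T_hom[of i] P_hom[of i]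
 by (simp_all add: Modules.module_hom.add Modules.module_hom.scale Modules.module_hom.zero Modules.module_hom.neg Modules.module_hom.diff)

text \<open>\<open>?y\<close> is the image of \<open>x\<close> under the inverse of
  \<open>T i\<close>. Writing \<open>x = T i ?y\<close> lets \<open>TP\<close> move the Clifford
  generator, and the quadratic relation removes the double \<open>T i\<close>.\<close>

lemma TP_Suc:
 assumes "1 \<le> i" "i < n" "x \<in> C"
 shows "T i (P (i + 1) x) = P i (T i x) - z *\<^sub>r P i x + z *\<^sub>r P (i + 1) x"
proof -
 note c = TC PC assms
 let ?y = "T i x - z *\<^sub>r x"
 have y: "?y \<in> C" using c C by (auto intro!: subspace_diff subspace_scale)
 have "T i ?y = x" using TT[of i x] assms by (simp add: algebra_simps)
 hence "P (i + 1) x = T i (P i ?y)" using TP[of i ?y] y assms by simp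
 hence "T i (P (i + 1) x) = T i (T i (P i ?y))" by simp
 also have "... = z *\<^sub>r T i (P i ?y) + P i ?y" using TT[of i "P i ?y"] PC[of i ?y] y assms by simp
 also have "T i (P i ?y) = P (i + 1) x" using \<open>P (i + 1) x = _\<close> by simp
 finally show ?thesis by (simp add: algebra_simps)
qed

text \<open>The product of \<open>T j, T (j + 1), ..., T (m - 1)\<close>. For \<open>m = n\<close>
  these are the minimal representatives of the cosets of the symmetric group on \<open>n\<close>
  letters modulo that on the first \<open>n - 1\<close>.\<close>

definition ch :: "nat => nat => 'm => 'm" where
 "ch j m x = foldr T [j..<m] x"

lemma ch_same [simp]: "ch j j x = x" by (simp add: ch_def)
lemma ch_step: "j < m ==> ch j m x = T j (ch (j + 1) m x)"
 by (simp add: ch_def upt_conv_Cons)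

lemma ch_split: "j \<le> i ==> i \<le> m ==> ch j m x = ch j i (ch i m x)"
 unfolding ch_def using upt_add_eq_append[of j i "m - i"] by (simp add: foldr_append)

lemma ch_C: "1 \<le> j ==> m \<le> n ==> x \<in> C ==> ch j m x \<in> C"
 unfolding ch_def
proof (induction "m - j" arbitrary: j)
 case (Suc d)
 hence "foldr T [j..<m] x = T j (foldr T [Suc j..<m] x)" by (simp add: upt_conv_Cons)
 with Suc show ?case by (auto intro!: TC)
qed simp

lemma ch_T_far:
 assumes "1 \<le> i" "i < n" "1 \<le> j" "m \<le> n" "i + 1 < j \<or> m < i" "x \<in> C"
 shows "T i (ch j m x) = ch j m (T i x)"
 using assms
proof (induction "m - j" arbitrary: j)
 case 0
 thus ?case by (simp add: ch_def)
next
 case (Suc d)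
 hence "T i (T j (ch (j + 1) m x)) = T j (T i (ch (j + 1) m x))"
  using T_far[of i j "ch (j + 1) m x"] T_far[of j i "ch (j + 1) m x"] ch_C[of "j + 1" m x]
  by auto
 moreover have "T i (ch (j + 1) m x) = ch (j + 1) m (T i x)" using Suc.prems Suc.hyps(2) by (intro Suc.hyps) auto
 ultimately show ?case using Suc.hyps(2) by (simp add: ch_step)
qed

lemma ch_P_far:
 assumes "1 \<le> i" "i \<le> n" "1 \<le> j" "m \<le> n" "i < j \<or> m < i" "x \<in> C"
 shows "P i (ch j m x) = ch j m (P i x)"
 using assms
proof (induction "m - j" arbitrary: j)
 case 0
 thus ?case by (simp add: ch_def)
next
 case (Suc d)
 hence "P i (T j (ch (j + 1) m x)) = T j (P i (ch (j + 1) m x))"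
  using TP_far[of j i "ch (j + 1) m x"] ch_C[of "j + 1" m x] by auto
 moreover have "P i (ch (j + 1) m x) = ch (j + 1) m (P i x)" using Suc.prems Suc.hyps(2) by (intro Suc.hyps) auto
 ultimately show ?case using Suc.hyps(2) by (simp add: ch_step)
qed

text \<open>Only the factor \<open>T (i - 1)\<close> of the chain touches the index: it turns
  \<open>P (i - 1)\<close> into \<open>P i\<close>. The other factors commute with the Clifford
  generator they meet.\<close>

lemma P_ch:
 assumes "1 \<le> j" "j < i" "i \<le> m" "m \<le> n" "x \<in> C"
 shows "P i (ch j m x) = ch j m (P (i - 1) x)"
proof -
 let ?y = "ch i m x"
 have y: "?y \<in> C" using assms ch_C by simp
 have s: "ch j m u = ch j (i - 1) (T (i - 1) (ch i m u))" for u
  using ch_split[of j "i - 1" m u] ch_step[of "i - 1" m u] assms by simp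
 have "P i (ch j m x) = ch j (i - 1) (P i (T (i - 1) ?y))"
  unfolding s using ch_P_far[of i j "i - 1" "T (i - 1) ?y"] TC[of "i - 1" ?y] y assms by simp
 also have "P i (T (i - 1) ?y) = T (i - 1) (P (i - 1) ?y)"
  using TP[of "i - 1" ?y] y assms by simp
 also have "P (i - 1) ?y = ch i m (P (i - 1) x)"
  using ch_P_far[of "i - 1" i m x] assms by simp
 finally show ?thesis by (simp add: s)
qed

lemma T_ch:
 assumes "1 \<le> j" "j < i" "i < m" "m \<le> n" "x \<in> C"
 shows "T i (ch j m x) = ch j m (T (i - 1) x)"
proof -
 let ?y = "ch (i + 1) m x"
 have y: "?y \<in> C" using assms ch_C by simp
 have s: "ch j m u = ch j (i - 1) (T (i - 1) (T i (ch (i + 1) m u)))" for u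
  using ch_split[of j "i - 1" m u] ch_step[of "i - 1" m u] ch_step[of i m u] assms by simp
 have "T i (ch j m x) = ch j (i - 1) (T i (T (i - 1) (T i ?y)))"
  unfolding s using ch_T_far[of i j "i - 1" "T (i - 1) (T i ?y)"] TC y assms by simp
 also have "T i (T (i - 1) (T i ?y)) = T (i - 1) (T i (T (i - 1) ?y))"
  using braid[of "i - 1" ?y] y assms by simp
 also have "T (i - 1) ?y = ch (i + 1) m (T (i - 1) x)"
  using ch_T_far[of "i - 1" "i + 1" m x] assms by simp
 finally show ?thesis by (simp add: s)
qed

text \<open>The induced module: when \<open>V\<close> is stable under the generators on the first
  \<open>n - 1\<close> strands, its \<open>2 * n\<close> translates, one for each coset and each
  parity, already span something stable under all generators.\<close>

definition coset_span :: "'m set => 'm set" where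
 "coset_span V = span ((\<Union>j\<in>{1..n}. ch j n ` V) \<union> (\<Union>j\<in>{1..n}. (\<lambda>x. P j (ch j n x)) ` V))"

context
 fixes V
 assumes V: "subspace V" "V \<subseteq> C"
  and VT: "\<And>i x. 1 \<le> i ==> i + 1 < n ==> x \<in> V ==> T i x \<in> V"
  and VP: "\<And>i x. 1 \<le> i ==> i < n ==> x \<in> V ==> P i x \<in> V"
begin

lemma coset_span_ch: "x \<in> V ==> 1 \<le> j ==> j \<le> n ==> ch j n x \<in> coset_span V"
 unfolding coset_span_def by (intro span_base UnI1 UN_I) auto

lemma coset_span_P_ch: "x \<in> V ==> 1 \<le> j ==> j \<le> n ==> P j (ch j n x) \<in> coset_span V"
 unfolding coset_span_def by (intro span_base UnI2 UN_I) auto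

lemma subspace_coset_span: "subspace (coset_span V)"
 unfolding coset_span_def by (rule subspace_span)

lemmas coset_span_closed = subspace_add[OF subspace_coset_span] subspace_diff[OF subspace_coset_span]
 subspace_scale[OF subspace_coset_span] subspace_neg[OF subspace_coset_span]
 coset_span_ch coset_span_P_ch

lemma P_ch_V:
 assumes "x \<in> V" "1 \<le> j" "j \<le> n" "1 \<le> i" "i \<le> n" "i \<noteq> j"
 shows "\<exists>y\<in>V. P i (ch j n x) = ch j n y"
proof (cases "i < j")
 case True
 thus ?thesis using assms V VP[of i x] ch_P_far[of i j n x] by (intro bexI[of _ "P i x"]) auto
next
 case False
 thus ?thesis using assms V VP[of "i - 1" x] P_ch[of j i n x]
  by (intro bexI[of _ "P (i - 1) x"]) auto
qed

lemma T_ch_V: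
 assumes "x \<in> V" "1 \<le> j" "j \<le> n" "1 \<le> i" "i < n" "i \<noteq> j" "j \<noteq> i + 1"
 shows "\<exists>y\<in>V. T i (ch j n x) = ch j n y"
proof (cases "i < j")
 case True
 thus ?thesis using assms V VT[of i x] ch_T_far[of i j n x] by (intro bexI[of _ "T i x"]) auto
next
 case False
 thus ?thesis using assms V VT[of "i - 1" x] T_ch[of j i n x]
  by (intro bexI[of _ "T (i - 1) x"]) auto
qed

lemma P_ch_coset:
 assumes "x \<in> V" "1 \<le> j" "j \<le> n" "1 \<le> i" "i \<le> n"
 shows "P i (ch j n x) \<in> coset_span V"
 using P_ch_V[OF assms] coset_span_P_ch[of x j] coset_span_ch assms by (cases "i = j") auto

lemma coset_span_P:
 assumes i: "1 \<le> i" "i \<le> n" and "x \<in> coset_span V"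
 shows "P i x \<in> coset_span V"
 using assms(3)[unfolded coset_span_def]
proof (induction rule: span_induct_alt)
 case (step c x y)
 have "P i x \<in> coset_span V"
 proof -
  from step obtain j v where j: "j \<in> {1..n}" "v \<in> V" "x = ch j n v \<or> x = P j (ch j n v)" by auto
  have C: "ch j n v \<in> C" using ch_C[of j n v] j V by auto
  consider "x = ch j n v" | "x = P j (ch j n v)" "i = j" | "x = P j (ch j n v)" "i \<noteq> j"
   using j by blast
  thus ?thesis
  proof cases
   case 1 thus ?thesis using P_ch_coset j i by auto
  next
   case 2 thus ?thesis using PP[of j, OF _ _ C] j i coset_span_closed(3,5) by auto
  next
   case 3
   with P_ch_V[of v j i] i j obtain y where "y \<in> V" "P i (ch j n v) = ch j n y" by auto
   thus ?thesis using 3 P_anti[of i j, OF _ _ _ _ _ C] i j coset_span_closed(4,6) by auto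
  qed
 qed
 thus ?case using step coset_span_closed by auto
qed (use subspace_0[OF subspace_coset_span] in simp)

lemma coset_span_T:
 assumes i: "1 \<le> i" "i < n" and "x \<in> coset_span V"
 shows "T i x \<in> coset_span V"
 using assms(3)[unfolded coset_span_def]
proof (induction rule: span_induct_alt)
 case (step c x y)
 have "T i x \<in> coset_span V"
 proof -
  from step obtain j v where j: "j \<in> {1..n}" "v \<in> V" "x = ch j n v \<or> x = P j (ch j n v)" by auto
  have C: "ch k n v \<in> C" if "1 \<le> k" for k using ch_C[of k n v] that j V by auto
  have T1: "T i (ch (i + 1) n v) = ch i n v" using ch_step[of i n v] i by simp
  have T2: "T i (ch i n v) = z *\<^sub>r ch i n v + ch (i + 1) n v"
   using TT[of i "ch (i + 1) n v"] C[of "i + 1"] i ch_step[of i n v] by simp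
  consider (a) "j \<noteq> i" "j \<noteq> i + 1" | (b) "j = i" | (c) "j = i + 1" by blast
  thus ?thesis
  proof cases
   case a
   with T_ch_V[of v j i] i j obtain y where y: "y \<in> V" "T i (ch j n v) = ch j n y" by auto
   thus ?thesis using TP_far[of i j, OF _ _ _ _ _ _ C] a i j coset_span_closed(5,6) by auto
  next
   case b
   hence "T i x = z *\<^sub>r ch i n v + ch (i + 1) n v \<or>
     T i x = z *\<^sub>r P (i + 1) (ch i n v) + P (i + 1) (ch (i + 1) n v)"
    using j(3) T2 TP[of i "ch i n v"] C i by auto
   thus ?thesis using P_ch_coset[of v i "i + 1"] j i coset_span_closed
    by auto
  next
   case c
   hence "T i x = ch i n v \<or> T i x = P i (ch i n v) - z *\<^sub>r P i (ch (i + 1) n v) +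
     z *\<^sub>r P (i + 1) (ch (i + 1) n v)"
    using j(3) T1 TP_Suc[of i "ch (i + 1) n v"] C[of "i + 1"] i by auto
   thus ?thesis using P_ch_coset[of v "i + 1" i] j i coset_span_closed
    by auto
  qed
 qed
 thus ?case using step coset_span_closed by auto
qed (use subspace_0[OF subspace_coset_span] in simp)

lemma coset_span_V: "1 \<le> n ==> V \<subseteq> coset_span V"
 using coset_span_ch[of _ n] by auto

end

end

section \<open>Associative algebras as corners of a larger one\<close>

locale corner_algebra = Modules.module scale
 for scale :: "'k::comm_ring_1 => 'a::ab_group_add => 'a" (infixr \<open>*\<^sub>r\<close> 75) +
 fixes mul :: "'a => 'a => 'a" (infixl \<open>**\<close> 80) and I :: 'a
 assumes mul_add_left: "(x + y) ** w = x ** w + y ** w"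
  and mul_add_right: "w ** (x + y) = w ** x + w ** y"
  and mul_scale_left: "(c *\<^sub>r x) ** w = c *\<^sub>r (x ** w)"
  and mul_scale_right: "w ** (c *\<^sub>r x) = c *\<^sub>r (w ** x)"
  and mul_assoc: "x ** y ** w = x ** (y ** w)"
  and I_I [simp]: "I ** I = I"
begin

lemma mul_zero [simp]: "0 ** x = 0" "x ** 0 = 0"
 using mul_add_left[of 0 0 x] mul_add_right[of x 0 0] by auto

lemma mul_minus [simp]: "(- y) ** x = - (y ** x)" "x ** (- y) = - (x ** y)"
 using mul_add_left[of y "- y" x] mul_add_right[of x y "- y"]
 by (simp_all add: eq_neg_iff_add_eq_0 add.commute)

lemma mul_diff: "(x - y) ** w = x ** w - y ** w" "w ** (x - y) = w ** x - w ** y"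
 using mul_add_left[of x "- y" w] mul_add_right[of w x "- y"] by simp_all

lemmas mul_lin = mul_add_left mul_add_right mul_scale_left mul_scale_right mul_diff

lemma opposite: "corner_algebra scale (\<lambda>x y. y ** x) I"
 by unfold_locales (simp_all add: mul_lin mul_assoc)

text \<open>Membership in the corner cut out by the idempotent \<open>I\<close>. The type used below
  carries the algebras of all parameters at once, so that \<open>I\<close> is the unit of one
  component only.\<close>

definition unital :: "'a => bool" where "unital x \<longleftrightarrow> I ** x = x \<and> x ** I = x"

lemma unitalD: "unital x ==> I ** x = x" "unital x ==> x ** I = x"
 "unital x ==> I ** (x ** y) = x ** y" "unital x ==> x ** (I ** y) = x ** y"
 by (auto simp: unital_def simp flip: mul_assoc)

lemma unital_closed [simp]: "unital I" "unital 0" "unital x ==> unital y ==> unital (x ** y)"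
 "unital x ==> unital y ==> unital (x + y)" "unital x ==> unital y ==> unital (x - y)"
 "unital x ==> unital (c *\<^sub>r x)" "unital x ==> unital (- x)"
 by (auto simp: unital_def mul_lin mul_assoc) (simp flip: mul_assoc)

definition comm :: "'a => 'a => bool" where "comm x y \<longleftrightarrow> x ** y = y ** x"

lemma commD: "comm x y ==> x ** y = y ** x" "comm x y ==> x ** (y ** w) = y ** (x ** w)"
 by (auto simp: comm_def simp flip: mul_assoc)

lemma comm_sym: "comm x y ==> comm y x"
 by (simp add: comm_def)

lemma comm_closed:
 "comm x y ==> comm x w ==> comm x (y ** w)" "comm x y ==> comm x w ==> comm x (y + w)"
 "comm x y ==> comm x w ==> comm x (y - w)" "comm x y ==> comm x (c *\<^sub>r y)" "unital x ==> comm x I"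
 "comm x 0" "comm y x ==> comm w x ==> comm (y ** w) x"
 by (auto simp: comm_def mul_lin unital_def mul_assoc) (metis mul_assoc)+

text \<open>Built by left multiplication with single generators, so that an induction handles one
  generator at a time; closure under all products is \<open>alg_mul\<close>.\<close>

inductive_set alg :: "'a set => 'a set" for G where
 alg_I: "I \<in> alg G"
| alg_0: "0 \<in> alg G"
| alg_add: "x \<in> alg G ==> y \<in> alg G ==> x + y \<in> alg G"
| alg_scale: "x \<in> alg G ==> c *\<^sub>r x \<in> alg G"
| alg_gen: "g \<in> G ==> x \<in> alg G ==> g ** x \<in> alg G"

lemma subspace_alg [simp]: "subspace (alg G)"
 by (rule subspaceI) (auto intro: alg.intros)

lemma alg_closed: "x \<in> alg G ==> y \<in> alg G ==> x + y \<in> alg G" "x \<in> alg G ==> y \<in> alg G ==> x - y \<in> alg G"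
 "x \<in> alg G ==> - x \<in> alg G" "x \<in> alg G ==> c *\<^sub>r x \<in> alg G" "0 \<in> alg G" "I \<in> alg G"
 by (auto intro: alg.intros subspace_diff subspace_neg)

lemma alg_unital:
 assumes "\<And>g. g \<in> G ==> unital g" "x \<in> alg G" shows "unital x"
 using assms(2) by induction (auto simp: assms(1))

lemma alg_mul:
 assumes "\<And>g. g \<in> G ==> unital g" "x \<in> alg G" "y \<in> alg G" shows "x ** y \<in> alg G"
 using assms(2)
proof induction
 case alg_I show ?case using alg_unital[OF assms(1,3)] assms(3) by (simp add: unitalD)
qed (auto simp: mul_lin mul_assoc intro: alg.intros)

lemma alg_base: "unital g ==> g \<in> G ==> g \<in> alg G"
 using alg_gen[OF _ alg_I, of g G] by (simp add: unitalD)

lemma alg_subset: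
 assumes "I \<in> V" "subspace V" "\<And>g x. g \<in> G ==> x \<in> V ==> g ** x \<in> V" shows "alg G \<subseteq> V"
proof
 fix x assume "x \<in> alg G"
 thus "x \<in> V" by induction (use assms subspace_0 subspace_add subspace_scale in auto)
qed

lemma alg_mono: "G \<subseteq> G' ==> alg G \<subseteq> alg G'"
 by (rule alg_subset) (auto intro: alg.intros)

lemma alg_comm:
 assumes "unital y" "\<And>g. g \<in> G ==> comm y g" "x \<in> alg G" shows "comm y x"
 using assms(3) by induction (auto intro: comm_closed assms)

text \<open>Generation from the left and from the right give the same set; this lets subalgebras be
  identified when the multiplication is reversed.\<close>

lemma alg_opposite:
 assumes "\<And>g. g \<in> G ==> unital g"
 shows "corner_algebra.alg scale (\<lambda>x y. y ** x) I G = alg G"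
proof -
 interpret op: corner_algebra scale "\<lambda>x y. y ** x" I by (rule opposite)
 have u: "op.unital x \<longleftrightarrow> unital x" for x by (auto simp: op.unital_def unital_def)
 show ?thesis
 proof
  show "op.alg G \<subseteq> alg G"
   by (rule op.alg_subset) (auto intro: alg_I alg_mul alg_base assms)
  show "alg G \<subseteq> op.alg G"
  proof (rule alg_subset)
   fix g x assume "g \<in> G" "x \<in> op.alg G"
   thus "g ** x \<in> op.alg G"
    using op.alg_mul[of G x g] op.alg_base[of g G] assms u by auto
  qed (auto intro: op.alg_I)
 qed
qed

definition prods :: "'a set => 'a set => 'a set" where
 "prods U V = span {u ** v | u v. u \<in> U \<and> v \<in> V}"

lemma subspace_prods [simp]: "subspace (prods U V)"
 by (simp add: prods_def)

lemma prodsI: "u \<in> U ==> v \<in> V ==> u ** v \<in> prods U V"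
 unfolding prods_def by (rule span_base) auto

lemma prods_least:
 assumes "subspace W" "\<And>u v. u \<in> U ==> v \<in> V ==> u ** v \<in> W" shows "prods U V \<subseteq> W"
 unfolding prods_def using assms by (intro span_minimal) auto

lemma linear_image_subset:
 assumes "x \<in> span S" "subspace W" "\<And>x y. f (x + y) = f x + f y" "\<And>c x. f (c *\<^sub>r x) = c *\<^sub>r f x"
  "\<And>s. s \<in> S ==> f s \<in> W"
 shows "f x \<in> W"
 using assms(1)
proof (induction rule: span_induct_alt)
 case base
 have "f 0 = 0" using assms(3)[of 0 0] by simp
 thus ?case using assms(2) by (simp add: subspace_0)
next
 case (step c x y)
 thus ?case using assms by (simp add: subspace_add subspace_scale)
qed

definition spanned :: "nat => 'a set => bool" where
 "spanned d U \<longleftrightarrow> (\<exists>B. finite B \<and> card B \<le> d \<and> U \<subseteq> span B)"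

lemma spanned_images:
 assumes "finite L" "\<And>f. f \<in> L ==> Modules.module_hom scale scale f" "spanned d V"
  and "U \<subseteq> span (\<Union>f\<in>L. f ` V)"
 shows "spanned (card L * d) U"
proof -
 obtain B where B: "finite B" "card B \<le> d" "V \<subseteq> span B" using assms(3) by (auto simp: spanned_def)
 let ?B = "\<Union>f\<in>L. f ` B"
 have "card ?B \<le> (\<Sum>f\<in>L. card (f ` B))" by (rule card_UN_le[OF assms(1)])
 also have "... \<le> (\<Sum>f\<in>L. d)"
  by (rule sum_mono) (use B(2) card_image_le[OF B(1)] order_trans in blast)
 finally have "card ?B \<le> card L * d" by simp
 moreover have "f ` V \<subseteq> span ?B" if f: "f \<in> L" for f
 proof -
  have "f ` span B \<subseteq> span (f ` B)"
   using Modules.module_hom.spans_image[OF assms(2)[OF f], of "span B" B] by simp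
  moreover have "span (f ` B) \<subseteq> span ?B" using f by (intro span_mono) auto
  ultimately show ?thesis using B(3) by blast
 qed
 hence "span (\<Union>f\<in>L. f ` V) \<subseteq> span ?B" by (intro span_minimal) auto
 ultimately show ?thesis using assms(1,4) B(1) unfolding spanned_def by (intro exI[of _ ?B]) auto
qed

lemma spanned_subset: "spanned d U ==> U' \<subseteq> U ==> spanned d U'"
 unfolding spanned_def by blast

lemma spanned_union:
 assumes "spanned d U" "spanned d' U'" shows "spanned (d + d') (span (U \<union> U'))"
proof -
 obtain B B' where B: "finite B" "card B \<le> d" "U \<subseteq> span B" "finite B'" "card B' \<le> d'" "U' \<subseteq> span B'"
  using assms by (auto simp: spanned_def)
 have "span (U \<union> U') \<subseteq> span (B \<union> B')"
  using B span_mono[of B "B \<union> B'"] span_mono[of B' "B \<union> B'"] by (intro span_minimal) auto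
 thus ?thesis using B card_Un_le[of B B'] unfolding spanned_def
  by (intro exI[of _ "B \<union> B'"]) auto
qed

end

section \<open>A spanning set of the walled Brauer--Clifford superalgebra\<close>

text \<open>
 Strands are numbered from the wall on both sides: \<open>T i\<close>, \<open>W i\<close> stand for
 \<open>t\<^sub>r\<^sub>-\<^sub>i\<close> and \<open>\<pi>\<^sub>r\<^sub>+\<^sub>1\<^sub>-\<^sub>i\<close>.  With this numbering the relations are invariant under
 reversing the multiplication and exchanging the two sides of the wall.
 Generators that do not exist are zero.
\<close>

locale walled = corner_algebra scale mul I
 for scale :: "'k::comm_ring_1 => 'a::ab_group_add => 'a" (infixr \<open>*\<^sub>r\<close> 75)
  and mul (infixl \<open>**\<close> 80) and I +
 fixes T W s q :: "nat => 'a" and e :: 'a and z a b :: 'k and r n :: nat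
 assumes unital_gen [simp]: "unital (T i)" "unital (W i)" "unital (s i)" "unital (q i)" "unital e"
  and TT: "1 \<le> i ==> i < r ==> T i ** T i = z *\<^sub>r T i + I"
  and ss: "1 \<le> i ==> i < n ==> s i ** s i = z *\<^sub>r s i + I"
  and T_braid: "T i ** T (Suc i) ** T i = T (Suc i) ** T i ** T (Suc i)"
  and s_braid: "s i ** s (Suc i) ** s i = s (Suc i) ** s i ** s (Suc i)"
  and T_T: "Suc i < j ==> comm (T i) (T j)"
  and s_s: "Suc i < j ==> comm (s i) (s j)"
  and T_s: "comm (T i) (s j)"
  and WW: "1 \<le> i ==> i \<le> r ==> W i ** W i = a *\<^sub>r I"
  and qq: "1 \<le> i ==> i \<le> n ==> q i ** q i = b *\<^sub>r I"
  and W_W: "i \<noteq> j ==> W i ** W j = - (W j ** W i)"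
  and q_q: "i \<noteq> j ==> q i ** q j = - (q j ** q i)"
  and W_q: "W i ** q j = - (q j ** W i)"
  and TW: "T i ** W (Suc i) = W i ** T i"
  and sq: "s i ** q i = q (Suc i) ** s i"
  and T_W: "j \<noteq> i ==> j \<noteq> Suc i ==> comm (T i) (W j)"
  and s_q: "j \<noteq> i ==> j \<noteq> Suc i ==> comm (s i) (q j)"
  and T_q: "comm (T i) (q j)" and s_W: "comm (s i) (W j)"
  and e_e: "e ** e = 0"
  and e_T_e: "1 < r ==> e ** T 1 ** e = e" and e_s_e: "1 < n ==> e ** s 1 ** e = e"
  and e_T: "1 < i ==> comm e (T i)" and e_s: "1 < i ==> comm e (s i)"
  and e_W: "1 < i ==> comm e (W i)" and e_q: "1 < i ==> comm e (q i)"
  and W_e: "W 1 ** e = q 1 ** e" and eW: "e ** W 1 = e ** q 1" and e_W_e: "e ** W 1 ** e = 0"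
  and T_Y: "1 < r ==> 1 < n ==> T 1 ** (e ** (T 1 - z *\<^sub>r I) ** s 1 ** e) = s 1 ** (e ** (T 1 - z *\<^sub>r I) ** s 1 ** e)"
  and Y_T: "1 < r ==> 1 < n ==> e ** (T 1 - z *\<^sub>r I) ** s 1 ** e ** T 1 = e ** (T 1 - z *\<^sub>r I) ** s 1 ** e ** s 1"
begin

definition Ti where "Ti i = T i - z *\<^sub>r I"
definition si where "si i = s i - z *\<^sub>r I"

lemma unital_inv [simp]: "unital (Ti i)" "unital (si i)"
 by (simp_all add: Ti_def si_def)

text \<open>Both sides equal \<open>e ** T 1 ** s 1 ** e - z *\<^sub>r e\<close>. This makes the
  element invariant under the reversal in \<open>symmetric\<close>.\<close>

lemma Y_eq: "1 < r ==> 1 < n ==> e ** Ti 1 ** s 1 ** e = e ** T 1 ** si 1 ** e"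
 using e_T_e e_s_e e_e by (simp add: Ti_def si_def mul_lin mul_assoc unitalD)

text \<open>Halves the work: every statement about the right-hand side of the wall and left
  multiplication yields one about the left-hand side and right multiplication, under the
  interpretation \<open>op\<close>.\<close>

lemma symmetric: "walled scale (\<lambda>x y. y ** x) I s q T W e z b a n r"
proof -
 interpret op: corner_algebra scale "\<lambda>x y. y ** x" I by (rule opposite)
 have [simp]: "op.unital x \<longleftrightarrow> unital x" "op.comm x y \<longleftrightarrow> comm x y" for x y
  by (auto simp: op.unital_def unital_def op.comm_def comm_def)
 have e3: "1 < r ==> e ** (T 1 ** e) = e" "1 < n ==> e ** (s 1 ** e) = e" "e ** (W 1 ** e) = 0"
  "e ** (q 1 ** e) = 0"
  using e_T_e e_s_e e_W_e by (simp_all add: mul_assoc W_e[symmetric, simplified])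
 have Y: "1 < r ==> 1 < n ==> e ** (T 1 ** ((s 1 - z *\<^sub>r I) ** e)) = e ** (T 1 - z *\<^sub>r I) ** s 1 ** e"
  using Y_eq by (simp add: Ti_def si_def mul_assoc)
 show ?thesis
 proof (unfold_locales, goal_cases)
  case (8 i) show ?case using s_braid[of i] by (simp add: mul_assoc)
 next
  case (9 i) show ?case using T_braid[of i] by (simp add: mul_assoc)
 next
  case 34
  thus ?case using T_Y Y_T e3 Y by (simp add: mul_assoc)
 next
  case 35
  thus ?case using T_Y Y_T e3 Y by (simp add: mul_assoc)
 qed (auto simp: TT ss WW qq TW sq W_e[symmetric, simplified] eW[symmetric, simplified] e_e e3[simplified] intro: T_T s_s comm_sym[OF T_s] W_W q_q W_q T_W s_q T_q s_W
   e_T e_s e_W e_q)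
qed

lemma s_inv [simp]:
 assumes "1 \<le> i" "i < n"
 shows "s i ** si i = I" "si i ** s i = I"
  "s i ** (si i ** x) = I ** x" "si i ** (s i ** x) = I ** x"
proof -
 show 1: "s i ** si i = I" "si i ** s i = I" using ss[OF assms] by (simp_all add: si_def mul_lin unitalD)
 thus "s i ** (si i ** x) = I ** x" "si i ** (s i ** x) = I ** x"
  by (simp_all flip: mul_assoc)
qed

lemma T_inv [simp]:
 assumes "1 \<le> i" "i < r"
 shows "T i ** Ti i = I" "Ti i ** T i = I"
  "T i ** (Ti i ** x) = I ** x" "Ti i ** (T i ** x) = I ** x"
proof -
 show 1: "T i ** Ti i = I" "Ti i ** T i = I" using TT[OF assms] by (simp_all add: Ti_def mul_lin unitalD)
 thus "T i ** (Ti i ** x) = I ** x" "Ti i ** (T i ** x) = I ** x"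
  by (simp_all flip: mul_assoc)
qed

lemma comm_inv:
 assumes "unital x"
 shows "comm x (T i) ==> comm x (Ti i)" "comm x (s i) ==> comm x (si i)"
  "comm (T i) x ==> comm (Ti i) x" "comm (s i) x ==> comm (si i) x"
 using assms by (simp_all add: Ti_def si_def comm_def mul_lin unitalD)

lemmas comm_gen = T_T T_T[THEN comm_sym] s_s s_s[THEN comm_sym] T_s T_s[THEN comm_sym]
 T_W T_W[THEN comm_sym] s_q s_q[THEN comm_sym] T_q T_q[THEN comm_sym] s_W s_W[THEN comm_sym]
 e_T e_T[THEN comm_sym] e_s e_s[THEN comm_sym] e_W e_W[THEN comm_sym] e_q e_q[THEN comm_sym]

primrec e1 :: "nat => 'a" where
 "e1 0 = e"
| "e1 (Suc k) = si (Suc k) ** e1 k ** s (Suc k)"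

text \<open>\<open>ee m k\<close> joins the strands \<open>m + 1\<close> and \<open>k + 1\<close> on the two sides of the wall.\<close>

primrec ee :: "nat => nat => 'a" where
 "ee 0 k = e1 k"
| "ee (Suc m) k = T (Suc m) ** ee m k ** Ti (Suc m)"

lemma unital_ee [simp]: "unital (ee m k)"
proof -
 have "unital (e1 k)" by (induction k) simp_all
 thus ?thesis by (induction m) simp_all
qed

lemma ee_Suc_right: "ee m (Suc k) = si (Suc k) ** ee m k ** s (Suc k)"
proof (induction m)
 case (Suc m)
 note c = commD[OF T_s[of "Suc m" "Suc k"]] commD[OF comm_inv(4)[OF _ T_s[THEN comm_sym], of "Suc m" "Suc k"]]
  commD[OF comm_inv(3)[OF _ T_s], of "Suc k" "Suc m"]
 show ?case using Suc c by (simp add: mul_assoc)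
qed simp

text \<open>Conjugation, with the inverse \<open>x'\<close> supplied separately. It is
  multiplicative on the corner and transports relations to neighbouring strands.\<close>

definition cj :: "'a => 'a => 'a => 'a" where "cj x x' y = x ** y ** x'"

lemma cj_mul: "x' ** x = I ==> unital w ==> cj x x' (y ** w) = cj x x' y ** cj x x' w"
proof -
 assume a: "x' ** x = I" "unital w"
 have "x' ** (x ** (w ** x')) = w ** x'"
  unfolding mul_assoc[of x' x, symmetric] a(1) using a(2) by (simp add: unitalD)
 thus ?thesis by (simp add: cj_def mul_assoc)
qed

lemma cj_comm: "x ** x' = I ==> unital y ==> comm x y ==> cj x x' y = y"
 by (simp add: cj_def comm_def mul_assoc) (simp add: unitalD)

lemma cj_lin: "cj x x' (y + w) = cj x x' y + cj x x' w" "cj x x' (c *\<^sub>r y) = c *\<^sub>r cj x x' y"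
 "cj x x' (y - w) = cj x x' y - cj x x' w" "cj x x' 0 = 0" "x ** x' = I ==> unital x ==> cj x x' I = I"
 by (simp_all add: cj_def mul_lin unitalD)

lemma braid_inv:
 assumes "1 \<le> i" "Suc i < n"
 shows "s i ** (si (Suc i) ** si i) = si (Suc i) ** (si i ** s (Suc i))"
  "s i ** (si (Suc i) ** (si i ** w)) = si (Suc i) ** (si i ** (s (Suc i) ** w))"
  "s i ** (s (Suc i) ** s i) = s (Suc i) ** (s i ** s (Suc i))"
  "s (Suc i) ** (s i ** (s (Suc i) ** w)) = s i ** (s (Suc i) ** (s i ** w))"
proof -
 show 1: "s i ** (si (Suc i) ** si i) = si (Suc i) ** (si i ** s (Suc i))"
  using ss[of i] ss[of "Suc i"] s_braid[of i] assms
  by (simp add: si_def mul_lin mul_assoc unitalD algebra_simps)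
 thus "s i ** (si (Suc i) ** (si i ** w)) = si (Suc i) ** (si i ** (s (Suc i) ** w))"
  by (simp flip: mul_assoc)
 show 2: "s i ** (s (Suc i) ** s i) = s (Suc i) ** (s i ** s (Suc i))"
  using s_braid[of i] by (simp add: mul_assoc)
 thus "s (Suc i) ** (s i ** (s (Suc i) ** w)) = s i ** (s (Suc i) ** (s i ** w))"
  by (simp flip: mul_assoc)
qed

lemma q_si:
 assumes "1 \<le> i" "i < n"
 shows "q i ** si i = si i ** q (Suc i)" "q i ** (si i ** w) = si i ** (q (Suc i) ** w)"
  "q (Suc i) ** (s i ** w) = s i ** (q i ** w)"
proof -
 have "si i ** (q (Suc i) ** s i) ** si i = si i ** (s i ** q i) ** si i" by (simp add: sq)
 thus 1: "q i ** si i = si i ** q (Suc i)" using assms by (simp add: mul_assoc unitalD)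
 thus "q i ** (si i ** w) = si i ** (q (Suc i) ** w)" by (simp flip: mul_assoc)
 show "q (Suc i) ** (s i ** w) = s i ** (q i ** w)" by (simp add: sq flip: mul_assoc)
qed

text \<open>Generators beyond the arc pass at once. For smaller indices, at the critical one the
  braid relation or \<open>q_si\<close> turns the generator into its successor, which already
  commutes with the shorter \<open>e1\<close>.\<close>

lemma e1_comm:
 assumes "k < n"
 shows "1 \<le> j ==> j < k ==> comm (e1 k) (s j)" "Suc k < j ==> comm (e1 k) (s j)"
  "1 \<le> j ==> j \<le> k ==> comm (e1 k) (q j)" "Suc k < j ==> comm (e1 k) (q j)"
  "1 < j ==> comm (e1 k) (T j)" "1 < j ==> comm (e1 k) (W j)"
proof -
 have u: "unital (e1 k)" for k using unital_ee[of 0] by simp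
 have TW: "comm (e1 k) (T j) \<and> comm (e1 k) (W j)" if "1 < j" for j k
  using that by (induction k) (auto intro!: comm_closed comm_gen intro: comm_inv)
 show "1 < j ==> comm (e1 k) (T j)" "1 < j ==> comm (e1 k) (W j)" using TW by auto
 have hi: "comm (e1 k) (s j) \<and> comm (e1 k) (q j)" if "Suc k < j" for j k
  using that by (induction k) (auto intro!: comm_closed comm_inv(4) intro: comm_gen)
 thus "Suc k < j ==> comm (e1 k) (s j)" "Suc k < j ==> comm (e1 k) (q j)" by auto
 have lo_s: "comm (e1 k) (s j)" if "1 \<le> j" "j < k" "k < n" for j k
  using that
 proof (induction k)
  case (Suc k)
  show ?case
  proof (cases "j < k")
   case True
   with Suc have "comm (e1 k) (s j)" by simp
   thus ?thesis using True by (auto intro!: comm_closed comm_inv(4) intro: comm_gen)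
  next
   case False
   with Suc have "\<exists>i. k = Suc i \<and> j = Suc i" by (cases k) auto
   then obtain i where k: "k = Suc i" "j = Suc i" by auto
   have c: "comm (s (Suc (Suc i))) (e1 i)" by (rule comm_sym, rule conjunct1[OF hi]) simp
   show ?thesis
    using braid_inv[of "Suc i"] Suc k commD(2)[OF c]
    by (simp add: comm_def mul_assoc)
  qed
 qed simp
 thus "1 \<le> j ==> j < k ==> comm (e1 k) (s j)" using assms by simp
 have lo_q: "comm (e1 k) (q j)" if "1 \<le> j" "j \<le> k" "k < n" for j k
  using that
 proof (induction k)
  case (Suc k)
  show ?case
  proof (cases "j \<le> k")
   case True
   with Suc have "comm (e1 k) (q j)" by simp
   thus ?thesis using True by (auto intro!: comm_closed comm_inv(4) intro: comm_gen)
  next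
   case False
   with Suc have j: "j = Suc k" by simp
   have c: "comm (q (Suc (Suc k))) (e1 k)" by (rule comm_sym, rule conjunct2[OF hi]) simp
   show ?thesis
    using q_si[of "Suc k"] Suc j commD(2)[OF c] sq[of "Suc k"]
    by (simp add: comm_def mul_assoc)
  qed
 qed simp
 thus "1 \<le> j ==> j \<le> k ==> comm (e1 k) (q j)" using assms by simp
qed

text \<open>The conjugations on the two sides of the wall commute, so it does not matter which side
  is extended first.\<close>

lemma ee_symmetric: "walled.ee scale (\<lambda>x y. y ** x) I s T e z m k = ee k m"
proof -
 interpret op: walled scale "\<lambda>x y. y ** x" I s q T W e z b a n r by (rule symmetric)
 have i: "op.si = Ti" "op.Ti = si" by (auto simp: op.si_def op.Ti_def Ti_def si_def)
 show ?thesis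
 proof (induction m)
  case 0
  show ?case by (induction k) (simp_all add: i mul_assoc)
 next
  case (Suc m)
  thus ?case by (simp only: op.ee.simps ee_Suc_right i mul_assoc)
 qed
qed

lemma ee_comm_sq:
 assumes "k < n"
 shows "1 \<le> j ==> j < k ==> comm (ee m k) (s j)" "Suc k < j ==> comm (ee m k) (s j)"
  "1 \<le> j ==> j \<le> k ==> comm (ee m k) (q j)" "Suc k < j ==> comm (ee m k) (q j)"
proof -
 have *: "comm (e1 k) x ==> unital x ==> (\<And>i. comm (T i) x) ==> comm (ee m k) x" for x
  by (induction m) (auto intro!: comm_closed comm_inv)
 show "1 \<le> j ==> j < k ==> comm (ee m k) (s j)" "Suc k < j ==> comm (ee m k) (s j)"
  "1 \<le> j ==> j \<le> k ==> comm (ee m k) (q j)" "Suc k < j ==> comm (ee m k) (q j)"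
  using assms by (auto intro!: * T_s T_q intro: e1_comm)
qed

lemma ee_comm_TW:
 assumes "m < r"
 shows "1 \<le> j ==> j < m ==> comm (ee m k) (T j)" "Suc m < j ==> comm (ee m k) (T j)"
  "1 \<le> j ==> j \<le> m ==> comm (ee m k) (W j)" "Suc m < j ==> comm (ee m k) (W j)"
proof -
 interpret op: walled scale "\<lambda>x y. y ** x" I s q T W e z b a n r by (rule symmetric)
 have [simp]: "op.comm x y \<longleftrightarrow> comm x y" for x y by (auto simp: op.comm_def comm_def)
 show "1 \<le> j ==> j < m ==> comm (ee m k) (T j)" "Suc m < j ==> comm (ee m k) (T j)"
  "1 \<le> j ==> j \<le> m ==> comm (ee m k) (W j)" "Suc m < j ==> comm (ee m k) (W j)"
  using op.ee_comm_sq[OF assms, of j k] by (simp_all add: ee_symmetric)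
qed

end

section \<open>Products of arcs\<close>

context walled begin

lemma ee_mul_ee: "m < r ==> k < n ==> ee m k ** ee m k = 0"
proof (induction m)
 case 0
 show ?case using 0(2)
 proof (induction k)
  case (Suc k)
  hence "e1 k ** (e1 k ** w) = 0" for w by (simp flip: mul_assoc)
  thus ?case using Suc.prems unital_ee[of 0 k] by (simp add: mul_assoc unitalD)
 qed (simp add: e_e)
next
 case (Suc m)
 have "ee m k ** (ee m k ** x) = 0" for x using Suc by (simp flip: mul_assoc)
 thus ?case using Suc by (simp add: mul_assoc unitalD)
qed

text \<open>The crossing \<open>?y\<close> commutes with \<open>ee m k\<close>, and the braid
  relation in the form \<open>?x' ** ?y ** ?x = ?y ** ?x ** ?y'\<close> moves it out of the
  conjugated product, leaving the relation for \<open>m\<close>.\<close>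

lemma ee_T_ee_step:
 assumes "Suc (Suc m) < r" "ee m k ** T (Suc m) ** ee m k = ee m k"
 shows "ee (Suc m) k ** T (Suc (Suc m)) ** ee (Suc m) k = ee (Suc m) k"
proof -
 let ?x = "T (Suc m)" and ?y = "T (Suc (Suc m))" and ?x' = "Ti (Suc m)" and ?y' = "Ti (Suc (Suc m))"
 have c: "comm (ee m k) ?y" using ee_comm_TW(2)[of m "Suc (Suc m)" k] assms by simp
 note cc = c comm_inv(1)[OF _ c]
 have b: "?x' ** (?y ** (?x ** w)) = ?y ** (?x ** (?y' ** w))" for w
 proof -
  have "?x' ** ?y ** ?x = ?y ** ?x ** ?y'"
   using TT[of "Suc m"] TT[of "Suc (Suc m)"] T_braid[of "Suc m"] assms(1)
   by (simp add: Ti_def mul_lin mul_assoc unitalD)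
  thus ?thesis by (simp flip: mul_assoc)
 qed
 have "ee m k ** (?x ** (ee m k ** w)) = ee m k ** w" for w using assms(2) by (simp flip: mul_assoc)
 moreover have "?y' ** (ee m k ** w) = ee m k ** (?y' ** w)" "ee m k ** (?y ** w) = ?y ** (ee m k ** w)" for w
  using cc commD(2) by auto
 moreover have "?x ** (?y ** (ee m k ** (?y' ** ?x'))) = ?x ** (ee m k ** ?x')"
  using assms commD(2)[OF c, symmetric] by (simp add: unitalD)
 ultimately show ?thesis by (simp add: mul_assoc b)
qed

lemma ee_T_ee: "Suc m < r ==> k < n ==> ee m k ** T (Suc m) ** ee m k = ee m k"
proof (induction m)
 case 0
 show ?case using 0(2)
 proof (induction k)
  case 0
  thus ?case using e_T_e \<open>Suc 0 < r\<close> by simp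
 next
  case (Suc k)
  note c = commD(2)[OF T_s[of 1 "Suc k", THEN comm_sym]]
  from Suc have "e1 k ** (T 1 ** (e1 k ** w)) = e1 k ** w" for w by (simp flip: mul_assoc)
  thus ?case using Suc.prems c unital_ee[of 0 k] by (simp add: mul_assoc unitalD)
 qed
next
 case (Suc m)
 thus ?case using ee_T_ee_step[of m k] by simp
qed

lemma ee_s_ee: "m < r ==> Suc k < n ==> ee m k ** s (Suc k) ** ee m k = ee m k"
proof -
 assume a: "m < r" "Suc k < n"
 interpret op: walled scale "\<lambda>x y. y ** x" I s q T W e z b a n r by (rule symmetric)
 show ?thesis using op.ee_T_ee[of k m] a by (simp add: ee_symmetric mul_assoc)
qed

lemma Ti_W:
 assumes "1 \<le> i" "i < r"
 shows "Ti i ** W (Suc i) = W i ** T i - z *\<^sub>r W (Suc i)"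
  "W (Suc i) ** Ti i = Ti i ** W i" "W (Suc i) ** (Ti i ** w) = Ti i ** (W i ** w)"
proof -
 interpret op: walled scale "\<lambda>x y. y ** x" I s q T W e z b a n r by (rule symmetric)
 show "Ti i ** W (Suc i) = W i ** T i - z *\<^sub>r W (Suc i)"
  using TW[of i] by (simp add: Ti_def mul_lin unitalD)
 show 1: "W (Suc i) ** Ti i = Ti i ** W i"
  using op.q_si(1)[OF assms] by (simp add: Ti_def op.si_def)
 thus "W (Suc i) ** (Ti i ** w) = Ti i ** (W i ** w)" by (simp flip: mul_assoc)
qed

text \<open>In the step, \<open>Ti_W\<close> expands the conjugated Clifford generator into the
  previous case and two terms with factor \<open>z\<close>. These cancel by \<open>ee_T_ee\<close>,
  because \<open>?V\<close> commutes with \<open>?E\<close>.\<close>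

lemma ee_W_ee: "m < r ==> k < n ==> ee m k ** W (Suc m) ** ee m k = 0"
proof (induction m)
 case 0
 show ?case using 0(2)
 proof (induction k)
  case 0
  thus ?case using e_W_e by simp
 next
  case (Suc k)
  note c = commD(2)[OF s_W[of "Suc k" 1]]
  from Suc have "e1 k ** (W 1 ** (e1 k ** w)) = 0" for w by (simp flip: mul_assoc)
  thus ?case using Suc.prems c unital_ee[of 0 k] by (simp add: mul_assoc unitalD)
 qed
next
 case (Suc m)
 let ?E = "ee m k" and ?T = "T (Suc m)" and ?V = "W (Suc (Suc m))" and ?W = "W (Suc m)"
 have c: "?E ** ?V = ?V ** ?E" using ee_comm_TW(4)[of m "Suc (Suc m)" k] Suc.prems by (simp add: comm_def)
 have 0: "?E ** ?W ** ?E = 0" and T: "?E ** ?T ** ?E = ?E" using Suc ee_T_ee[of m k] by simp_all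
 have "?E ** (?W ** ?T - z *\<^sub>r ?V) ** ?T ** ?E = z *\<^sub>r (?E ** (?W ** ?T) ** ?E) + ?E ** ?W ** ?E - z *\<^sub>r (?V ** (?E ** ?T ** ?E))"
  using TT[of "Suc m"] Suc.prems c by (simp add: mul_lin unitalD flip: mul_assoc) (simp add: mul_lin mul_assoc unitalD)
 also have "?E ** (?W ** ?T) ** ?E = ?E ** ?T ** ?E ** ?V"
  using TW[of "Suc m", symmetric] c by (simp add: mul_assoc)
 finally have "?E ** (Ti (Suc m) ** ?V) ** ?T ** ?E = 0"
  using 0 T c Ti_W(1)[of "Suc m"] Suc.prems by simp
 hence "?E ** (Ti (Suc m) ** (?V ** (?T ** (?E ** w)))) = 0" for w by (simp add: mul_assoc) (simp flip: mul_assoc)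
 thus ?case by (simp add: mul_assoc)
qed

text \<open>Two nested arcs: by \<open>ee_ee_Suc\<close> this is the product of
  \<open>ee m k\<close> and \<open>ee (Suc m) (Suc k)\<close> in either order.\<close>

definition YY where "YY m k = ee m k ** Ti (Suc m) ** s (Suc k) ** ee m k"

lemma YY_eq:
 assumes "Suc m < r" "Suc k < n"
 shows "ee m k ** T (Suc m) ** si (Suc k) ** ee m k = YY m k"
 using ee_T_ee[of m k] ee_s_ee[of m k] ee_mul_ee[of m k] assms
 by (simp add: YY_def Ti_def si_def mul_lin mul_assoc unitalD)

lemma YY_step:
 assumes "Suc m < r" "Suc (Suc k) < n"
  and "T (Suc m) ** YY m k = s (Suc k) ** YY m k" "YY m k ** T (Suc m) = YY m k ** s (Suc k)"
 shows "T (Suc m) ** YY m (Suc k) = s (Suc (Suc k)) ** YY m (Suc k) \<and>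
  YY m (Suc k) ** T (Suc m) = YY m (Suc k) ** s (Suc (Suc k))"
proof -
 let ?x = "si (Suc k) ** si (Suc (Suc k))" and ?x' = "s (Suc (Suc k)) ** s (Suc k)"
 have inv: "?x ** ?x' = I" "?x' ** ?x = I" using assms by (simp_all add: mul_assoc unitalD)
 have c: "comm (ee m k) (s (Suc (Suc k)))" using ee_comm_sq(2)[of k "Suc (Suc k)" m] assms by simp
 have E: "cj ?x ?x' (ee m k) = ee m (Suc k)"
  using commD(2)[OF c] assms by (simp add: cj_def mul_assoc ee_Suc_right unitalD)
 have T: "cj ?x ?x' (T (Suc m)) = T (Suc m)" "cj ?x ?x' (Ti (Suc m)) = Ti (Suc m)"
  using inv(1) by (auto intro!: cj_comm comm_closed comm_inv intro: comm_gen)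
 have S: "cj ?x ?x' (s (Suc k)) = s (Suc (Suc k))"
  using braid_inv(3)[of "Suc k"] assms by (simp add: cj_def mul_assoc unitalD)
 have YY: "cj ?x ?x' (YY m k) = YY m (Suc k)"
  unfolding YY_def using inv by (simp add: cj_mul E T S)
 have "unital (YY m k)" by (simp add: YY_def)
 thus ?thesis
  using assms(3,4)[THEN arg_cong[of _ _ "cj ?x ?x'"]] inv by (simp add: cj_mul YY T S)
qed

text \<open>Conjugation by crossings carries the relations from the innermost pair outwards. The
  step in \<open>m\<close> is the step in \<open>k\<close> for the mirrored algebra.\<close>

lemma YY_T_s:
 assumes "Suc m < r" "Suc k < n"
 shows "T (Suc m) ** YY m k = s (Suc k) ** YY m k" "YY m k ** T (Suc m) = YY m k ** s (Suc k)"
proof -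
 interpret op: walled scale "\<lambda>x y. y ** x" I s q T W e z b a n r by (rule symmetric)
 have i: "op.si = Ti" "op.Ti = si" by (auto simp: op.si_def op.Ti_def Ti_def si_def)
 have Y: "op.YY i j = YY j i" if "Suc i < n" "Suc j < r" for i j
  using YY_eq[of j i] that by (simp add: op.YY_def i ee_symmetric mul_assoc)
 have base: "T (Suc m) ** YY m 0 = s (Suc 0) ** YY m 0 \<and> YY m 0 ** T (Suc m) = YY m 0 ** s (Suc 0)"
  using assms(1)
 proof (induction m)
  case 0
  thus ?case using T_Y Y_T assms by (simp add: YY_def Ti_def)
 next
  case (Suc m)
  thus ?case using op.YY_step[of 0 m] assms by (simp add: Y)
 qed
 have "T (Suc m) ** YY m k = s (Suc k) ** YY m k \<and> YY m k ** T (Suc m) = YY m k ** s (Suc k)"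
  using assms(2)
 proof (induction k)
  case 0
  thus ?case using base by simp
 next
  case (Suc k)
  thus ?case using YY_step[of m k] assms by simp
 qed
 thus "T (Suc m) ** YY m k = s (Suc k) ** YY m k" "YY m k ** T (Suc m) = YY m k ** s (Suc k)" by auto
qed

text \<open>Passing from \<open>ee m k\<close> to the next pair conjugates by
  \<open>T (Suc m)\<close> and \<open>si (Suc k)\<close>; next to the doubled element these
  crossings act as inverses of each other by \<open>YY_T_s\<close> and cancel.\<close>

lemma ee_ee_Suc:
 assumes "Suc m < r" "Suc k < n"
 shows "ee m k ** ee (Suc m) (Suc k) = YY m k" "ee (Suc m) (Suc k) ** ee m k = YY m k"
proof -
 note Y = YY_T_s[OF assms]
 have u: "unital (YY m k)" by (simp add: YY_def)
 have c: "Ti (Suc m) ** s (Suc k) = s (Suc k) ** Ti (Suc m)"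
  "si (Suc k) ** (T (Suc m) ** w) = T (Suc m) ** (si (Suc k) ** w)" for w
 proof -
  have "comm (Ti (Suc m)) (s (Suc k))" "comm (si (Suc k)) (T (Suc m))"
   by (rule comm_inv; simp add: T_s comm_sym[OF T_s])+
  thus "Ti (Suc m) ** s (Suc k) = s (Suc k) ** Ti (Suc m)"
   "si (Suc k) ** (T (Suc m) ** w) = T (Suc m) ** (si (Suc k) ** w)" by (auto dest: commD)
 qed
 have "ee m k ** (T (Suc m) ** (si (Suc k) ** (ee m k ** w))) = YY m k ** w" for w
  using YY_eq[OF assms] by (simp flip: mul_assoc)
 hence "ee m k ** ee (Suc m) (Suc k) = YY m k ** (s (Suc k) ** Ti (Suc m))"
  by (simp add: ee_Suc_right mul_assoc c)
 also have "... = YY m k ** T (Suc m) ** Ti (Suc m)" by (simp add: Y(2) mul_assoc)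
 also have "... = YY m k" using u assms by (simp add: mul_assoc unitalD)
 finally show "ee m k ** ee (Suc m) (Suc k) = YY m k" .
 have "ee (Suc m) (Suc k) ** ee m k = si (Suc k) ** (T (Suc m) ** YY m k)"
  using commD(2)[OF T_s[of "Suc m" "Suc k"]] c
  by (simp add: ee_Suc_right YY_def mul_assoc)
 also have "... = YY m k" using Y(1) u assms by (simp add: unitalD)
 finally show "ee (Suc m) (Suc k) ** ee m k = YY m k" .
qed

text \<open>For the neighbouring arc both orders agree by \<open>ee_ee_Suc\<close>; the crossings
  that conjugate it further away all commute with \<open>e\<close>.\<close>

lemma e_comm_ee:
 assumes "m < r" "k < n" "1 \<le> m" "1 \<le> k"
 shows "comm e (ee m k)"
proof -
 have "comm e (ee (Suc m) (Suc 0))" if "Suc m < r" for m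
  using that
 proof (induction m)
  case 0
  thus ?case using ee_ee_Suc[of 0 0] assms by (simp add: comm_def)
 next
  case (Suc m)
  thus ?case unfolding ee.simps(2)[of "Suc m"] by (auto intro!: comm_closed comm_inv e_T simp del: ee.simps)
 qed
 moreover have "comm e (ee m (Suc k))" if "Suc k < n" "comm e (ee m (Suc 0))" for k
  using that
 proof (induction k)
  case (Suc k)
  thus ?case by (auto simp: ee_Suc_right[of _ "Suc k"] simp del: ee.simps intro!: comm_closed comm_inv e_s)
 qed simp
 moreover obtain i j where "m = Suc i" "k = Suc j" using assms(3,4) by (cases m; cases k) auto
 ultimately show ?thesis using assms(1,2) by blast
qed

end

context corner_algebra begin

text \<open>Commuting or anticommuting. Moving \<open>x\<close> past a sum of products changes signs
  term by term, so the sum becomes another element of the same subalgebra, which is all that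
  \<open>skew_alg\<close> records.\<close>

definition skew :: "'a => 'a => bool" where
 "skew x y \<longleftrightarrow> x ** y = y ** x \<or> x ** y = - (y ** x)"

lemma skew_alg:
 assumes "unital x" "\<And>g. g \<in> G ==> skew x g" "u \<in> alg G"
 shows "\<exists>v\<in>alg G. x ** u = v ** x" "\<exists>v\<in>alg G. u ** x = x ** v"
proof -
 have "(\<exists>v\<in>alg G. x ** u = v ** x) \<and> (\<exists>v\<in>alg G. u ** x = x ** v)"
  using assms(3)
 proof induction
  case alg_I
  show ?case using assms(1) by (auto intro!: bexI[of _ I] alg.alg_I simp: unitalD)
 next
  case alg_0
  show ?case by (auto intro!: bexI[of _ 0] alg.alg_0)
 next
  case (alg_add u u')
  then obtain v w v' w' where "v \<in> alg G" "w \<in> alg G" "v' \<in> alg G" "w' \<in> alg G"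
   "x ** u = v ** x" "u ** x = x ** w" "x ** u' = v' ** x" "u' ** x = x ** w'" by blast
  thus ?case by (intro conjI bexI[of _ "v + v'"] bexI[of _ "w + w'"]) (auto simp: mul_lin intro: alg.alg_add)
 next
  case (alg_scale u c)
  then obtain v w where "v \<in> alg G" "w \<in> alg G" "x ** u = v ** x" "u ** x = x ** w" by blast
  thus ?case by (intro conjI bexI[of _ "c *\<^sub>r v"] bexI[of _ "c *\<^sub>r w"]) (auto simp: mul_lin intro: alg.alg_scale)
 next
  case (alg_gen g u)
  then obtain v w where vw: "v \<in> alg G" "w \<in> alg G" "x ** u = v ** x" "u ** x = x ** w" by blast
  hence gv: "g ** v \<in> alg G" "g ** w \<in> alg G" using alg_gen by (auto intro: alg.alg_gen)
  from assms(2)[OF alg_gen(1)] consider "x ** g = g ** x" | "x ** g = - (g ** x)" by (auto simp: skew_def)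
  thus ?case
  proof cases
   case 1
   hence "x ** (g ** u) = (g ** v) ** x" "(g ** u) ** x = x ** (g ** w)"
    using vw by (simp_all add: mul_assoc) (simp_all flip: mul_assoc; simp add: mul_assoc vw)+
   thus ?thesis using gv by blast
  next
   case 2
   have "x ** (g ** u) = (x ** g) ** u" "x ** (g ** w) = (x ** g) ** w" by (simp_all add: mul_assoc)
   hence "x ** (g ** u) = (- (g ** v)) ** x" "(g ** u) ** x = x ** (- (g ** w))"
    using vw 2 by (simp_all add: mul_assoc)
   thus ?thesis using gv alg_closed(3) by blast
  qed
 qed
 thus "\<exists>v\<in>alg G. x ** u = v ** x" "\<exists>v\<in>alg G. u ** x = x ** v" by auto
qed

end

section \<open>Subalgebras on the strands next to the wall\<close>

context walled begin

definition Kg where "Kg k = s ` {1..<k} \<union> q ` {1..k}"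
definition Hg where "Hg m = T ` {1..<m} \<union> W ` {1..m}"
text \<open>\<open>A m k\<close> will be the walled algebra on the \<open>m\<close> and
  \<open>k\<close> strands nearest to the wall, with the Hecke--Clifford algebras \<open>H m\<close>
  and \<open>K k\<close> inside it. The condition on \<open>e\<close> makes \<open>A m 0\<close>
  equal to \<open>H m\<close> and \<open>A 0 k\<close> equal to \<open>K k\<close>.\<close>

definition Ag where "Ag m k = Hg m \<union> Kg k \<union> (if 1 \<le> m \<and> 1 \<le> k then {e} else {})"
definition K where "K k = alg (Kg k)"
definition H where "H m = alg (Hg m)"
definition A where "A m k = alg (Ag m k)"

lemma unital_Kg [simp]: "g \<in> Kg k ==> unital g" and unital_Hg [simp]: "g \<in> Hg k ==> unital g"
 and unital_Ag [simp]: "g \<in> Ag m k ==> unital g"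
 by (auto simp: Kg_def Hg_def Ag_def split: if_splits)

lemma unital_K: "x \<in> K k ==> unital x" and unital_H: "x \<in> H k ==> unital x"
 and unital_A: "x \<in> A m k ==> unital x"
 unfolding K_def H_def A_def
 by (rule alg_unital[rotated], assumption, simp)+

lemma subspaces [simp]: "subspace (K k)" "subspace (H m)" "subspace (A m k)"
 by (simp_all add: K_def H_def A_def)

lemma K_mul: "x \<in> K k ==> y \<in> K k ==> x ** y \<in> K k" and H_mul: "x \<in> H k ==> y \<in> H k ==> x ** y \<in> H k"
 and A_mul: "x \<in> A m k ==> y \<in> A m k ==> x ** y \<in> A m k"
 unfolding K_def H_def A_def by (intro alg_mul; simp)+

lemma K_gen: "1 \<le> j ==> j < k ==> s j \<in> K k" "1 \<le> j ==> j < k ==> si j \<in> K k" "1 \<le> j ==> j \<le> k ==> q j \<in> K k"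
  "I \<in> K k"
 unfolding K_def si_def by (auto intro!: alg_base alg_closed simp: Kg_def)

lemma H_gen: "1 \<le> j ==> j < k ==> T j \<in> H k" "1 \<le> j ==> j < k ==> Ti j \<in> H k" "1 \<le> j ==> j \<le> k ==> W j \<in> H k"
  "I \<in> H k"
 unfolding H_def Ti_def by (auto intro!: alg_base alg_closed simp: Hg_def)

lemma K_mono: "i \<le> k ==> K i \<subseteq> K k" and H_mono: "i \<le> k ==> H i \<subseteq> H k"
 and A_mono: "i \<le> m ==> j \<le> k ==> A i j \<subseteq> A m k"
 unfolding K_def H_def A_def
 by (intro alg_mono; auto simp: Kg_def Hg_def Ag_def)+

lemma K_A: "k \<le> k' ==> K k \<subseteq> A m k'" and H_A: "m \<le> m' ==> H m \<subseteq> A m' k"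
 unfolding K_def H_def A_def
 by (intro alg_mono; auto simp: Kg_def Hg_def Ag_def)+

lemma A_0 [simp]: "A m 0 = H m" "A 0 k = K k"
 by (simp_all add: A_def H_def K_def Ag_def Kg_def Hg_def)

lemma e_A: "1 \<le> m ==> 1 \<le> k ==> e \<in> A m k"
 by (auto simp: A_def Ag_def intro!: alg_base)

lemmas A_gen = K_gen(1)[THEN subsetD[OF K_A, rotated]] K_gen(2)[THEN subsetD[OF K_A, rotated]]
 K_gen(3)[THEN subsetD[OF K_A, rotated]] K_gen(4)[THEN subsetD[OF K_A, rotated]]
 H_gen(1-3)[THEN subsetD[OF H_A, rotated]]

lemma A_closed: "x \<in> A m k ==> y \<in> A m k ==> x + y \<in> A m k" "x \<in> A m k ==> y \<in> A m k ==> x - y \<in> A m k"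
 "x \<in> A m k ==> - x \<in> A m k" "x \<in> A m k ==> c *\<^sub>r x \<in> A m k"
 unfolding A_def by (auto intro: alg_closed)

lemma ee_A: "ee m k \<in> A (Suc m) (Suc k)"
proof -
 have "e1 k \<in> A (Suc m) (Suc k)" for m
 proof (induction k)
  case (Suc k)
  hence "e1 k \<in> A (Suc m) (Suc (Suc k))" using A_mono[of "Suc m" "Suc m" "Suc k" "Suc (Suc k)"] by auto
  thus ?case by (auto intro!: A_mul K_gen(1,2)[THEN subsetD[OF K_A, rotated]])
 qed (auto intro: e_A)
 thus ?thesis
 proof (induction m)
  case (Suc m)
  hence "ee m k \<in> A (Suc (Suc m)) (Suc k)" using A_mono[of "Suc m" "Suc (Suc m)" "Suc k" "Suc k"] by auto
  thus ?case by (auto intro!: A_mul H_gen(1,2)[THEN subsetD[OF H_A, rotated]])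
 qed simp
qed

lemma Ag_cases:
 assumes "g \<in> Ag m k"
 obtains (T) i where "g = T i" "1 \<le> i" "i < m" | (W) i where "g = W i" "1 \<le> i" "i \<le> m"
 | (s) j where "g = s j" "1 \<le> j" "j < k" | (q) j where "g = q j" "1 \<le> j" "j \<le> k"
 | (e) "g = e" "1 \<le> m" "1 \<le> k"
 using assms unfolding Ag_def Hg_def Kg_def by (fastforce split: if_splits)

lemma comm_A:
 assumes "unital x" "\<And>i. 1 \<le> i ==> i < m ==> comm x (T i)" "\<And>i. 1 \<le> i ==> i \<le> m ==> comm x (W i)"
  "\<And>j. 1 \<le> j ==> j < k ==> comm x (s j)" "\<And>j. 1 \<le> j ==> j \<le> k ==> comm x (q j)"
  "1 \<le> m ==> 1 \<le> k ==> comm x e" "u \<in> A m k"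
 shows "comm x u"
proof (rule alg_comm)
 show "comm x g" if "g \<in> Ag m k" for g using that by (cases rule: Ag_cases) (use assms in blast)+
qed (use assms in \<open>simp_all add: A_def\<close>)

lemma skew_A:
 assumes "unital x" "\<And>i. 1 \<le> i ==> i < m ==> skew x (T i)" "\<And>i. 1 \<le> i ==> i \<le> m ==> skew x (W i)"
  "\<And>j. 1 \<le> j ==> j < k ==> skew x (s j)" "\<And>j. 1 \<le> j ==> j \<le> k ==> skew x (q j)"
  "1 \<le> m ==> 1 \<le> k ==> skew x e" "u \<in> A m k"
 shows "\<exists>v\<in>A m k. x ** u = v ** x"
 unfolding A_def
proof (rule skew_alg)
 show "skew x g" if "g \<in> Ag m k" for g using that by (cases rule: Ag_cases) (use assms in blast)+
qed (use assms in \<open>simp_all add: A_def\<close>)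

text \<open>The arc between the strands \<open>m + 1\<close> and \<open>k + 1\<close> encloses all
  strands of \<open>A m k\<close>.\<close>

lemma comm_ee_A: "m < r ==> k < n ==> u \<in> A m k ==> comm (ee m k) u"
 by (rule comm_A[of _ m k]) (auto intro: ee_comm_sq(1,3) ee_comm_TW(1,3) e_comm_ee[THEN comm_sym])

lemma comm_s_A: "k < j ==> u \<in> A m k ==> comm (s j) u"
 by (rule comm_A[of _ m k]) (auto intro: comm_sym[OF T_s] s_W comm_sym[OF s_s] s_q comm_sym[OF e_s])

lemma comm_T_K: "u \<in> K k ==> comm (T i) u" and comm_s_H: "u \<in> H k ==> comm (s i) u"
 by (rule comm_A[of "T i" 0 k u]; simp add: T_s T_q) (rule comm_A[of "s i" k 0 u]; simp add: comm_sym[OF T_s] s_W)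

lemma skew_W_K: "u \<in> K k ==> \<exists>v\<in>K k. W i ** u = v ** W i"
 using skew_A[of "W i" 0 k u] commD(1)[OF s_W, symmetric] W_q by (simp add: skew_def)

lemma skew_q_A:
 assumes "j = Suc k" "u \<in> A m k" shows "\<exists>v\<in>A m k. q j ** u = v ** q j"
 using assms(2)
proof (rule skew_A[rotated -1])
 show "skew (q j) (T i)" for i using commD(1)[OF T_q, symmetric] by (simp add: skew_def)
 show "skew (q j) (W i)" for i using W_q[of i j] by (simp add: skew_def)
 show "skew (q j) (s i)" if "i < k" for i using commD(1)[OF s_q[of j i], symmetric] that assms by (simp add: skew_def)
 show "skew (q j) (q i)" if "i \<le> k" for i using q_q[of j i] that assms by (simp add: skew_def)
 show "skew (q j) e" if "1 \<le> m" "1 \<le> k" using commD(1)[OF e_q[of j], symmetric] that assms by (simp add: skew_def)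
qed simp

lemma K_module:
 assumes "k \<le> n"
 shows "hecke_clifford_module scale {x. I ** x = x} (\<lambda>i x. s i ** x) (\<lambda>i x. q i ** x) z b k"
proof -
 have *: "I ** (g ** x) = g ** x" if "unital g" for g x using that by (simp add: unitalD)
 have ass: "u ** (v ** x) = c *\<^sub>r (u' ** (v' ** x))" if "u ** v = c *\<^sub>r (u' ** v')" for u v u' v' c x
  using that by (simp add: mul_lin flip: mul_assoc)
 show ?thesis
 proof unfold_locales
  show "subspace {x. I ** x = x}" by (rule subspaceI) (auto simp: mul_lin)
  show "s i ** (s i ** x) = z *\<^sub>r (s i ** x) + x" if "1 \<le> i" "i < k" "x \<in> {x. I ** x = x}" for i x
   using ss[of i] that assms by (simp flip: mul_assoc) (simp add: mul_lin)
  show "s i ** (s (i + 1) ** (s i ** x)) = s (i + 1) ** (s i ** (s (i + 1) ** x))" for i x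
   using s_braid[of i] by (simp flip: mul_assoc)
  show "s i ** (s j ** x) = s j ** (s i ** x)" if "i + 1 < j" for i j x
   using commD(2)[OF s_s[of i j]] that by simp
  show "q i ** (q i ** x) = b *\<^sub>r x" if "1 \<le> i" "i \<le> k" "x \<in> {x. I ** x = x}" for i x
   using qq[of i] that assms by (simp flip: mul_assoc) (simp add: mul_lin)
  show "q i ** (q j ** x) = - (q j ** (q i ** x))" if "i \<noteq> j" for i j x
   using q_q[OF that] ass[of "q i" "q j" "- 1" "q j" "q i" x] by simp
  show "s i ** (q i ** x) = q (i + 1) ** (s i ** x)" for i x
   using sq[of i] by (simp flip: mul_assoc)
  show "s i ** (q j ** x) = q j ** (s i ** x)" if "j \<noteq> i" "j \<noteq> i + 1" for i j x
   using commD(2)[OF s_q[of j i]] that by simp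
 qed (auto simp: * mul_lin)
qed

end

section \<open>Coset decompositions and arcs at the new strand\<close>

context walled begin

primrec cs :: "nat => nat => 'a" where
 "cs j 0 = I"
| "cs j (Suc k) = (if j \<le> k then cs j k ** s k else I)"

text \<open>\<open>cs j k = s\<^sub>j s\<^sub>j\<^sub>+\<^sub>1 ... s\<^sub>k\<^sub>-\<^sub>1\<close>.\<close>

lemma cs_same [simp]: "cs j j = I" by (cases j) auto
lemma cs_rec: "j < k ==> cs j k = s j ** cs (Suc j) k"
proof (induction k)
 case (Suc k)
 thus ?case by (cases "j = k") (auto simp: mul_assoc unitalD)
qed simp

lemma cs_K: "1 \<le> j ==> cs j k \<in> K k"
proof (induction k)
 case (Suc k)
 thus ?case using K_mono[of k "Suc k"] by (auto intro!: K_mul K_gen)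
qed (simp add: K_gen)

lemma ch_cs:
 assumes "k \<le> n" "j \<le> k" "unital x"
 shows "hecke_clifford_module.ch (\<lambda>i x. s i ** x) j k x = cs j k ** x"
proof -
 interpret hc: hecke_clifford_module scale "{x. I ** x = x}" "\<lambda>i x. s i ** x" "\<lambda>i x. q i ** x" z b k
  by (rule K_module[OF assms(1)])
 show ?thesis using assms(2)
 proof (induction rule: inc_induct)
  case base
  thus ?case using assms(3) by (simp add: unitalD)
 next
  case (step j)
  thus ?case using cs_rec[of j k] hc.ch_step[of j k x] by (simp add: mul_assoc)
 qed
qed

abbreviation (input) cosets where
 "cosets k V \<equiv> (\<Union>j\<in>{1..k}. (\<lambda>v. cs j k ** v) ` V) \<union> (\<Union>j\<in>{1..k}. (\<lambda>v. q j ** (cs j k ** v)) ` V)"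

text \<open>The coset span of \<open>V\<close> is stable under the generators of \<open>K k\<close>,
  so applying the letters of \<open>x\<close> to \<open>v\<close> one at a time never leaves it. The
  set \<open>V\<close> is only assumed stable under generators avoiding the strand
  \<open>k\<close>.\<close>

lemma K_subset_coset:
 assumes "1 \<le> k" "k \<le> n" and V: "subspace V" "\<And>x. x \<in> V ==> unital x"
  and "\<And>i x. 1 \<le> i ==> i + 1 < k ==> x \<in> V ==> s i ** x \<in> V"
  and "\<And>i x. 1 \<le> i ==> i < k ==> x \<in> V ==> q i ** x \<in> V"
  and x: "x \<in> K k" "v \<in> V"
 shows "x ** v \<in> span (cosets k V)"
  (is "_ \<in> span ?S")
proof -
 interpret hc: hecke_clifford_module scale "{x. I ** x = x}" "\<lambda>i x. s i ** x" "\<lambda>i x. q i ** x" z b k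
  by (rule K_module[OF assms(2)])
 have VC: "V \<subseteq> {x. I ** x = x}" using V(2) by (auto simp: unital_def)
 have "x ** v \<in> hc.coset_span V"
  using x(1)[unfolded K_def]
 proof (induction rule: alg.induct)
  case alg_I
  thus ?case using hc.coset_span_V[OF V(1) VC assms(5,6)] x(2) V(2) assms(1) by (auto simp: unitalD)
 next
  case (alg_gen g u)
  have "g ** (u ** v) \<in> hc.coset_span V"
   using alg_gen(1) hc.coset_span_T[OF V(1) VC assms(5,6) _ _ alg_gen.IH] hc.coset_span_P[OF V(1) VC assms(5,6) _ _ alg_gen.IH]
   by (auto simp: Kg_def)
  thus ?case by (simp add: mul_assoc)
 next
  case (alg_add u u')
  thus ?case by (simp add: mul_lin hc.coset_span_def span_add)
 next
  case (alg_scale u c)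
  thus ?case by (simp add: mul_lin hc.coset_span_def span_scale)
 qed (simp add: hc.coset_span_def span_zero)
 moreover have "hc.ch j k ` V = (\<lambda>v. cs j k ** v) ` V" if "j \<in> {1..k}" for j
  using ch_cs[OF assms(2), of j] that V(2) by (auto simp: image_iff)
 moreover have "(\<lambda>x. q j ** hc.ch j k x) ` V = (\<lambda>v. q j ** (cs j k ** v)) ` V" if "j \<in> {1..k}" for j
  using ch_cs[OF assms(2), of j] that V(2) by (auto simp: image_iff)
 ultimately show ?thesis by (simp add: hc.coset_span_def)
qed

lemma K_coset:
 assumes "k < n" "x \<in> K (Suc k)"
 shows "x \<in> span (cosets (Suc k) (K k))"
proof -
 have "x ** I \<in> span (cosets (Suc k) (K k))"
  by (rule K_subset_coset[OF _ _ _ _ _ _ assms(2)]) (use assms in \<open>auto intro: unital_K intro!: K_mul K_gen\<close>)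
 thus ?thesis using unital_K[OF assms(2)] by (simp add: unitalD)
qed

lemma span_case:
 assumes "x \<in> span S" "Modules.module_hom scale scale f" "subspace V" "\<And>s. s \<in> S ==> f s \<in> V"
 shows "f x \<in> V"
 using linear_image_subset[of x S V f] assms by (simp add: Modules.module_hom.add Modules.module_hom.scale)

lemma module_hom_mul:
 "Modules.module_hom scale scale (\<lambda>x. x)"
 "Modules.module_hom scale scale f ==> Modules.module_hom scale scale (\<lambda>x. c ** f x)"
 "Modules.module_hom scale scale f ==> Modules.module_hom scale scale (\<lambda>x. f x ** c)"
 using module_axioms
 by (auto simp: Modules.module_hom_iff mul_lin)

text \<open>The coset representatives contain the last crossing at most once. A linear statement
  therefore needs checking only without the new strand, with its Clifford generator, or with one
  occurrence of \<open>s k\<close>.\<close>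

lemma K_Suc_cases:
 assumes "x \<in> K (Suc k)" "k < n" "Modules.module_hom scale scale f" "subspace V"
  and 1: "\<And>u. u \<in> K k ==> f u \<in> V" and 2: "\<And>u. u \<in> K k ==> f (q (Suc k) ** u) \<in> V"
  and 3: "\<And>w u. 1 \<le> k ==> w \<in> K k ==> u \<in> K k ==> f (w ** (s k ** u)) \<in> V"
 shows "f x \<in> V"
proof (rule span_case[OF K_coset[OF assms(2,1)] assms(3,4)])
 fix y assume "y \<in> cosets (Suc k) (K k)"
 then obtain j v where j: "1 \<le> j" "j \<le> Suc k" "v \<in> K k" and y: "y = cs j (Suc k) ** v \<or> y = q j ** (cs j (Suc k) ** v)"
  by auto
 show "f y \<in> V"
 proof (cases "j = Suc k")
  case True
  thus ?thesis using y 1[of v] 2[of v] j unital_K[OF j(3)] by (auto simp: unitalD)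
 next
  case False
  hence "y = cs j k ** (s k ** v) \<or> y = (q j ** cs j k) ** (s k ** v)" "1 \<le> k" using j y by (auto simp: mul_assoc)
  moreover have "cs j k \<in> K k" "q j ** cs j k \<in> K k" using j False by (auto intro!: cs_K K_mul K_gen)
  ultimately show ?thesis using 3[of "cs j k" v] 3[of "q j ** cs j k" v] j by auto
 qed
qed

lemma symmetric_eqs:
 "walled.K scale (\<lambda>x y. y ** x) I T W k = H k" "walled.H scale (\<lambda>x y. y ** x) I s q k = K k"
 "walled.A scale (\<lambda>x y. y ** x) I s q T W e m k = A k m"
proof -
 interpret op: walled scale "\<lambda>x y. y ** x" I s q T W e z b a n r by (rule symmetric)
 have g: "op.Kg = Hg" "op.Hg = Kg" "op.Ag m k = Ag k m" for m k
  by (auto simp: op.Kg_def op.Hg_def Kg_def Hg_def op.Ag_def Ag_def fun_eq_iff)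
 show "op.K k = H k" "op.H k = K k" "op.A m k = A k m"
  by (simp_all add: op.K_def op.H_def op.A_def g K_def H_def A_def alg_opposite)
qed

lemma H_Suc_cases:
 assumes "x \<in> H (Suc m)" "m < r" "Modules.module_hom scale scale f" "subspace V"
  and 1: "\<And>u. u \<in> H m ==> f u \<in> V" and 2: "\<And>u. u \<in> H m ==> f (u ** W (Suc m)) \<in> V"
  and 3: "\<And>w u. 1 \<le> m ==> w \<in> H m ==> u \<in> H m ==> f (u ** T m ** w) \<in> V"
 shows "f x \<in> V"
proof -
 interpret op: walled scale "\<lambda>x y. y ** x" I s q T W e z b a n r by (rule symmetric)
 show ?thesis using assms by (intro op.K_Suc_cases[of x m f V]) (auto simp: symmetric_eqs)
qed

text \<open>Two arcs that share the strand \<open>m + 1\<close>: the last crossing is absorbed by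
  the outer arc or exchanges it for the inner one.\<close>

lemma ee_eqs:
 assumes "m < r" "Suc k < n"
 shows "s (Suc k) ** ee m (Suc k) = ee m k ** ee m (Suc k)"
  "ee m k ** ee m (Suc k) = ee m k ** s (Suc k)"
  "ee m (Suc k) ** ee m k = si (Suc k) ** ee m k"
  "s (Suc k) ** ee m k = z *\<^sub>r ee m k + ee m (Suc k) ** si (Suc k)"
  "s (Suc k) ** (ee m k ** ee m (Suc k)) = z *\<^sub>r (ee m k ** ee m (Suc k)) + ee m (Suc k)"
proof -
 have E: "ee m k ** (si (Suc k) ** (ee m k ** w)) = ee m k ** w" "ee m k ** (s (Suc k) ** (ee m k ** w)) = ee m k ** w" for w
 proof -
  have "ee m k ** s (Suc k) ** ee m k = ee m k" "ee m k ** si (Suc k) ** ee m k = ee m k"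
   using ee_s_ee[OF assms] ee_mul_ee[of m k] assms by (simp_all add: si_def mul_lin mul_assoc unitalD)
  thus "ee m k ** (si (Suc k) ** (ee m k ** w)) = ee m k ** w" "ee m k ** (s (Suc k) ** (ee m k ** w)) = ee m k ** w"
   by (simp_all flip: mul_assoc)
 qed
 have sE: "s (Suc k) ** ee m (Suc k) = ee m k ** s (Suc k)"
  using assms by (simp add: ee_Suc_right mul_assoc unitalD)
 show 2: "ee m k ** ee m (Suc k) = ee m k ** s (Suc k)"
  using E by (simp add: ee_Suc_right mul_assoc)
 show 1: "s (Suc k) ** ee m (Suc k) = ee m k ** ee m (Suc k)" by (simp add: sE 2)
 have "ee m k ** (s (Suc k) ** ee m k) = ee m k" using ee_s_ee[OF assms] by (simp add: mul_assoc)
 thus "ee m (Suc k) ** ee m k = si (Suc k) ** ee m k"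
  by (simp add: ee_Suc_right mul_assoc)
 have s2: "s (Suc k) = z *\<^sub>r I + si (Suc k)" by (simp add: si_def)
 have "ee m (Suc k) ** si (Suc k) = si (Suc k) ** ee m k" using assms by (simp add: ee_Suc_right mul_assoc unitalD)
 thus "s (Suc k) ** ee m k = z *\<^sub>r ee m k + ee m (Suc k) ** si (Suc k)"
  by (subst s2) (simp add: mul_lin unitalD)
 have "s (Suc k) ** (s (Suc k) ** ee m (Suc k)) = z *\<^sub>r (s (Suc k) ** ee m (Suc k)) + ee m (Suc k)"
  using ss[of "Suc k"] assms by (simp flip: mul_assoc) (simp add: mul_lin unitalD)
 thus "s (Suc k) ** (ee m k ** ee m (Suc k)) = z *\<^sub>r (ee m k ** ee m (Suc k)) + ee m (Suc k)"
  by (simp add: 1)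
qed

text \<open>The Clifford generator slides along the arc to the other side of the wall. At the
  innermost arc this is \<open>W_e\<close>; passing a crossing costs terms with factor
  \<open>z\<close>, whose left factors stay in the smaller algebra.\<close>

lemma q_ee: "m < r ==> k < n ==> \<exists>a\<in>A (Suc m) k. q (Suc k) ** ee m k = a ** ee m k"
proof (induction k)
 case 0
 have "\<exists>a\<in>H (Suc m). q (Suc 0) ** ee m 0 = a ** ee m 0" using 0(1)
 proof (induction m)
  case 0
  thus ?case using W_e by (auto intro!: bexI[of _ "W 1"] H_gen)
 next
  case (Suc m)
  then obtain a where a: "a \<in> H (Suc m)" "q (Suc 0) ** ee m 0 = a ** ee m 0" by auto
  have "q (Suc 0) ** ee (Suc m) 0 = T (Suc m) ** ((q (Suc 0) ** ee m 0) ** Ti (Suc m))"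
   using commD(2)[OF T_q[of "Suc m" 1]] by (simp add: mul_assoc)
  also have "... = (T (Suc m) ** a ** Ti (Suc m)) ** ee (Suc m) 0"
   using Suc.prems unital_ee[of m 0] unfolding a(2) by (simp add: mul_assoc unitalD)
  finally show ?case using a(1) H_mono[of "Suc m" "Suc (Suc m)"] by (auto intro!: bexI H_mul H_gen)
 qed
 thus ?case by simp
next
 case (Suc k)
 let ?E = "ee m k" and ?F = "ee m (Suc k)" and ?s = "s (Suc k)"
 obtain a where a: "a \<in> A (Suc m) k" "q (Suc k) ** ?E = a ** ?E" using Suc by auto
 note eq = ee_eqs[OF Suc.prems]
 have inv: "?s ** (si (Suc k) ** w) = I ** w" for w using Suc.prems by simp
 have "?s ** (si (Suc k) ** ?F) = ?F" using Suc.prems by (simp add: unitalD)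
 hence "q (Suc (Suc k)) ** ?F = q (Suc (Suc k)) ** (?s ** (si (Suc k) ** ?F))" by simp
 also have "... = ?s ** (q (Suc k) ** (si (Suc k) ** ?F))"
  by (rule q_si(3)) (use Suc.prems in auto)
 also have "si (Suc k) ** ?F = ?E ** ?F - z *\<^sub>r ?F" by (simp add: si_def mul_lin eq(1) unitalD)
 also have "?s ** (q (Suc k) ** (?E ** ?F - z *\<^sub>r ?F)) = ?s ** ((q (Suc k) ** ?E) ** ?F) - z *\<^sub>r (?s ** (q (Suc k) ** ?F))"
  by (simp add: mul_lin mul_assoc)
 also have "?s ** ((q (Suc k) ** ?E) ** ?F) = a ** (?s ** (?E ** ?F))"
  unfolding a(2) using comm_s_A[of k "Suc k" a "Suc m"] a(1) by (simp add: mul_assoc commD)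
 also have "... = (z *\<^sub>r (a ** ?E) + a) ** ?F" by (simp add: eq(5) mul_lin mul_assoc)
 also have "q (Suc k) ** ?F = ?F ** q (Suc k)" using ee_comm_sq(3)[of "Suc k" "Suc k" m] Suc.prems by (simp add: comm_def)
 also have "?s ** (?F ** q (Suc k)) = ?E ** (?F ** q (Suc k))" using eq(1) by (simp flip: mul_assoc)
 also have "... = (?E ** q (Suc k)) ** ?F" using \<open>q (Suc k) ** ?F = _\<close> by (simp add: mul_assoc)
 finally have "q (Suc (Suc k)) ** ?F = (z *\<^sub>r (a ** ?E) + a - z *\<^sub>r (?E ** q (Suc k))) ** ?F"
  by (simp add: mul_lin)
 moreover have "z *\<^sub>r (a ** ?E) + a - z *\<^sub>r (?E ** q (Suc k)) \<in> A (Suc m) (Suc k)"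
  using a(1) A_mono[of "Suc m" "Suc m" k "Suc k"] ee_A[of m k]
  by (intro A_closed A_mul A_gen) auto
 ultimately show ?case by blast
qed

definition AE where "AE m k = (\<lambda>a. a ** ee m k) ` A (Suc m) k"
text \<open>Elements in which the strand \<open>k + 1\<close> is caught in an arc. The factor
  \<open>h\<close> distributes the other end of the arc over the left-hand strands.\<close>

definition V where "V m k = span {x ** ee m k ** h | x h. x \<in> A (Suc m) k \<and> h \<in> H (Suc m)}"

lemma subspace_AE [simp]: "subspace (AE m k)"
proof (rule subspaceI)
 show "0 \<in> AE m k" by (auto simp: AE_def image_iff intro!: bexI[of _ 0] subspace_0)
 show "x + y \<in> AE m k" if "x \<in> AE m k" "y \<in> AE m k" for x y
  using that by (auto simp: AE_def simp flip: mul_add_left intro: A_closed)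
 show "c *\<^sub>r x \<in> AE m k" if "x \<in> AE m k" for x c
  using that by (auto simp: AE_def simp flip: mul_scale_left intro: A_closed)
qed

lemma subspace_V [simp]: "subspace (V m k)" by (simp add: V_def)

lemma V_base: "x \<in> A (Suc m) k ==> h \<in> H (Suc m) ==> x ** ee m k ** h \<in> V m k"
 unfolding V_def by (rule span_base) auto

lemma AE_V: "x \<in> AE m k ==> x \<in> V m k"
 using V_base[of _ m k I] by (auto simp: AE_def unitalD H_gen mul_assoc)

lemma V_cases:
 assumes "x \<in> V m k" "Modules.module_hom scale scale f" "subspace U"
  "\<And>x h. x \<in> A (Suc m) k ==> h \<in> H (Suc m) ==> f (x ** ee m k ** h) \<in> U"
 shows "f x \<in> U"
 by (rule span_case[OF assms(1)[unfolded V_def] assms(2,3)]) (use assms(4) in auto)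

lemma V_left: "g \<in> A (Suc m) k ==> x \<in> V m k ==> g ** x \<in> V m k"
 using V_base[OF A_mul[of g]] by (intro V_cases[of x m k "\<lambda>x. g ** x"]) (auto intro: module_hom_mul simp: mul_assoc)

lemma V_right: "g \<in> H (Suc m) ==> x \<in> V m k ==> x ** g \<in> V m k"
 by (rule V_cases[of _ m k "\<lambda>x. x ** g"]) (auto intro: module_hom_mul simp: mul_assoc intro!: H_mul V_base[unfolded mul_assoc])

lemma AE_left: "g \<in> A (Suc m) k ==> x \<in> AE m k ==> g ** x \<in> AE m k"
 by (auto simp: AE_def simp flip: mul_assoc intro: A_mul)

end

section \<open>Neighbouring arcs separated by a generator\<close>

context walled begin

text \<open>The three cases of \<open>K_Suc_cases\<close> are commutation, \<open>q_ee\<close>, and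
  \<open>ee_eqs(1)\<close>, which trades the last crossing for the inner arc; the latter lies in
  \<open>A (Suc m) k\<close>.\<close>

lemma K_ee:
 assumes "m < r" "k < n" "x \<in> K (Suc k)" shows "x ** ee m k \<in> AE m k"
proof (rule K_Suc_cases[OF assms(3,2) _ subspace_AE, of "\<lambda>x. x ** ee m k"])
 have c: "u ** ee m k = ee m k ** u" if "u \<in> K k" for u
 proof -
  have "comm (ee m k) u" by (rule comm_A[of _ 0 k]) (use that assms in \<open>auto intro: ee_comm_sq(1,3)\<close>)
  thus ?thesis by (simp add: comm_def)
 qed
 fix u assume u: "u \<in> K k"
 show "u ** ee m k \<in> AE m k" using u K_A[of k k "Suc m"] by (auto simp: AE_def)
 obtain a where a: "a \<in> A (Suc m) k" "q (Suc k) ** ee m k = a ** ee m k" using q_ee[OF assms(1,2)] by auto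
 have "q (Suc k) ** u ** ee m k = a ** u ** ee m k" using c[OF u] a(2) by (simp add: mul_assoc) (simp flip: mul_assoc)
 thus "q (Suc k) ** u ** ee m k \<in> AE m k" using a u K_A[of k k "Suc m"] by (auto simp: AE_def intro: A_mul)
 fix w assume w: "w \<in> K k" "1 \<le> k"
 then obtain i where k: "k = Suc i" by (cases k) auto
 have "w ** (s k ** u) ** ee m k = w ** ee m i ** u ** ee m k"
  using ee_eqs(1)[of m i] c[OF u] assms k by (simp add: mul_assoc) (simp flip: mul_assoc)
 moreover have "w ** ee m i ** u \<in> A (Suc m) k"
  using u w ee_A[of m i] K_A[of k k "Suc m"] k by (auto intro!: A_mul)
 ultimately show "w ** (s k ** u) ** ee m k \<in> AE m k" by (auto simp: AE_def)
qed (auto intro: module_hom_mul)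

lemma T_V_Ti:
 assumes "Suc m < r" "x \<in> V m k" shows "T (Suc m) ** x ** Ti (Suc m) \<in> V (Suc m) k"
proof (rule V_cases[OF assms(2), of "\<lambda>x. T (Suc m) ** x ** Ti (Suc m)"])
 fix a h assume a: "a \<in> A (Suc m) k" "h \<in> H (Suc m)"
 let ?T = "T (Suc m)" and ?Ti = "Ti (Suc m)"
 have "?T ** (a ** ee m k ** h) ** ?Ti = (?T ** a ** ?Ti) ** ee (Suc m) k ** (?T ** h ** ?Ti)"
  using assms(1) unital_A[OF a(1)] unital_H[OF a(2)] by (simp add: mul_assoc unitalD)
 moreover have "?T ** a ** ?Ti \<in> A (Suc (Suc m)) k" "?T ** h ** ?Ti \<in> H (Suc (Suc m))"
  using a A_mono[of "Suc m" "Suc (Suc m)" k k] H_mono[of "Suc m" "Suc (Suc m)"]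
  by (auto intro!: A_mul H_mul A_gen H_gen)
 ultimately show "?T ** (a ** ee m k ** h) ** ?Ti \<in> V (Suc m) k" by (simp add: V_base del: ee.simps)
qed (intro module_hom_mul subspace_V)+

lemma e1_W_e1:
 "Suc i < n ==> 0 < r ==> \<exists>x\<in>K (Suc (Suc i)). e1 i ** (W 1 ** e1 (Suc i)) = x ** e1 (Suc i)"
proof (induction i)
 case 0
 have 1: "e ** (si 1 ** e) = e" using e_s_e e_e 0 by (simp add: si_def mul_lin mul_assoc unitalD)
 have qe: "q 2 ** e = e ** q 2" using e_q[of 2] by (simp add: comm_def)
 have "e ** (W 1 ** e1 (Suc 0)) = e ** (q 1 ** (si 1 ** (e ** s 1)))"
  using eW by (simp flip: mul_assoc)
 also have "... = e ** (si 1 ** (q 2 ** (e ** s 1)))"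
  using q_si(2)[of 1 "e ** s 1"] 0 by (simp add: numeral_2_eq_2)
 also have "... = (e ** (si 1 ** e)) ** (q 2 ** s 1)" using qe by (simp add: mul_assoc) (simp flip: mul_assoc)
 also have "... = q 2 ** (e ** s 1)" unfolding 1 using qe by (simp flip: mul_assoc)
 also have "... = (q 2 ** s 1) ** e1 (Suc 0)" using 0 by (simp add: mul_assoc unitalD)
 finally show ?case by (auto intro!: bexI[of _ "q 2 ** s 1"] K_mul K_gen simp: numeral_2_eq_2)
next
 case (Suc i)
 then obtain x where x: "x \<in> K (Suc (Suc i))" "e1 i ** (W 1 ** e1 (Suc i)) = x ** e1 (Suc i)" by auto
 let ?x = "si (Suc i) ** si (Suc (Suc i))" and ?x' = "s (Suc (Suc i)) ** s (Suc i)"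
 have inv: "?x ** ?x' = I" "?x' ** ?x = I" using Suc by (simp_all add: mul_assoc unitalD)
 have c: "comm (e1 i) (s (Suc (Suc i)))" using Suc by (intro e1_comm) auto
 have c': "comm (e1 (Suc (Suc i))) (s (Suc i))" using Suc by (intro e1_comm) auto
 have u: "unital (e1 i)" for i using unital_ee[of 0 i] by simp
 have E: "cj ?x ?x' (e1 i) = e1 (Suc i)" using commD(2)[OF c] Suc u by (simp add: cj_def mul_assoc unitalD)
 have "cj ?x ?x' (e1 (Suc i)) = si (Suc i) ** (e1 (Suc (Suc i)) ** s (Suc i))" by (simp add: cj_def mul_assoc)
 also have "... = e1 (Suc (Suc i))" unfolding commD(1)[OF c'] using Suc u[of "Suc (Suc i)"] by (simp add: unitalD)
 finally have E': "cj ?x ?x' (e1 (Suc i)) = e1 (Suc (Suc i))" .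
 have W: "cj ?x ?x' (W (Suc 0)) = W (Suc 0)"
  using inv(1) by (auto intro!: cj_comm comm_closed comm_inv s_W)
 have "e1 (Suc i) ** (W 1 ** e1 (Suc (Suc i))) = cj ?x ?x' x ** e1 (Suc (Suc i))"
  using arg_cong[OF x(2), of "cj ?x ?x'"] inv unital_K[OF x(1)] u by (simp add: cj_mul E E' W del: e1.simps)
 moreover have "cj ?x ?x' x \<in> K (Suc (Suc (Suc i)))"
  unfolding cj_def using x(1) K_mono[of "Suc (Suc i)" "Suc (Suc (Suc i))"] by (auto intro!: K_mul K_gen)
 ultimately show ?case by blast
qed

lemma ee_T_ee_YY:
 assumes "Suc m < r" "Suc i < n"
 shows "ee m i ** (T (Suc m) ** ee m (Suc i)) = YY m i ** s (Suc i)"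
  "YY m i ** (s (Suc i) ** Ti (Suc m)) = YY m i"
  "s (Suc i) ** YY m i = T (Suc m) ** YY m i"
  "YY m i = ee m i ** ee (Suc m) (Suc i)"
proof -
 show "ee m i ** (T (Suc m) ** ee m (Suc i)) = YY m i ** s (Suc i)"
  using YY_eq[OF assms] by (simp add: ee_Suc_right mul_assoc) (simp flip: mul_assoc)
 have "YY m i ** (s (Suc i) ** Ti (Suc m)) = YY m i ** T (Suc m) ** Ti (Suc m)"
  using YY_T_s(2)[OF assms] by (simp flip: mul_assoc)
 thus "YY m i ** (s (Suc i) ** Ti (Suc m)) = YY m i"
  using assms by (simp add: mul_assoc) (simp add: YY_def unitalD)
 show "s (Suc i) ** YY m i = T (Suc m) ** YY m i" using YY_T_s(1)[OF assms] by simp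
 show "YY m i = ee m i ** ee (Suc m) (Suc i)" using ee_ee_Suc(1)[OF assms] by simp
qed

text \<open>Induction on \<open>m\<close>. Expanding the Clifford generator conjugated by
  \<open>T (Suc m)\<close> gives the conjugate of the previous product, covered by
  \<open>T_V_Ti\<close>, and two terms with factor \<open>z\<close> in which the doubled element
  \<open>?Y\<close> absorbs the crossings.\<close>

lemma s_ee_W_ee:
 assumes "m < r" "Suc i < n"
 shows "s (Suc i) ** (ee m i ** (W (Suc m) ** ee m (Suc i))) \<in> V m (Suc i)"
 using assms(1)
proof (induction m)
 case 0
 obtain x where x: "x \<in> K (Suc (Suc i))" "e1 i ** (W 1 ** e1 (Suc i)) = x ** e1 (Suc i)"
  using e1_W_e1[of i] assms by auto
 have "s (Suc i) ** x ** ee 0 (Suc i) \<in> AE 0 (Suc i)"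
  using x(1) assms by (intro K_ee K_mul K_gen) auto
 thus ?case using x(2) AE_V by (simp add: mul_assoc)
next
 case (Suc m)
 let ?T = "T (Suc m)" and ?Ti = "Ti (Suc m)" and ?s = "s (Suc i)" and ?V = "W (Suc (Suc m))" and ?W = "W (Suc m)"
 let ?E = "ee m i" and ?F = "ee m (Suc i)" and ?F' = "ee (Suc m) (Suc i)" and ?Y = "YY m i"
 note Y = ee_T_ee_YY[OF Suc.prems assms(2)]
 have Tm: "?T ** ?T = z *\<^sub>r ?T + I" "?W ** ?T = ?T ** ?V" "?E ** ?V = ?V ** ?E" "?F ** ?V = ?V ** ?F"
  using TT[of "Suc m"] TW[of "Suc m"] ee_comm_TW(4)[of m "Suc (Suc m)"] Suc.prems by (auto simp: comm_def)
 have sT: "?s ** (?T ** w) = ?T ** (?s ** w)" "?s ** (?V ** w) = ?V ** (?s ** w)" for w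
  using commD(2)[OF comm_sym[OF T_s]] commD(2)[OF s_W] by auto
 have YsTi: "?Y ** (?s ** (?Ti ** w)) = ?Y ** w" for w
 proof -
  have "?Y ** (?s ** (?Ti ** w)) = (?Y ** (?s ** ?Ti)) ** w" by (simp add: mul_assoc)
  thus ?thesis by (simp add: Y(2))
 qed
 have EV: "?E ** (?V ** w) = ?V ** (?E ** w)" for w using Tm(3) by (simp flip: mul_assoc)
 have ETF: "?E ** (?T ** (?F ** w)) = ?Y ** (?s ** w)" for w
 proof -
  have "?E ** (?T ** (?F ** w)) = (?E ** (?T ** ?F)) ** w" by (simp add: mul_assoc)
  thus ?thesis by (simp add: Y(1) mul_assoc)
 qed
 have "?E ** (?Ti ** (?V ** (?T ** (?F ** w)))) = ?E ** (?W ** (?F ** w)) + z *\<^sub>r (?Y ** (?s ** (?V ** w))) - z *\<^sub>r (?V ** (?Y ** (?s ** w)))" for w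
 proof -
  have "?Ti ** (?V ** (?T ** u)) = ?W ** (z *\<^sub>r (?T ** u) + I ** u) - z *\<^sub>r (?V ** (?T ** u))" for u
  proof -
   have "?Ti ** (?V ** (?T ** u)) = (?Ti ** ?V) ** (?T ** u)" by (simp add: mul_assoc)
   also have "... = ?W ** ((?T ** ?T) ** u) - z *\<^sub>r (?V ** (?T ** u))"
    using Ti_W(1)[of "Suc m"] Suc.prems by (simp add: mul_lin mul_assoc)
   finally show ?thesis by (simp add: Tm(1) mul_lin)
  qed
  hence "?E ** (?Ti ** (?V ** (?T ** (?F ** w)))) = z *\<^sub>r (?E ** (?W ** (?T ** (?F ** w)))) + ?E ** (?W ** (?F ** w))
    - z *\<^sub>r (?E ** (?V ** (?T ** (?F ** w))))"
   by (simp add: mul_lin unitalD)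
  also have "?W ** (?T ** (?F ** w)) = ?T ** (?F ** (?V ** w))"
  proof -
   have "?W ** (?T ** (?F ** w)) = (?W ** ?T) ** (?F ** w)" by (simp add: mul_assoc)
   also have "... = ?T ** ((?V ** ?F) ** w)" by (simp add: Tm(2) mul_assoc)
   also have "... = ?T ** (?F ** (?V ** w))" unfolding Tm(4)[symmetric] by (simp add: mul_assoc)
   finally show ?thesis .
  qed
  finally show ?thesis by (simp add: ETF EV)
 qed
 hence "?s ** (ee (Suc m) i ** (?V ** ?F')) = ?s ** (?T ** (?E ** (?W ** (?F ** ?Ti)) + z *\<^sub>r (?Y ** (?s ** (?V ** ?Ti)))
   - z *\<^sub>r (?V ** (?Y ** (?s ** ?Ti)))))"
  by (simp add: mul_assoc)
 also have "?V ** ?Ti = ?Ti ** ?W" using Ti_W(2)[of "Suc m"] Suc.prems by simp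
 also have "?s ** (?T ** (?E ** (?W ** (?F ** ?Ti)) + z *\<^sub>r (?Y ** (?s ** (?Ti ** ?W))) - z *\<^sub>r (?V ** (?Y ** (?s ** ?Ti)))))
   = ?T ** (?s ** (?E ** (?W ** ?F))) ** ?Ti + z *\<^sub>r (?T ** ((?s ** ?Y) ** ?W)) - z *\<^sub>r (?T ** (?V ** (?s ** ?Y)))"
  by (simp add: mul_lin sT YsTi Y(2) mul_assoc)
 also have "... = ?T ** (?s ** (?E ** (?W ** ?F))) ** ?Ti + z *\<^sub>r ((?T ** ?T ** ?E) ** ?F' ** ?W) - z *\<^sub>r ((?T ** ?V ** ?T ** ?E) ** ?F')"
  unfolding Y(3) by (simp only: Y(4) mul_assoc)
 also have "... \<in> V (Suc m) (Suc i)"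
 proof -
  have EA: "?E \<in> A (Suc (Suc m)) (Suc i)" using ee_A[of m i] A_mono[of "Suc m" "Suc (Suc m)" "Suc i" "Suc i"] by auto
  have "?T ** (?s ** (?E ** (?W ** ?F))) ** ?Ti \<in> V (Suc m) (Suc i)" using Suc by (intro T_V_Ti) auto
  moreover have "(?T ** ?T ** ?E) ** ?F' ** ?W \<in> V (Suc m) (Suc i)" using EA by (intro V_base A_mul A_gen H_gen) auto
  moreover have "(?T ** ?V ** ?T ** ?E) ** ?F' \<in> V (Suc m) (Suc i)"
   using EA by (intro AE_V) (auto simp: AE_def intro!: imageI A_mul A_gen)
  ultimately show ?thesis by (intro subspace_add subspace_diff subspace_scale) auto
 qed
 finally show ?case .
qed

lemma s_ee_T_ee:
 assumes "Suc m < r" "Suc i < n"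
 shows "s (Suc i) ** (ee (Suc m) i ** (T (Suc m) ** ee (Suc m) (Suc i))) \<in> AE (Suc m) (Suc i)"
proof -
 let ?T = "T (Suc m)" and ?Ti = "Ti (Suc m)" and ?s = "s (Suc i)"
 note Y = ee_T_ee_YY[OF assms]
 have "ee (Suc m) i ** (?T ** ee (Suc m) (Suc i)) = ?T ** (ee m i ** (?T ** ee m (Suc i))) ** ?Ti"
  using assms by (simp add: mul_assoc unitalD)
 also have "... = ?T ** YY m i" using Y(2) by (simp add: Y(1) mul_assoc)
 finally have "?s ** (ee (Suc m) i ** (?T ** ee (Suc m) (Suc i))) = ?T ** (?s ** YY m i)"
  using commD(2)[OF comm_sym[OF T_s]] by simp
 also have "... = (?T ** ?T ** ee m i) ** ee (Suc m) (Suc i)" unfolding Y(3) by (simp only: Y(4) mul_assoc)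
 also have "... \<in> AE (Suc m) (Suc i)"
  using ee_A[of m i] A_mono[of "Suc m" "Suc (Suc m)" "Suc i" "Suc i"]
  unfolding AE_def by (intro imageI A_mul A_gen) auto
 finally show ?thesis .
qed

end

section \<open>The last crossing preserves \<open>V\<close>\<close>

context walled begin

function dn :: "nat => nat => 'a" where
 "dn k j = (if j < k then dn k (Suc j) ** s j else s k)"
 by auto
termination by (relation "measure (\<lambda>(k, j). k - j)") auto

text \<open>\<open>dn k j = s\<^sub>k s\<^sub>k\<^sub>-\<^sub>1 ... s\<^sub>j\<close>.\<close>

declare dn.simps [simp del]

lemma dn_induct [consumes 1, case_names base step]:
 assumes "j \<le> k" "P k" "\<And>j. j < k ==> P (Suc j) ==> P j" shows "P j"
 using assms(1) by (induction rule: inc_induct) (use assms in auto)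

lemma dn_K: "j \<le> k ==> 1 \<le> j ==> dn k j \<in> K (Suc k)"
 by (induction j rule: dn_induct; subst dn.simps) (auto intro!: K_mul K_gen)

lemma dn_comm_A: "j \<le> k ==> i < j ==> u \<in> A m i ==> comm (dn k j) u"
proof (induction j rule: dn_induct)
 case base
 thus ?case by (subst dn.simps) (simp add: comm_s_A)
next
 case (step j)
 thus ?case by (subst dn.simps) (simp add: comm_closed(7) comm_s_A)
qed

lemma comm_dn: "j \<le> k ==> (\<And>j. comm x (s j)) ==> comm x (dn k j)"
proof (induction j rule: dn_induct)
 case base
 thus ?case by (subst dn.simps) simp
next
 case (step j)
 thus ?case by (subst dn.simps) (simp add: comm_closed(1))
qed

lemma V_right_s:
 assumes "m < r" "k < n" "1 \<le> j" "j < k" "x \<in> V m k" shows "x ** si j \<in> V m k"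
proof (rule V_cases[OF assms(5), of "\<lambda>x. x ** si j"])
 fix a h assume a: "a \<in> A (Suc m) k" "h \<in> H (Suc m)"
 have "comm (ee m k) (si j)" using assms by (intro comm_inv ee_comm_sq) auto
 moreover have "comm (si j) h" by (intro comm_inv comm_s_H[OF a(2)] unital_H[OF a(2)])
 ultimately have "a ** ee m k ** h ** si j = (a ** si j) ** ee m k ** h"
  using commD(2)[of "ee m k" "si j"] commD(1)[of "si j" h, symmetric] by (simp add: mul_assoc)
 also have "... \<in> V m k" using a assms by (intro V_base A_mul A_gen) auto
 finally show "a ** ee m k ** h ** si j \<in> V m k" .
qed (intro module_hom_mul subspace_V)+

text \<open>Induction downwards from \<open>Suc i = k\<close>. By \<open>ee_eqs(4)\<close> the last
  factor of the chain produces \<open>z\<close> times the arc, where \<open>K_ee\<close> applies,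
  and the next arc times an inverse crossing, which commutes to the right and is harmless by
  \<open>V_right_s\<close>.\<close>

lemma dn_ee_V:
 assumes mk: "m < r" "k < n" and x: "unital x" "x \<in> A (Suc m) k" "\<And>j. comm x (s j)"
  and base: "\<And>i. k = Suc i ==> s k ** (ee m i ** (x ** ee m k)) \<in> V m k"
  and "Suc i \<le> k"
 shows "dn k (Suc i) ** (ee m i ** (x ** ee m k)) \<in> V m k"
 using assms(7)
proof (induction "Suc i" arbitrary: i rule: dn_induct)
 case base
 thus ?case using assms(6)[of i] by (subst dn.simps) simp
next
 case (step i)
 let ?d = "dn k (Suc (Suc i))"
 have d: "dn k (Suc i) = ?d ** s (Suc i)" using step by (subst dn.simps) simp
 have c: "comm ?d (ee m i)" using step ee_A[of m i] by (intro dn_comm_A[of _ _ "Suc i" _ "Suc m"]) auto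
 have cx: "comm ?d x" using comm_dn[of "Suc (Suc i)" k x] x step by (auto intro: comm_sym)
 have cE: "comm (ee m k) (si (Suc i))" using step mk by (intro comm_inv ee_comm_sq) auto
 have csx: "comm (si (Suc i)) x" using x by (auto intro: comm_inv comm_sym)
 have "dn k (Suc i) ** (ee m i ** (x ** ee m k)) = ?d ** ((s (Suc i) ** ee m i) ** (x ** ee m k))"
  by (simp add: d mul_assoc)
 also have "... = z *\<^sub>r ((ee m i ** x) ** (?d ** ee m k)) + ?d ** (ee m (Suc i) ** (x ** ee m k)) ** si (Suc i)"
  using ee_eqs(4)[of m i] mk step commD(2)[OF c] commD(2)[OF cx] commD(1)[OF cE] commD(2)[OF csx]
  by (simp add: mul_lin mul_assoc)
 also have "... \<in> V m k"
 proof -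
  have "?d ** ee m k \<in> AE m k" using mk step by (intro K_ee dn_K) auto
  moreover have "ee m i ** x \<in> A (Suc m) k"
   using ee_A[of m i] A_mono[of "Suc m" "Suc m" "Suc i" k] step x by (intro A_mul) auto
  ultimately have "(ee m i ** x) ** (?d ** ee m k) \<in> V m k" by (intro AE_V AE_left[of "ee m i ** x"])
  moreover have "?d ** (ee m (Suc i) ** (x ** ee m k)) ** si (Suc i) \<in> V m k"
   using step mk by (intro V_right_s step.hyps) auto
  ultimately show ?thesis by (intro subspace_add subspace_scale subspace_V)
 qed
 finally show ?case .
qed

text \<open>The branching rule behind the count: the strand \<open>k + 1\<close> is either moved by
  one of \<open>2 * (k + 1)\<close> coset representatives or caught in an arc, for which there are
  \<open>2 * (m + 1)\<close> choices. Each new strand thus multiplies the bound by twice the new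
  number of strands.\<close>

definition D1 where
 "D1 m k \<longleftrightarrow> A (Suc m) (Suc k) \<subseteq> span (prods (K (Suc k)) (A (Suc m) k) \<union> V m k)"

text \<open>Everything from \<open>H m\<close> commutes with the arcs and with the chain. By
  \<open>H_Suc_cases\<close> only \<open>I\<close>, \<open>W (Suc m)\<close> or \<open>T m\<close>
  is left between the arcs.\<close>

lemma dn_ee_H_V:
 assumes mk: "m < r" "k < n" and i: "Suc i \<le> k" and h: "h \<in> H (Suc m)"
 shows "dn k (Suc i) ** (ee m i ** (h ** ee m k)) \<in> V m k"
proof -
 let ?d = "dn k (Suc i)"
 have n: "i < n" using i mk by simp
 have cd: "?d ** (u ** w) = u ** (?d ** w)" if "u \<in> H m" for u w
  using commD(2)[OF dn_comm_A[of "Suc i" k 0 u m]] i that by simp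
 have ce: "ee m j ** (u ** w) = u ** (ee m j ** w)" "u ** ee m j = ee m j ** u" if "u \<in> H m" "j < n" for u w j
  using commD[OF comm_ee_A[OF mk(1) that(2), of u]] that H_A[of m m j] by auto
 have HA: "H m \<subseteq> A (Suc m) k" by (rule H_A) simp
 have HH: "H m \<subseteq> H (Suc m)" by (rule H_mono) simp
 have base: "?d ** (ee m i ** (x ** ee m k)) \<in> V m k" if "x = I \<or> x = W (Suc m) \<or> (\<exists>m'. m = Suc m' \<and> x = T m)" for x
 proof (rule dn_ee_V[OF mk _ _ _ _ i])
  show "unital x" "x \<in> A (Suc m) k" using that by (auto intro: A_gen)
  show "comm x (s j)" for j using that by (auto intro: comm_sym T_s s_W simp: comm_def[of I] unitalD)
  show "s k ** (ee m j ** (x ** ee m k)) \<in> V m k" if kj: "k = Suc j" for j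
  proof -
   consider "x = I" | "x = W (Suc m)" | m' where "m = Suc m'" "x = T m"
    using \<open>x = I \<or> x = W (Suc m) \<or> (\<exists>m'. m = Suc m' \<and> x = T m)\<close> by blast
   thus ?thesis
   proof cases
    case 1
    have "s k ** (ee m j ** (x ** ee m k)) = (z *\<^sub>r ee m j + I) ** ee m k"
     using ee_eqs(5)[of m j] mk kj by (simp add: 1 mul_lin unitalD)
    moreover have "z *\<^sub>r ee m j + I \<in> A (Suc m) k" using ee_A[of m j] kj by (intro A_closed A_gen) auto
    ultimately show ?thesis by (intro AE_V) (simp add: AE_def)
   next
    case 2 thus ?thesis using s_ee_W_ee[of m j] mk kj by simp
   next
    case 3 thus ?thesis using s_ee_T_ee[of m' j] mk kj AE_V by simp
   qed
  qed
 qed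
 have hom: "Modules.module_hom scale scale (\<lambda>h. ?d ** (ee m i ** (h ** ee m k)))" by (intro module_hom_mul)
 have move: "?d ** (ee m i ** ((u ** x ** w) ** ee m k)) = u ** ((?d ** (ee m i ** (x ** ee m k))) ** w)"
  if "u \<in> H m" "w \<in> H m" for u x w
  using cd[OF that(1)] ce[OF that(1) n] ce(2)[OF that(2) mk(2)] by (simp add: mul_assoc)
 show ?thesis
 proof (rule H_Suc_cases[OF h mk(1) hom subspace_V])
  fix u w assume u: "u \<in> H m"
  have uI: "u = u ** I ** I" using unital_H[OF u] by (simp add: unitalD)
  show "?d ** (ee m i ** (u ** ee m k)) \<in> V m k"
   using V_left[OF _ V_right[OF H_gen(4) base[of I]], of u] u HA by (subst uI, subst move) (auto intro: H_gen)
  show "?d ** (ee m i ** (u ** W (Suc m) ** ee m k)) \<in> V m k"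
   using move[OF u H_gen(4), of "W (Suc m)"] V_left[of u m k] V_right[OF H_gen(4)] u HA base[of "W (Suc m)"]
   by (simp add: unitalD mul_assoc) (auto simp: unitalD)
  assume "w \<in> H m" "1 \<le> m"
  moreover from this have "\<exists>m'. m = Suc m'" by (cases m) auto
  ultimately show "?d ** (ee m i ** (u ** T m ** w ** ee m k)) \<in> V m k"
   using V_left[OF _ V_right[OF _ base[of "T m"]], of u w] u HA HH by (subst move[OF u]) auto
 qed
qed

text \<open>The chain is what \<open>s k\<close> grows into when it is pushed through
  \<open>x\<close>. Expanding \<open>x\<close> by \<open>D1\<close> for smaller \<open>j\<close>,
  the chain either reaches \<open>ee m k\<close>, or takes up one more crossing and meets a smaller
  algebra, or meets an arc, which is \<open>dn_ee_H_V\<close>.\<close>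

lemma dn_A_V:
 assumes mk: "m < r" "k < n" and D1: "\<And>i. i < k ==> D1 m i"
 shows "Suc j \<le> k ==> x \<in> A (Suc m) (Suc j) ==> dn k (Suc j) ** (x ** ee m k) \<in> V m k"
proof (induction j arbitrary: x rule: less_induct)
 case (less j)
 let ?d = "dn k (Suc j)" and ?E = "ee m k"
 have A: "A (Suc m) j \<subseteq> A (Suc m) k" using less.prems by (intro A_mono) auto
 have c: "?d ** (u ** w) = u ** (?d ** w)" if "u \<in> A (Suc m) j" for u w
  using commD(2)[OF dn_comm_A[OF _ _ that]] less.prems by simp
 have dE: "y ** ?E \<in> AE m k" if "y \<in> K (Suc k)" for y by (rule K_ee[OF mk that])
 have dK: "?d \<in> K (Suc k)" using less.prems by (intro dn_K) auto
 have P: "?d ** ((y ** u) ** ?E) \<in> V m k" if y: "y \<in> K (Suc j)" and u: "u \<in> A (Suc m) j" for y u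
 proof (rule K_Suc_cases[OF y _ _ subspace_V, of "\<lambda>y. ?d ** ((y ** u) ** ?E)"])
  show "j < n" using less.prems mk by simp
  show "Modules.module_hom scale scale (\<lambda>y. ?d ** ((y ** u) ** ?E))" by (intro module_hom_mul)
  fix v assume "v \<in> K j"
  hence vu: "v ** u \<in> A (Suc m) j" using u K_A[of j j "Suc m"] by (auto intro: A_mul)
  show "?d ** ((v ** u) ** ?E) \<in> V m k"
   using AE_V[OF AE_left[OF _ dE[OF dK], of "v ** u"]] vu A c[OF vu] by (auto simp: mul_assoc)
  obtain v' where v': "v' \<in> A (Suc m) j" "q (Suc j) ** (v ** u) = v' ** q (Suc j)"
   using skew_q_A[OF refl vu] by auto
  have "?d ** ((q (Suc j) ** v ** u) ** ?E) = v' ** ((?d ** q (Suc j)) ** ?E)"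
  proof -
   have "(q (Suc j) ** v ** u) ** ?E = (q (Suc j) ** (v ** u)) ** ?E" by (simp add: mul_assoc)
   thus ?thesis using c[OF v'(1)] by (simp add: v'(2) mul_assoc)
  qed
  also have "... \<in> V m k"
   using v'(1) A less.prems dK by (intro AE_V AE_left dE K_mul K_gen) auto
  finally show "?d ** ((q (Suc j) ** v ** u) ** ?E) \<in> V m k" .
  fix w assume w: "w \<in> K j" and j: "1 \<le> j"
  then obtain j' where j': "j = Suc j'" by (cases j) auto
  have wA: "w \<in> A (Suc m) j" using w K_A[of j j "Suc m"] by auto
  have "?d ** ((w ** (s j ** v) ** u) ** ?E) = w ** (dn k j ** ((v ** u) ** ?E))"
   using c[OF wA] less.prems by (simp add: dn.simps[of k j] mul_assoc)
  also have "... \<in> V m k"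
   using V_left[OF _ less.IH[of j' "v ** u"], of w] vu j' less.prems wA A by auto
  finally show "?d ** ((w ** (s j ** v) ** u) ** ?E) \<in> V m k" .
 qed
 have "D1 m j" using D1 less.prems by simp
 hence "x \<in> span (prods (K (Suc j)) (A (Suc m) j) \<union> V m j)" using less.prems by (auto simp: D1_def)
 thus ?case
 proof (rule span_case[where f = "\<lambda>x. ?d ** (x ** ?E)"])
  show "Modules.module_hom scale scale (\<lambda>x. ?d ** (x ** ?E))" by (intro module_hom_mul)
  fix y assume "y \<in> prods (K (Suc j)) (A (Suc m) j) \<union> V m j"
  thus "?d ** (y ** ?E) \<in> V m k"
  proof
   assume "y \<in> prods (K (Suc j)) (A (Suc m) j)"
   thus ?thesis unfolding prods_def
    by (rule span_case[where f = "\<lambda>x. ?d ** (x ** ?E)"]) (intro module_hom_mul, auto intro: P)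
  next
   assume y: "y \<in> V m j"
   show ?thesis
   proof (rule V_cases[OF y, of "\<lambda>x. ?d ** (x ** ?E)"])
    fix u h assume u: "u \<in> A (Suc m) j" "h \<in> H (Suc m)"
    show "?d ** (u ** ee m j ** h ** ?E) \<in> V m k"
     using V_left[OF _ dn_ee_H_V[OF mk less.prems(1) u(2)], of u] u(1) A c[OF u(1)] by (auto simp: mul_assoc)
   qed (intro module_hom_mul subspace_V)+
  qed
 qed simp
qed

lemma s_V: "m < r ==> k < n ==> (\<And>i. i < k ==> D1 m i) ==> 1 \<le> k ==> x \<in> V m k ==> s k ** x \<in> V m k"
proof (rule V_cases[of x m k "\<lambda>x. s k ** x"])
 fix u h assume a: "m < r" "k < n" "\<And>i. i < k ==> D1 m i" "1 \<le> k" "u \<in> A (Suc m) k" "h \<in> H (Suc m)"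
 then obtain j where k: "k = Suc j" by (cases k) auto
 have "s k ** (u ** ee m k) \<in> V m k" using dn_A_V[of m k j u] a k by (simp add: dn.simps)
 from V_right[OF a(6) this] show "s k ** (u ** ee m k ** h) \<in> V m k" by (simp add: mul_assoc)
qed (auto intro: module_hom_mul)

end

section \<open>The branching rule and the resulting bound\<close>

context walled begin

definition M where "M m k = span (prods (K (Suc k)) (A (Suc m) k) \<union> V m k)"

text \<open>\<open>D1\<close> for the mirrored algebra, written out; see
  \<open>D1_symmetric\<close>.\<close>

definition D2 where
 "D2 m k \<longleftrightarrow> A (Suc m) (Suc k) \<subseteq> span (prods (A m (Suc k)) (H (Suc m)) \<union>
   span {h ** (ee m k ** x) | x h. x \<in> A m (Suc k) \<and> h \<in> K (Suc k)})"

lemma D1_symmetric: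
 "walled.D1 scale (\<lambda>x y. y ** x) I s q T W e z k m = D2 m k"
proof -
 interpret op: walled scale "\<lambda>x y. y ** x" I s q T W e z b a n r by (rule symmetric)
 have "op.prods U V = prods V U" for U V unfolding op.prods_def prods_def by (rule arg_cong[of _ _ span]) auto
 thus ?thesis
  by (simp add: op.D1_def D2_def op.V_def symmetric_eqs ee_symmetric)
qed

lemma D2_symmetric:
 "walled.D2 scale (\<lambda>x y. y ** x) I s q T W e z k m = D1 m k"
proof -
 interpret op: walled scale "\<lambda>x y. y ** x" I s q T W e z b a n r by (rule symmetric)
 have "op.prods U V = prods V U" for U V unfolding op.prods_def prods_def by (rule arg_cong[of _ _ span]) auto
 thus ?thesis
  by (simp add: D1_def op.D2_def V_def symmetric_eqs ee_symmetric mul_assoc)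
qed

lemma M_prod: "x \<in> K (Suc k) ==> y \<in> A (Suc m) k ==> x ** y \<in> M m k"
 unfolding M_def by (intro span_base UnI1 prodsI)

lemma M_V: "x \<in> V m k ==> x \<in> M m k"
 unfolding M_def by (intro span_base UnI2)

lemma subspace_M [simp]: "subspace (M m k)" by (simp add: M_def)

lemma M_left:
 assumes "\<And>x y. x \<in> K (Suc k) ==> y \<in> A (Suc m) k ==> g ** (x ** y) \<in> M m k"
  "\<And>x. x \<in> V m k ==> g ** x \<in> M m k" "x \<in> M m k"
 shows "g ** x \<in> M m k"
proof (rule span_case[OF assms(3)[unfolded M_def] _ subspace_M, of "\<lambda>x. g ** x"])
 fix y assume "y \<in> prods (K (Suc k)) (A (Suc m) k) \<union> V m k"
 thus "g ** y \<in> M m k"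
 proof
  assume "y \<in> prods (K (Suc k)) (A (Suc m) k)"
  thus ?thesis unfolding prods_def
   by (rule span_case[where f = "\<lambda>x. g ** x"]) (intro module_hom_mul, auto intro: assms)
 qed (rule assms)
qed (intro module_hom_mul)

lemma ee_H_ee0:
 assumes "m < r" "0 < n" "h \<in> H (Suc m)"
 shows "\<exists>u\<in>H (Suc m). ee m 0 ** (h ** ee m 0) = u ** ee m 0"
proof -
 let ?E = "ee m 0"
 have c: "u ** ?E = ?E ** u" if "u \<in> H m" for u
  using comm_ee_A[of m 0 u] that assms by (simp add: comm_def)
 have "?E ** (h ** ?E) \<in> AE m 0"
 proof (rule H_Suc_cases[OF assms(3,1) _ subspace_AE, of "\<lambda>h. ?E ** (h ** ?E)"])
  fix u assume u: "u \<in> H m"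
  have 0: "?E ** (?E ** w) = 0" for w using ee_mul_ee[of m 0] assms by (simp flip: mul_assoc)
  show "?E ** (u ** ?E) \<in> AE m 0" using 0 c[OF u] subspace_0[OF subspace_AE] by simp
  have "?E ** (u ** W (Suc m) ** ?E) = u ** (?E ** W (Suc m) ** ?E)"
   using c[OF u] by (simp add: mul_assoc) (simp flip: mul_assoc)
  thus "?E ** (u ** W (Suc m) ** ?E) \<in> AE m 0"
   using ee_W_ee[of m 0] assms subspace_0[OF subspace_AE] by simp
  fix w assume w: "w \<in> H m" and m: "1 \<le> m"
  then obtain i where i: "m = Suc i" by (cases m) auto
  have "?E ** T m ** ?E = T m ** (ee i 0 ** T m ** ee i 0) ** Ti m"
   using assms i by (simp add: mul_assoc unitalD)
  also have "... = ?E" using ee_T_ee[of i 0] assms i by simp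
  finally have "?E ** (T m ** (?E ** w)) = ?E ** w" for w by (simp flip: mul_assoc)
  moreover have "?E ** (u ** T m ** w ** ?E) = u ** (?E ** (T m ** (?E ** w)))"
   using c[OF u] c[OF w] by (simp add: mul_assoc) (simp flip: mul_assoc)
  ultimately have "?E ** (u ** T m ** w ** ?E) = (u ** w) ** ?E" using c[OF w] by (simp add: mul_assoc)
  thus "?E ** (u ** T m ** w ** ?E) \<in> AE m 0"
   using u w H_mono[of m "Suc m"] by (auto simp: AE_def intro!: imageI H_mul)
 qed (intro module_hom_mul)
 thus ?thesis by (auto simp: AE_def)
qed

text \<open>Undoes the conjugation by the \<open>T\<close>, with factors that do not depend on
  \<open>k\<close>. It replaces the arc at the first left-hand strand, which left multiplication by
  \<open>e\<close> produces, by the outermost one, for which commutation is known.\<close>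

lemma e1_ee:
 assumes "m < r"
 obtains h h' where "h \<in> H (Suc m)" "h' \<in> H (Suc m)" "\<And>k. e1 k = h ** ee m k ** h'"
proof -
 have "\<exists>h\<in>H (Suc m). \<exists>h'\<in>H (Suc m). \<forall>k. e1 k = h ** ee m k ** h'"
  using assms
 proof (induction m)
  case 0
  have "unital (e1 k)" for k using unital_ee[of 0 k] by simp
  thus ?case by (intro bexI[of _ I]) (auto simp: unitalD H_gen)
 next
  case (Suc m)
  then obtain h h' where h: "h \<in> H (Suc m)" "h' \<in> H (Suc m)" "\<And>k. e1 k = h ** ee m k ** h'" by auto
  have "h ** Ti (Suc m) ** ee (Suc m) k ** (T (Suc m) ** h') = e1 k" for k
   using Suc.prems h(3)[of k] unital_H[OF h(2)] by (simp add: mul_assoc unitalD)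
  moreover have "h ** Ti (Suc m) \<in> H (Suc (Suc m))" "T (Suc m) ** h' \<in> H (Suc (Suc m))"
   using h H_mono[of "Suc m" "Suc (Suc m)"] by (auto intro!: H_mul H_gen)
  ultimately show ?case by metis
 qed
 thus ?thesis using that by blast
qed

lemma e_cs: "0 < r ==> k < n ==> e ** cs 1 (Suc k) = cs 1 (Suc k) ** e1 k"
proof (induction k)
 case (Suc k)
 have "e ** cs 1 (Suc (Suc k)) = (e ** cs 1 (Suc k)) ** s (Suc k)" by (simp add: mul_assoc)
 also have "... = cs 1 (Suc k) ** (e1 k ** s (Suc k))" using Suc by (simp add: mul_assoc)
 also have "e1 k ** s (Suc k) = s (Suc k) ** e1 (Suc k)"
  using Suc.prems unital_ee[of 0 k] by (simp add: unitalD mul_assoc)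
 finally show ?case by (simp add: mul_assoc)
qed (simp add: unitalD)

lemma e_cs_far: "1 < j ==> comm e (cs j k)"
 by (induction k) (auto intro!: comm_closed(1,5) e_s)

text \<open>Since \<open>M m k\<close> contains \<open>I\<close>, stability under left
  multiplication by the generators suffices. For \<open>e\<close>, the factor from
  \<open>K (Suc k)\<close> is expanded in cosets: if the first strand is not involved,
  \<open>e\<close> passes; otherwise it turns into \<open>e1 k\<close> and then into
  \<open>ee m k\<close>, where \<open>X\<close> applies.\<close>

lemma D1_step:
 assumes mk: "m < r" "k < n" and D1: "\<And>i. i < k ==> D1 m i"
  and X: "\<And>x. x \<in> A (Suc m) k ==> ee m k ** x \<in> M m k"
 shows "D1 m k"
proof -
 have sV: "s j ** x \<in> V m k" if "1 \<le> j" "j \<le> k" "x \<in> V m k" for j x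
  using s_V[OF mk D1 _ that(3)] V_left[OF A_gen(1) that(3), of j k] that by (cases "j = k") auto
 have VI: "I ** y = y" if "y \<in> V m k" for y
 proof -
  have "V m k \<subseteq> {y. I ** y = y}" unfolding V_def
  proof (rule span_minimal)
   show "{x ** ee m k ** h |x h. x \<in> A (Suc m) k \<and> h \<in> H (Suc m)} \<subseteq> {y. I ** y = y}"
    by (auto simp: unitalD mul_assoc dest: unital_A)
  qed (rule subspaceI; simp add: mul_lin)
  thus ?thesis using that by auto
 qed
 have siV: "si j ** x \<in> V m k" if "1 \<le> j" "j \<le> k" "x \<in> V m k" for j x
  using subspace_diff[OF subspace_V sV[OF that] subspace_scale[OF subspace_V that(3), of z]] VI[OF that(3)]
  by (simp add: si_def mul_lin)
 have M_W: "g ** x \<in> M m k" if g: "g \<in> Hg (Suc m)" and x: "x \<in> M m k" for g x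
 proof (rule M_left[OF _ _ x])
  have gA: "g \<in> A (Suc m) k" using g by (auto simp: Hg_def intro: A_gen)
  show "g ** y \<in> M m k" if "y \<in> V m k" for y by (intro M_V V_left gA that)
  fix u y assume u: "u \<in> K (Suc k)" "y \<in> A (Suc m) k"
  have "\<exists>v\<in>K (Suc k). g ** u = v ** g"
   using g skew_W_K[OF u(1)] commD(1)[OF comm_T_K[OF u(1)]] u(1) by (auto simp: Hg_def)
  then obtain v where "v \<in> K (Suc k)" "g ** u = v ** g" by auto
  thus "g ** (u ** y) \<in> M m k" using M_prod[of v k "g ** y" m] gA u
   by (auto intro: A_mul simp flip: mul_assoc)
 qed
 have M_K: "g ** x \<in> M m k" if g: "g \<in> Kg (Suc k)" and x: "x \<in> M m k" for g x
 proof (rule M_left[OF _ _ x])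
  have gK: "g \<in> K (Suc k)" using g by (auto simp: Kg_def intro: K_gen)
  show "g ** (u ** y) \<in> M m k" if "u \<in> K (Suc k)" "y \<in> A (Suc m) k" for u y
   using M_prod[of "g ** u" k y m] that gK by (auto intro: K_mul simp flip: mul_assoc)
  fix y assume y: "y \<in> V m k"
  show "g ** y \<in> M m k"
  proof (cases "g = q (Suc k)")
   case False
   hence "\<exists>j. g = s j \<and> 1 \<le> j \<and> j \<le> k \<or> g = q j \<and> 1 \<le> j \<and> j \<le> k"
    using g by (fastforce simp: Kg_def le_Suc_eq)
   then obtain j where "g = s j \<and> 1 \<le> j \<and> j \<le> k \<or> g = q j \<and> 1 \<le> j \<and> j \<le> k" by blast
   thus ?thesis using sV[OF _ _ y] V_left[OF A_gen(3) y] M_V by auto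
  next
   case g: True
   show ?thesis
   proof (cases k)
    case 0
    show ?thesis unfolding g
    proof (rule V_cases[OF y _ subspace_M, of "\<lambda>y. q (Suc k) ** y"])
     fix u h assume u: "u \<in> A (Suc m) k" "h \<in> H (Suc m)"
     obtain v where v: "v \<in> A (Suc m) k" "q (Suc k) ** u = v ** q (Suc k)" using skew_q_A[OF refl u(1)] by auto
     obtain w where w: "w \<in> A (Suc m) k" "q (Suc k) ** ee m k = w ** ee m k" using q_ee[OF mk] by auto
     have "q (Suc k) ** (u ** ee m k ** h) = (q (Suc k) ** u) ** ee m k ** h" by (simp add: mul_assoc)
     also have "... = v ** (q (Suc k) ** ee m k) ** h" by (simp add: v mul_assoc)
     also have "... = (v ** w) ** ee m k ** h" by (simp add: w mul_assoc)
     also have "... \<in> M m k" using u v w by (intro M_V V_base A_mul) auto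
     finally show "q (Suc k) ** (u ** ee m k ** h) \<in> M m k" .
    qed (intro module_hom_mul)
   next
    case (Suc i)
    have ssi: "s (Suc i) ** (si (Suc i) ** y) = y"
     using VI[OF y] mk Suc by simp
    \<comment> \<open>The generator \<open>q (Suc k)\<close> is conjugate to \<open>q k\<close>, and
      each of the three resulting factors preserves \<open>V\<close>.\<close>
    have "q (Suc k) ** y = q (Suc k) ** (s (Suc i) ** (si (Suc i) ** y))" unfolding ssi ..
    also have "... = s k ** (q k ** (si k ** y))" unfolding Suc by (rule q_si(3)) (use mk Suc in auto)
    also have "... \<in> M m k" using y Suc by (intro M_V sV V_left[OF A_gen(3)] siV) auto
    finally show ?thesis unfolding g .
   qed
  qed
 qed
 have M_alg: "g ** x \<in> M m k" if "g \<in> H (Suc m) \<or> g \<in> K (Suc k)" "x \<in> M m k" for g x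
 proof -
  have *: "I ** x = x"
  proof -
   have "prods (K (Suc k)) (A (Suc m) k) \<subseteq> {y. I ** y = y}"
    by (rule prods_least, rule subspaceI) (auto simp: mul_lin unitalD dest: unital_K)
   hence "M m k \<subseteq> {y. I ** y = y}" unfolding M_def
    by (intro span_minimal Un_least) (auto intro: VI subspaceI simp: mul_lin)
   thus ?thesis using that by auto
  qed
  have "H (Suc m) \<subseteq> {g. g ** x \<in> M m k}" unfolding H_def
   by (rule alg_subset, simp_all add: * that(2) mul_assoc M_W, rule subspaceI)
    (auto simp: mul_lin intro: subspace_0 subspace_add subspace_scale)
  moreover have "K (Suc k) \<subseteq> {g. g ** x \<in> M m k}" unfolding K_def
   by (rule alg_subset, simp_all add: * that(2) mul_assoc M_K, rule subspaceI)
    (auto simp: mul_lin intro: subspace_0 subspace_add subspace_scale)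
  ultimately show ?thesis using that by auto
 qed
 obtain h h' where h: "h \<in> H (Suc m)" "h' \<in> H (Suc m)" "\<And>k. e1 k = h ** ee m k ** h'"
  using e1_ee[OF mk(1)] by blast
 have hA: "H (Suc m) \<subseteq> A (Suc m) k" by (rule H_A) simp
 have M_e: "e ** x \<in> M m k" if x: "x \<in> M m k" for x
 proof (rule M_left[OF _ _ x])
  fix y assume y: "y \<in> V m k"
  show "e ** y \<in> M m k"
  proof (cases "k = 0")
   case False
   thus ?thesis using y by (intro M_V V_left e_A) auto
  next
   case True
   show ?thesis
   proof (rule V_cases[OF y _ subspace_M, of "\<lambda>y. e ** y"])
    fix u w assume u: "u \<in> A (Suc m) k" "w \<in> H (Suc m)"
    have "h' ** u \<in> H (Suc m)" using h(2) u(1) True by (auto intro: H_mul)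
    then obtain v where v: "v \<in> H (Suc m)" "ee m 0 ** (h' ** u ** ee m 0) = v ** ee m 0"
     using ee_H_ee0[of m "h' ** u"] mk by auto
    have "e ** (u ** ee m k ** w) = (h ** ee m 0 ** h') ** (u ** ee m k ** w)"
     using h(3)[of 0] by simp
    also have "... = h ** (ee m 0 ** (h' ** u ** ee m 0)) ** w" by (simp add: True mul_assoc)
    also have "... = (h ** v) ** ee m k ** w" unfolding v(2) True by (simp add: mul_assoc)
    also have "... \<in> M m k" using h v u hA by (intro M_V V_base A_mul) auto
    finally show "e ** (u ** ee m k ** w) \<in> M m k" .
   qed (intro module_hom_mul)
  qed
 next
  fix u y assume u: "u \<in> K (Suc k)" and y: "y \<in> A (Suc m) k"
  show "e ** (u ** y) \<in> M m k"
  proof (rule span_case[OF K_coset[OF mk(2) u] _ subspace_M, of "\<lambda>u. e ** (u ** y)"])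
   fix v assume "v \<in> cosets (Suc k) (K k)"
   then obtain j w where j: "1 \<le> j" "j \<le> Suc k" "w \<in> K k"
    and v: "v = cs j (Suc k) ** w \<or> v = q j ** (cs j (Suc k) ** w)" by auto
   have wy: "w ** y \<in> A (Suc m) k" using j y K_A[of k k "Suc m"] by (auto intro: A_mul)
   show "e ** (v ** y) \<in> M m k"
   proof (cases "j = 1")
    case False
    have c: "e ** (cs j (Suc k) ** x) = cs j (Suc k) ** (e ** x)" "e ** (q j ** x) = q j ** (e ** x)" for x
     using commD(2)[OF e_cs_far[of j "Suc k"]] commD(2)[OF e_q[of j]] j False by auto
    have "e ** (v ** y) = cs j (Suc k) ** (e ** (w ** y)) \<or> e ** (v ** y) = (q j ** cs j (Suc k)) ** (e ** (w ** y))"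
     using v by (auto simp: mul_assoc c simp del: cs.simps)
    moreover have P: "e ** (w ** y) \<in> A (Suc m) k" using j False by (intro A_mul[OF e_A wy]) auto
    moreover have "cs j (Suc k) \<in> K (Suc k)" "q j ** cs j (Suc k) \<in> K (Suc k)"
     using j by (intro cs_K K_mul K_gen; simp)+
    ultimately show ?thesis using M_prod[OF _ P] by presburger
   next
    case True
    have *: "e ** (cs 1 (Suc k) ** x) \<in> M m k" if "x \<in> A (Suc m) k" for x
    proof -
     have "e ** (cs 1 (Suc k) ** x) = (e ** cs 1 (Suc k)) ** x" by (simp add: mul_assoc)
     also have "... = cs 1 (Suc k) ** (h ** (ee m k ** (h' ** x)))"
      using e_cs[of k] mk h(3)[of k] by (simp add: mul_assoc del: cs.simps)
     also have "... \<in> M m k"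
     proof -
      have "h' ** x \<in> A (Suc m) k" using h(2) hA that by (auto intro: A_mul)
      hence "h ** (ee m k ** (h' ** x)) \<in> M m k" using X h(1) M_alg by blast
      moreover have "cs 1 (Suc k) \<in> K (Suc k)" by (rule cs_K) simp
      ultimately show ?thesis using M_alg by blast
     qed
     finally show ?thesis .
    qed
    \<comment> \<open>Next to \<open>e\<close> the generator \<open>q 1\<close> becomes
      \<open>W 1\<close>, which commutes with the chain and can be absorbed into
      \<open>x\<close>.\<close>
    have W: "e ** (q 1 ** (cs 1 (Suc k) ** x)) = e ** (cs 1 (Suc k) ** (W 1 ** x))" for x
    proof -
     have "comm (W 1) (cs 1 j)" for j by (induction j) (auto intro: comm_closed comm_sym[OF s_W])
     from commD(2)[OF this, of "Suc k" x] have "cs 1 (Suc k) ** (W 1 ** x) = W 1 ** (cs 1 (Suc k) ** x)" by simp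
     moreover have "e ** (q 1 ** y) = e ** (W 1 ** y)" for y using eW by (simp flip: mul_assoc)
     ultimately show ?thesis by simp
    qed
    have "W 1 ** (w ** y) \<in> A (Suc m) k" by (intro A_mul[OF _ wy] A_gen) auto
    hence "e ** (cs 1 (Suc k) ** (W 1 ** (w ** y))) \<in> M m k" by (rule *)
    thus ?thesis using v *[OF wy] W[of "w ** y"] unfolding True by (auto simp only: mul_assoc)
   qed
  qed (intro module_hom_mul)
 qed
 have "A (Suc m) (Suc k) \<subseteq> M m k" unfolding A_def
 proof (rule alg_subset)
  show "I \<in> M m k" using M_prod[of I k I m] by (auto intro: K_gen A_gen)
  show "g ** x \<in> M m k" if "g \<in> Ag (Suc m) (Suc k)" "x \<in> M m k" for g x
   using that M_W[of g x] M_K[of g x] M_e[of x] by (auto simp: Ag_def)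
 qed simp
 thus ?thesis by (simp add: D1_def M_def)
qed

text \<open>Here the mirrored rule enters. It writes \<open>x\<close> with a left factor from
  \<open>A m k\<close>, which commutes with \<open>ee m k\<close>, or with an arc
  \<open>ee m j\<close>, and \<open>ee_eqs(3)\<close> turns the product of the two arcs into a
  crossing and an arc.\<close>

lemma ee_A_M:
 assumes mk: "m < r" "k < n" and D2: "\<And>j. k = Suc j ==> D2 m j" and x: "x \<in> A (Suc m) k"
 shows "ee m k ** x \<in> M m k"
proof (cases k)
 case 0
 thus ?thesis using V_base[of I m k x] x by (intro M_V) (auto simp: mul_assoc unitalD H_gen)
next
 case (Suc j)
 have "x \<in> span (prods (A m (Suc j)) (H (Suc m)) \<union>
   span {h ** (ee m j ** x) | x h. x \<in> A m (Suc j) \<and> h \<in> K (Suc j)})"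
  using D2[OF Suc] x Suc by (auto simp: D2_def)
 thus ?thesis
 proof (rule span_case[OF _ _ subspace_M])
  show "Modules.module_hom scale scale (\<lambda>x. ee m k ** x)" by (intro module_hom_mul)
  fix y assume "y \<in> prods (A m (Suc j)) (H (Suc m)) \<union> span {h ** (ee m j ** x) | x h. x \<in> A m (Suc j) \<and> h \<in> K (Suc j)}"
  thus "ee m k ** y \<in> M m k"
  proof
   assume "y \<in> prods (A m (Suc j)) (H (Suc m))"
   thus ?thesis unfolding prods_def
   proof (rule span_case[OF _ _ subspace_M, where f = "\<lambda>x. ee m k ** x"], intro module_hom_mul, elim CollectE exE conjE)
    fix t u v assume u: "t = u ** v" "u \<in> A m (Suc j)" "v \<in> H (Suc m)"
    hence "ee m k ** t = u ** ee m k ** v"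
     using commD(2)[OF comm_ee_A[OF mk, of u]] Suc by (simp add: mul_assoc)
    thus "ee m k ** t \<in> M m k" using u A_mono[of m "Suc m" "Suc j" k] Suc by (auto intro!: M_V V_base)
   qed
  next
   assume "y \<in> span {h ** (ee m j ** x) | x h. x \<in> A m (Suc j) \<and> h \<in> K (Suc j)}"
   thus ?thesis
   proof (rule span_case[OF _ _ subspace_M, where f = "\<lambda>x. ee m k ** x"], intro module_hom_mul, elim CollectE exE conjE)
    fix t u v assume u: "t = v ** (ee m j ** u)" "u \<in> A m (Suc j)" "v \<in> K (Suc j)"
    have "comm (ee m k) v" using comm_ee_A[OF mk, of v] K_A[of k k m] u Suc by auto
    hence "ee m k ** t = v ** ((ee m k ** ee m j) ** u)" using u commD(2) by (simp add: mul_assoc)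
    also have "... = (v ** si (Suc j)) ** (ee m j ** u)"
     using ee_eqs(3)[of m j] mk Suc by (simp add: mul_assoc)
    also have "... \<in> M m k"
     using u Suc K_mono[of k "Suc k"] ee_A[of m j] A_mono[of m "Suc m" "Suc j" k]
     by (intro M_prod K_mul K_gen A_mul) auto
    finally show "ee m k ** t \<in> M m k" .
   qed
  qed
 qed
qed

text \<open>Joint induction on \<open>m + k\<close>: \<open>D1 m k\<close> rests on
  \<open>D1 m i\<close> for \<open>i < k\<close> and on \<open>D2 m (k - 1)\<close>, and
  \<open>D2 m k\<close> is the same statement for the mirrored algebra.\<close>

theorem D1_D2: "m < r ==> k < n ==> D1 m k \<and> D2 m k"
proof (induction "m + k" arbitrary: m k rule: less_induct)
 case less
 interpret op: walled scale "\<lambda>x y. y ** x" I s q T W e z b a n r by (rule symmetric)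
 have IH: "D1 i j \<and> D2 i j" if "i + j < m + k" "i \<le> m" "j \<le> k" for i j
  using less that by auto
 have "D1 m k"
 proof (rule D1_step[OF less.prems])
  show "D1 m i" if "i < k" for i using IH[of m i] that by simp
  show "ee m k ** x \<in> M m k" if "x \<in> A (Suc m) k" for x
   by (rule ee_A_M[OF less.prems _ that]) (use IH in simp)
 qed
 moreover have "op.D1 k m"
 proof (rule op.D1_step[OF less.prems(2,1)])
  show "op.D1 k i" if "i < m" for i using IH[of i k] that by (simp add: D1_symmetric)
  show "x ** op.ee k m \<in> op.M k m" if "x \<in> op.A (Suc k) m" for x
   by (rule op.ee_A_M[OF less.prems(2,1) _ that]) (use IH in \<open>simp add: D2_symmetric\<close>)
 qed
 ultimately show ?case by (simp add: D1_symmetric)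
qed

lemma spanned_K_A:
 assumes "k < n" "spanned d (A m k)"
 shows "spanned (2 * Suc k * d) (prods (K (Suc k)) (A m k))"
proof -
 define L where "L = (\<lambda>j v. cs j (Suc k) ** v) ` {1..Suc k} \<union> (\<lambda>j v. q j ** (cs j (Suc k) ** v)) ` {1..Suc k}"
 have "card L \<le> 2 * Suc k"
  unfolding L_def using card_image_le[of "{1..Suc k}" "\<lambda>j v. cs j (Suc k) ** v"]
   card_image_le[of "{1..Suc k}" "\<lambda>j v. q j ** (cs j (Suc k) ** v)"]
  by (intro order_trans[OF card_Un_le]) (simp del: cs.simps)
 moreover have "spanned (card L * d) (prods (K (Suc k)) (A m k))"
 proof (rule spanned_images)
  show "finite L" by (simp add: L_def)
  show "Modules.module_hom scale scale f" if "f \<in> L" for f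
   using that by (auto simp: L_def simp del: cs.simps intro!: module_hom_mul)
  have "x ** y \<in> span (cosets (Suc k) (A m k))"
   if "x \<in> K (Suc k)" "y \<in> A m k" for x y
   by (rule K_subset_coset[OF _ _ _ _ _ _ that]) (use assms in \<open>auto intro: unital_A intro!: A_mul A_gen\<close>)
  moreover have "cosets (Suc k) (A m k)
    = (\<Union>f\<in>L. f ` A m k)" by (auto simp: L_def simp del: cs.simps)
  ultimately show "prods (K (Suc k)) (A m k) \<subseteq> span (\<Union>f\<in>L. f ` A m k)"
   by (intro prods_least) (auto simp del: UN_Un)
 qed (rule assms)
 ultimately show ?thesis unfolding spanned_def by (meson le_trans mult_le_mono1)
qed

text \<open>The factor in \<open>H (Suc m)\<close> is expanded in cosets from the right; its part in
  \<open>H m\<close> commutes with \<open>ee m k\<close> and joins the left factor.\<close>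

lemma spanned_V:
 assumes mk: "m < r" "k < n" and d: "spanned d (A (Suc m) k)"
 shows "spanned (2 * Suc m * d) (V m k)"
proof -
 interpret op: walled scale "\<lambda>x y. y ** x" I s q T W e z b a n r by (rule symmetric)
 let ?c = "\<lambda>j. op.cs j (Suc m)" and ?E = "ee m k"
 define L where "L = (\<lambda>j v. v ** (?E ** ?c j)) ` {1..Suc m} \<union> (\<lambda>j v. v ** (?E ** (?c j ** W j))) ` {1..Suc m}"
 have "card L \<le> 2 * Suc m"
  unfolding L_def using card_image_le[of "{1..Suc m}" "\<lambda>j v. v ** (?E ** ?c j)"]
   card_image_le[of "{1..Suc m}" "\<lambda>j v. v ** (?E ** (?c j ** W j))"]
  by (intro order_trans[OF card_Un_le]) (simp del: op.cs.simps)
 moreover have "spanned (card L * d) (V m k)"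
 proof (rule spanned_images)
  show "finite L" by (simp add: L_def)
  show "Modules.module_hom scale scale f" if "f \<in> L" for f
   using that by (auto simp: L_def simp del: op.cs.simps intro!: module_hom_mul)
  show "V m k \<subseteq> span (\<Union>f\<in>L. f ` A (Suc m) k)"
   unfolding V_def
  proof (intro span_minimal subspace_span subsetI, elim CollectE exE conjE)
   fix t x h assume t: "t = x ** ?E ** h" and x: "x \<in> A (Suc m) k" and h: "h \<in> H (Suc m)"
   have h': "h \<in> span ((\<Union>j\<in>{1..Suc m}. (\<lambda>v. v ** ?c j) ` H m) \<union> (\<Union>j\<in>{1..Suc m}. (\<lambda>v. (v ** ?c j) ** W j) ` H m))"
    using op.K_coset[of m h] mk(1) h by (simp add: symmetric_eqs del: op.cs.simps UN_Un)
   have "x ** ?E ** h \<in> span (\<Union>f\<in>L. f ` A (Suc m) k)"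
   proof (rule span_case[OF h' _ subspace_span, of "\<lambda>h. x ** ?E ** h"])
    fix y assume "y \<in> (\<Union>j\<in>{1..Suc m}. (\<lambda>v. v ** ?c j) ` H m) \<union> (\<Union>j\<in>{1..Suc m}. (\<lambda>v. (v ** ?c j) ** W j) ` H m)"
    then obtain j v where j: "j \<in> {1..Suc m}" "v \<in> H m" and y: "y = v ** ?c j \<or> y = (v ** ?c j) ** W j" by blast
    have "?E ** (v ** w) = v ** (?E ** w)" for w
     using commD(2)[OF comm_ee_A[OF mk, of v]] j(2) H_A[of m m k] by auto
    hence "x ** ?E ** y = (\<lambda>u. u ** (?E ** ?c j)) (x ** v) \<or> x ** ?E ** y = (\<lambda>u. u ** (?E ** (?c j ** W j))) (x ** v)"
     using y by (auto simp: mul_assoc simp del: op.cs.simps)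
    moreover have "x ** v \<in> A (Suc m) k" using x j H_A[of m "Suc m" k] by (auto intro: A_mul)
    moreover have "(\<lambda>u. u ** (?E ** ?c j)) \<in> L" "(\<lambda>u. u ** (?E ** (?c j ** W j))) \<in> L"
     using j unfolding L_def by blast+
    ultimately show "x ** ?E ** y \<in> span (\<Union>f\<in>L. f ` A (Suc m) k)"
     by (intro span_base) blast
   qed (intro module_hom_mul)
   thus "t \<in> span (\<Union>f\<in>L. f ` A (Suc m) k)" by (simp add: t)
  qed
 qed (rule d)
 ultimately show ?thesis unfolding spanned_def by (meson le_trans mult_le_mono1)
qed

lemma spanned_K_0:
 assumes "k \<le> n" shows "spanned (2 ^ k * fact k) (A 0 k)"
 using assms
proof (induction k)
 case 0
 have "A 0 0 \<subseteq> span {I}" unfolding A_def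
  by (rule alg_subset) (auto simp: Ag_def Hg_def Kg_def intro: span_base)
 thus ?case unfolding spanned_def by (intro exI[of _ "{I}"]) auto
next
 case (Suc k)
 hence "spanned (2 * Suc k * (2 ^ k * fact k)) (prods (K (Suc k)) (A 0 k))" by (intro spanned_K_A) auto
 moreover have "A 0 (Suc k) \<subseteq> prods (K (Suc k)) (A 0 k)"
 proof
  fix x assume "x \<in> A 0 (Suc k)"
  hence "x ** I \<in> prods (K (Suc k)) (A 0 k)" by (intro prodsI) (auto intro: K_gen)
  thus "x \<in> prods (K (Suc k)) (A 0 k)" using unital_A[OF \<open>x \<in> A 0 (Suc k)\<close>] by (simp add: unitalD)
 qed
 ultimately show ?case by (auto intro: spanned_subset simp: algebra_simps)
qed

lemma spanned_A:
 assumes "m \<le> r" "k \<le> n" shows "spanned (2 ^ (m + k) * fact (m + k)) (A m k)"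
 using assms
proof (induction k)
 case 0
 interpret op: walled scale "\<lambda>x y. y ** x" I s q T W e z b a n r by (rule symmetric)
 have "op.spanned d U = spanned d U" for d U by (simp add: op.spanned_def spanned_def)
 thus ?case using op.spanned_K_0[OF 0(1)] by (simp add: symmetric_eqs)
next
 case (Suc k)
 show ?case
 proof (cases m)
  case 0
  thus ?thesis using spanned_K_0[of "Suc k"] Suc by simp
 next
  case (Suc i)
  let ?d = "2 ^ (m + k) * fact (m + k) :: nat"
  have d: "spanned ?d (A (Suc i) k)" using Suc.IH Suc.prems Suc by simp
  have mk: "i < r" "k < n" using Suc.prems Suc by auto
  have "spanned (2 * Suc k * ?d + 2 * Suc i * ?d) (span (prods (K (Suc k)) (A (Suc i) k) \<union> V i k))"
   by (intro spanned_union spanned_K_A spanned_V d mk)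
  moreover have "2 * Suc k * ?d + 2 * Suc i * ?d = 2 ^ (m + Suc k) * fact (m + Suc k)"
   using Suc by (simp add: algebra_simps)
  ultimately show ?thesis
   using D1_D2[OF mk] spanned_subset Suc by (auto simp: D1_def)
 qed
qed

end

text \<open>
 All the algebras \<open>BC z r s\<close> are assembled into one type, with zero outside of one component,
 so that the results above, which are about a type, apply to each of them.
\<close>

typedef (overloaded) 'k BC_family =
 "{f :: 'k::comm_ring_1 => nat => nat => 'k BC_term set. \<forall>z r s. f z r s \<in> carrier (BC z r s)}"
proof -
 have "\<zero>\<^bsub>BC z r s\<^esub> \<in> carrier (BC z r s)" for z :: 'k and r s
  using superalgebra_BC[of z r s] by (simp add: superalgebra_def ring.ring_simprules)
 thus ?thesis by (intro exI[of _ "\<lambda>z r s. \<zero>\<^bsub>BC z r s\<^esub>"]) simp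
qed

setup_lifting type_definition_BC_family

lemma ring_BC: "ring (BC z r s)"
 using superalgebra_BC[of z r s] by (simp add: superalgebra_def)

lemmas BC_ring = ring.ring_simprules[OF ring_BC]
lemmas BC_closed [simp] = BC_ring(1-6)

instantiation BC_family :: (comm_ring_1) ab_group_add
begin

lift_definition zero_BC_family :: "'a BC_family" is "\<lambda>z r s. \<zero>\<^bsub>BC z r s\<^esub>"
 by simp
lift_definition plus_BC_family :: "'a BC_family => 'a BC_family => 'a BC_family"
 is "\<lambda>f g z r s. f z r s \<oplus>\<^bsub>BC z r s\<^esub> g z r s"
 by simp
lift_definition uminus_BC_family :: "'a BC_family => 'a BC_family" is "\<lambda>f z r s. \<ominus>\<^bsub>BC z r s\<^esub> f z r s"
 by simp
definition minus_BC_family :: "'a BC_family => 'a BC_family => 'a BC_family" where "minus_BC_family x y = x + - y"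

instance
proof
 fix a b c :: "'a BC_family"
 show "a + b + c = a + (b + c)" by transfer (simp add: fun_eq_iff BC_ring(7))
 show "a + b = b + a" by transfer (simp add: fun_eq_iff BC_ring(10))
 show "0 + a = a" by transfer (simp add: fun_eq_iff BC_ring(8))
 show "- a + a = 0" by transfer (simp add: fun_eq_iff BC_ring(9))
qed (simp add: minus_BC_family_def)

end

lemma module_BC: "Module.module (ground_superalgebra :: ('k::comm_ring_1, 'k) superalg) (BC z r s)"
 using superalgebra_BC[of z r s] by (simp add: superalgebra_def)

lemma carrier_ground: "carrier (ground_superalgebra :: ('k::comm_ring_1, 'k) superalg) = UNIV"
 "x \<oplus>\<^bsub>ground_superalgebra :: ('k::comm_ring_1, 'k) superalg\<^esub> y = x + y"
 "x \<otimes>\<^bsub>ground_superalgebra :: ('k::comm_ring_1, 'k) superalg\<^esub> y = x * y"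
 "\<one>\<^bsub>ground_superalgebra :: ('k::comm_ring_1, 'k) superalg\<^esub> = 1"
 by (simp_all add: ground_superalgebra_def)

lemma BC_smult [simp]: "x \<in> carrier (BC z r s) ==> c \<odot>\<^bsub>BC z r s\<^esub> x \<in> carrier (BC z r s)"
 using Module.module.smult_closed[OF module_BC] by (simp add: carrier_ground)

lemma BC_module:
 assumes "x \<in> carrier (BC z r s)"
 shows "(a + b) \<odot>\<^bsub>BC z r s\<^esub> x = a \<odot>\<^bsub>BC z r s\<^esub> x \<oplus>\<^bsub>BC z r s\<^esub> b \<odot>\<^bsub>BC z r s\<^esub> x"
  "(a * b) \<odot>\<^bsub>BC z r s\<^esub> x = a \<odot>\<^bsub>BC z r s\<^esub> (b \<odot>\<^bsub>BC z r s\<^esub> x)"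
  "1 \<odot>\<^bsub>BC z r s\<^esub> x = x"
 using Module.module.smult_l_distr[OF module_BC, of a b x z r s] Module.module.smult_assoc1[OF module_BC, of a b x z r s]
  Module.module.smult_one[OF module_BC, of x z r s] assms
 by (simp_all add: carrier_ground)

lemma BC_smult_mult:
 assumes "x \<in> carrier (BC z r s)" "y \<in> carrier (BC z r s)"
 shows "(c \<odot>\<^bsub>BC z r s\<^esub> x) \<otimes>\<^bsub>BC z r s\<^esub> y = c \<odot>\<^bsub>BC z r s\<^esub> (x \<otimes>\<^bsub>BC z r s\<^esub> y)"
  "x \<otimes>\<^bsub>BC z r s\<^esub> (c \<odot>\<^bsub>BC z r s\<^esub> y) = c \<odot>\<^bsub>BC z r s\<^esub> (x \<otimes>\<^bsub>BC z r s\<^esub> y)"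
 using superalgebra_BC[of z r s] assms unfolding superalgebra_def by simp_all

lift_definition BC_mul :: "'k::comm_ring_1 BC_family => 'k BC_family => 'k BC_family"
 is "\<lambda>f g z r s. f z r s \<otimes>\<^bsub>BC z r s\<^esub> g z r s"
 by simp

lift_definition BC_scale :: "'k::comm_ring_1 => 'k BC_family => 'k BC_family"
 is "\<lambda>c f z r s. c \<odot>\<^bsub>BC z r s\<^esub> f z r s"
 by simp

interpretation BCf: Modules.module "BC_scale :: 'k::comm_ring_1 => 'k BC_family => 'k BC_family"
proof
 fix a b :: 'k and x y :: "'k BC_family"
 note m = module_BC
 show "BC_scale a (x + y) = BC_scale a x + BC_scale a y"
  by transfer (simp add: fun_eq_iff Module.module.smult_r_distr[OF m] carrier_ground)
 show "BC_scale (a + b) x = BC_scale a x + BC_scale b x"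
  by transfer (simp add: fun_eq_iff BC_module)
 show "BC_scale a (BC_scale b x) = BC_scale (a * b) x"
  by transfer (simp add: fun_eq_iff BC_module)
 show "BC_scale 1 x = x"
  by transfer (simp add: fun_eq_iff BC_module)
qed

section \<open>Terms as elements of the common type\<close>

context
 fixes z :: "'k::comm_ring_1" and r s :: nat
begin

interpretation gc: graded_congruence "aterms (BC_gens r s)" "{(t, u). acong (BC_gens r s) (BC_rel z r) t u}"
 AAdd AZero AScale AMult AOne "\<lambda>p. {t \<in> aterms (BC_gens r s). ahomog BC_par p t}"
 by (rule graded_congruence_acong) (rule BC_rel_homog)

lemma gc_A: "gc.A = BC z r s"
 by (simp add: gc.A_def BC_def presented_superalgebra_def)

text \<open>A term with a generator outside the range is sent to zero, in accordance with the
  convention of \<open>walled\<close> for generators that do not exist.\<close>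

definition em :: "'k BC_term => 'k BC_family" where
 "em t = Abs_BC_family (\<lambda>z' r' s'. if (z', r', s') = (z, r, s) \<and> t \<in> aterms (BC_gens r s) then gc.cl t else \<zero>\<^bsub>BC z' r' s'\<^esub>)"

lemma Rep_em: "Rep_BC_family (em t) z' r' s' =
  (if (z', r', s') = (z, r, s) \<and> t \<in> aterms (BC_gens r s) then gc.cl t else \<zero>\<^bsub>BC z' r' s'\<^esub>)"
proof -
 have "gc.cl t \<in> carrier (BC z r s)" if "t \<in> aterms (BC_gens r s)"
  using that gc.carrier_A by (auto simp: gc_A)
 thus ?thesis unfolding em_def by (subst Abs_BC_family_inverse) auto
qed

lemma em_eqI: "(\<And>z r s. Rep_BC_family x z r s = Rep_BC_family y z r s) ==> x = y"
 by (simp add: Rep_BC_family_inject[symmetric] fun_eq_iff)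

lemma em_out: "t \<notin> aterms (BC_gens r s) ==> em t = 0"
 by (rule em_eqI) (simp add: Rep_em zero_BC_family.rep_eq)

lemma em_simps:
 assumes "t \<in> aterms (BC_gens r s)" "u \<in> aterms (BC_gens r s)"
 shows "em (AAdd t u) = em t + em u" "em (t \<bullet> u) = BC_mul (em t) (em u)"
proof -
 show "em (AAdd t u) = em t + em u"
  using gc.add_A[of t u] assms by (intro em_eqI) (simp add: Rep_em plus_BC_family.rep_eq gc_A BC_ring(8))
 show "em (t \<bullet> u) = BC_mul (em t) (em u)"
  using gc.mult_A[of t u] assms
  by (intro em_eqI) (simp add: Rep_em BC_mul.rep_eq gc_A ring.ring_simprules(24)[OF ring_BC])
qed

lemma em_zero: "em AZero = 0" and em_scale: "t \<in> aterms (BC_gens r s) ==> em (AScale c t) = BC_scale c (em t)"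
proof -
 show "em AZero = 0" using gc.zero_A by (intro em_eqI) (simp add: Rep_em zero_BC_family.rep_eq gc_A)
 show "t \<in> aterms (BC_gens r s) ==> em (AScale c t) = BC_scale c (em t)"
  using gc.smult_A[of t c]
  by (intro em_eqI) (simp add: Rep_em BC_scale.rep_eq gc_A carrier_ground Module.module.smult_r_null[OF module_BC])
qed

lemma em_eq_iff:
 assumes "t \<in> aterms (BC_gens r s)" "u \<in> aterms (BC_gens r s)"
 shows "em t = em u \<longleftrightarrow> acong (BC_gens r s) (BC_rel z r) t u"
proof -
 have "em t = em u \<longleftrightarrow> gc.cl t = gc.cl u"
 proof
  assume "em t = em u"
  hence "Rep_BC_family (em t) z r s = Rep_BC_family (em u) z r s" by simp
  thus "gc.cl t = gc.cl u" using assms by (simp add: Rep_em)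
 next
  assume "gc.cl t = gc.cl u"
  thus "em t = em u" by (intro em_eqI) (simp add: Rep_em assms)
 qed
 thus ?thesis using gc.cl_eq_iff assms by simp
qed

lemma em_rel:
 assumes "BC_rel z r t u" "t \<in> aterms (BC_gens r s)" "u \<in> aterms (BC_gens r s)"
 shows "em t = em u"
 using acong_rel[of "BC_rel z r", OF assms] em_eq_iff assms by simp

lemma corner_algebra_BC: "corner_algebra BC_scale BC_mul (em AOne)"
proof unfold_locales
 fix x y w :: "'k BC_family" and c :: 'k
 show "BC_mul (x + y) w = BC_mul x w + BC_mul y w"
  by transfer (simp add: fun_eq_iff ring.ring_simprules(13)[OF ring_BC])
 show "BC_mul w (x + y) = BC_mul w x + BC_mul w y"
  by transfer (simp add: fun_eq_iff ring.ring_simprules(23)[OF ring_BC])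
 show "BC_mul (BC_scale c x) w = BC_scale c (BC_mul x w)" "BC_mul w (BC_scale c x) = BC_scale c (BC_mul w x)"
  by (transfer; simp add: fun_eq_iff BC_smult_mult)+
 show "BC_mul (BC_mul x y) w = BC_mul x (BC_mul y w)"
  by transfer (simp add: fun_eq_iff ring.ring_simprules(11)[OF ring_BC])
 have "acong (BC_gens r s) (BC_rel z r) (AOne \<bullet> AOne) AOne" by (rule acong_mult_one_left) simp
 thus "BC_mul (em AOne) (em AOne) = em AOne"
  using em_simps(2)[of AOne AOne] em_eq_iff[of "AOne \<bullet> AOne" AOne] by simp
qed

interpretation corner_algebra BC_scale BC_mul "em AOne"
 by (rule corner_algebra_BC)

lemma em_unital: "unital (em t)"
proof (cases "t \<in> aterms (BC_gens r s)")
 case True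
 have "em (AOne \<bullet> t) = em t" "em (t \<bullet> AOne) = em t"
  using True by (auto simp: em_eq_iff intro: acong_mult_one_left acong_mult_one_right)
 thus ?thesis using em_simps(2) True by (simp add: unital_def)
qed (simp add: em_out)

lemma em_corner: "\<exists>t\<in>aterms (BC_gens r s). BC_mul (em AOne) x = em t"
proof -
 have "Rep_BC_family x z r s \<in> carrier (BC z r s)" using Rep_BC_family[of x] by simp
 then obtain t where t: "t \<in> aterms (BC_gens r s)" "Rep_BC_family x z r s = gc.cl t"
  using gc.carrier_A by (auto simp: gc_A)
 have "gc.cl AOne \<otimes>\<^bsub>BC z r s\<^esub> gc.cl t = gc.cl t"
  using t gc.one_A \<open>Rep_BC_family x z r s \<in> _\<close> ring.ring_simprules(12)[OF ring_BC, of "gc.cl t" z r s] by (simp add: gc_A)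
 moreover have "Rep_BC_family x z' r' s' \<in> carrier (BC z' r' s')" for z' r' s' using Rep_BC_family[of x] by simp
 ultimately have "BC_mul (em AOne) x = em t"
  using t by (intro em_eqI) (simp add: BC_mul.rep_eq Rep_em ring.ring_simprules(24)[OF ring_BC])
 thus ?thesis using t by blast
qed

end

lemma BC_gens_iff:
 "GT i \<in> BC_gens r s \<longleftrightarrow> 1 \<le> i \<and> i < r" "GTs i \<in> BC_gens r s \<longleftrightarrow> 1 \<le> i \<and> i < s"
 "GPi i \<in> BC_gens r s \<longleftrightarrow> 1 \<le> i \<and> i \<le> r" "GPis i \<in> BC_gens r s \<longleftrightarrow> 1 \<le> i \<and> i \<le> s"
 "GE \<in> BC_gens r s \<longleftrightarrow> 0 < r \<and> 0 < s"
 by (auto simp: BC_gens_def)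

context
 fixes z :: "'k::comm_ring_1" and r n :: nat
begin

interpretation corner_algebra BC_scale BC_mul "em z r n AOne"
 by (rule corner_algebra_BC)

abbreviation (input) EM where "EM \<equiv> em z r n"
abbreviation (input) TG :: "'k BC_term set" where "TG \<equiv> aterms (BC_gens r n)"
abbreviation BC_mult (infixl \<open>**\<close> 80) where "x ** y \<equiv> BC_mul x y"

text \<open>If a generator on one side is missing, so is one on the other, and both products vanish.
  Relations thus hold without index ranges.\<close>

lemma em_rel2:
 assumes "BC_rel z r (x \<bullet> y) (x' \<bullet> y')" "x \<in> TG \<and> y \<in> TG \<longleftrightarrow> x' \<in> TG \<and> y' \<in> TG"
 shows "EM x ** EM y = EM x' ** EM y'"
proof (cases "x \<in> TG \<and> y \<in> TG")
 case True
 thus ?thesis using em_rel[OF assms(1), of n] assms(2) by (auto simp: em_simps)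
next
 case False
 thus ?thesis using assms(2) em_out[of _ r n z] by (metis mul_zero)
qed

lemma em_comm: "BC_rel z r (x \<bullet> y) (y \<bullet> x) ==> comm (EM x) (EM y)"
 unfolding comm_def by (rule em_rel2) auto

lemma em_anti:
 assumes "BC_rel z r (x \<bullet> y) (AScale (- 1) (y \<bullet> x))"
 shows "EM x ** EM y = - (EM y ** EM x)"
proof (cases "x \<in> TG \<and> y \<in> TG")
 case True
 thus ?thesis using em_rel[OF assms(1), of n] by (auto simp: em_scale em_simps)
next
 case False
 thus ?thesis using em_out[of _ r n z] by (metis mul_zero minus_zero)
qed

lemma em_rel3:
 assumes "BC_rel z r (x \<bullet> y \<bullet> w) (x' \<bullet> y' \<bullet> w')"
  "x \<in> TG \<and> y \<in> TG \<and> w \<in> TG \<longleftrightarrow> x' \<in> TG \<and> y' \<in> TG \<and> w' \<in> TG"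
 shows "EM x ** EM y ** EM w = EM x' ** EM y' ** EM w'"
proof (cases "x \<in> TG \<and> y \<in> TG \<and> w \<in> TG")
 case True
 thus ?thesis using em_rel[OF assms(1), of n] assms(2) by (auto simp: mul_assoc em_simps)
next
 case False
 thus ?thesis using assms(2) em_out[of _ r n z] by (metis mul_zero)
qed

text \<open>The two relations on the double cup-cap element follow from the single one by multiplying it with \<open>e t\<close>.\<close>

lemma em_YY:
 assumes r: "1 < r" "1 < n"
 defines "Y \<equiv> EM \<e> ** EM (bc_tinv z (r - 1)) ** EM (\<t>\<^sup>* 1) ** EM \<e>"
 shows "EM (\<t> (r - 1)) ** Y = EM (\<t>\<^sup>* 1) ** Y" "Y ** EM (\<t> (r - 1)) = Y ** EM (\<t>\<^sup>* 1)"
proof -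
 note rl = BC_rel.intros[where z = z and r = r]
 let ?e = "EM \<e>" and ?T = "EM (\<t> (r - 1))" and ?U = "EM (bc_tinv z (r - 1))" and ?s = "EM (\<t>\<^sup>* 1)" and ?I = "EM AOne"
 have G: "\<t> (r - 1) \<in> TG" "\<t>\<^sup>* 1 \<in> TG" "\<e> \<in> TG" "bc_tinv z (r - 1) \<in> TG" using r by (auto simp: BC_gens_iff)
 have u: "unital ?e" "unital ?T" "unital ?U" "unital ?s" by (rule em_unital)+
 have U: "?U = ?T - BC_scale z ?I"
  using G by (simp add: em_simps em_scale)
 have TT: "?T ** ?T = BC_scale z ?T + ?I"
  using em_rel[OF rl(1), of "r - 1" n] G by (simp add: em_simps em_scale)
 have TU: "?T ** ?U = ?I" "?U ** ?T = ?I" unfolding U using TT u by (simp_all add: mul_lin unitalD)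
 have Ts: "comm ?T ?s" by (rule em_comm, rule rl(7))
 have Us: "?U ** ?s = ?s ** ?U" unfolding U using Ts u by (simp add: mul_lin unitalD comm_def)
 have Usw: "?U ** (?s ** w) = ?s ** (?U ** w)" for w using Us by (simp flip: mul_assoc)
 have ee: "?e ** ?e = 0" using em_rel[OF rl(19), of n] G by (simp add: em_simps em_zero)
 have eTe: "?e ** ?T ** ?e = ?e" using em_rel[OF rl(20), of n] G by (simp add: em_simps mul_assoc)
 have ese: "?e ** ?s ** ?e = ?e" using em_rel[OF rl(22), of n] G by (simp add: em_simps mul_assoc)
 have rel: "Y ** (?U ** ?s) = (?U ** ?s) ** Y"
  using em_rel[OF rl(28), of n] G Us
  by (simp add: em_simps(2) Y_def mul_assoc Us[symmetric, simplified] Usw[symmetric, simplified])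
 have eTY: "?e ** ?T ** Y = Y" "?e ** ?s ** Y = Y"
  unfolding Y_def using eTe ese by (simp_all flip: mul_assoc)
 have uY: "unital Y" unfolding Y_def using u by simp
 have "?e ** ?T ** ((?U ** ?s) ** Y) = ?e ** ((?T ** ?U) ** (?s ** Y))" by (simp add: mul_assoc)
 also have "... = Y" using TU u eTY(2) by (simp add: unitalD mul_assoc)
 finally have "Y = ?e ** ?T ** (Y ** (?U ** ?s))" unfolding rel by (rule sym)
 also have "... = Y ** (?U ** ?s)" using eTY(1) by (simp flip: mul_assoc)
 finally have 1: "Y = Y ** (?U ** ?s)" .
 hence 2: "Y = (?U ** ?s) ** Y" using rel by simp
 have "?T ** Y = (?T ** ?U) ** (?s ** Y)" by (subst 2) (simp add: mul_assoc)
 thus "?T ** Y = ?s ** Y" using TU u by (simp add: unitalD)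
 have "Y ** ?T = Y ** (?s ** (?U ** ?T))" by (subst 1) (simp only: mul_assoc Usw)
 thus "Y ** ?T = Y ** ?s" using TU u by (simp add: unitalD)
qed

abbreviation (input) "bt i \<equiv> EM (\<t> (r - i))"
abbreviation (input) "bp i \<equiv> EM (\<pp> (r + 1 - i))"
abbreviation (input) "bs i \<equiv> EM (\<t>\<^sup>* i)"
abbreviation (input) "bq i \<equiv> EM (\<pp>\<^sup>* i)"
abbreviation (input) "bE \<equiv> EM \<e>"

lemma walled_BC:
 "walled BC_scale BC_mul (EM AOne) bt bp bs
   bq bE z (- 1) 1 r n"
proof
 fix i j :: nat
 note G = BC_gens_iff
 note rl = BC_rel.intros[where z = z and r = r]
 have out: "EM (AGen g) = 0" if "g \<notin> BC_gens r n" for g using that by (simp add: em_out)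
 show "unital (bt i)" "unital (bp i)" "unital (bs i)" "unital (bq i)" "unital bE"
  by (rule em_unital)+
 show "bt i ** bt i = BC_scale z (bt i) + EM AOne" if "1 \<le> i" "i < r"
  using em_rel[OF rl(1), of "r - i" n] that by (simp add: em_simps em_scale G)
 show "bs i ** bs i = BC_scale z (bs i) + EM AOne" if "1 \<le> i" "i < n"
  using em_rel[OF rl(2), of i n] that by (simp add: em_simps em_scale G)
 show "bt i ** bt (Suc i) ** bt i = bt (Suc i) ** bt i ** bt (Suc i)"
 proof (cases "Suc i < r")
  case True
  hence "r - i = r - Suc i + 1" by simp
  thus ?thesis by (simp only:) (rule em_rel3[OF rl(3), symmetric]; blast)
 qed (auto simp: out G Suc_le_eq)
 show "bs i ** bs (Suc i) ** bs i = bs (Suc i) ** bs i ** bs (Suc i)"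
  using em_rel3[OF rl(4), of i] by auto
 show "comm (bt i) (bt j)" if "Suc i < j"
 proof (cases "j < r")
  case True
  thus ?thesis using that by (intro em_comm rl(5)) auto
 qed (auto simp: out G comm_def Suc_le_eq)
 show "comm (bs i) (bs j)" if "Suc i < j"
  using that by (intro em_comm rl(6)) auto
 show "comm (bt i) (bs j)" by (intro em_comm rl(7))
 show "bp i ** bp i = BC_scale (- 1) (EM AOne)" if "1 \<le> i" "i \<le> r"
 proof -
  define k where "k = r + 1 - i"
  have "1 \<le> k" "k \<le> r" using that by (auto simp: k_def)
  thus ?thesis using em_rel[OF rl(8), of k n] by (simp add: em_simps em_scale G k_def)
 qed
 show "bq i ** bq i = BC_scale 1 (EM AOne)" if "1 \<le> i" "i \<le> n"
  using em_rel[OF rl(10), of i n] that by (simp add: em_simps em_scale G)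
 show "bp i ** bp j = - (bp j ** bp i)" if "i \<noteq> j"
 proof (cases "i \<le> r \<and> j \<le> r")
  case True
  thus ?thesis using that by (intro em_anti rl(9)) auto
 qed (auto simp: out G Suc_le_eq)
 show "bq i ** bq j = - (bq j ** bq i)" if "i \<noteq> j"
  using that by (intro em_anti rl(11))
 show "bp i ** bq j = - (bq j ** bp i)"
  by (intro em_anti rl(12))
 show "bt i ** bp (Suc i) = bp i ** bt i"
 proof (cases "1 \<le> i \<and> i < r")
  case True
  hence "r + 1 - i = r - i + 1" "r + 1 - Suc i = r - i" by auto
  thus ?thesis using True by (simp only:) (rule em_rel2[OF rl(13)]; auto simp: G)
 qed (auto simp: out G Suc_le_eq)
 show "bs i ** bq i = bq (Suc i) ** bs i"
  unfolding Suc_eq_plus1 by (rule em_rel2[OF rl(14)]) (auto simp: G)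
 show "comm (bt i) (bp j)" if "j \<noteq> i" "j \<noteq> Suc i"
 proof (cases "1 \<le> i \<and> i < r \<and> 1 \<le> j \<and> j \<le> r")
  case True
  thus ?thesis using that by (intro em_comm rl(15)) auto
 qed (auto simp: out G comm_def Suc_le_eq)
 show "comm (bs i) (bq j)" if "j \<noteq> i" "j \<noteq> Suc i"
  using that by (intro em_comm rl(16)) auto
 show "comm (bt i) (bq j)" by (intro em_comm rl(17))
 show "comm (bs i) (bp j)" by (intro em_comm rl(18))
 show "bE ** bE = 0"
  using em_rel[OF rl(19), of n] by (cases "\<e> \<in> TG") (auto simp: em_simps em_zero out)
 have e0: "bE = 0" if "\<e> \<notin> TG" using that by (rule em_out)
 show "bE ** bt 1 ** bE = bE" if "1 < r"
  using em_rel[OF rl(20), of n] that e0 by (cases "\<e> \<in> TG") (auto simp: em_simps G mul_assoc)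
 show "bE ** bs 1 ** bE = bE" if "1 < n"
  using em_rel[OF rl(22), of n] that e0 by (cases "\<e> \<in> TG") (auto simp: em_simps G mul_assoc)
 show "comm bE (bt i)" if "1 < i"
 proof (cases "i < r")
  case True
  thus ?thesis using that by (intro em_comm rl(21)) auto
 qed (auto simp: out G comm_def Suc_le_eq)
 show "comm bE (bs i)" if "1 < i"
  using that by (intro em_comm rl(23)) auto
 show "comm bE (bp i)" if "1 < i"
 proof (cases "i \<le> r")
  case True
  thus ?thesis using that by (intro comm_sym[OF em_comm] rl(26)) auto
 qed (auto simp: out G comm_def Suc_le_eq)
 show "comm bE (bq i)" if "1 < i"
  using that by (intro comm_sym[OF em_comm] rl(27)) auto
 show "bp 1 ** bE = bq 1 ** bE"
  unfolding add_diff_cancel_right' by (rule em_rel2[OF rl(24)]) (auto simp: G)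
 show "bE ** bp 1 = bE ** bq 1"
  unfolding add_diff_cancel_right' by (rule em_rel2[OF rl(25)]) (auto simp: G)
 show "bE ** bp 1 ** bE = 0"
  using em_rel[OF rl(29), of n] by (cases "\<e> \<in> TG") (auto simp: em_simps em_zero out G mul_assoc)
 assume r: "1 < r" "1 < n"
 have U: "bt 1 - BC_scale z (EM AOne) = EM (bc_tinv z (r - 1))"
  using r by (simp add: em_simps em_scale G)
 show "bt 1 ** (bE ** (bt 1 - BC_scale z (EM AOne)) ** bs 1 ** bE) =
   bs 1 ** (bE ** (bt 1 - BC_scale z (EM AOne)) ** bs 1 ** bE)"
  "bE ** (bt 1 - BC_scale z (EM AOne)) ** bs 1 ** bE ** bt 1 =
   bE ** (bt 1 - BC_scale z (EM AOne)) ** bs 1 ** bE ** bs 1"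
  unfolding U by (rule em_YY[OF r])+
qed

text \<open>The spanning set supplied by \<open>spanned_A\<close> may have parts in other
  components. Multiplication by the unit \<open>EM AOne\<close> removes them, and by
  \<open>em_corner\<close> the results come from terms over the generators.\<close>

theorem BC_spanned:
 "\<exists>ts. length ts \<le> 2 ^ (r + n) * fact (r + n) \<and> set ts \<subseteq> TG \<and>
   (\<forall>t\<in>TG. \<exists>c. EM t = (\<Sum>i<length ts. BC_scale (c i) (EM (ts ! i))))"
proof -
 interpret w: walled BC_scale BC_mul "EM AOne" "\<lambda>i. EM (\<t> (r - i))" "\<lambda>i. EM (\<pp> (Suc r - i))" "\<lambda>i. EM (\<t>\<^sup>* i)"
  "\<lambda>i. EM (\<pp>\<^sup>* i)" "EM \<e>" z "- 1" 1 r n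
  using walled_BC by simp
 have em_A: "EM t \<in> w.A r n" if "t \<in> TG" for t
  using that
 proof (induction t)
  case (AGen g)
  have "EM (AGen g) \<in> w.Ag r n"
  proof (cases g)
   case (GT i)
   hence "EM (AGen g) = EM (\<t> (r - (r - i)))" "r - i \<in> {1..<r}" using AGen by (auto simp: BC_gens_iff)
   thus ?thesis unfolding w.Ag_def w.Hg_def by blast
  next
   case (GPi i)
   hence "EM (AGen g) = EM (\<pp> (Suc r - (Suc r - i)))" "Suc r - i \<in> {1..r}" using AGen by (auto simp: BC_gens_iff)
   thus ?thesis unfolding w.Ag_def w.Hg_def by blast
  next
   case (GTs i)
   hence "i \<in> {1..<n}" using AGen by (auto simp: BC_gens_iff)
   thus ?thesis unfolding w.Ag_def w.Kg_def GTs by blast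
  next
   case (GPis i)
   hence "i \<in> {1..n}" using AGen by (auto simp: BC_gens_iff)
   thus ?thesis unfolding w.Ag_def w.Kg_def GPis by blast
  next
   case GE
   hence "1 \<le> r \<and> 1 \<le> n" using AGen by (auto simp: BC_gens_iff)
   thus ?thesis unfolding w.Ag_def GE by simp
  qed
  thus ?case unfolding w.A_def by (intro alg_base em_unital)
 next
  case AOne show ?case by (simp add: w.A_def alg.alg_I)
 next
  case AZero show ?case by (simp add: em_zero w.A_def alg.alg_0)
 next
  case (AAdd t u) thus ?case by (simp add: em_simps w.A_closed)
 next
  case (AScale c t) thus ?case by (simp add: em_scale w.A_closed)
 next
  case (AMult t u) thus ?case by (simp add: em_simps w.A_mul)
 qed
 obtain B where B: "finite B" "card B \<le> 2 ^ (r + n) * fact (r + n)" "w.A r n \<subseteq> BCf.span B"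
  using w.spanned_A[of r n] by (auto simp: spanned_def)
 obtain bs where bs: "set bs = B" "distinct bs" using finite_distinct_list[OF B(1)] by auto
 have "\<exists>t\<in>TG. EM AOne ** x = EM t" for x by (rule em_corner)
 then obtain f where f: "\<And>x. f x \<in> TG" "\<And>x. EM AOne ** x = EM (f x)" by metis
 show ?thesis
 proof (intro exI[of _ "map f bs"] conjI ballI)
  show "length (map f bs) \<le> 2 ^ (r + n) * fact (r + n)" using B(2) bs distinct_card[OF bs(2)] by simp
  show "set (map f bs) \<subseteq> TG" using f by auto
  fix t assume "t \<in> TG"
  hence "EM t \<in> BCf.span B" using em_A B(3) by auto
  then obtain c where c: "EM t = (\<Sum>b\<in>B. BC_scale (c b) b)" using B(1) by (auto simp: BCf.span_finite)
  have hom: "EM AOne ** (\<Sum>b\<in>B. BC_scale (c b) b) = (\<Sum>b\<in>B. BC_scale (c b) (EM AOne ** b))"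
   using B(1) by (induction B rule: finite_induct) (simp_all add: mul_lin)
  have "EM t = EM AOne ** EM t" using em_unital[of z r n t] by (simp add: unitalD)
  also have "... = (\<Sum>b\<in>B. BC_scale (c b) (EM (f b)))" unfolding c hom by (simp only: f(2))
  also have "... = (\<Sum>i<length bs. BC_scale (c (bs ! i)) (EM (f (bs ! i))))"
   using sum.reindex_bij_betw[OF bij_betw_nth[OF bs(2), of "{..<length bs}" B], of "\<lambda>b. BC_scale (c b) (EM (f b))"] bs
   by simp
  finally show "\<exists>c. EM t = (\<Sum>i<length (map f bs). BC_scale (c i) (EM (map f bs ! i)))"
   by (intro exI[of _ "\<lambda>i. c (bs ! i)"]) simp
 qed
qed

end

section \<open>Morphisms as elements of one module\<close>

abbreviation Qeq :: "'k::comm_ring_1 => Q_obj list => Q_obj list => 'k Q_mor => 'k Q_mor => bool"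
 where "Qeq z \<equiv> mor_cong Q_sig (Q_rel z)"
abbreviation Qty :: "Q_obj list => Q_obj list => 'k::comm_ring_1 Q_mor => bool"
 where "Qty \<equiv> mor_type Q_sig"

lemmas tyI = mor_type.intros and homI = mor_homog.intros

text \<open>
 An element of the following type is a choice of a morphism \<open>X \<rightarrow> Y\<close> of the category with
 parameter \<open>z\<close> for all \<open>z\<close>, \<open>X\<close> and \<open>Y\<close>.  Postcomposition with \<open>1 \<otimes> f \<otimes> 1\<close>, with \<open>n\<close> strands to the
 left of \<open>f\<close>, is an operator on this one abelian group.
\<close>

quotient_type (overloaded) 'k Qf = "'k::comm_ring_1 => Q_obj list => Q_obj list => 'k Q_mor" / partial:
 "\<lambda>F G. \<forall>z X Y. Qeq z X Y (F z X Y) (G z X Y)"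
proof (rule part_equivpI)
 show "\<exists>F :: 'k => Q_obj list => Q_obj list => 'k Q_mor. \<forall>z X Y. Qeq z X Y (F z X Y) (F z X Y)"
  by (rule exI[of _ "\<lambda>z X Y. MZero X Y"]) (simp add: mor_cong_refl tyI)
qed (auto simp: symp_def transp_def intro: mor_cong_sym, blast intro: mor_cong_trans)

definition Qmk :: "('k::comm_ring_1 => Q_obj list => Q_obj list => 'k Q_mor) => 'k Qf" where "Qmk = abs_Qf"
definition cmp :: "'k::comm_ring_1 Qf => 'k => Q_obj list => Q_obj list => 'k Q_mor" where "cmp = rep_Qf"

lemma cmp_refl: "Qeq z X Y (cmp x z X Y) (cmp x z X Y)"
 using Quotient3_rep_reflp[OF Quotient3_Qf, of x] by (simp add: cmp_def)

lemma cmp_type: "Qty X Y (cmp x z X Y)"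
 using cmp_refl mor_cong_type by blast

lemma Qf_eqI:
 assumes "\<And>z X Y. \<exists>f g. Qeq z X Y (cmp x z X Y) f \<and> Qeq z X Y (cmp y z X Y) g \<and> Qeq z X Y f g"
 shows "x = y"
proof -
 have "Qeq z X Y (cmp x z X Y) (cmp y z X Y)" for z X Y
  using assms[of z X Y] by (blast intro: mor_cong_sym mor_cong_trans)
 thus ?thesis
  using Quotient3_rel_rep[OF Quotient3_Qf, of x y] by (simp add: cmp_def)
qed

lemma cmp_Qmk:
 assumes "\<And>z X Y. Qty X Y (F z X Y)" "Qeq z X Y (F z X Y) f"
 shows "Qeq z X Y (cmp (Qmk F) z X Y) f"
proof -
 have "Qeq z X Y (rep_Qf (abs_Qf F) z X Y) (F z X Y)" for z X Y
  using rep_abs_rsp_left[OF Quotient3_Qf, of F F] assms(1) by (simp add: mor_cong_refl)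
 thus ?thesis using assms(2) by (auto simp: cmp_def Qmk_def intro: mor_cong_trans)
qed

instantiation Qf :: (comm_ring_1) ab_group_add
begin

definition zero_Qf :: "'a Qf" where "0 = Qmk (\<lambda>z X Y. MZero X Y)"
definition plus_Qf :: "'a Qf => 'a Qf => 'a Qf" where "x + y = Qmk (\<lambda>z X Y. MAdd (cmp x z X Y) (cmp y z X Y))"
definition uminus_Qf :: "'a Qf => 'a Qf" where "- x = Qmk (\<lambda>z X Y. MScale (- 1) (cmp x z X Y))"
definition minus_Qf :: "'a Qf => 'a Qf => 'a Qf" where "x - y = x + - (y :: 'a Qf)"

lemma cmp_ab:
 "Qeq z X Y (cmp (0 :: 'a Qf) z X Y) (MZero X Y)"
 "Qeq z X Y (cmp x z X Y) f ==> Qeq z X Y (cmp y z X Y) g ==> Qeq z X Y (cmp (x + y :: 'a Qf) z X Y) (MAdd f g)"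
 "Qeq z X Y (cmp x z X Y) f ==> Qeq z X Y (cmp (- x :: 'a Qf) z X Y) (MScale (- 1) f)"
 unfolding zero_Qf_def plus_Qf_def uminus_Qf_def
 by (rule cmp_Qmk; intro tyI cmp_type mor_cong_add_cong mor_cong_scale_cong mor_cong_refl; assumption)+

instance
proof
 fix a b c :: "'a Qf"
 show "a + b + c = a + (b + c)"
  by (rule Qf_eqI, intro exI conjI, (rule cmp_ab cmp_refl)+, rule mor_cong_add_assoc) (rule cmp_type)+
 show "a + b = b + a"
  by (rule Qf_eqI, intro exI conjI, (rule cmp_ab cmp_refl)+, rule mor_cong_add_commute) (rule cmp_type)+
 show "0 + a = a"
  by (rule Qf_eqI, intro exI conjI, (rule cmp_ab cmp_refl)+, rule mor_cong_add_zero) (rule cmp_type)+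
 show "- a + a = 0"
  by (rule Qf_eqI, intro exI conjI, (rule cmp_ab cmp_refl)+, rule mor_cong_add_neg) (rule cmp_type)+
qed (simp add: minus_Qf_def)

end

definition Qscale :: "'k::comm_ring_1 => 'k Qf => 'k Qf" (infixr \<open>*\<^sub>q\<close> 75)
 where "c *\<^sub>q x = Qmk (\<lambda>z X Y. MScale c (cmp x z X Y))"
text \<open>The parameter differs from component to component, so multiplication by it is an
  operator of its own; on a single component it is \<open>Qscale z\<close>
  (\<open>zhat_Qat\<close>).\<close>

definition zhat :: "'k::comm_ring_1 Qf => 'k Qf" where "zhat x = Qmk (\<lambda>z X Y. MScale z (cmp x z X Y))"

lemma cmp_scale:
 "Qeq z X Y (cmp x z X Y) f ==> Qeq z X Y (cmp (c *\<^sub>q x) z X Y) (MScale c f)"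
 "Qeq z X Y (cmp x z X Y) f ==> Qeq z X Y (cmp (zhat x) z X Y) (MScale z f)"
 unfolding Qscale_def zhat_def
 by (rule cmp_Qmk; intro tyI cmp_type mor_cong_scale_cong; assumption)+

interpretation Qm: Modules.module "Qscale :: 'k::comm_ring_1 => 'k Qf => 'k Qf"
proof
 fix a b :: 'k and x y :: "'k Qf"
 show "a *\<^sub>q (x + y) = a *\<^sub>q x + a *\<^sub>q y"
  by (rule Qf_eqI, intro exI conjI, (rule cmp_ab cmp_scale cmp_refl)+, rule mor_cong_scale_add_right) (rule cmp_type)+
 show "(a + b) *\<^sub>q x = a *\<^sub>q x + b *\<^sub>q x"
  by (rule Qf_eqI, intro exI conjI, (rule cmp_ab cmp_scale cmp_refl)+, rule mor_cong_scale_add_left) (rule cmp_type)+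
 show "a *\<^sub>q b *\<^sub>q x = (a * b) *\<^sub>q x"
  by (rule Qf_eqI, intro exI conjI, (rule cmp_ab cmp_scale cmp_refl)+, rule mor_cong_sym[OF mor_cong_scale_scale]) (rule cmp_type)+
 show "1 *\<^sub>q x = x"
  by (rule Qf_eqI, intro exI conjI, (rule cmp_ab cmp_scale cmp_refl)+, rule mor_cong_scale_one) (rule cmp_type)+
qed

section \<open>Postcomposition with padded morphisms\<close>

definition isat :: "nat => Q_obj list => Q_obj list => bool" where
 "isat n N Y \<longleftrightarrow> n + length N \<le> length Y \<and> take (length N) (drop n Y) = N"

definition repl :: "nat => Q_obj list => Q_obj list => Q_obj list => Q_obj list" where
 "repl n N M Y = take n Y @ M @ drop (n + length N) Y"

lemma isat_append [simp]: "isat (length A) N (A @ N @ B)"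
 by (simp add: isat_def)

lemma isatE: assumes "isat n N Y" obtains A B where "Y = A @ N @ B" "length A = n"
proof
 have "drop n Y = N @ drop (n + length N) Y"
  using assms append_take_drop_id[of "length N" "drop n Y"] by (simp add: isat_def add.commute)
 thus "Y = take n Y @ N @ drop (n + length N) Y" by (metis append_take_drop_id)
qed (use assms in \<open>simp add: isat_def\<close>)

lemma repl_append [simp]: "repl (length A) N M (A @ N @ B) = A @ M @ B"
 by (simp add: repl_def)

lemma MId_refl: "Qeq z X X (MId X) (MId X)"
 by (rule mor_cong_refl[OF tyI(2)])

lemmas MId_tens_cong = mor_cong_tens_cong[OF MId_refl]

definition pad :: "Q_obj list => 'k::comm_ring_1 Q_mor => Q_obj list => 'k Q_mor" where
 "pad A f B = MId A \<^bold>\<otimes> f \<^bold>\<otimes> MId B"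

lemma pad_type: "Qty M N f ==> Qty (A @ M @ B) (A @ N @ B) (pad A f B)"
 unfolding pad_def by (intro tyI)

lemma pad_cong: "Qeq z M N f g ==> Qeq z (A @ M @ B) (A @ N @ B) (pad A f B) (pad A g B)"
 unfolding pad_def by (intro mor_cong_tens_cong mor_cong_refl tyI)

text \<open>The component at \<open>Y\<close> vanishes unless \<open>Y\<close> has the codomain \<open>N\<close> of \<open>f\<close> at position \<open>n\<close>.\<close>

definition W :: "'k::comm_ring_1 Q_mor => Q_obj list => Q_obj list => nat => 'k Qf => 'k Qf" where
 "W f M N n x = Qmk (\<lambda>z X Y. if Qty M N f \<and> isat n N Y
  then pad (take n Y) f (drop (n + length N) Y) \<^bold>\<circ> cmp x z X (repl n N M Y) else MZero X Y)"

lemma cmp_W_type: "Qty X Y (if Qty M N f \<and> isat n N Y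
  then pad (take n Y) f (drop (n + length N) Y) \<^bold>\<circ> cmp x z X (repl n N M Y) else MZero X Y)"
proof (cases "Qty M N f \<and> isat n N Y")
 case True
 then obtain A B where "Y = A @ N @ B" "length A = n" by (auto elim: isatE)
 thus ?thesis using True by (auto intro!: tyI(6) cmp_type pad_type)
qed (auto intro: tyI)

lemma cmp_W:
 assumes "Qty M N f" "Qeq z X (A @ M @ B) (cmp x z X (A @ M @ B)) g"
 shows "Qeq z X (A @ N @ B) (cmp (W f M N (length A) x) z X (A @ N @ B)) (pad A f B \<^bold>\<circ> g)"
 unfolding W_def
 by (rule cmp_Qmk[OF cmp_W_type]) (use assms in \<open>auto intro!: mor_cong_comp_cong mor_cong_refl pad_type\<close>)

lemma cmp_W_zero: "\<not> isat n N Y ==> Qeq z X Y (cmp (W f M N n x) z X Y) (MZero X Y)"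
 unfolding W_def by (rule cmp_Qmk[OF cmp_W_type]) (auto intro!: mor_cong_refl tyI)

lemma Qf_eqI':
 assumes "\<And>z X Y. \<exists>f. Qeq z X Y (cmp x z X Y) f \<and> Qeq z X Y (cmp y z X Y) f"
 shows "x = y"
 by (rule Qf_eqI) (metis assms mor_cong_refl mor_cong_type)

lemma W_eqI:
 assumes "\<And>Y z X. \<not> isat n N Y ==> Qeq z X Y (cmp x z X Y) (MZero X Y) \<and> Qeq z X Y (cmp y z X Y) (MZero X Y)"
  and "\<And>A B z X. n = length A ==> \<exists>f g. Qeq z X (A @ N @ B) (cmp x z X (A @ N @ B)) f \<and>
   Qeq z X (A @ N @ B) (cmp y z X (A @ N @ B)) g \<and> Qeq z X (A @ N @ B) f g"
 shows "x = y"
proof (rule Qf_eqI)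
 fix z X Y
 show "\<exists>f g. Qeq z X Y (cmp x z X Y) f \<and> Qeq z X Y (cmp y z X Y) g \<and> Qeq z X Y f g"
 proof (cases "isat n N Y")
  case True
  thus ?thesis using assms(2) by (auto elim!: isatE)
 next
  case False
  thus ?thesis using assms(1)[of Y z X] by (blast intro: mor_cong_refl tyI)
 qed
qed

lemma Qeq_add_zero: "Qeq z X Y f (MZero X Y) ==> Qeq z X Y g (MZero X Y) ==> Qeq z X Y (MAdd f g) (MZero X Y)"
 by (rule m_add_zero_cong)

lemma Qeq_scale_zero: "Qeq z X Y f (MZero X Y) ==> Qeq z X Y (MScale c f) (MZero X Y)"
 by (blast intro: m_scale_zero mor_cong_trans mor_cong_scale_cong)

lemma cmp_zeros:
 "Qeq z X Y (cmp x z X Y) (MZero X Y) ==> Qeq z X Y (cmp y z X Y) (MZero X Y) ==> Qeq z X Y (cmp (x + y) z X Y) (MZero X Y)"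
 "Qeq z X Y (cmp x z X Y) (MZero X Y) ==> Qeq z X Y (cmp (c *\<^sub>q x) z X Y) (MZero X Y)"
 "Qeq z X Y (cmp x z X Y) (MZero X Y) ==> Qeq z X Y (cmp (zhat x) z X Y) (MZero X Y)"
 by (meson cmp_ab cmp_scale cmp_refl mor_cong_trans Qeq_add_zero Qeq_scale_zero)+

context
 fixes f :: "'k::comm_ring_1 Q_mor" and M N :: "Q_obj list"
 assumes f: "Qty M N f"
begin

lemma W_add: "W f M N n (x + y) = W f M N n x + W f M N n y"
 and W_scale: "W f M N n (c *\<^sub>q x) = c *\<^sub>q W f M N n x"
 and W_zhat: "W f M N n (zhat x) = zhat (W f M N n x)"
 by (rule W_eqI[of n N], (auto intro: cmp_W_zero cmp_zeros)[1], hypsubst, intro exI conjI,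
  (rule cmp_ab cmp_scale cmp_W[OF f] cmp_refl)+, rule mor_cong_comp_add_right mor_cong_comp_scale_right,
  (rule cmp_type pad_type f)+)+

end

lemma W_cong:
 assumes "\<And>z. Qeq z M N f g"
 shows "W f M N n x = W g M N n x"
proof (rule W_eqI[of n N])
 have f: "Qty M N f" and g: "Qty M N g" using assms mor_cong_type by blast+
 fix A B :: "Q_obj list" and z :: 'a and X assume n: "n = length A"
 show "\<exists>u v. Qeq z X (A @ N @ B) (cmp (W f M N n x) z X (A @ N @ B)) u \<and>
   Qeq z X (A @ N @ B) (cmp (W g M N n x) z X (A @ N @ B)) v \<and> Qeq z X (A @ N @ B) u v"
  unfolding n
  by (intro exI conjI, (rule cmp_W[OF f] cmp_W[OF g] cmp_refl)+, rule mor_cong_comp_cong)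
   (rule pad_cong assms cmp_refl)+
qed (auto intro: cmp_W_zero)

abbreviation Qhom :: "bit => Q_obj list => Q_obj list => 'k::comm_ring_1 Q_mor => bool"
 where "Qhom \<equiv> mor_homog Q_sig"

lemma Qhom_type: "Qhom p X Y f ==> Qty X Y f"
 by (rule mor_homog_type)

lemma interchange_even:
 assumes "Qhom p X Y f" "Qhom q V Y' g" "Qty Y Z f'" "Qty U V g'" "p = 0 \<or> q = 0"
 shows "Qeq z (X @ U) (Z @ Y') ((f' \<^bold>\<otimes> g) \<^bold>\<circ> (f \<^bold>\<otimes> g')) ((f' \<^bold>\<circ> f) \<^bold>\<otimes> (g \<^bold>\<circ> g'))"
proof -
 have T: "Qty (X @ U) (Z @ Y') ((f' \<^bold>\<circ> f) \<^bold>\<otimes> (g \<^bold>\<circ> g'))"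
  using assms by (intro tyI(6,7)) (auto dest: Qhom_type)
 have "Qeq z (X @ U) (Z @ Y') ((f' \<^bold>\<otimes> g) \<^bold>\<circ> (f \<^bold>\<otimes> g')) (MScale 1 ((f' \<^bold>\<circ> f) \<^bold>\<otimes> (g \<^bold>\<circ> g')))"
  using mor_cong_super_interchange[OF assms(1-4), of "Q_rel z"] assms(5) by auto
 thus ?thesis using mor_cong_scale_one[OF T] by (rule mor_cong_trans)
qed

lemma MId_tens_comp:
 assumes f: "Qhom p N L f" and g: "Qty M N g"
 shows "Qeq z (A @ M) (A @ L) ((MId A \<^bold>\<otimes> f) \<^bold>\<circ> (MId A \<^bold>\<otimes> g)) (MId A \<^bold>\<otimes> (f \<^bold>\<circ> g))"
proof -
 have "Qeq z (A @ M) (A @ L) ((MId A \<^bold>\<otimes> f) \<^bold>\<circ> (MId A \<^bold>\<otimes> g)) ((MId A \<^bold>\<circ> MId A) \<^bold>\<otimes> (f \<^bold>\<circ> g))"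
  by (rule interchange_even[of 0 A A _ p]) (auto intro: homI tyI f g)
 also have "Qeq z (A @ M) (A @ L) ... (MId A \<^bold>\<otimes> (f \<^bold>\<circ> g))"
  using f g by (intro mor_cong_tens_cong mor_cong_comp_id_left mor_cong_refl tyI) (auto dest: Qhom_type)
 finally show ?thesis .
qed

lemma tens_MId_comp:
 assumes f: "Qty N L f" and g: "Qhom p M N g"
 shows "Qeq z (M @ B) (L @ B) ((f \<^bold>\<otimes> MId B) \<^bold>\<circ> (g \<^bold>\<otimes> MId B)) ((f \<^bold>\<circ> g) \<^bold>\<otimes> MId B)"
proof -
 have "Qeq z (M @ B) (L @ B) ((f \<^bold>\<otimes> MId B) \<^bold>\<circ> (g \<^bold>\<otimes> MId B)) ((f \<^bold>\<circ> g) \<^bold>\<otimes> (MId B \<^bold>\<circ> MId B))"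
  by (rule interchange_even[of p M N _ 0]) (auto intro: homI tyI f g)
 also have "Qeq z (M @ B) (L @ B) ... ((f \<^bold>\<circ> g) \<^bold>\<otimes> MId B)"
  using f g by (intro mor_cong_tens_cong mor_cong_comp_id_left mor_cong_refl tyI) (auto dest: Qhom_type)
 finally show ?thesis .
qed

lemma pad_comp:
 assumes f: "Qhom p N L f" and g: "Qhom q M N g"
 shows "Qeq z (A @ M @ B) (A @ L @ B) (pad A f B \<^bold>\<circ> pad A g B) (pad A (f \<^bold>\<circ> g) B)"
proof -
 have t: "Qty N L f" "Qty M N g" using f g by (auto dest: Qhom_type)
 have "Qeq z (A @ M @ B) (A @ L @ B) (pad A f B \<^bold>\<circ> pad A g B) (MId A \<^bold>\<otimes> ((f \<^bold>\<otimes> MId B) \<^bold>\<circ> (g \<^bold>\<otimes> MId B)))"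
  unfolding pad_def by (rule MId_tens_comp[OF homI(7)[OF f homI(2)] tyI(7)[OF t(2) tyI(2)]])
 also have "Qeq z (A @ M @ B) (A @ L @ B) ... (pad A (f \<^bold>\<circ> g) B)"
  unfolding pad_def by (rule MId_tens_cong[OF tens_MId_comp[OF t(1) g]])
 finally show ?thesis .
qed

lemma pad_MId: "Qeq z (A @ X @ B) (A @ X @ B) (pad A (MId X) B) (MId (A @ X @ B))"
 unfolding pad_def
 by (rule mor_cong_trans[OF mor_cong_tens_cong[OF mor_cong_refl mor_cong_tens_id] mor_cong_tens_id]) (intro tyI)

lemma pad_add:
 assumes "Qty M N f" "Qty M N g"
 shows "Qeq z (A @ M @ B) (A @ N @ B) (pad A (MAdd f g) B) (MAdd (pad A f B) (pad A g B))"
 unfolding pad_def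
 by (rule mor_cong_trans[OF mor_cong_tens_cong[OF mor_cong_refl mor_cong_tens_add_left] mor_cong_tens_add_right])
  (intro tyI assms)+

lemma pad_scaled:
 assumes "Qty M N f"
 shows "Qeq z (A @ M @ B) (A @ N @ B) (pad A (MScale c f) B) (MScale c (pad A f B))"
 unfolding pad_def
 by (rule mor_cong_trans[OF mor_cong_tens_cong[OF mor_cong_refl mor_cong_tens_scale_left] mor_cong_tens_scale_right])
  (intro tyI assms)+

lemma pad_unit:
 assumes "Qty X Y g"
 shows "Qeq z X Y (pad [] g []) g"
 unfolding pad_def
 using mor_cong_trans[OF mor_cong_tens_unit_left mor_cong_tens_unit_right[OF assms], of "Q_rel z"]
  tyI(7)[OF assms tyI(2), of "[]"] by simp

lemma MId_append_tens:
 assumes "Qty M N f"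
 shows "Qeq z (A @ B @ M) (A @ B @ N) (MId (A @ B) \<^bold>\<otimes> f) (MId A \<^bold>\<otimes> MId B \<^bold>\<otimes> f)"
proof -
 have "Qeq z ((A @ B) @ M) ((A @ B) @ N) (MId (A @ B) \<^bold>\<otimes> f) ((MId A \<^bold>\<otimes> MId B) \<^bold>\<otimes> f)"
  by (intro mor_cong_tens_cong mor_cong_sym[OF mor_cong_tens_id] mor_cong_refl assms)
 also have "Qeq z ((A @ B) @ M) ((A @ B) @ N) ... (MId A \<^bold>\<otimes> MId B \<^bold>\<otimes> f)"
  unfolding append_assoc by (intro mor_cong_tens_assoc tyI assms)
 finally show ?thesis by simp
qed

lemma pad_interchange:
 assumes f: "Qhom p M N f" and g: "Qhom q K L g"
 shows "Qeq z (A @ M @ B @ K @ C) (A @ N @ B @ L @ C) (pad (A @ N @ B) g C \<^bold>\<circ> pad A f (B @ K @ C))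
  (MScale (if p = 1 \<and> q = 1 then - 1 else 1) (pad A f (B @ L @ C) \<^bold>\<circ> pad (A @ M @ B) g C))"
proof -
 let ?c = "if p = 1 \<and> q = 1 then - 1 else 1 :: 'a" and ?K = "B @ K @ C" and ?L = "B @ L @ C"
 define G where "G = pad B g C"
 have t: "Qty M N f" "Qty K L g" using f g by (auto dest: Qhom_type)
 have Gh: "Qhom (0 + (q + 0)) ?K ?L G" unfolding G_def pad_def by (intro homI g)
 hence G: "Qhom q ?K ?L G" by simp
 hence Gt: "Qty ?K ?L G" by (rule Qhom_type)
 have pg: "Qeq z (A @ D @ ?K) (A @ D @ ?L) (pad (A @ D @ B) g C) (MId A \<^bold>\<otimes> MId D \<^bold>\<otimes> G)" for D
 proof -
  have "Qeq z (A @ (D @ B) @ K @ C) (A @ (D @ B) @ L @ C) (pad (A @ D @ B) g C) (MId A \<^bold>\<otimes> MId (D @ B) \<^bold>\<otimes> (g \<^bold>\<otimes> MId C))"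
   unfolding pad_def using MId_append_tens[of "K @ C" "L @ C" "g \<^bold>\<otimes> MId C" z A "D @ B"] tyI(7)[OF t(2) tyI(2)] by simp
  also have "Qeq z (A @ (D @ B) @ K @ C) (A @ (D @ B) @ L @ C) ... (MId A \<^bold>\<otimes> MId D \<^bold>\<otimes> G)"
   unfolding G_def pad_def append_assoc
   by (intro mor_cong_tens_cong mor_cong_refl MId_append_tens tyI t)
  finally show ?thesis by simp
 qed
 have 1: "Qeq z (M @ ?K) (N @ ?L) ((MId N \<^bold>\<otimes> G) \<^bold>\<circ> (f \<^bold>\<otimes> MId ?K)) (MScale ?c (f \<^bold>\<otimes> G))"
 proof -
  have "Qeq z (M @ ?K) (N @ ?L) ((MId N \<^bold>\<otimes> G) \<^bold>\<circ> (f \<^bold>\<otimes> MId ?K)) (MScale ?c ((MId N \<^bold>\<circ> f) \<^bold>\<otimes> (G \<^bold>\<circ> MId ?K)))"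
   by (rule mor_cong_super_interchange[OF f G]) (rule tyI)+
  also have "Qeq z (M @ ?K) (N @ ?L) ... (MScale ?c (f \<^bold>\<otimes> G))"
   by (intro mor_cong_scale_cong mor_cong_tens_cong mor_cong_comp_id_left mor_cong_comp_id_right t Gt)
  finally show ?thesis .
 qed
 have 2: "Qeq z (M @ ?K) (N @ ?L) ((f \<^bold>\<otimes> MId ?L) \<^bold>\<circ> (MId M \<^bold>\<otimes> G)) (f \<^bold>\<otimes> G)"
 proof -
  have "Qeq z (M @ ?K) (N @ ?L) ((f \<^bold>\<otimes> MId ?L) \<^bold>\<circ> (MId M \<^bold>\<otimes> G)) ((f \<^bold>\<circ> MId M) \<^bold>\<otimes> (MId ?L \<^bold>\<circ> G))"
   by (rule interchange_even[of 0 M M _ 0]) (auto intro: homI tyI t Gt)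
  also have "Qeq z (M @ ?K) (N @ ?L) ... (f \<^bold>\<otimes> G)"
   by (intro mor_cong_tens_cong mor_cong_comp_id_left mor_cong_comp_id_right t Gt)
  finally show ?thesis .
 qed
 have "Qeq z (A @ M @ ?K) (A @ N @ ?L) (pad (A @ N @ B) g C \<^bold>\<circ> pad A f ?K)
   ((MId A \<^bold>\<otimes> MId N \<^bold>\<otimes> G) \<^bold>\<circ> (MId A \<^bold>\<otimes> f \<^bold>\<otimes> MId ?K))"
  by (rule mor_cong_comp_cong[OF pg]) (auto simp: pad_def intro!: mor_cong_refl tyI t)
 also have "Qeq z (A @ M @ ?K) (A @ N @ ?L) ... (MId A \<^bold>\<otimes> ((MId N \<^bold>\<otimes> G) \<^bold>\<circ> (f \<^bold>\<otimes> MId ?K)))"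
  by (rule MId_tens_comp[OF homI(7)[OF homI(2) G] tyI(7)[OF t(1) tyI(2)]])
 also have "Qeq z (A @ M @ ?K) (A @ N @ ?L) ... (MId A \<^bold>\<otimes> MScale ?c ((f \<^bold>\<otimes> MId ?L) \<^bold>\<circ> (MId M \<^bold>\<otimes> G)))"
  by (intro mor_cong_tens_cong mor_cong_refl tyI)
   (rule mor_cong_trans[OF 1 mor_cong_scale_cong[OF mor_cong_sym[OF 2]]])
 also have "Qeq z (A @ M @ ?K) (A @ N @ ?L) ... (MScale ?c (MId A \<^bold>\<otimes> ((f \<^bold>\<otimes> MId ?L) \<^bold>\<circ> (MId M \<^bold>\<otimes> G))))"
  by (intro mor_cong_tens_scale_right tyI(2)
   tyI(6)[OF tyI(7)[OF t(1) tyI(2)] tyI(7)[OF tyI(2) Gt]])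
 also have "Qeq z (A @ M @ ?K) (A @ N @ ?L) ...
   (MScale ?c ((MId A \<^bold>\<otimes> f \<^bold>\<otimes> MId ?L) \<^bold>\<circ> (MId A \<^bold>\<otimes> MId M \<^bold>\<otimes> G)))"
  by (intro mor_cong_scale_cong mor_cong_sym[OF MId_tens_comp[OF homI(7)[OF f homI(2)] tyI(7)[OF tyI(2) Gt]]])
 also have "Qeq z (A @ M @ ?K) (A @ N @ ?L) ... (MScale ?c (pad A f ?L \<^bold>\<circ> pad (A @ M @ B) g C))"
  by (intro mor_cong_scale_cong mor_cong_comp_cong[OF _ mor_cong_sym[OF pg]])
   (auto simp: pad_def intro!: mor_cong_refl tyI t)
 finally show ?thesis by simp
qed

lemma W_comp:
 assumes f: "Qhom p N L f" and g: "Qhom q M N g"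
 shows "W (f \<^bold>\<circ> g) M L n x = W f N L n (W g M N n x)"
proof (rule W_eqI[of n L])
 have t: "Qty N L f" "Qty M N g" using f g by (auto dest: Qhom_type)
 have fg: "Qty M L (f \<^bold>\<circ> g)" using t by (rule tyI)
 fix A B :: "Q_obj list" and z :: 'a and X assume n: "n = length A"
 show "\<exists>u v. Qeq z X (A @ L @ B) (cmp (W (f \<^bold>\<circ> g) M L n x) z X (A @ L @ B)) u \<and>
   Qeq z X (A @ L @ B) (cmp (W f N L n (W g M N n x)) z X (A @ L @ B)) v \<and> Qeq z X (A @ L @ B) u v"
  unfolding n
 proof (intro exI conjI, (rule cmp_W[OF fg] cmp_W[OF t(1)] cmp_W[OF t(2)] cmp_refl)+)
  let ?h = "cmp x z X (A @ M @ B)"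
  have "Qeq z X (A @ L @ B) (pad A (f \<^bold>\<circ> g) B \<^bold>\<circ> ?h) ((pad A f B \<^bold>\<circ> pad A g B) \<^bold>\<circ> ?h)"
   by (rule mor_cong_comp_cong[OF mor_cong_sym[OF pad_comp[OF f g]] cmp_refl])
  also have "Qeq z X (A @ L @ B) ... (pad A f B \<^bold>\<circ> pad A g B \<^bold>\<circ> ?h)"
   by (rule mor_cong_comp_assoc[OF pad_type[OF t(1)] pad_type[OF t(2)] cmp_type])
  finally show "Qeq z X (A @ L @ B) (pad A (f \<^bold>\<circ> g) B \<^bold>\<circ> ?h) (pad A f B \<^bold>\<circ> pad A g B \<^bold>\<circ> ?h)" .
 qed
qed (auto intro: cmp_W_zero)

text \<open>\<open>P\<close> selects the components in which an element may be nonzero. Hypotheses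
  on the orientation of strands become statements about the support.\<close>

definition supp :: "('k::comm_ring_1 => Q_obj list => Q_obj list => bool) => 'k Qf set" where
 "supp P = {x. \<forall>z X Y. \<not> P z X Y --> Qeq z X Y (cmp x z X Y) (MZero X Y)}"

lemma suppD: "x \<in> supp P ==> \<not> P z X Y ==> Qeq z X Y (cmp x z X Y) (MZero X Y)"
 by (simp add: supp_def)

lemma supp_subspace: "Qm.subspace (supp P)"
 by (rule Qm.subspaceI) (auto simp: supp_def intro: cmp_zeros cmp_ab)

lemma supp_zhat: "x \<in> supp P ==> zhat x \<in> supp P"
 by (auto simp: supp_def intro: cmp_zeros)

lemma Qeq_comp_zero: "Qty Y Z f ==> Qeq z X Y h (MZero X Y) ==> Qeq z X Z (f \<^bold>\<circ> h) (MZero X Z)"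
 by (meson m_comp_zero_right mor_cong_comp_cong mor_cong_refl mor_cong_trans)

lemma cmp_W_zero': "Qeq z X (A @ M @ B) (cmp x z X (A @ M @ B)) (MZero X (A @ M @ B)) ==> length A = n ==> Qty M N f ==>
 Qeq z X (A @ N @ B) (cmp (W f M N n x) z X (A @ N @ B)) (MZero X (A @ N @ B))"
 using cmp_W[of M N f z X A B x "MZero X (A @ M @ B)"] by (blast intro: mor_cong_trans Qeq_comp_zero pad_type mor_cong_refl tyI)

lemma supp_W:
 assumes "Qty M N f" "x \<in> supp P"
  and "\<And>A B z X. length A = n ==> P z X (A @ M @ B) ==> P' z X (A @ N @ B)"
 shows "W f M N n x \<in> supp P'"
 unfolding supp_def
proof (intro CollectI allI impI)
 fix z X Y assume P: "\<not> P' z X Y"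
 show "Qeq z X Y (cmp (W f M N n x) z X Y) (MZero X Y)"
 proof (cases "isat n N Y")
  case True
  then obtain A B where "Y = A @ N @ B" "length A = n" by (rule isatE)
  thus ?thesis using P assms(1,3) by (auto intro!: cmp_W_zero' suppD[OF assms(2)])
 qed (rule cmp_W_zero)
qed

text \<open>Position \<open>m\<close> refers to the word after \<open>f\<close>; before
  \<open>f\<close> it is shifted by the change of length. If the codomain does not contain both
  patterns, both sides vanish there.\<close>

lemma W_interchange:
 assumes f: "Qhom p M N f" and g: "Qhom q K L g" and m: "n + length N \<le> m"
 shows "W g K L m (W f M N n x) =
  (if p = 1 \<and> q = 1 then - 1 else 1) *\<^sub>q W f M N n (W g K L (m - length N + length M) x)" (is "?l = ?c *\<^sub>q ?r")
proof (rule Qf_eqI)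
 have t: "Qty M N f" "Qty K L g" using f g by (auto dest: Qhom_type)
 let ?c = "(if p = 1 \<and> q = 1 then - 1 else 1)" let ?m = "m - length N + length M"
 fix z :: 'a and X Y
 show "\<exists>u v. Qeq z X Y (cmp ?l z X Y) u \<and> Qeq z X Y (cmp (?c *\<^sub>q ?r) z X Y) v \<and> Qeq z X Y u v"
 proof (cases "\<exists>A B C. Y = A @ N @ B @ L @ C \<and> n = length A \<and> m = length (A @ N @ B)")
  case True
  then obtain A B C where Y: "Y = A @ N @ B @ L @ C" "n = length A" "m = length (A @ N @ B)" by blast
  let ?h = "cmp x z X (A @ M @ B @ K @ C)"
  have m': "?m = length (A @ M @ B)" using Y by simp
  have 1: "Qeq z X (A @ N @ B @ L @ C) (cmp ?l z X (A @ N @ B @ L @ C)) (pad (A @ N @ B) g C \<^bold>\<circ> pad A f (B @ K @ C) \<^bold>\<circ> ?h)"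
  proof -
   have "Qeq z X ((A @ N @ B) @ K @ C) (cmp (W f M N n x) z X ((A @ N @ B) @ K @ C)) (pad A f (B @ K @ C) \<^bold>\<circ> ?h)"
    using cmp_W[OF t(1) cmp_refl, of z X A "B @ K @ C" x] Y by simp
   from cmp_W[OF t(2) this] show ?thesis using Y by simp
  qed
  have 2: "Qeq z X (A @ N @ B @ L @ C) (cmp ?r z X (A @ N @ B @ L @ C)) (pad A f (B @ L @ C) \<^bold>\<circ> pad (A @ M @ B) g C \<^bold>\<circ> ?h)"
  proof -
   have "Qeq z X (A @ M @ B @ L @ C) (cmp (W g K L ?m x) z X (A @ M @ B @ L @ C)) (pad (A @ M @ B) g C \<^bold>\<circ> ?h)"
    using cmp_W[OF t(2) cmp_refl, of z X "A @ M @ B" C x] unfolding m' by simp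
   from cmp_W[OF t(1) this] show ?thesis using Y(2) by simp
  qed
  have "Qeq z X (A @ N @ B @ L @ C) (pad (A @ N @ B) g C \<^bold>\<circ> pad A f (B @ K @ C) \<^bold>\<circ> ?h)
    (MScale ?c (pad A f (B @ L @ C) \<^bold>\<circ> pad (A @ M @ B) g C \<^bold>\<circ> ?h))"
  proof -
   let ?S = "A @ M @ B @ K @ C" and ?T = "A @ N @ B @ L @ C"
   have ty: "Qty ?S (A @ N @ B @ K @ C) (pad A f (B @ K @ C))" "Qty (A @ M @ B @ L @ C) ?T (pad A f (B @ L @ C))"
    by (intro pad_type t)+
   have ty': "Qty ?S (A @ M @ B @ L @ C) (pad (A @ M @ B) g C)" "Qty (A @ N @ B @ K @ C) ?T (pad (A @ N @ B) g C)"
    using pad_type[OF t(2), of "A @ M @ B" C] pad_type[OF t(2), of "A @ N @ B" C] by simp_all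
   have "Qeq z X ?T (pad (A @ N @ B) g C \<^bold>\<circ> pad A f (B @ K @ C) \<^bold>\<circ> ?h) ((pad (A @ N @ B) g C \<^bold>\<circ> pad A f (B @ K @ C)) \<^bold>\<circ> ?h)"
    by (rule mor_cong_sym[OF mor_cong_comp_assoc[OF ty'(2) ty(1) cmp_type]])
   also have "Qeq z X ?T ... (MScale ?c (pad A f (B @ L @ C) \<^bold>\<circ> pad (A @ M @ B) g C) \<^bold>\<circ> ?h)"
    by (rule mor_cong_comp_cong[OF pad_interchange[OF f g] cmp_refl])
   also have "Qeq z X ?T ... (MScale ?c ((pad A f (B @ L @ C) \<^bold>\<circ> pad (A @ M @ B) g C) \<^bold>\<circ> ?h))"
    by (rule mor_cong_comp_scale_left[OF tyI(6)[OF ty(2) ty'(1)] cmp_type])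
   also have "Qeq z X ?T ... (MScale ?c (pad A f (B @ L @ C) \<^bold>\<circ> pad (A @ M @ B) g C \<^bold>\<circ> ?h))"
    by (rule mor_cong_scale_cong[OF mor_cong_comp_assoc[OF ty(2) ty'(1) cmp_type]])
   finally show ?thesis .
  qed
  thus ?thesis using 1 cmp_scale(1)[OF 2, of ?c] Y(1) by blast
 next
  case False
  have l: "Qeq z X Y (cmp ?l z X Y) (MZero X Y)"
  proof (cases "isat m L Y")
   case True
   then obtain D C where Y: "Y = D @ L @ C" "length D = m" by (rule isatE)
   have "\<not> isat n N (D @ K @ C)"
   proof
    assume "isat n N (D @ K @ C)"
    hence "take (length N) (drop n D) = N" "n + length N \<le> length D" using m Y by (auto simp: isat_def)
    hence "isat n N D" by (simp add: isat_def)
    then obtain A B where "D = A @ N @ B" "length A = n" by (rule isatE)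
    thus False using False Y by auto
   qed
   thus ?thesis unfolding Y(1) using Y by (intro cmp_W_zero' cmp_W_zero t)
  qed (rule cmp_W_zero)
  have "Qeq z X Y (cmp ?r z X Y) (MZero X Y)"
  proof (cases "isat n N Y")
   case True
   then obtain A D where Y: "Y = A @ N @ D" "length A = n" by (rule isatE)
   have "\<not> isat ?m L (A @ M @ D)"
   proof
    assume "isat ?m L (A @ M @ D)"
    hence "isat (m - length N - n) L D" using m Y by (auto simp: isat_def)
    then obtain B C where "D = B @ L @ C" "length B = m - length N - n" by (rule isatE)
    thus False using False Y m by auto
   qed
   thus ?thesis unfolding Y(1) using Y by (intro cmp_W_zero' cmp_W_zero t)
  qed (rule cmp_W_zero)
  thus ?thesis using l cmp_zeros by (blast intro: mor_cong_refl tyI)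
 qed
qed

text \<open>Describing words letter by letter lets the condition on one strand pass through
  operators on the others.\<close>

definition at1 :: "Q_obj => nat => 'k::comm_ring_1 Qf => bool" where
 "at1 a n x \<longleftrightarrow> x \<in> supp (\<lambda>z X Y. n < length Y \<and> Y ! n = a)"

definition ats :: "nat => Q_obj list => 'k::comm_ring_1 Qf set" where
 "ats n M = supp (\<lambda>z X Y. isat n M Y)"

lemma isat_Cons: "isat n (a # M) Y \<longleftrightarrow> n < length Y \<and> Y ! n = a \<and> isat (Suc n) M Y"
 by (auto simp: isat_def simp flip: Cons_nth_drop_Suc)

lemma ats_Cons: "at1 a n x ==> x \<in> ats (Suc n) M ==> x \<in> ats n (a # M)"
 by (auto simp: at1_def ats_def supp_def isat_Cons)

lemma ats_single: "at1 a n x ==> x \<in> ats n [a]"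
 by (auto simp: at1_def ats_def supp_def isat_def take_Suc_conv_app_nth simp flip: Cons_nth_drop_Suc)

text \<open>The operator also projects to the components whose codomain contains \<open>M\<close> at
  position \<open>n\<close>, hence the condition on the support.\<close>

lemma W_MId:
 assumes "x \<in> ats n M"
 shows "W (MId M) M M n x = x"
proof (rule W_eqI[of n M])
 show "Qeq z X Y (cmp (W (MId M) M M n x) z X Y) (MZero X Y) \<and> Qeq z X Y (cmp x z X Y) (MZero X Y)"
  if "\<not> isat n M Y" for z X Y
  using that assms by (auto intro: cmp_W_zero suppD simp: ats_def)
 fix A B :: "Q_obj list" and z :: 'a and X assume n: "n = length A"
 let ?Y = "A @ M @ B"
 have "Qeq z X ?Y (pad A (MId M) B \<^bold>\<circ> cmp x z X ?Y) (cmp x z X ?Y)"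
  by (rule mor_cong_trans[OF mor_cong_comp_cong[OF pad_MId cmp_refl] mor_cong_comp_id_left[OF cmp_type]])
 thus "\<exists>f g. Qeq z X ?Y (cmp (W (MId M) M M n x) z X ?Y) f \<and> Qeq z X ?Y (cmp x z X ?Y) g \<and> Qeq z X ?Y f g"
  using cmp_W[of M M "MId M" z X A B x, OF tyI(2) cmp_refl] n by (blast intro: cmp_refl)
qed

lemma W_tens_MId_right:
 assumes f: "Qty M N f" and x: "x \<in> ats (n + length M) B"
 shows "W (f \<^bold>\<otimes> MId B) (M @ B) (N @ B) n x = W f M N n x"
proof (rule W_eqI[of n "N @ B"])
 have t: "Qty (M @ B) (N @ B) (f \<^bold>\<otimes> MId B)" by (intro tyI f)
 show "Qeq z X Y (cmp (W (f \<^bold>\<otimes> MId B) (M @ B) (N @ B) n x) z X Y) (MZero X Y) \<and>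
  Qeq z X Y (cmp (W f M N n x) z X Y) (MZero X Y)" if nY: "\<not> isat n (N @ B) Y" for z X Y
 proof (rule conjI[OF cmp_W_zero[OF nY]])
  show "Qeq z X Y (cmp (W f M N n x) z X Y) (MZero X Y)"
  proof (cases "isat n N Y")
   case True
   then obtain A D where Y: "Y = A @ N @ D" "length A = n" by (rule isatE)
   hence "\<not> isat (n + length M) B (A @ M @ D)" using nY by (auto simp: isat_def)
   thus ?thesis unfolding Y(1) using Y(2) x by (intro cmp_W_zero' f suppD) (auto simp: ats_def)
  qed (rule cmp_W_zero)
 qed
 fix A C :: "Q_obj list" and z :: 'a and X assume n: "n = length A"
 let ?Y = "A @ N @ B @ C" and ?h = "cmp x z X (A @ M @ B @ C)"
 have e: "Qeq z (M @ B @ C) (N @ B @ C) ((f \<^bold>\<otimes> MId B) \<^bold>\<otimes> MId C) (f \<^bold>\<otimes> MId (B @ C))"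
  by (rule mor_cong_trans[OF mor_cong_tens_assoc[OF f tyI(2) tyI(2)]
     mor_cong_tens_cong[OF mor_cong_refl[OF f] mor_cong_tens_id]])
 have "Qeq z (A @ M @ B @ C) ?Y (pad A (f \<^bold>\<otimes> MId B) C) (pad A f (B @ C))"
  unfolding pad_def by (rule MId_tens_cong[OF e])
 hence "Qeq z X ?Y (pad A (f \<^bold>\<otimes> MId B) C \<^bold>\<circ> ?h) (pad A f (B @ C) \<^bold>\<circ> ?h)"
  by (rule mor_cong_comp_cong[OF _ cmp_refl])
 moreover have "Qeq z X ?Y (cmp (W (f \<^bold>\<otimes> MId B) (M @ B) (N @ B) n x) z X ?Y) (pad A (f \<^bold>\<otimes> MId B) C \<^bold>\<circ> ?h)"
  using cmp_W[OF t cmp_refl, of z X A C x] n by simp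
 moreover have "Qeq z X ?Y (cmp (W f M N n x) z X ?Y) (pad A f (B @ C) \<^bold>\<circ> ?h)"
  using cmp_W[OF f cmp_refl, of z X A "B @ C" x] n by simp
 ultimately show "\<exists>u v. Qeq z X (A @ (N @ B) @ C) (cmp (W (f \<^bold>\<otimes> MId B) (M @ B) (N @ B) n x) z X (A @ (N @ B) @ C)) u \<and>
   Qeq z X (A @ (N @ B) @ C) (cmp (W f M N n x) z X (A @ (N @ B) @ C)) v \<and> Qeq z X (A @ (N @ B) @ C) u v"
  unfolding append_assoc by blast
qed

lemma W_tens_MId_left:
 assumes f: "Qty M N f" and x: "x \<in> ats n B"
 shows "W (MId B \<^bold>\<otimes> f) (B @ M) (B @ N) n x = W f M N (n + length B) x"
proof (rule W_eqI[of n "B @ N"])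
 have t: "Qty (B @ M) (B @ N) (MId B \<^bold>\<otimes> f)" by (intro tyI f)
 show "Qeq z X Y (cmp (W (MId B \<^bold>\<otimes> f) (B @ M) (B @ N) n x) z X Y) (MZero X Y) \<and>
  Qeq z X Y (cmp (W f M N (n + length B) x) z X Y) (MZero X Y)" if nY: "\<not> isat n (B @ N) Y" for z X Y
 proof (rule conjI[OF cmp_W_zero[OF nY]])
  show "Qeq z X Y (cmp (W f M N (n + length B) x) z X Y) (MZero X Y)"
  proof (cases "isat (n + length B) N Y")
   case True
   then obtain A D where Y: "Y = A @ N @ D" "length A = n + length B" by (rule isatE)
   have "\<not> isat n B A"
   proof
    assume "isat n B A"
    then obtain A' A'' where "A = A' @ B @ A''" "length A' = n" by (rule isatE)
    thus False using nY Y isat_append[of A' "B @ N" D] by simp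
   qed
   hence "\<not> isat n B (A @ M @ D)" using Y by (auto simp: isat_def)
   thus ?thesis unfolding Y(1) using Y(2) x by (intro cmp_W_zero' f suppD) (auto simp: ats_def)
  qed (rule cmp_W_zero)
 qed
 fix A C :: "Q_obj list" and z :: 'a and X assume n: "n = length A"
 let ?Y = "A @ B @ N @ C" and ?h = "cmp x z X (A @ B @ M @ C)"
 have f1: "Qty (M @ C) (N @ C) (f \<^bold>\<otimes> MId C)" by (intro tyI f)
 have "Qeq z (A @ B @ M @ C) ?Y (pad A (MId B \<^bold>\<otimes> f) C) (MId A \<^bold>\<otimes> MId B \<^bold>\<otimes> f \<^bold>\<otimes> MId C)"
  unfolding pad_def
  by (rule MId_tens_cong[OF mor_cong_tens_assoc[OF tyI(2) f tyI(2)]])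
 also have "Qeq z (A @ B @ M @ C) ?Y ... (pad (A @ B) f C)"
  unfolding pad_def by (rule mor_cong_sym[OF MId_append_tens[OF f1]])
 finally have "Qeq z X ?Y (pad A (MId B \<^bold>\<otimes> f) C \<^bold>\<circ> ?h) (pad (A @ B) f C \<^bold>\<circ> ?h)"
  by (rule mor_cong_comp_cong[OF _ cmp_refl])
 moreover have "Qeq z X ?Y (cmp (W (MId B \<^bold>\<otimes> f) (B @ M) (B @ N) n x) z X ?Y) (pad A (MId B \<^bold>\<otimes> f) C \<^bold>\<circ> ?h)"
  using cmp_W[OF t cmp_refl, of z X A C x] n by simp
 moreover have "Qeq z X ?Y (cmp (W f M N (n + length B) x) z X ?Y) (pad (A @ B) f C \<^bold>\<circ> ?h)"
  using cmp_W[OF f cmp_refl, of z X "A @ B" C x] n by simp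
 ultimately show "\<exists>u v. Qeq z X (A @ (B @ N) @ C) (cmp (W (MId B \<^bold>\<otimes> f) (B @ M) (B @ N) n x) z X (A @ (B @ N) @ C)) u \<and>
   Qeq z X (A @ (B @ N) @ C) (cmp (W f M N (n + length B) x) z X (A @ (B @ N) @ C)) v \<and> Qeq z X (A @ (B @ N) @ C) u v"
  unfolding append_assoc by blast
qed

lemma pad_scale_cmp:
 assumes f: "Qty M N f"
 shows "Qeq z X (A @ N @ B) (pad A (MScale c f) B \<^bold>\<circ> cmp x z X (A @ M @ B)) (MScale c (pad A f B \<^bold>\<circ> cmp x z X (A @ M @ B)))"
 by (rule mor_cong_trans[OF mor_cong_comp_cong[OF pad_scaled[OF f] cmp_refl] mor_cong_comp_scale_left[OF pad_type[OF f] cmp_type]])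

lemma W_scaled:
 assumes f: "Qty M N f"
 shows "W (MScale c f) M N n x = c *\<^sub>q W f M N n x"
proof (rule W_eqI[of n N])
 have cf: "Qty M N (MScale c f)" by (intro tyI f)
 fix A B :: "Q_obj list" and z :: 'a and X assume n: "n = length A"
 let ?Y = "A @ N @ B"
 show "\<exists>u v. Qeq z X ?Y (cmp (W (MScale c f) M N n x) z X ?Y) u \<and>
   Qeq z X ?Y (cmp (c *\<^sub>q W f M N n x) z X ?Y) v \<and> Qeq z X ?Y u v"
  using cmp_W[OF cf cmp_refl, of z X A B x] cmp_scale(1)[OF cmp_W[OF f cmp_refl, of z X A B x], of c]
   pad_scale_cmp[OF f, of z X A B c x] n by blast
qed (auto intro: cmp_W_zero cmp_zeros)

text \<open>Shaped for the one defining relation that contains the parameter: it holds with the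
  \<open>z\<close> of each component, hence \<open>zhat\<close>.\<close>

lemma W_added:
 assumes "\<And>z. Qeq z M N (MAdd f (MScale (- 1) g)) (MScale z h)" and t: "Qty M N f" "Qty M N g" "Qty M N h"
 shows "W f M N n x - W g M N n x = zhat (W h M N n x)"
proof (rule W_eqI[of n N])
 show "Qeq z X Y (cmp (W f M N n x - W g M N n x) z X Y) (MZero X Y) \<and>
   Qeq z X Y (cmp (zhat (W h M N n x)) z X Y) (MZero X Y)" if "\<not> isat n N Y" for z X Y
  using that Qm.subspace_diff[OF supp_subspace, of "W f M N n x" "\<lambda>z X Y. isat n N Y" "W g M N n x"]
  by (auto simp: supp_def intro: cmp_W_zero cmp_zeros)
 fix A B :: "Q_obj list" and z :: 'a and X assume n: "n = length A"
 let ?S = "A @ M @ B" and ?Y = "A @ N @ B" let ?x = "cmp x z X ?S" and ?p = "\<lambda>f. pad A f B \<^bold>\<circ> cmp x z X ?S"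
 note sc = pad_scale_cmp[of _ _ _ z X A B _ x]
 let ?g = "MScale (- 1) g" have g: "Qty M N ?g" by (intro tyI t)
 have "Qeq z X ?Y (?p (MAdd f ?g)) (MAdd (pad A f B) (pad A ?g B) \<^bold>\<circ> ?x)"
  by (rule mor_cong_comp_cong[OF pad_add[OF t(1) g] cmp_refl])
 also have "Qeq z X ?Y ... (MAdd (?p f) (?p ?g))"
  by (rule mor_cong_comp_add_left[OF pad_type[OF t(1)] pad_type[OF g] cmp_type])
 also have "Qeq z X ?Y ... (MAdd (?p f) (MScale (- 1) (?p g)))"
  by (rule mor_cong_add_cong[OF mor_cong_refl sc[OF t(2)]]) (rule tyI(6)[OF pad_type[OF t(1)] cmp_type])
 finally have "Qeq z X ?Y (MAdd (?p f) (MScale (- 1) (?p g))) (?p (MAdd f ?g))" by (rule mor_cong_sym)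
 also have "Qeq z X ?Y ... (?p (MScale z h))"
  by (rule mor_cong_comp_cong[OF pad_cong[OF assms(1)] cmp_refl])
 also have "Qeq z X ?Y ... (MScale z (?p h))" by (rule sc[OF t(3)])
 finally show "\<exists>u v. Qeq z X ?Y (cmp (W f M N n x - W g M N n x) z X ?Y) u \<and>
   Qeq z X ?Y (cmp (zhat (W h M N n x)) z X ?Y) v \<and> Qeq z X ?Y u v"
  using cmp_ab(2)[OF cmp_W[OF t(1) cmp_refl] cmp_ab(3)[OF cmp_W[OF t(2) cmp_refl]], of z X A B x]
   cmp_scale(2)[OF cmp_W[OF t(3) cmp_refl, of z X A B x]]
  unfolding n minus_Qf_def by blast
qed

section \<open>Diagram calculus\<close>

text \<open>The six generators, followed by the right cap \<open>oK\<close>, the crossing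
  \<open>oL\<close>, the crossing \<open>oD\<close> of two down strands obtained by rotation, and
  the Clifford token \<open>oS\<close> on a down strand.\<close>

datatype Q_op = oU | oV | oR | oC | oCap | oCup | oK | oL | oD | oS

fun odom :: "Q_op => Q_obj list" where
 "odom oU = [Up, Up]" | "odom oV = [Up, Up]" | "odom oR = [Up, Down]" | "odom oC = [Up]"
| "odom oCap = [Down, Up]" | "odom oCup = []" | "odom oK = [Up, Down]" | "odom oL = [Down, Up]"
| "odom oD = [Down, Down]" | "odom oS = [Down]"

fun ocod :: "Q_op => Q_obj list" where
 "ocod oU = [Up, Up]" | "ocod oV = [Up, Up]" | "ocod oR = [Down, Up]" | "ocod oC = [Up]"
| "ocod oCap = []" | "ocod oCup = [Up, Down]" | "ocod oK = []" | "ocod oL = [Up, Down]"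
| "ocod oD = [Down, Down]" | "ocod oS = [Down]"

fun omor :: "Q_op => 'k::comm_ring_1 Q_mor" where
 "omor oU = u\<^sup>+" | "omor oV = u\<^sup>-" | "omor oR = r\<^sup>-" | "omor oC = cl"
| "omor oCap = capL" | "omor oCup = cupL" | "omor oK = capR" | "omor oL = l\<^sup>+"
| "omor oD = (capL \<^bold>\<otimes> MId [Down, Down]) \<^bold>\<circ> (1\<^sub>\<down> \<^bold>\<otimes> l\<^sup>+ \<^bold>\<otimes> 1\<^sub>\<down>) \<^bold>\<circ> (MId [Down, Down] \<^bold>\<otimes> cupL)"
| "omor oS = (capL \<^bold>\<otimes> 1\<^sub>\<down>) \<^bold>\<circ> (1\<^sub>\<down> \<^bold>\<otimes> cl \<^bold>\<otimes> 1\<^sub>\<down>) \<^bold>\<circ> (1\<^sub>\<down> \<^bold>\<otimes> cupL)"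

definition opar :: "Q_op => bit" where "opar p = (if p = oC \<or> p = oS then 1 else 0)"

lemma Qhom_op: "Qhom (opar p) (odom p) (ocod p) (omor p)"
 apply (cases p)
 apply (simp_all only: opar_def omor.simps odom.simps ocod.simps capR_def lplus_def Q_op.distinct if_False if_True simp_thms)
 apply ((rule mor_homogI refl | (simp; fail))+)
 done

lemma opar_simps [simp]: "opar oC = 1" "opar oS = 1" "p \<noteq> oC ==> p \<noteq> oS ==> opar p = 0"
 by (auto simp: opar_def)

lemma Qty_op: "Qty (odom p) (ocod p) (omor p)"
 by (rule Qhom_type[OF Qhom_op])

definition Op :: "Q_op => nat => 'k::comm_ring_1 Qf => 'k Qf" where
 "Op p = W (omor p) (odom p) (ocod p)"

abbreviation opU (\<open>\<u>\<close>) where "\<u> \<equiv> Op oU"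
abbreviation opV (\<open>\<v>\<close>) where "\<v> \<equiv> Op oV"
abbreviation opR (\<open>\<r>\<close>) where "\<r> \<equiv> Op oR"
abbreviation opC (\<open>\<c>\<close>) where "\<c> \<equiv> Op oC"
abbreviation opCap (\<open>\<CC>\<close>) where "\<CC> \<equiv> Op oCap"
abbreviation opCup (\<open>\<UU>\<close>) where "\<UU> \<equiv> Op oCup"
abbreviation opK (\<open>\<k>\<close>) where "\<k> \<equiv> Op oK"
abbreviation opL (\<open>\<l>\<close>) where "\<l> \<equiv> Op oL"
abbreviation opD (\<open>\<d>\<close>) where "\<d> \<equiv> Op oD"
abbreviation opS (\<open>\<s>\<close>) where "\<s> \<equiv> Op oS"

lemma Op_hom: "module_hom Qscale Qscale (Op p n)"
 by unfold_locales (simp_all add: Op_def W_add W_scale Qty_op)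

lemma Op_zhat: "Op p n (zhat x) = zhat (Op p n x)"
 by (simp add: Op_def W_zhat Qty_op)

lemmas Op_lin [simp] = Modules.module_hom.add[OF Op_hom] Modules.module_hom.scale[OF Op_hom] Modules.module_hom.zero[OF Op_hom]
 Modules.module_hom.neg[OF Op_hom] Modules.module_hom.diff[OF Op_hom] Op_zhat

lemma Op_interchange:
 assumes "n + length (ocod p) \<le> m"
 shows "Op q m (Op p n x) = (if opar p = 1 \<and> opar q = 1 then - 1 else 1) *\<^sub>q Op p n (Op q (m - length (ocod p) + length (odom p)) x)"
 unfolding Op_def by (rule W_interchange[OF Qhom_op Qhom_op assms])

lemma Op_interchange_same:
 assumes "length (odom p) = length (ocod p)" "n + length (ocod p) \<le> m"
 shows "Op q m (Op p n x) = (if opar p = 1 \<and> opar q = 1 then - 1 else 1) *\<^sub>q Op p n (Op q m x)"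
 using Op_interchange[OF assms(2), of q x] assms by simp

lemmas inter =
 Op_interchange_same[of oU, simplified]
 Op_interchange_same[of oV, simplified]
 Op_interchange_same[of oR, simplified]
 Op_interchange_same[of oL, simplified]
 Op_interchange_same[of oD, simplified]
 Op_interchange_same[of oC, simplified]
 Op_interchange_same[of oS, simplified]
 Op_interchange[where p = oK, simplified]
 Op_interchange[where p = oCap, simplified]
 Op_interchange[where p = oCup, simplified]

lemma at1_cod: "k < length (ocod p) ==> at1 (ocod p ! k) (n + k) (Op p n x)"
 unfolding at1_def Op_def
 by (rule supp_W[OF Qty_op, where P = "\<lambda>z X Y. True"]) (auto simp: supp_def nth_append)

lemma at1_left: "m < n ==> at1 a m x ==> at1 a m (Op p n x)"
 unfolding at1_def Op_def by (erule supp_W[OF Qty_op]) (auto simp: nth_append)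

lemma at1_right:
 assumes "n + length (ocod p) \<le> m" "at1 a (m - length (ocod p) + length (odom p)) x"
 shows "at1 a m (Op p n x)"
 unfolding at1_def Op_def
proof (rule supp_W[OF Qty_op assms(2)[unfolded at1_def]])
 fix A B z X
 define k where "k = m - length (ocod p) - n"
 have "m = n + length (ocod p) + k" using assms(1) by (simp add: k_def)
 moreover assume "length A = n" "m - length (ocod p) + length (odom p) < length (A @ odom p @ B) \<and> (A @ odom p @ B) ! (m - length (ocod p) + length (odom p)) = a"
 ultimately show "m < length (A @ ocod p @ B) \<and> (A @ ocod p @ B) ! m = a" by (simp add: nth_append)
qed

lemma at1_right_same:
 "length (odom p) = length (ocod p) ==> n + length (ocod p) \<le> m ==> at1 a m x ==> at1 a m (Op p n x)"
 using at1_right[of n p m a x] by simp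

lemma at1_lin: "at1 a n x ==> at1 a n y ==> at1 a n (x + y)" "at1 a n x ==> at1 a n y ==> at1 a n (x - y)"
 "at1 a n x ==> at1 a n (- x)" "at1 a n x ==> at1 a n (c *\<^sub>q x)" "at1 a n x ==> at1 a n (zhat x)" "at1 a n 0"
 unfolding at1_def
 by (auto intro: Qm.subspace_add Qm.subspace_diff Qm.subspace_neg Qm.subspace_scale Qm.subspace_0 supp_subspace supp_zhat)

lemmas at1_Op [simp] = at1_left
 at1_right_same[of oU, simplified]
 at1_right_same[of oV, simplified]
 at1_right_same[of oR, simplified]
 at1_right_same[of oL, simplified]
 at1_right_same[of oD, simplified]
 at1_right_same[of oC, simplified]
 at1_right_same[of oS, simplified]
 at1_right[of _ oCap, simplified]
 at1_right[of _ oK, simplified]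
 at1_right[of _ oCup, simplified]
 at1_cod[of 0 oU, simplified] at1_cod[of 1 oU, simplified]
 at1_cod[of 0 oV, simplified] at1_cod[of 1 oV, simplified]
 at1_cod[of 0 oR, simplified] at1_cod[of 1 oR, simplified]
 at1_cod[of 0 oL, simplified] at1_cod[of 1 oL, simplified]
 at1_cod[of 0 oD, simplified] at1_cod[of 1 oD, simplified]
 at1_cod[of 0 oCup, simplified] at1_cod[of 1 oCup, simplified]
 at1_cod[of 0 oC, simplified]
 at1_cod[of 0 oS, simplified]

lemma W_op: "W (omor p) (odom p) (ocod p) n x = Op p n x"
 by (simp add: Op_def)
lemmas W_ops = W_op[of oU, simplified] W_op[of oV, simplified] W_op[of oR, simplified] W_op[of oC, simplified]
 W_op[of oCap, simplified] W_op[of oCup, simplified] W_op[of oK, simplified] W_op[of oL, simplified]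

lemmas Qhom_ops = Qhom_op[of oU, simplified] Qhom_op[of oV, simplified] Qhom_op[of oR, simplified] Qhom_op[of oC, simplified]
 Qhom_op[of oCap, simplified] Qhom_op[of oCup, simplified] Qhom_op[of oK, simplified] Qhom_op[of oL, simplified]
lemmas Qty_ops = Qhom_ops[THEN Qhom_type]

lemma W_left1: "Qty M N f ==> at1 a n x ==> L = a # M ==> K = a # N ==> W (MId [a] \<^bold>\<otimes> f) L K n x = W f M N (Suc n) x"
 using W_tens_MId_left[of M N f x n "[a]"] by (simp add: ats_single)

lemma W_right1: "Qty M N f ==> at1 a (n + length M) x ==> L = M @ [a] ==> K = N @ [a] ==> W (f \<^bold>\<otimes> MId [a]) L K n x = W f M N n x"
 using W_tens_MId_right[of M N f x n "[a]"] by (simp add: ats_single)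

lemma k_def: "\<k> n x = \<CC> n (\<r> n x)"
 unfolding Op_def omor.simps odom.simps ocod.simps capR_def by (rule W_comp[OF Qhom_ops(5) Qhom_ops(3)])

lemma W_rel:
 assumes "\<And>z. Q_rel z f g" "Qhom p M N f" "Qhom p M N g"
 shows "W f M N n x = W g M N n x"
 by (rule W_cong) (use assms in \<open>auto intro: mor_cong_rel dest: Qhom_type\<close>)

lemma ats2: "at1 a n x ==> at1 b (Suc n) x ==> x \<in> ats n [a, b]"
 by (simp add: ats_Cons ats_single)

lemma W_MId2: "at1 a n x ==> at1 b (Suc n) x ==> W (MId [a, b]) [a, b] [a, b] n x = x"
 by (rule W_MId[OF ats2])

lemma W_MId1: "at1 a n x ==> W (MId [a]) [a] [a] n x = x"
 by (rule W_MId[OF ats_single])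

section \<open>The defining relations as identities of operators\<close>

lemma vu [simp]: "at1 Up n x ==> at1 Up (Suc n) x ==> \<v> n (\<u> n x) = x"
 using W_rel[OF Q_rel.intros(1) homI(6)[OF Qhom_ops(2,1)], of n x] W_comp[OF Qhom_ops(2,1), of n x]
 by (simp add: W_MId2 W_ops homI)

lemma uv [simp]: "at1 Up n x ==> at1 Up (Suc n) x ==> \<u> n (\<v> n x) = x"
 using W_rel[OF Q_rel.intros(2) homI(6)[OF Qhom_ops(1,2)], of n x] W_comp[OF Qhom_ops(1,2), of n x]
 by (simp add: W_MId2 W_ops homI)

lemma lr [simp]: "at1 Up n x ==> at1 Down (Suc n) x ==> \<l> n (\<r> n x) = x"
 using W_rel[OF Q_rel.intros(3) homI(6)[OF Qhom_ops(8,3)], of n x] W_comp[OF Qhom_ops(8,3), of n x]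
 by (simp add: W_MId2 W_ops homI)

lemma rl [simp]: "at1 Down n x ==> at1 Up (Suc n) x ==> \<r> n (\<l> n x) = x"
 using W_rel[OF Q_rel.intros(4) homI(6)[OF Qhom_ops(3,8)], of n x] W_comp[OF Qhom_ops(3,8), of n x]
 by (simp add: W_MId2 W_ops homI)

lemma cc [simp]: "at1 Up n x ==> \<c> n (\<c> n x) = - x"
 using W_rel[OF Q_rel.intros(7), of 0 "[Up]" "[Up]" n x] homI(6)[OF Qhom_ops(4,4)] W_comp[OF Qhom_ops(4,4), of n x]
 by (simp add: W_MId1 W_ops homI W_scaled tyI)

lemma u_v:
 assumes "at1 Up n x" "at1 Up (Suc n) x"
 shows "\<u> n x - \<v> n x = zhat x"
proof -
 have "Qeq z [Up, Up] [Up, Up] (MAdd u\<^sup>+ (MScale (- 1) u\<^sup>-)) (MScale z (MId [Up, Up]))" for z :: 'a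
  by (rule mor_cong_rel[where R = "Q_rel z"]) (intro Q_rel.intros tyI Qty_ops)+
 from W_added[OF this] show ?thesis
  using assms by (simp add: W_MId2 W_ops tyI Qty_ops)
qed

lemma zig [simp]: "at1 Up n x ==> \<CC> (Suc n) (\<UU> n x) = x"
proof -
 assume x: "at1 Up n x"
 have h: "Qhom 0 [Up, Down, Up] [Up] (1\<^sub>\<up> \<^bold>\<otimes> capL)" "Qhom 0 [Up] [Up, Down, Up] (cupL \<^bold>\<otimes> 1\<^sub>\<up>)"
  using homI(7)[OF homI(2) Qhom_ops(5), of "[Up]"] homI(7)[OF Qhom_ops(6) homI(2), of "[Up]"]
  by simp_all
 have "W ((1\<^sub>\<up> \<^bold>\<otimes> capL) \<^bold>\<circ> (cupL \<^bold>\<otimes> 1\<^sub>\<up>)) [Up] [Up] n x = W 1\<^sub>\<up> [Up] [Up] n x"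
  by (rule W_rel[OF Q_rel.intros(11), of 0]) (use homI(6)[OF h] in \<open>auto intro: homI\<close>)
 thus ?thesis using x
  by (simp add: W_comp[OF h] W_MId1 W_right1[OF Qty_ops(6)] W_left1[OF Qty_ops(5)] W_ops)
qed

lemma zag [simp]: "at1 Down n x ==> \<CC> n (\<UU> (Suc n) x) = x"
proof -
 assume x: "at1 Down n x"
 have h: "Qhom 0 [Down, Up, Down] [Down] (capL \<^bold>\<otimes> 1\<^sub>\<down>)" "Qhom 0 [Down] [Down, Up, Down] (1\<^sub>\<down> \<^bold>\<otimes> cupL)"
  using homI(7)[OF Qhom_ops(5) homI(2), of "[Down]"] homI(7)[OF homI(2) Qhom_ops(6), of "[Down]"]
  by simp_all
 have "W ((capL \<^bold>\<otimes> 1\<^sub>\<down>) \<^bold>\<circ> (1\<^sub>\<down> \<^bold>\<otimes> cupL)) [Down] [Down] n x = W 1\<^sub>\<down> [Down] [Down] n x"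
  by (rule W_rel[OF Q_rel.intros(12), of 0]) (use homI(6)[OF h] in \<open>auto intro: homI\<close>)
 thus ?thesis using x
  by (simp add: W_comp[OF h] W_MId1 W_right1[OF Qty_ops(5)] W_left1[OF Qty_ops(6)] W_ops)
qed

lemma W_MZero: "W (MZero M N) M N n x = (0 :: 'k::comm_ring_1 Qf)"
proof -
 have "W (MScale 0 (MZero M N)) M N n x = (0 :: 'k Qf)"
  by (simp add: W_scaled tyI)
 moreover have "W (MScale 0 (MZero M N)) M N n x = (W (MZero M N) M N n x :: 'k Qf)"
  by (rule W_cong) (rule m_scale_zero)
 ultimately show ?thesis by simp
qed

lemma k_cup [simp]: "\<k> n (\<UU> n x) = 0"
 using W_rel[OF Q_rel.intros(10) homI(6)[OF Qhom_ops(7,6)], of n x] W_comp[OF Qhom_ops(7,6), of n x]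
 by (simp add: W_MZero W_ops homI)

lemma k_c_cup [simp]: "\<k> n (\<c> n (\<UU> n x)) = 0"
proof -
 have h: "Qhom 1 [Up, Down] [Up, Down] (cl \<^bold>\<otimes> 1\<^sub>\<down>)" using homI(7)[OF Qhom_ops(4) homI(2), of "[Down]"] by simp
 have h': "Qhom 1 [] [Up, Down] ((cl \<^bold>\<otimes> 1\<^sub>\<down>) \<^bold>\<circ> cupL)" using homI(6)[OF h Qhom_ops(6)] by simp
 have "W (capR \<^bold>\<circ> (cl \<^bold>\<otimes> 1\<^sub>\<down>) \<^bold>\<circ> cupL) [] [] n x = W (MZero [] []) [] [] n x"
  by (rule W_rel[OF Q_rel.intros(9), of 1]) (use homI(6)[OF Qhom_ops(7) h'] in \<open>auto intro: homI\<close>)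
 thus ?thesis by (simp add: W_comp[OF Qhom_ops(7) h'] W_comp[OF h Qhom_ops(6)] W_MZero W_ops W_right1[OF Qty_ops(4)])
qed

lemma u_c0: "at1 Up (Suc n) x ==> \<u> n (\<c> n x) = \<c> (Suc n) (\<u> n x)"
proof -
 assume x: "at1 Up (Suc n) x"
 have h: "Qhom 1 [Up, Up] [Up, Up] (cl \<^bold>\<otimes> 1\<^sub>\<up>)" "Qhom 1 [Up, Up] [Up, Up] (1\<^sub>\<up> \<^bold>\<otimes> cl)"
  using homI(7)[OF Qhom_ops(4) homI(2), of "[Up]"] homI(7)[OF homI(2) Qhom_ops(4), of "[Up]"]
  by simp_all
 have "W (u\<^sup>+ \<^bold>\<circ> (cl \<^bold>\<otimes> 1\<^sub>\<up>)) [Up, Up] [Up, Up] n x = W ((1\<^sub>\<up> \<^bold>\<otimes> cl) \<^bold>\<circ> u\<^sup>+) [Up, Up] [Up, Up] n x"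
  by (rule W_rel[OF Q_rel.intros(8), of 1]) (use homI(6)[OF Qhom_ops(1) h(1)] homI(6)[OF h(2) Qhom_ops(1)] in auto)
 thus ?thesis using x
  by (simp add: W_comp[OF Qhom_ops(1) h(1)] W_comp[OF h(2) Qhom_ops(1)] W_right1[OF Qty_ops(4)] W_left1[OF Qty_ops(4)] W_ops)
qed

lemma u_braid0: "at1 Up n x ==> at1 Up (Suc (Suc n)) x ==> \<u> n (\<u> (Suc n) (\<u> n x)) = \<u> (Suc n) (\<u> n (\<u> (Suc n) x))"
proof -
 assume x: "at1 Up (Suc (Suc n)) x" "at1 Up n x"
 let ?O = "[Up, Up, Up]"
 have h: "Qhom 0 ?O ?O (u\<^sup>+ \<^bold>\<otimes> 1\<^sub>\<up>)" "Qhom 0 ?O ?O (1\<^sub>\<up> \<^bold>\<otimes> u\<^sup>+)"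
  using homI(7)[OF Qhom_ops(1) homI(2), of "[Up]"] homI(7)[OF homI(2) Qhom_ops(1), of "[Up]"]
  by simp_all
 have hh: "Qhom 0 ?O ?O ((1\<^sub>\<up> \<^bold>\<otimes> u\<^sup>+) \<^bold>\<circ> (u\<^sup>+ \<^bold>\<otimes> 1\<^sub>\<up>))" "Qhom 0 ?O ?O ((u\<^sup>+ \<^bold>\<otimes> 1\<^sub>\<up>) \<^bold>\<circ> (1\<^sub>\<up> \<^bold>\<otimes> u\<^sup>+))"
  using homI(6)[OF h(2,1)] homI(6)[OF h] by simp_all
 have "W ((u\<^sup>+ \<^bold>\<otimes> 1\<^sub>\<up>) \<^bold>\<circ> (1\<^sub>\<up> \<^bold>\<otimes> u\<^sup>+) \<^bold>\<circ> (u\<^sup>+ \<^bold>\<otimes> 1\<^sub>\<up>)) ?O ?O n x = W ((1\<^sub>\<up> \<^bold>\<otimes> u\<^sup>+) \<^bold>\<circ> (u\<^sup>+ \<^bold>\<otimes> 1\<^sub>\<up>) \<^bold>\<circ> (1\<^sub>\<up> \<^bold>\<otimes> u\<^sup>+)) ?O ?O n x"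
  by (rule W_rel[OF Q_rel.intros(5), of 0]) (use homI(6)[OF h(1) hh(1)] homI(6)[OF h(2) hh(2)] in auto)
 thus ?thesis using x
  by (simp add: W_comp[OF h(1) hh(1)] W_comp[OF h(2) hh(2)] W_comp[OF h] W_comp[OF h(2,1)] W_right1[OF Qty_ops(1)] W_left1[OF Qty_ops(1)] W_ops)
qed

lemma l_def: "at1 Down n x ==> at1 Up (Suc n) x ==> \<l> n x = \<CC> n (\<u> (Suc n) (\<UU> (Suc (Suc n)) x))"
proof -
 assume x: "at1 Down n x" "at1 Up (Suc n) x"
 let ?A = "[Down, Up, Up, Down]"
 have h: "Qhom 0 ?A [Up, Down] (capL \<^bold>\<otimes> 1\<^sub>\<up> \<^bold>\<otimes> 1\<^sub>\<down>)" "Qhom 0 ?A ?A (1\<^sub>\<down> \<^bold>\<otimes> u\<^sup>+ \<^bold>\<otimes> 1\<^sub>\<down>)" "Qhom 0 [Down, Up] ?A (1\<^sub>\<down> \<^bold>\<otimes> 1\<^sub>\<up> \<^bold>\<otimes> cupL)"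
  by ((rule mor_homogI refl | (simp; fail))+)
 have hh: "Qhom 0 [Down, Up] ?A ((1\<^sub>\<down> \<^bold>\<otimes> u\<^sup>+ \<^bold>\<otimes> 1\<^sub>\<down>) \<^bold>\<circ> (1\<^sub>\<down> \<^bold>\<otimes> 1\<^sub>\<up> \<^bold>\<otimes> cupL))"
  using homI(6)[OF h(2,3)] by simp
 have t: "Qty [Up, Up, Down] [Up, Up, Down] (u\<^sup>+ \<^bold>\<otimes> 1\<^sub>\<down>)" "Qty [Up] [Up, Up, Down] (1\<^sub>\<up> \<^bold>\<otimes> cupL)"
  using tyI(7)[OF Qty_ops(1) tyI(2), of "[Down]"] tyI(7)[OF tyI(2) Qty_ops(6), of "[Up]"] by simp_all
 have e: "W (capL \<^bold>\<otimes> 1\<^sub>\<up> \<^bold>\<otimes> 1\<^sub>\<down>) ?A [Up, Down] n y = \<CC> n y" if y: "at1 Up (Suc (Suc n)) y" "at1 Down (Suc (Suc (Suc n))) y" for y :: "'a Qf"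
 proof -
  have "W (capL \<^bold>\<otimes> 1\<^sub>\<up> \<^bold>\<otimes> 1\<^sub>\<down>) ?A [Up, Down] n y = W (capL \<^bold>\<otimes> MId [Up, Down]) ?A [Up, Down] n y"
   by (rule W_cong) (use mor_cong_tens_cong[OF mor_cong_refl[OF Qty_ops(5)] mor_cong_tens_id[of _ _ "[Up]" "[Down]"]] in simp)
  also have "... = \<CC> n y" using W_tens_MId_right[OF Qty_ops(5), of y n "[Up, Down]"] y by (simp add: ats2 W_ops)
  finally show ?thesis .
 qed
 show ?thesis
  using x unfolding W_ops(8)[symmetric]
  by (simp add: lplus_def W_comp[OF h(1) hh] W_comp[OF h(2,3)] e W_left1[OF t(1)] W_left1[OF t(2)] W_right1[OF Qty_ops(1)] W_left1[OF Qty_ops(6)] W_ops)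
qed

lemma d_def: "at1 Down n x ==> at1 Down (Suc n) x ==> \<d> n x = \<CC> n (\<l> (Suc n) (\<UU> (Suc (Suc n)) x))"
proof -
 assume x: "at1 Down n x" "at1 Down (Suc n) x"
 let ?A = "[Down, Down, Up, Down]" and ?B = "[Down, Up, Down, Down]"
 have h: "Qhom 0 ?B [Down, Down] (capL \<^bold>\<otimes> MId [Down, Down])" "Qhom 0 ?A ?B (1\<^sub>\<down> \<^bold>\<otimes> l\<^sup>+ \<^bold>\<otimes> 1\<^sub>\<down>)"
  "Qhom 0 [Down, Down] ?A (MId [Down, Down] \<^bold>\<otimes> cupL)"
  unfolding lplus_def by ((rule mor_homogI refl | (simp; fail))+)
 have hh: "Qhom 0 [Down, Down] ?B ((1\<^sub>\<down> \<^bold>\<otimes> l\<^sup>+ \<^bold>\<otimes> 1\<^sub>\<down>) \<^bold>\<circ> (MId [Down, Down] \<^bold>\<otimes> cupL))"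
  using homI(6)[OF h(2,3)] by simp
 have t: "Qty [Down, Up, Down] [Up, Down, Down] (l\<^sup>+ \<^bold>\<otimes> 1\<^sub>\<down>)"
  using tyI(7)[OF Qty_ops(8) tyI(2), of "[Down]"] by simp
 show ?thesis
  using x W_op[of oD n x]
  by (simp add: W_comp[OF h(1) hh] W_comp[OF h(2,3)] W_left1[OF t] W_right1[OF Qty_ops(8)] W_ops
   W_tens_MId_right[OF Qty_ops(5), of _ n "[Down, Down]", simplified] W_tens_MId_left[OF Qty_ops(6), of _ n "[Down, Down]", simplified] ats2)
qed

lemma s_def: "at1 Down n x ==> \<s> n x = \<CC> n (\<c> (Suc n) (\<UU> (Suc n) x))"
proof -
 assume x: "at1 Down n x"
 let ?A = "[Down, Up, Down]"
 have h: "Qhom 0 ?A [Down] (capL \<^bold>\<otimes> 1\<^sub>\<down>)" "Qhom 1 ?A ?A (1\<^sub>\<down> \<^bold>\<otimes> cl \<^bold>\<otimes> 1\<^sub>\<down>)" "Qhom 0 [Down] ?A (1\<^sub>\<down> \<^bold>\<otimes> cupL)"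
  by ((rule mor_homogI refl | (simp; fail))+)
 have hh: "Qhom 1 [Down] ?A ((1\<^sub>\<down> \<^bold>\<otimes> cl \<^bold>\<otimes> 1\<^sub>\<down>) \<^bold>\<circ> (1\<^sub>\<down> \<^bold>\<otimes> cupL))"
  using homI(6)[OF h(2,3)] by simp
 have t: "Qty [Up, Down] [Up, Down] (cl \<^bold>\<otimes> 1\<^sub>\<down>)"
  using tyI(7)[OF Qty_ops(4) tyI(2), of "[Down]"] by simp
 show ?thesis
  using x W_op[of oS n x]
  by (simp add: W_comp[OF h(1) hh] W_comp[OF h(2,3)] W_left1[OF t] W_right1[OF Qty_ops(4)] W_right1[OF Qty_ops(5)] W_left1[OF Qty_ops(6)] W_ops)
qed

text \<open>
 The rules \<open>inter\<close> move operators further left to the outside; together with the zigzag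
 relations this makes most identities of diagrams automatic.
\<close>

lemma l_cup_u: "at1 Up n x ==> \<l> (Suc n) (\<UU> n x) = \<u> n (\<UU> (Suc n) x)"
 by (simp add: l_def inter)

lemma d_cup: "at1 Down n x ==> \<d> (Suc n) (\<UU> n x) = \<l> n (\<UU> (Suc n) x)"
 by (simp add: d_def inter)

lemma cap_l: "at1 Down n x ==> at1 Up (Suc n) x ==> at1 Up (Suc (Suc n)) x ==> \<CC> (Suc n) (\<l> n x) = \<CC> n (\<u> (Suc n) x)"
 by (simp add: l_def inter)

lemma cap_d: "at1 Down n x ==> at1 Down (Suc n) x ==> at1 Up (Suc (Suc n)) x ==> \<CC> (Suc n) (\<d> n x) = \<CC> n (\<l> (Suc n) x)"
 by (simp add: d_def inter)

lemma s_cup: "\<s> (Suc n) (\<UU> n x) = \<c> n (\<UU> n x)"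
 by (simp add: s_def inter)

lemma cap_s: "at1 Down n x ==> at1 Up (Suc n) x ==> \<CC> n (\<s> n x) = \<CC> n (\<c> (Suc n) x)"
 by (simp add: s_def inter)

lemma l_l: "at1 Down n x ==> at1 Up (Suc n) x ==> at1 Up (Suc (Suc n)) x ==>
 \<l> (Suc n) (\<l> n x) = \<CC> n (\<u> (Suc n) (\<u> (Suc (Suc n)) (\<UU> (Suc (Suc (Suc n))) x)))"
 by (simp add: l_def inter)

text \<open>A down strand slides past a crossing of two up strands: after bending the down strand
  this is the braid relation.\<close>

lemma u_l_l: "at1 Down n x ==> at1 Up (Suc n) x ==> at1 Up (Suc (Suc n)) x ==>
 \<u> n (\<l> (Suc n) (\<l> n x)) = \<l> (Suc n) (\<l> n (\<u> (Suc n) x))"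
 by (simp add: l_l inter u_braid0[symmetric])

lemma u_u: "at1 Up n x ==> at1 Up (Suc n) x ==> \<u> n (\<u> n x) = zhat (\<u> n x) + x"
 using u_v[of n "\<u> n x"] by (simp add: algebra_simps)

lemma v_eq: "at1 Up n x ==> at1 Up (Suc n) x ==> \<v> n x = \<u> n x - zhat x"
 using u_v[of n x] by (simp add: algebra_simps)

lemma zhat_lin [simp]: "zhat (x + y) = zhat x + zhat y" "zhat (c *\<^sub>q x) = c *\<^sub>q zhat x" "zhat 0 = 0"
 "zhat (- x) = - zhat x" "zhat (x - y) = zhat x - zhat y"
proof -
 show add: "zhat (x + y) = zhat x + zhat y" for x y
  by (rule Qf_eqI, intro exI conjI, (rule cmp_ab cmp_scale cmp_refl)+, rule mor_cong_scale_add_right) (rule cmp_type)+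
 show z: "zhat 0 = 0" using add[of 0 0] by simp
 show neg: "zhat (- x) = - zhat x" for x using add[of x "- x", symmetric] z by (simp add: eq_neg_iff_add_eq_0 add.commute)
 show "zhat (x - y) = zhat x - zhat y" using add[of x "- y"] neg by simp
 show "zhat (c *\<^sub>q x) = c *\<^sub>q zhat x"
 proof (rule Qf_eqI, intro exI conjI, (rule cmp_ab cmp_scale cmp_refl)+)
  fix z X Y
  have "Qeq z X Y (MScale z (MScale c (cmp x z X Y))) (MScale (c * z) (cmp x z X Y))"
   using mor_cong_sym[OF mor_cong_scale_scale[OF cmp_type[of X Y x z], of "Q_rel z" z c]] by (simp add: mult.commute)
  thus "Qeq z X Y (MScale z (MScale c (cmp x z X Y))) (MScale c (MScale z (cmp x z X Y)))"
   using mor_cong_trans mor_cong_scale_scale[OF cmp_type] by blast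
 qed
qed

lemma u_c1: "at1 Up n x ==> at1 Up (Suc n) x ==> \<u> n (\<c> (Suc n) x) = \<c> n (\<u> n x) - zhat (\<c> n x) + zhat (\<c> (Suc n) x)"
proof -
 assume x: "at1 Up n x" "at1 Up (Suc n) x"
 have "\<u> n (\<c> (Suc n) x) = \<u> n (\<c> (Suc n) (\<u> n (\<v> n x)))" using x by simp
 also have "... = \<u> n (\<u> n (\<c> n (\<v> n x)))" by (simp add: u_c0)
 also have "... = zhat (\<c> (Suc n) (\<u> n (\<v> n x))) + \<c> n (\<v> n x)" by (subst u_u) (simp_all add: u_c0)
 also have "... = zhat (\<c> (Suc n) x) + \<c> n (\<v> n x)" using x by simp
 finally show ?thesis using x by (simp add: v_eq)
qed

lemma d_l_l: "at1 Down n x ==> at1 Down (Suc n) x ==> at1 Up (Suc (Suc n)) x ==>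
 \<d> (Suc n) (\<l> n (\<l> (Suc n) x)) = \<l> n (\<l> (Suc n) (\<d> n x))"
proof -
 let ?i = "Suc n" and ?j = "Suc (Suc n)" and ?k = "Suc (Suc (Suc n))"
 assume x: "at1 Down n x" "at1 Down ?i x" "at1 Up ?j x"
 have "\<d> ?i (\<l> n (\<l> ?i x)) = \<CC> ?i (\<l> n (\<l> ?j (\<l> ?i (\<UU> ?k x))))"
  using x by (simp add: d_def inter)
 also have "... = \<CC> n (\<u> ?i (\<l> ?j (\<l> ?i (\<UU> ?k x))))" using x by (simp add: cap_l)
 also have "... = \<CC> n (\<l> ?j (\<l> ?i (\<l> ?k (\<UU> ?j x))))" using x by (simp add: u_l_l l_cup_u)
 also have "... = \<l> n (\<l> ?i (\<d> n x))" using x by (simp add: d_def inter)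
 finally show ?thesis .
qed

lemma cap2_d: "at1 Down n x ==> at1 Down (Suc n) x ==> at1 Up (Suc (Suc n)) x ==> at1 Up (Suc (Suc (Suc n))) x ==>
 \<CC> n (\<CC> (Suc n) (\<d> n x)) = \<CC> n (\<CC> (Suc n) (\<u> (Suc (Suc n)) x))"
 by (simp add: cap_d inter cap_l)

text \<open>A crossing of the two down ends of nested cups travels around to their up ends.\<close>

lemma cup2_d: "\<d> (Suc (Suc n)) (\<UU> (Suc n) (\<UU> n x)) = \<u> n (\<UU> (Suc n) (\<UU> n x))"
proof -
 have "\<u> n (\<UU> (Suc n) (\<UU> n x)) = \<l> (Suc n) (\<UU> (Suc (Suc n)) (\<UU> n x))"
  by (simp add: l_cup_u[symmetric] inter)
 also have "... = \<d> (Suc (Suc n)) (\<UU> (Suc n) (\<UU> n x))" by (simp only: d_cup at1_Op)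
 finally show ?thesis by simp
qed

lemma zag2: "at1 Down n x ==> at1 Down (Suc n) x ==>
 \<CC> n (\<CC> (Suc n) (\<UU> (Suc (Suc (Suc n))) (\<UU> (Suc (Suc n)) x))) = x"
 by (simp flip: inter(9)[of "Suc n" "Suc n" oCup])

text \<open>The expressions in the last premise reduce to \<open>x\<close> and \<open>y\<close> by
  \<open>zag2\<close>. Written with caps and cups, however, crossings and tokens on down strands
  travel through the caps to up strands, where the defining relations apply.\<close>

lemma down2_ext:
 assumes "at1 Down n x" "at1 Down (Suc n) x" "at1 Down n y" "at1 Down (Suc n) y"
  and "\<CC> n (\<CC> (Suc n) (\<UU> (Suc (Suc (Suc n))) (\<UU> (Suc (Suc n)) x))) = \<CC> n (\<CC> (Suc n) (\<UU> (Suc (Suc (Suc n))) (\<UU> (Suc (Suc n)) y)))"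
 shows "x = y"
 using assms by (simp add: zag2)

lemma d_d: "at1 Down n x ==> at1 Down (Suc n) x ==> \<d> n (\<d> n x) = zhat (\<d> n x) + x"
 by (rule down2_ext[of n]) (simp_all add: at1_lin inter cap2_d u_u)

lemma d_s0: "at1 Down n x ==> at1 Down (Suc n) x ==> \<d> n (\<s> n x) = \<s> (Suc n) (\<d> n x)"
 by (rule down2_ext[of n]) (simp_all add: at1_lin inter cap2_d cap_s u_c0)

text \<open>The sign from interchanging the two odd tokens compensates the square \<open>- 1\<close>
  of the token on an up strand.\<close>

lemma ss: "at1 Down n x ==> \<s> n (\<s> n x) = x"
proof -
 assume x: "at1 Down n x"
 have "\<s> n (\<s> n x) = \<CC> n (\<c> (Suc n) (\<UU> (Suc n) (\<s> n x)))" by (simp add: s_def[of n "\<s> n x"])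
 also have "... = - \<CC> n (\<s> n (\<c> (Suc n) (\<UU> (Suc n) x)))" by (simp add: inter)
 also have "... = x" using x by (simp add: cap_s)
 finally show ?thesis .
qed

lemma zag3: "at1 Down n x ==> at1 Down (Suc n) x ==> at1 Down (Suc (Suc n)) x ==>
 \<CC> n (\<CC> (Suc n) (\<CC> (Suc (Suc n)) (\<UU> (Suc (Suc (Suc (Suc (Suc n))))) (\<UU> (Suc (Suc (Suc (Suc n)))) (\<UU> (Suc (Suc (Suc n))) x))))) = x"
 by (simp add: zag2 flip: inter(9)[of "Suc (Suc n)" "Suc (Suc (Suc n))" oCup] inter(9)[of "Suc (Suc n)" "Suc (Suc n)" oCup])

lemma cap3_d: "at1 Down n x ==> at1 Down (Suc n) x ==> at1 Down (Suc (Suc n)) x ==>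
 at1 Up (Suc (Suc (Suc n))) x ==> at1 Up (Suc (Suc (Suc (Suc n)))) x ==> at1 Up (Suc (Suc (Suc (Suc (Suc n))))) x ==>
 \<CC> n (\<CC> (Suc n) (\<d> n (\<CC> (Suc (Suc n)) x))) = \<CC> n (\<CC> (Suc n) (\<CC> (Suc (Suc n)) (\<u> (Suc (Suc (Suc (Suc n)))) x)))"
 by (simp add: cap2_d inter)

lemma d_braid: "at1 Down n x ==> at1 Down (Suc n) x ==> at1 Down (Suc (Suc n)) x ==>
 \<d> n (\<d> (Suc n) (\<d> n x)) = \<d> (Suc n) (\<d> n (\<d> (Suc n) x))"
proof -
 let ?e = "\<lambda>x. \<CC> n (\<CC> (Suc n) (\<CC> (Suc (Suc n)) (\<UU> (Suc (Suc (Suc (Suc (Suc n))))) (\<UU> (Suc (Suc (Suc (Suc n)))) (\<UU> (Suc (Suc (Suc n))) x)))))"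
 assume x: "at1 Down n x" "at1 Down (Suc n) x" "at1 Down (Suc (Suc n)) x"
 have "?e (\<d> n (\<d> (Suc n) (\<d> n x))) = ?e (\<d> (Suc n) (\<d> n (\<d> (Suc n) x)))"
  using x by (simp add: inter cap3_d cap2_d u_braid0)
 thus ?thesis using x by (simp add: zag3)
qed

lemma k_l: "at1 Down n x ==> at1 Up (Suc n) x ==> \<k> n (\<l> n x) = \<CC> n x"
 by (simp add: k_def)

text \<open>\<open>w\<close> has its down strand on the left. In terms of \<open>w\<close> both
  right caps become left caps by \<open>k_l\<close>, and a crossing slides past the down strand by
  \<open>u_l_l\<close>. The proof of \<open>k_d\<close> follows the same pattern.\<close>

lemma k_r: "at1 Up n x ==> at1 Up (Suc n) x ==> at1 Down (Suc (Suc n)) x ==> \<k> n (\<r> (Suc n) x) = \<k> (Suc n) (\<v> n x)"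
proof -
 assume x: "at1 Up n x" "at1 Up (Suc n) x" "at1 Down (Suc (Suc n)) x"
 define w where "w = \<r> n (\<r> (Suc n) (\<v> n x))"
 have w: "at1 Down n w" "at1 Up (Suc n) w" "at1 Up (Suc (Suc n)) w" using x by (simp_all add: w_def)
 have "\<v> n x = \<l> (Suc n) (\<l> n w)" using x by (simp add: w_def)
 moreover from this have "x = \<u> n (\<l> (Suc n) (\<l> n w))" using x by (metis uv)
 ultimately show ?thesis using w by (simp add: u_l_l k_l cap_l)
qed

lemma k_d: "at1 Up n x ==> at1 Down (Suc n) x ==> at1 Down (Suc (Suc n)) x ==> \<k> (Suc n) (\<r> n (\<d> (Suc n) x)) = \<k> n x"
proof -
 assume x: "at1 Up n x" "at1 Down (Suc n) x" "at1 Down (Suc (Suc n)) x"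
 define w where "w = \<r> (Suc n) (\<r> n x)"
 have w: "at1 Down n w" "at1 Down (Suc n) w" "at1 Up (Suc (Suc n)) w" using x by (simp_all add: w_def)
 have "x = \<l> n (\<l> (Suc n) w)" using x by (simp add: w_def)
 thus ?thesis using w by (simp add: d_l_l k_l cap_d)
qed

lemma k2_d: "at1 Up n x ==> at1 Up (Suc n) x ==> at1 Down (Suc (Suc n)) x ==> at1 Down (Suc (Suc (Suc n))) x ==>
 \<k> n (\<k> (Suc n) (\<d> (Suc (Suc n)) x)) = \<k> n (\<k> (Suc n) (\<u> n x))"
proof -
 assume x: "at1 Up n x" "at1 Up (Suc n) x" "at1 Down (Suc (Suc n)) x" "at1 Down (Suc (Suc (Suc n))) x"
 define y where "y = \<u> n x"
 have y: "at1 Up n y" "at1 Up (Suc n) y" "at1 Down (Suc (Suc n)) y" "at1 Down (Suc (Suc (Suc n))) y" and xy: "x = \<v> n y"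
  using x by (simp_all add: y_def)
 have "\<k> n (\<k> (Suc n) (\<d> (Suc (Suc n)) (\<v> n y))) = \<k> n (\<k> (Suc n) (\<v> n (\<d> (Suc (Suc n)) y)))"
  by (simp add: inter)
 also have "... = \<k> n (\<k> n (\<r> (Suc n) (\<d> (Suc (Suc n)) y)))" using y by (simp add: k_r)
 also have "... = \<k> n (\<k> (Suc n) y)" using y by (simp add: inter k_d)
 finally show ?thesis unfolding xy using y by simp
qed

lemma l_c1: "at1 Down n x ==> at1 Up (Suc n) x ==> \<l> n (\<c> (Suc n) x) = \<c> n (\<l> n x)"
 by (simp add: l_def inter u_c0)

text \<open>The token does not pass this crossing freely: \<open>u_c1\<close> leaves two terms in
  which the strands are reconnected by a cap and a cup. A right cap kills both, which is how
  \<open>k_s\<close> follows.\<close>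

lemma s_l: "at1 Down n x ==> at1 Up (Suc n) x ==>
 \<s> (Suc n) (\<l> n x) = \<l> n (\<s> n x) + zhat (\<c> n (\<UU> n (\<CC> n x))) - zhat (\<UU> n (\<CC> n (\<c> (Suc n) x)))"
proof -
 assume x: "at1 Down n x" "at1 Up (Suc n) x"
 let ?j = "Suc (Suc n)"
 have 1: "\<CC> n (\<c> ?j (\<UU> ?j y)) = \<c> n (\<UU> n (\<CC> n y))" "\<CC> n (\<UU> ?j y) = \<UU> n (\<CC> n y)" for y :: "'a Qf"
  by (simp_all add: inter)
 have "\<s> (Suc n) (\<l> n x) = \<CC> n (\<u> (Suc n) (\<c> ?j (\<UU> ?j x)))"
  using x by (simp add: l_def inter s_cup)
 also have "... = \<CC> n (\<c> (Suc n) (\<u> (Suc n) (\<UU> ?j x))) - zhat (\<CC> n (\<c> (Suc n) (\<UU> ?j x))) + zhat (\<c> n (\<UU> n (\<CC> n x)))"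
  using x by (simp add: u_c1 1)
 also have "\<CC> n (\<c> (Suc n) (\<u> (Suc n) (\<UU> ?j x))) = \<l> n (\<s> n x)"
  using x cap_s[of n "\<u> (Suc n) (\<UU> ?j x)"] by (simp add: l_def inter)
 also have "\<CC> n (\<c> (Suc n) (\<UU> ?j x)) = \<UU> n (\<CC> n (\<c> (Suc n) x))"
  using 1(2)[of "\<c> (Suc n) x"] by (simp add: inter)
 finally show ?thesis by (simp add: algebra_simps)
qed

lemma k_s: "at1 Up n x ==> at1 Down (Suc n) x ==> \<k> n (\<s> (Suc n) x) = \<k> n (\<c> n x)"
proof -
 assume x: "at1 Up n x" "at1 Down (Suc n) x"
 define y where "y = \<r> n x"
 have y: "at1 Down n y" "at1 Up (Suc n) y" "x = \<l> n y" using x by (simp_all add: y_def)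
 show ?thesis unfolding y(3) using y(1,2) by (simp add: s_l k_l cap_s flip: l_c1)
qed

section \<open>Straightening morphisms into an unsorted word\<close>

text \<open>This and the next identities express an operator touching an inversion of the word by an
  operator on a word with fewer inversions, up to restoring the inversions; they drive the
  inductions below.\<close>

lemma u_via_l: "at1 Down n x ==> at1 Up (Suc n) x ==> at1 Up (Suc (Suc n)) x ==>
 \<u> (Suc n) x = \<r> n (\<r> (Suc n) (\<u> n (\<l> (Suc n) (\<l> n x))))"
 by (simp add: u_l_l)

lemma d_via_l: "at1 Down n x ==> at1 Down (Suc n) x ==> at1 Up (Suc (Suc n)) x ==>
 \<d> n x = \<r> (Suc n) (\<r> n (\<d> (Suc n) (\<l> n (\<l> (Suc n) x))))"
 by (simp add: d_l_l)

lemma c_via_l: "at1 Down n x ==> at1 Up (Suc n) x ==> \<c> (Suc n) x = \<r> n (\<c> n (\<l> n x))"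
 by (simp flip: l_c1)

lemma k_via_l1: "at1 Down n x ==> at1 Up (Suc n) x ==> at1 Down (Suc (Suc n)) x ==>
 \<k> (Suc n) x = \<k> n (\<d> (Suc n) (\<l> n x) - zhat (\<l> n x))"
proof -
 assume x: "at1 Down n x" "at1 Up (Suc n) x" "at1 Down (Suc (Suc n)) x"
 let ?w = "\<l> n x"
 have "\<d> (Suc n) (\<d> (Suc n) ?w - zhat ?w) = ?w" using x by (simp add: d_d)
 thus ?thesis using x k_d[of n "\<d> (Suc n) ?w - zhat ?w"] by (simp add: at1_lin)
qed

lemma k_via_l2: "at1 Up n x ==> at1 Down (Suc n) x ==> at1 Up (Suc (Suc n)) x ==>
 \<k> n x = \<k> (Suc n) (\<u> n (\<l> (Suc n) x) - zhat (\<l> (Suc n) x))"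
 using k_r[of n "\<l> (Suc n) x"] by (simp add: v_eq)

lemma cup_via_up: "at1 Up n x ==> \<UU> n x = \<r> (Suc n) (\<u> n (\<UU> (Suc n) x))"
 by (simp flip: l_cup_u)

lemma cup_via_down: "at1 Down n x ==> \<UU> (Suc n) x = \<r> n (\<d> (Suc n) (\<UU> n x))"
 by (simp add: d_cup)

abbreviation srt :: "nat => nat => Q_obj list" where "srt a b \<equiv> replicate a Up @ replicate b Down"

definition Qat :: "'k::comm_ring_1 => Q_obj list => 'k Qf set" where "Qat z Y = supp (\<lambda>z' X Y'. z' = z \<and> Y' = Y)"

lemma Qat_subspace: "Qm.subspace (Qat z Y)" by (simp add: Qat_def supp_subspace)

lemma supp_mono: "x \<in> supp P ==> (\<And>z X Y. P z X Y ==> P' z X Y) ==> x \<in> supp P'"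
 unfolding supp_def by blast

lemma Qat_at1: "x \<in> Qat z Y ==> n < length Y ==> Y ! n = a ==> at1 a n x"
 unfolding Qat_def at1_def by (erule supp_mono) auto

lemma Qat_Op: "x \<in> Qat z (A @ odom p @ B) ==> Op p (length A) x \<in> Qat z (A @ ocod p @ B)"
 unfolding Qat_def Op_def by (erule supp_W[OF Qty_op]) simp

lemma Qat_Op': "x \<in> Qat z Y ==> isat n (odom p) Y ==> Op p n x \<in> Qat z (repl n (odom p) (ocod p) Y)"
 by (auto elim!: isatE intro: Qat_Op)

lemma zhat_Qat:
 assumes x: "x \<in> Qat z Y"
 shows "zhat x = z *\<^sub>q x"
proof (rule Qf_eqI)
 fix z' X Y'
 show "\<exists>f g. Qeq z' X Y' (cmp (zhat x) z' X Y') f \<and> Qeq z' X Y' (cmp (z *\<^sub>q x) z' X Y') g \<and> Qeq z' X Y' f g"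
 proof (cases "z' = z")
  case True
  have "Qeq z X Y' (cmp (zhat x) z X Y') (MScale z (cmp x z X Y'))" "Qeq z X Y' (cmp (z *\<^sub>q x) z X Y') (MScale z (cmp x z X Y'))"
   by (rule cmp_scale cmp_refl)+
  thus ?thesis unfolding True by (blast intro: mor_cong_refl tyI cmp_type)
 next
  case False
  hence "Qeq z' X Y' (cmp x z' X Y') (MZero X Y')" using x by (simp add: Qat_def suppD)
  thus ?thesis using cmp_zeros(2,3) by (blast intro: mor_cong_refl tyI)
 qed
qed

text \<open>\<open>E a b\<close> is a space of morphisms into a sorted word. The closure conditions
  involve only operators that keep words sorted; the right cap and the cup act at the border of the
  two blocks.\<close>

locale levels =
 fixes z :: "'k::comm_ring_1" and E :: "nat => nat => 'k Qf set"
 assumes E_subspace: "Qm.subspace (E a b)"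
  and E_Qat: "E a b \<subseteq> Qat z (srt a b)"
  and E_u: "x \<in> E a b ==> Suc n < a ==> \<u> n x \<in> E a b"
  and E_c: "x \<in> E a b ==> n < a ==> \<c> n x \<in> E a b"
  and E_d: "x \<in> E a b ==> a \<le> n ==> Suc n < a + b ==> \<d> n x \<in> E a b"
  and E_k: "x \<in> E (Suc a) (Suc b) ==> \<k> a x \<in> E a b"
  and E_cup: "x \<in> E a b ==> \<UU> a x \<in> E (Suc a) (Suc b)"
begin

text \<open>\<open>R k Y\<close> is reached from the sorted levels by \<open>k\<close> crossings; \<open>k\<close> is the number of inversions of \<open>Y\<close>.\<close>

inductive R :: "nat => Q_obj list => 'k Qf => bool" where
 R_base: "x \<in> E a b ==> R 0 (srt a b) x"
| R_step: "R k Y x ==> Suc m < length Y ==> Y ! m = Up ==> Y ! Suc m = Down ==> R (Suc k) (Y[m := Down, Suc m := Up]) (\<r> m x)"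
| R_add: "R k Y x ==> R k Y y ==> R k Y (x + y)"
| R_scale: "R k Y x ==> R k Y (c *\<^sub>q x)"

lemma isat2: "Suc n < length Y ==> isat n [a, b] Y \<longleftrightarrow> Y ! n = a \<and> Y ! Suc n = b"
 by (auto simp: isat_def take_Suc_conv_app_nth simp flip: Cons_nth_drop_Suc)

lemma nth_upd: "i < length Y ==> Y[m := a] ! i = (if i = m then a else Y ! i)"
 by (auto simp: nth_list_update)

lemma repl2:
 assumes "Suc n < length Y"
 shows "repl n [a, b] [a', b'] Y = Y[n := a', Suc n := b']"
proof -
 obtain A B where Y: "Y = A @ [Y ! n, Y ! Suc n] @ B" "length A = n"
  using isatE[of n "[Y ! n, Y ! Suc n]" Y] isat2[OF assms] by blast
 have "repl (length A) [a, b] [a', b'] (A @ [x, y] @ B) = (A @ [x, y] @ B)[length A := a', Suc (length A) := b']" for x y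
  by (simp add: repl_def list_update_append)
 thus ?thesis using Y by metis
qed

lemma R_Qat: "R k Y x ==> x \<in> Qat z Y"
proof (induction rule: R.induct)
 case (R_step k Y x m)
 thus ?case using Qat_Op'[of x z Y m oR] by (simp add: isat2 repl2)
qed (use E_Qat in \<open>auto intro: Qm.subspace_add Qm.subspace_scale Qat_subspace\<close>)

lemma R_at1: "R k Y x ==> n < length Y ==> Y ! n = a ==> at1 a n x"
 using R_Qat Qat_at1 by blast

lemma R_zhat: "R k Y x ==> R k Y (zhat x)"
 using R_scale[of k Y x z] zhat_Qat[OF R_Qat] by simp

lemma R_diff: "R k Y x ==> R k Y y ==> R k Y (x - y)"
 using R_add[of k Y x "(- 1) *\<^sub>q y"] R_scale[of k Y y "- 1"] by simp

lemma R_0: "R 0 Y x ==> \<exists>a b. Y = srt a b \<and> x \<in> E a b"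
proof (induction "0 :: nat" Y x rule: R.induct)
 case (R_add Y x y)
 then obtain a b a' b' where *: "Y = srt a b" "x \<in> E a b" "Y = srt a' b'" "y \<in> E a' b'" by blast
 have "length (filter (\<lambda>y. y = Up) (srt i j)) = i" "length (filter (\<lambda>y. y = Down) (srt i j)) = j" for i j by simp_all
 hence "a = a'" "b = b'" using * by metis+
 thus ?case using * E_subspace by (metis Qm.subspace_add)
qed (use E_subspace Qm.subspace_scale in blast)+

definition descent :: "nat => Q_obj list => bool" where
 "descent m Y \<longleftrightarrow> Suc m < length Y \<and> Y ! m = Down \<and> Y ! Suc m = Up"

lemma R_descent: "R (Suc k) Y x ==> \<exists>m. descent m Y"
 by (induction "Suc k" Y x rule: R.induct) (auto simp: descent_def)

text \<open>Any inversion can be undone, not only the one made last: distant crossings commute, and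
  overlapping positions cannot both be inversions. Straightening is therefore independent of the
  order of the crossings.\<close>

lemma R_l:
 assumes "R k Y x" "descent n Y"
 shows "\<exists>j. k = Suc j \<and> R j (Y[n := Up, Suc n := Down]) (\<l> n x)"
 using assms
proof (induction k Y x rule: R.induct)
 case (R_base x a b)
 thus ?case by (auto simp: descent_def nth_append split: if_splits)
next
 case (R_step k Y x m)
 let ?Y = "Y[m := Down, Suc m := Up]"
 have n: "Suc n < length Y" "?Y ! n = Down" "?Y ! Suc n = Up" using R_step.prems by (auto simp: descent_def)
 consider "n = m" | "Suc n < m \<or> Suc m < n" | "Suc n = m" | "n = Suc m" by linarith
 thus ?case
 proof cases
  case 1
  have "Y[m := Down, Suc m := Up, m := Up, Suc m := Down] = Y"
   using R_step.hyps by (intro nth_equalityI) (auto simp: nth_upd)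
  thus ?thesis using R_step.hyps 1 by (simp add: R_at1[OF R_step.hyps(1)])
 next
  case 2
  hence "descent n Y" using n by (auto simp: descent_def nth_upd split: if_splits)
  then obtain j where j: "k = Suc j" "R j (Y[n := Up, Suc n := Down]) (\<l> n x)" using R_step.IH by blast
  have "\<l> n (\<r> m x) = \<r> m (\<l> n x)" using 2 by (auto simp: inter)
  moreover have "Y[m := Down, Suc m := Up, n := Up, Suc n := Down] = Y[n := Up, Suc n := Down, m := Down, Suc m := Up]"
   using 2 by (intro nth_equalityI) (auto simp: nth_upd)
  ultimately show ?thesis
   using R_step.hyps R.R_step[OF j(2), of m] 2 j(1) by (auto simp: nth_upd)
 qed (use n R_step.hyps in \<open>auto simp: nth_upd\<close>)
next
 case (R_add k Y x y) thus ?case by (auto intro: R.R_add)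
next
 case (R_scale k Y x c) thus ?case by (auto intro: R.R_scale)
qed

lemma R_rl: "R k Y x ==> descent n Y ==> \<r> n (\<l> n x) = x"
 by (simp add: descent_def R_at1)

lemma R_r:
 assumes "R j Y x" "Suc m < length Y" "Y ! m = Up" "Y ! Suc m = Down" "Y' = Y[m := Down, Suc m := Up]"
 shows "R (Suc j) Y' (\<r> m x)"
 using R_step[OF assms(1-4)] assms(5) by simp

lemma upd2_id: "descent m Y ==> Y = Y[m := Up, Suc m := Down, m := Down, Suc m := Up]"
 by (intro nth_equalityI) (auto simp: nth_upd descent_def)

lemma R_far:
 assumes x: "R k Y x" and m: "descent m Y" and p: "odom p = ocod p"
  and far: "Suc m < n \<or> n + length (ocod p) \<le> m"
  and IH: "\<And>i. k = Suc i ==> R i (Y[m := Up, Suc m := Down]) (\<l> m x) ==> R i (Y[m := Up, Suc m := Down]) (Op p n (\<l> m x))"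
 shows "R k Y (Op p n x)"
proof -
 from R_l[OF x m] obtain i where i: "k = Suc i" "R i (Y[m := Up, Suc m := Down]) (\<l> m x)" by blast
 have "R k Y (\<r> m (Op p n (\<l> m x)))" unfolding i(1)
  by (rule R_r[OF IH[OF i]]) (use m upd2_id[OF m] in \<open>auto simp: descent_def nth_upd\<close>)
 also have "\<r> m (Op p n (\<l> m x)) = Op p n (\<r> m (\<l> m x))"
  using far
 proof
  assume "Suc m < n"
  thus ?thesis by (simp add: inter)
 next
  assume "n + length (ocod p) \<le> m"
  thus ?thesis using Op_interchange_same[of p n m oR "\<l> m x"] p by simp
 qed
 also have "\<r> m (\<l> m x) = x" by (rule R_rl[OF x m])
 finally show ?thesis .
qed

text \<open>Induction on the number of inversions. A disjoint inversion is undone and redone around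
  the operator; a down strand directly before the two up strands is moved past both by
  \<open>u_via_l\<close>. Without inversions the word is sorted and \<open>E_u\<close>
  applies.\<close>

lemma R_u:
 assumes "R k Y x" "Suc n < length Y" "Y ! n = Up" "Y ! Suc n = Up"
 shows "R k Y (\<u> n x)"
 using assms
proof (induction k arbitrary: Y x n rule: less_induct)
 case (less k)
 show ?case
 proof (cases k)
  case 0
  then obtain a b where Y: "Y = srt a b" "x \<in> E a b" using R_0 less.prems by blast
  hence "Suc n < a" using less.prems by (auto simp: nth_append split: if_splits)
  thus ?thesis using Y E_u 0 R_base by simp
 next
  case (Suc j)
  then obtain m where m: "descent m Y" using R_descent less.prems by blast
  show ?thesis
  proof (cases "Suc m = n")
   case True
   from R_l[OF less.prems(1) m] obtain i where i: "k = Suc i" "R i (Y[m := Up, Suc m := Down]) (\<l> m x)" by blast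
   let ?Y = "Y[m := Up, n := Down]" and ?Z = "Y[m := Up, n := Up, Suc n := Down]"
   have d: "descent n ?Y" using m True less.prems by (auto simp: descent_def nth_upd)
   then obtain i' where i': "i = Suc i'" "R i' ?Z (\<l> n (\<l> m x))" using R_l[OF i(2)[unfolded True] d] True
    by auto
   have "R i' ?Z (\<u> m (\<l> n (\<l> m x)))"
    by (rule less.IH[OF _ i'(2)]) (use i i' m True less.prems in \<open>auto simp: descent_def nth_upd\<close>)
   hence "R i ?Y (\<r> n (\<u> m (\<l> n (\<l> m x))))" unfolding i'(1)
    by (rule R_r) (use m True less.prems in \<open>auto simp: descent_def nth_upd intro!: nth_equalityI\<close>)
   hence "R k Y (\<r> m (\<r> n (\<u> m (\<l> n (\<l> m x)))))" unfolding i(1)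
    by (rule R_r) (use m True less.prems in \<open>auto simp: descent_def nth_upd intro!: nth_equalityI\<close>)
   moreover have "\<u> n x = \<r> m (\<r> n (\<u> m (\<l> n (\<l> m x))))"
    using u_via_l[of m x] m True less.prems by (simp add: descent_def R_at1)
   ultimately show ?thesis by simp
  next
   case False
   hence "Suc m < n \<or> Suc n < m" using m less.prems by (cases "m = n"; cases "m = Suc n"; simp add: descent_def; linarith)
   thus ?thesis
    by (intro R_far[OF less.prems(1) m]) (use less in \<open>auto simp: nth_upd\<close>)
  qed
 qed
qed

lemma R_d:
 assumes "R k Y x" "Suc n < length Y" "Y ! n = Down" "Y ! Suc n = Down"
 shows "R k Y (\<d> n x)"
 using assms
proof (induction k arbitrary: Y x n rule: less_induct)
 case (less k)
 show ?case
 proof (cases k)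
  case 0
  then obtain a b where Y: "Y = srt a b" "x \<in> E a b" using R_0 less.prems by blast
  hence "a \<le> n" "Suc n < a + b" using less.prems by (auto simp: nth_append split: if_splits)
  thus ?thesis using Y E_d 0 R_base by simp
 next
  case (Suc j)
  then obtain m where m: "descent m Y" using R_descent less.prems by blast
  show ?thesis
  proof (cases "m = Suc n")
   case True
   from R_l[OF less.prems(1) m] obtain i where i: "k = Suc i" "R i (Y[m := Up, Suc m := Down]) (\<l> m x)" by blast
   let ?Y = "Y[m := Up, Suc m := Down]" and ?Z = "Y[m := Up, Suc m := Down, n := Up, m := Down]"
   have d: "descent n ?Y" using m True less.prems by (auto simp: descent_def nth_upd)
   then obtain i' where i': "i = Suc i'" "R i' ?Z (\<l> n (\<l> m x))" using R_l[OF i(2) d] True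
    by auto
   have "R i' ?Z (\<d> m (\<l> n (\<l> m x)))"
    by (rule less.IH[OF _ i'(2)]) (use i i' m True less.prems in \<open>auto simp: descent_def nth_upd\<close>)
   hence "R i ?Y (\<r> n (\<d> m (\<l> n (\<l> m x))))" unfolding i'(1)
    by (rule R_r) (use m True less.prems in \<open>auto simp: descent_def nth_upd intro!: nth_equalityI\<close>)
   hence "R k Y (\<r> m (\<r> n (\<d> m (\<l> n (\<l> m x)))))" unfolding i(1)
    by (rule R_r) (use m True less.prems in \<open>auto simp: descent_def nth_upd intro!: nth_equalityI\<close>)
   moreover have "\<d> n x = \<r> m (\<r> n (\<d> m (\<l> n (\<l> m x))))"
    using d_via_l[of n x] m True less.prems by (simp add: descent_def R_at1)
   ultimately show ?thesis by simp
  next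
   case False
   hence "Suc m < n \<or> Suc n < m" using m less.prems by (cases "m = n"; cases "Suc m = n"; simp add: descent_def; linarith)
   thus ?thesis
    by (intro R_far[OF less.prems(1) m]) (use less in \<open>auto simp: nth_upd\<close>)
  qed
 qed
qed

lemma R_c:
 assumes "R k Y x" "n < length Y" "Y ! n = Up"
 shows "R k Y (\<c> n x)"
 using assms
proof (induction k arbitrary: Y x n rule: less_induct)
 case (less k)
 show ?case
 proof (cases k)
  case 0
  then obtain a b where Y: "Y = srt a b" "x \<in> E a b" using R_0 less.prems by blast
  hence "n < a" using less.prems by (auto simp: nth_append split: if_splits)
  thus ?thesis using Y E_c 0 R_base by simp
 next
  case (Suc j)
  then obtain m where m: "descent m Y" using R_descent less.prems by blast
  show ?thesis
  proof (cases "Suc m = n")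
   case True
   from R_l[OF less.prems(1) m] obtain i where i: "k = Suc i" "R i (Y[m := Up, Suc m := Down]) (\<l> m x)" by blast
   have "R i (Y[m := Up, Suc m := Down]) (\<c> m (\<l> m x))"
    by (rule less.IH[OF _ i(2)]) (use i m True less.prems in \<open>auto simp: descent_def nth_upd\<close>)
   hence "R k Y (\<r> m (\<c> m (\<l> m x)))" unfolding i(1)
    by (rule R_r) (use m upd2_id[OF m] in \<open>auto simp: descent_def nth_upd\<close>)
   moreover have "\<c> n x = \<r> m (\<c> m (\<l> m x))"
    using c_via_l[of m x] m True less.prems by (simp add: descent_def R_at1)
   ultimately show ?thesis by simp
  next
   case False
   hence "Suc m < n \<or> n < m" using m less.prems by (cases "m = n"; simp add: descent_def; linarith)
   thus ?thesis
    by (intro R_far[OF less.prems(1) m]) (use less in \<open>auto simp: nth_upd\<close>)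
  qed
 qed
qed

definition del :: "nat => Q_obj list => Q_obj list" where "del n Y = take n Y @ drop (n + 2) Y"
definition ins :: "nat => Q_obj list => Q_obj list" where "ins n Y = take n Y @ [Up, Down] @ drop n Y"

lemma del_nth: "Suc n < length Y ==> i < length Y - 2 ==> del n Y ! i = (if i < n then Y ! i else Y ! (i + 2))"
 by (auto simp: del_def nth_append add.commute)

lemma del_length [simp]: "Suc n < length Y ==> length (del n Y) = length Y - 2"
 by (simp add: del_def)

lemma ins_nth: "n \<le> length Y ==> i < length Y + 2 ==>
 ins n Y ! i = (if i < n then Y ! i else if i = n then Up else if i = Suc n then Down else Y ! (i - 2))"
 by (auto simp: ins_def nth_append nth_Cons split: nat.split intro!: arg_cong[where f = "(!) Y"])

lemma ins_length [simp]: "n \<le> length Y ==> length (ins n Y) = length Y + 2"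
 by (simp add: ins_def)

definition R' :: "Q_obj list => 'k Qf => bool" where "R' Y x \<longleftrightarrow> (\<exists>k. R k Y x)"

lemma R'_r: "R' Y x ==> Suc m < length Y ==> Y ! m = Up ==> Y ! Suc m = Down ==> Y' = Y[m := Down, Suc m := Up] ==> R' Y' (\<r> m x)"
 unfolding R'_def using R_r by blast

text \<open>The word gets shorter, so the number of inversions of the result is left open in
  \<open>R'\<close>. An inversion that touches the cap is removed by \<open>k_via_l1\<close> or
  \<open>k_via_l2\<close>, where an inverse crossing appears as a difference.\<close>

lemma R_k:
 assumes "R k Y x" "Suc n < length Y" "Y ! n = Up" "Y ! Suc n = Down"
 shows "R' (del n Y) (\<k> n x)"
 using assms
proof (induction k arbitrary: Y x n rule: less_induct)
 case (less k)
 show ?case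
 proof (cases k)
  case 0
  then obtain a b where Y: "Y = srt a b" "x \<in> E a b" using R_0 less.prems by blast
  hence "a = Suc n" using less.prems by (auto simp: nth_append split: if_splits)
  moreover obtain b' where "b = Suc b'" using Y less.prems calculation by (cases b) auto
  moreover have "replicate (Suc n) Up @ Z = replicate n Up @ Up # Z" for Z by (simp add: replicate_app_Cons_same)
  ultimately have "del n Y = srt n b'" "\<k> n x \<in> E n b'" using Y E_k[of x n b'] by (auto simp: del_def simp del: replicate_Suc)
  thus ?thesis using R_base[of "\<k> n x" n b'] by (auto simp: R'_def)
 next
  case (Suc j)
  then obtain m where m: "descent m Y" using R_descent less.prems by blast
  from R_l[OF less.prems(1) m] obtain i where i: "k = Suc i" "R i (Y[m := Up, Suc m := Down]) (\<l> m x)" by blast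
  let ?Y = "Y[m := Up, Suc m := Down]" and ?w = "\<l> m x"
  have x: "\<r> m ?w = x" by (rule R_rl[OF less.prems(1) m])
  consider "Suc m = n" | "m = Suc n" | "Suc m < n" | "Suc n < m"
   using m less.prems by (cases "m = n"; simp add: descent_def; linarith)
  thus ?thesis
  proof cases
   case 1
   have "R i ?Y (\<d> n ?w - zhat ?w)"
    by (intro R_diff R_zhat i(2) R_d) (use 1 m less.prems in \<open>auto simp: descent_def nth_upd\<close>)
   hence "R' (del m ?Y) (\<k> m (\<d> n ?w - zhat ?w))"
    by (rule less.IH[rotated]) (use 1 i(1) m less.prems in \<open>auto simp: descent_def nth_upd\<close>)
   moreover have "\<k> n x = \<k> m (\<d> n ?w - zhat ?w)"
    using k_via_l1[of m x] m 1 less.prems by (simp add: descent_def R_at1)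
   moreover have "del m ?Y = del n Y"
    by (rule nth_equalityI) (use 1 m less.prems in \<open>auto simp: descent_def del_nth nth_upd less_Suc_eq\<close>)
   ultimately show ?thesis by simp
  next
   case 2
   have "R i ?Y (\<u> n ?w - zhat ?w)"
    by (intro R_diff R_zhat i(2) R_u) (use 2 m less.prems in \<open>auto simp: descent_def nth_upd\<close>)
   hence "R' (del m ?Y) (\<k> m (\<u> n ?w - zhat ?w))"
    by (rule less.IH[rotated]) (use 2 i(1) m less.prems in \<open>auto simp: descent_def nth_upd\<close>)
   moreover have "\<k> n x = \<k> m (\<u> n ?w - zhat ?w)"
    using k_via_l2[of n x] m 2 less.prems by (simp add: descent_def R_at1)
   moreover have "del m ?Y = del n Y"
    by (rule nth_equalityI) (use 2 m less.prems in \<open>auto simp: descent_def del_nth nth_upd less_Suc_eq\<close>)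
   ultimately show ?thesis by simp
  next
   case 3
   have "R' (del n ?Y) (\<k> n ?w)"
    by (rule less.IH[OF _ i(2)]) (use 3 i(1) m less.prems in \<open>auto simp: descent_def nth_upd\<close>)
   hence "R' (del n Y) (\<r> m (\<k> n ?w))"
    by (rule R'_r) (use 3 m less.prems in \<open>auto simp: descent_def del_nth nth_upd intro!: nth_equalityI\<close>)
   moreover have "\<r> m (\<k> n ?w) = \<k> n (\<r> m ?w)" using 3 by (simp add: inter)
   ultimately show ?thesis using x by simp
  next
   case 4
   then obtain m' where m': "m = Suc (Suc m')" "n \<le> m'" by (metis Suc_le_D Suc_le_mono less_eq_Suc_le)
   have "R' (del n ?Y) (\<k> n ?w)"
    by (rule less.IH[OF _ i(2)]) (use 4 i(1) m less.prems in \<open>auto simp: descent_def nth_upd\<close>)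
   hence "R' (del n Y) (\<r> m' (\<k> n ?w))"
    by (rule R'_r) (use m' m less.prems in \<open>auto simp: descent_def del_nth nth_upd intro!: nth_equalityI\<close>)
   moreover have "\<r> m' (\<k> n ?w) = \<k> n (\<r> m ?w)" using m' by (simp add: inter)
   ultimately show ?thesis using x by simp
  qed
 qed
qed

text \<open>\<open>E_cup\<close> creates the pair at the border of the blocks. To reach any other
  position the cup moves step by step, through the up block by \<open>cup_via_up\<close> and through
  the down block by \<open>cup_via_down\<close>.\<close>

lemma R_cup_sorted:
 assumes x: "x \<in> E a b" and n: "n \<le> a + b"
 shows "R' (ins n (srt a b)) (\<UU> n x)"
proof (cases "n \<le> a")
 case True
 thus ?thesis
 proof (induction n rule: inc_induct)
  case base
  have "ins a (srt a b) = srt (Suc a) (Suc b)" by (simp add: ins_def replicate_append_same)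
  thus ?case using R_base[OF E_cup[OF x]] by (auto simp: R'_def)
 next
  case (step n)
  have "R' (ins (Suc n) (srt a b)) (\<u> n (\<UU> (Suc n) x))"
   using step.IH unfolding R'_def using step.hyps by (auto intro!: R_u simp: ins_nth nth_append)
  hence "R' (ins n (srt a b)) (\<r> (Suc n) (\<u> n (\<UU> (Suc n) x)))"
   by (rule R'_r) (use step.hyps in \<open>(simp add: ins_nth nth_append; fail) | (auto simp: ins_nth nth_append nth_upd less_Suc_eq intro!: nth_equalityI)\<close>)+
  moreover have "at1 Up n x" using E_Qat x step.hyps by (auto intro!: Qat_at1[of x z "srt a b"] simp: nth_append)
  ultimately show ?case using cup_via_up[of n x] by simp
 qed
next
 case False
 hence "a \<le> n" by simp
 thus ?thesis using n
 proof (induction n rule: dec_induct)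
  case base
  have "ins a (srt a b) = srt (Suc a) (Suc b)" by (simp add: ins_def replicate_append_same)
  thus ?case using R_base[OF E_cup[OF x]] by (auto simp: R'_def)
 next
  case (step n)
  have "R' (ins n (srt a b)) (\<d> (Suc n) (\<UU> n x))"
   using step.IH step.prems unfolding R'_def using step.hyps by (auto intro!: R_d simp: ins_nth nth_append)
  hence "R' (ins (Suc n) (srt a b)) (\<r> n (\<d> (Suc n) (\<UU> n x)))"
   by (rule R'_r) (use step in \<open>(simp add: ins_nth nth_append; fail) | (auto simp: ins_nth nth_append nth_upd less_Suc_eq intro!: nth_equalityI)\<close>)+
  moreover have "at1 Down n x" using E_Qat x step by (auto intro!: Qat_at1[of x z "srt a b"] simp: nth_append)
  ultimately show ?case using cup_via_down[of n x] by simp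
 qed
qed

lemma R_cup:
 assumes "R k Y x" "n \<le> length Y"
 shows "R' (ins n Y) (\<UU> n x)"
 using assms
proof (induction k arbitrary: Y x n rule: less_induct)
 case (less k)
 show ?case
 proof (cases k)
  case 0
  then obtain a b where "Y = srt a b" "x \<in> E a b" using R_0 less.prems by blast
  thus ?thesis using R_cup_sorted less.prems by simp
 next
  case (Suc j)
  then obtain m where m: "descent m Y" using R_descent less.prems by blast
  from R_l[OF less.prems(1) m] obtain i where i: "k = Suc i" "R i (Y[m := Up, Suc m := Down]) (\<l> m x)" by blast
  let ?Y = "Y[m := Up, Suc m := Down]" and ?w = "\<l> m x"
  have x: "\<r> m ?w = x" by (rule R_rl[OF less.prems(1) m])
  have IH: "R' (ins n' ?Y) (\<UU> n' ?w)" if "n' \<le> length Y" for n'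
   by (rule less.IH[OF _ i(2)]) (use that i(1) in auto)
  have low: "R' (ins n' Y) (\<UU> n' x)" if "n' \<le> m" for n'
  proof -
   have "R' (ins n' Y) (\<r> (Suc (Suc m)) (\<UU> n' ?w))"
    by (rule R'_r[OF IH]) (use that m in \<open>(simp add: descent_def ins_nth nth_upd; fail) | (auto simp: descent_def ins_nth nth_upd less_Suc_eq intro!: nth_equalityI)\<close>)+
   moreover have "\<r> (Suc (Suc m)) (\<UU> n' ?w) = \<UU> n' (\<r> m ?w)" using that by (simp add: inter)
   ultimately show ?thesis using x by simp
  qed
  consider "n \<le> m" | "n = Suc m" | "Suc m < n" by linarith
  thus ?thesis
  proof cases
   case 1 thus ?thesis by (rule low)
  next
   \<comment> \<open>A cup between the two strands of the inversion is obtained from the one just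
     left of them, moved one place by \<open>cup_via_down\<close>.\<close>
   case 2
   have "R' (ins m Y) (\<d> n (\<UU> m x))"
    using low[of m] unfolding R'_def using 2 m by (auto intro!: R_d simp: descent_def ins_nth)
   hence "R' (ins n Y) (\<r> m (\<d> n (\<UU> m x)))"
    by (rule R'_r) (use 2 m in \<open>auto simp: descent_def ins_nth nth_upd less_Suc_eq intro!: nth_equalityI\<close>)
   thus ?thesis using cup_via_down[of m x] 2 m less.prems by (simp add: descent_def R_at1)
  next
   case 3
   have "R' (ins n Y) (\<r> m (\<UU> n ?w))"
    by (rule R'_r[OF IH]) (use 3 m less.prems in \<open>auto simp: descent_def ins_nth nth_upd less_Suc_eq intro!: nth_equalityI\<close>)
   moreover have "\<r> m (\<UU> n ?w) = \<UU> n (\<r> m ?w)" using 3 by (simp add: inter)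
   ultimately show ?thesis using x by simp
  qed
 qed
qed

end

text \<open>A single morphism as the family that vanishes in all other components; terms of the
  wrong type give zero.\<close>

definition el :: "'k::comm_ring_1 => Q_obj list => Q_obj list => 'k Q_mor => 'k Qf" where
 "el z X Y f = Qmk (\<lambda>z' X' Y'. if z' = z \<and> X' = X \<and> Y' = Y \<and> Qty X Y f then f else MZero X' Y')"

lemma cmp_el: "Qty X Y f ==> Qeq z X Y (cmp (el z X Y f) z X Y) f"
 unfolding el_def by (rule cmp_Qmk) (auto intro: tyI mor_cong_refl)

lemma cmp_el_other: "(z', X', Y') \<noteq> (z, X, Y) ==> Qeq z' X' Y' (cmp (el z X Y f) z' X' Y') (MZero X' Y')"
 unfolding el_def by (rule cmp_Qmk) (auto intro!: tyI mor_cong_refl)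

lemma el_eqI:
 assumes "x \<in> supp (\<lambda>z' X' Y'. (z', X', Y') = (z, X, Y))" "Qeq z X Y (cmp x z X Y) f"
 shows "x = el z X Y f"
proof (rule Qf_eqI')
 fix z' X' Y'
 show "\<exists>g. Qeq z' X' Y' (cmp x z' X' Y') g \<and> Qeq z' X' Y' (cmp (el z X Y f) z' X' Y') g"
 proof (cases "(z', X', Y') = (z, X, Y)")
  case True
  thus ?thesis using assms(2) mor_cong_type[OF assms(2)] cmp_el[of X Y f z] by auto
 next
  case False
  thus ?thesis using assms(1) cmp_el_other[OF False] suppD by blast
 qed
qed

lemma el_supp: "el z X Y f \<in> supp (\<lambda>z' X' Y'. (z', X', Y') = (z, X, Y))"
 unfolding supp_def using cmp_el_other by blast

lemma el_Qat: "el z X Y f \<in> Qat z Y"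
 unfolding Qat_def by (rule supp_mono[OF el_supp]) auto

lemma el_cong: "Qeq z X Y f g ==> el z X Y f = el z X Y g"
 using mor_cong_type[of Q_sig "Q_rel z" X Y f g] by (intro el_eqI el_supp) (blast intro: cmp_el mor_cong_trans)

lemma el_eqD: "el z X Y f = el z X Y g ==> Qty X Y f ==> Qty X Y g ==> Qeq z X Y f g"
 using cmp_el[of X Y f z] cmp_el[of X Y g z] by (auto intro: mor_cong_sym mor_cong_trans)

lemma el_add: "Qty X Y f ==> Qty X Y g ==> el z X Y (MAdd f g) = el z X Y f + el z X Y g"
 by (rule el_eqI[symmetric], rule Qm.subspace_add[OF supp_subspace el_supp el_supp], rule cmp_ab) (rule cmp_el; assumption)+

lemma el_scale: "Qty X Y f ==> el z X Y (MScale c f) = c *\<^sub>q el z X Y f"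
 by (rule el_eqI[symmetric], rule Qm.subspace_scale[OF supp_subspace el_supp], rule cmp_scale) (rule cmp_el; assumption)+

lemma el_zero: "el z X Y (MZero X Y) = 0"
 by (rule el_eqI[symmetric], rule Qm.subspace_0[OF supp_subspace], rule cmp_ab)

lemma Op_el:
 assumes f: "Qty X (A @ odom p @ B) f"
 shows "Op p (length A) (el z X (A @ odom p @ B) f) = el z X (A @ ocod p @ B) (pad A (omor p) B \<^bold>\<circ> f)"
proof (rule el_eqI)
 show "Op p (length A) (el z X (A @ odom p @ B) f) \<in> supp (\<lambda>z' X' Y'. (z', X', Y') = (z, X, A @ ocod p @ B))"
  unfolding Op_def by (rule supp_W[OF Qty_op el_supp]) simp
 show "Qeq z X (A @ ocod p @ B) (cmp (Op p (length A) (el z X (A @ odom p @ B) f)) z X (A @ ocod p @ B)) (pad A (omor p) B \<^bold>\<circ> f)"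
  unfolding Op_def by (rule cmp_W[OF Qty_op cmp_el[OF f]])
qed

lemma isat_repl_ex: "isat n M Y ==> \<exists>A B. length A = n \<and> Y = A @ M @ B"
 by (auto elim!: isatE)

section \<open>All morphisms out of a word whose identity is reached\<close>

context levels
begin

lemma R_unique: "R k Y x ==> R j Y y ==> k = j"
proof (induction k arbitrary: j Y x y)
 case 0
 then obtain a b where "Y = srt a b" using R_0 by blast
 hence "\<not> descent m Y" for m by (auto simp: descent_def nth_append split: if_splits)
 thus ?case using R_descent[of _ Y y] 0 by (cases j) auto
next
 case (Suc k)
 then obtain m where m: "descent m Y" using R_descent by blast
 show ?case using R_l[OF Suc.prems(1) m] R_l[OF Suc.prems(2) m] Suc.IH by auto
qed

text \<open>Adjoining zero by hand replaces an argument that every word can be reached from a sorted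
  one.\<close>

definition RZ :: "Q_obj list => 'k Qf => bool" where "RZ Y x \<longleftrightarrow> x = 0 \<or> R' Y x"

lemma RZ_lin: "RZ Y x ==> RZ Y y ==> RZ Y (x + y)" "RZ Y x ==> RZ Y (c *\<^sub>q x)" "RZ Y 0"
proof -
 show "RZ Y x ==> RZ Y (c *\<^sub>q x)" "RZ Y 0" by (auto simp: RZ_def R'_def intro: R_scale)
 assume "RZ Y x" "RZ Y y"
 moreover have "R' Y (x + y)" if "R' Y x" "R' Y y"
  using that R_unique R_add unfolding R'_def by blast
 ultimately show "RZ Y (x + y)" by (auto simp: RZ_def)
qed

lemma R'_gen:
 assumes x: "R' (A @ odom p @ B) x" and p: "p \<in> {oU, oV, oR, oC, oCap, oCup}"
 shows "R' (A @ ocod p @ B) (Op p (length A) x)"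
proof -
 let ?Y = "A @ odom p @ B" and ?n = "length A"
 obtain k where k: "R k ?Y x" using x by (auto simp: R'_def)
 have at: "i < length (odom p) ==> ?Y ! (?n + i) = odom p ! i" for i by (simp add: nth_append)
 note at2 = at[of 0] at[of 1]
 from p consider "p = oU" | "p = oV" | "p = oR" | "p = oC" | "p = oCap" | "p = oCup" by auto
 thus ?thesis
 proof cases
  case 1 thus ?thesis using R_u[OF k, of ?n] at2 k by (auto simp: R'_def)
 next
  case 2
  hence "\<v> ?n x = \<u> ?n x - zhat x" using at2 k by (intro v_eq) (auto intro: R_at1)
  thus ?thesis using 2 R_u[OF k, of ?n] at2 k R_diff[OF _ R_zhat[OF k]] by (auto simp: R'_def)
 next
  case 3 thus ?thesis using R_step[OF k, of ?n] at2 by (auto simp: R'_def list_update_append)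
 next
  case 4 thus ?thesis using R_c[OF k, of ?n] at2 by (auto simp: R'_def)
 next
  \<comment> \<open>The left cap is the right cap after undoing the inversion formed by its two
    strands.\<close>
  case 5
  hence d: "descent ?n ?Y" using at2 by (simp add: descent_def)
  from R_l[OF k d] obtain j where "R j (?Y[?n := Up, Suc ?n := Down]) (\<l> ?n x)" by blast
  from R_k[OF this, of ?n] have "R' (A @ B) (\<k> ?n (\<l> ?n x))"
   using 5 by (simp add: list_update_append nth_append del_def)
  moreover have "\<k> ?n (\<l> ?n x) = \<CC> ?n x" using 5 at2 k by (intro k_l) (auto intro: R_at1)
  ultimately show ?thesis using 5 by simp
 next
  case 6 thus ?thesis using R_cup[OF k, of ?n] by (simp add: ins_def)
 qed
qed

lemma RZ_gen: "RZ (A @ odom p @ B) x ==> p \<in> {oU, oV, oR, oC, oCap, oCup} ==> RZ (A @ ocod p @ B) (Op p (length A) x)"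
 using R'_gen[of A p B x] by (auto simp: RZ_def)

text \<open>The strands \<open>A\<close>, \<open>B\<close> beside \<open>f\<close> and the arbitrary
  \<open>h\<close> before it are what makes the induction pass through tensor products and
  composites.\<close>

lemma RZ_mor:
 assumes "Qhom p M N f" "Qty X (A @ M @ B) h" "RZ (A @ M @ B) (el z X (A @ M @ B) h)"
 shows "RZ (A @ N @ B) (el z X (A @ N @ B) (pad A f B \<^bold>\<circ> h))"
 using assms
proof (induction arbitrary: A B h rule: mor_homog.induct)
 case (1 g)
 have *: "RZ (A @ ocod p @ B) (el z X (A @ ocod p @ B) (pad A (omor p) B \<^bold>\<circ> h))"
  if "odom p = Q_dom g" "p \<in> {oU, oV, oR, oC, oCap, oCup}" for p
  using RZ_gen[of A p B "el z X (A @ odom p @ B) h"] Op_el[of X A p B h z] 1 that by simp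
 show ?case
  using *[of oU] *[of oV] *[of oR] *[of oC] *[of oCap] *[of oCup] by (cases g) simp_all
next
 case (2 Y)
 have "Qeq z X (A @ Y @ B) (pad A (MId Y) B \<^bold>\<circ> h) h"
  using pad_MId 2(1) mor_cong_comp_id_left mor_cong_trans mor_cong_comp_cong[OF _ mor_cong_refl[OF 2(1)]] by blast
 thus ?case using 2 el_cong by metis
next
 case (3 p U V)
 have 1: "Qeq z (A @ U @ B) (A @ V @ B) (pad A (MZero U V) B) (MId A \<^bold>\<otimes> MZero (U @ B) (V @ B))"
  unfolding pad_def by (rule MId_tens_cong[OF m_tens_zero_left]) (rule tyI)
 have "Qeq z (A @ U @ B) (A @ V @ B) (MId A \<^bold>\<otimes> MZero (U @ B) (V @ B)) (MZero (A @ U @ B) (A @ V @ B))"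
  by (rule m_tens_zero_right) (rule tyI)
 with 1 have "Qeq z (A @ U @ B) (A @ V @ B) (pad A (MZero U V) B) (MZero (A @ U @ B) (A @ V @ B))"
  by (rule mor_cong_trans)
 hence "Qeq z X (A @ V @ B) (pad A (MZero U V) B \<^bold>\<circ> h) (MZero (A @ U @ B) (A @ V @ B) \<^bold>\<circ> h)"
  by (rule mor_cong_comp_cong[OF _ mor_cong_refl[OF 3(1)]])
 also have "Qeq z X (A @ V @ B) ... (MZero X (A @ V @ B))" by (rule m_comp_zero_left[OF 3(1)])
 finally show ?case using el_cong el_zero RZ_lin(3) by metis
next
 case (4 p U V f g)
 note t = Qhom_type[OF 4(1)] Qhom_type[OF 4(2)]
 have "Qeq z X (A @ V @ B) (pad A (MAdd f g) B \<^bold>\<circ> h) (MAdd (pad A f B) (pad A g B) \<^bold>\<circ> h)"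
  by (rule mor_cong_comp_cong[OF pad_add[OF t] mor_cong_refl[OF 4(5)]])
 also have "Qeq z X (A @ V @ B) ... (MAdd (pad A f B \<^bold>\<circ> h) (pad A g B \<^bold>\<circ> h))"
  by (rule mor_cong_comp_add_left[OF pad_type[OF t(1)] pad_type[OF t(2)] 4(5)])
 finally show ?case
  using RZ_lin(1)[OF 4(3,4)[OF 4(5,6)]] el_cong el_add tyI(6)[OF pad_type 4(5)] t by metis
next
 case (5 p U V f c)
 note t = Qhom_type[OF 5(1)]
 have "Qeq z X (A @ V @ B) (pad A (MScale c f) B \<^bold>\<circ> h) (MScale c (pad A f B) \<^bold>\<circ> h)"
  by (rule mor_cong_comp_cong[OF pad_scaled[OF t] mor_cong_refl[OF 5(3)]])
 also have "Qeq z X (A @ V @ B) ... (MScale c (pad A f B \<^bold>\<circ> h))"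
  by (rule mor_cong_comp_scale_left[OF pad_type[OF t] 5(3)])
 finally show ?case
  using RZ_lin(2)[OF 5(2)[OF 5(3,4)]] el_cong el_scale tyI(6)[OF pad_type 5(3)] t by metis
next
 case (6 p V W f q U g)
 note t = Qhom_type[OF 6(1)] Qhom_type[OF 6(2)]
 have "Qeq z X (A @ W @ B) (pad A f B \<^bold>\<circ> pad A g B \<^bold>\<circ> h) ((pad A f B \<^bold>\<circ> pad A g B) \<^bold>\<circ> h)"
  by (rule mor_cong_sym[OF mor_cong_comp_assoc[OF pad_type[OF t(1)] pad_type[OF t(2)] 6(5)]])
 also have "Qeq z X (A @ W @ B) ... (pad A (f \<^bold>\<circ> g) B \<^bold>\<circ> h)"
  by (rule mor_cong_comp_cong[OF pad_comp[OF 6(1,2)] mor_cong_refl[OF 6(5)]])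
 finally show ?case
  using 6(3)[OF tyI(6)[OF pad_type[OF t(2)] 6(5)] 6(4)[OF 6(5,6)]] el_cong by metis
next
 case (7 p U V f q U' V' g)
 note t = Qhom_type[OF 7(1)] Qhom_type[OF 7(2)]
 have h: "Qty X (A @ U @ U' @ B) h" using 7(5) by simp
 have h1: "Qty X ((A @ U) @ U' @ B) h" using 7(5) by simp
 have h2: "Qty X (A @ U @ V' @ B) (pad (A @ U) g B \<^bold>\<circ> h)"
  using tyI(6)[OF pad_type[OF t(2)] h1] by simp
 have "RZ ((A @ U) @ V' @ B) (el z X ((A @ U) @ V' @ B) (pad (A @ U) g B \<^bold>\<circ> h))"
  using 7(4)[of "A @ U" B h] 7(5,6) by simp
 hence 1: "RZ (A @ V @ V' @ B) (el z X (A @ V @ V' @ B) (pad A f (V' @ B) \<^bold>\<circ> pad (A @ U) g B \<^bold>\<circ> h))"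
  using 7(3)[OF h2] by simp
 have pg: "Qty (A @ U @ U' @ B) (A @ U @ V' @ B) (pad (A @ U) g B)" using pad_type[OF t(2), of "A @ U" B] by simp
 have gB: "Qty (U' @ B) (V' @ B) (g \<^bold>\<otimes> MId B)" by (intro tyI t)
 have fB: "Qhom (p + 0) (U @ V' @ B) (V @ V' @ B) (f \<^bold>\<otimes> MId (V' @ B))" by (intro homI 7)
 have e: "Qeq z (A @ U @ U' @ B) (A @ V @ V' @ B) (pad A f (V' @ B) \<^bold>\<circ> pad (A @ U) g B) (pad A (f \<^bold>\<otimes> g) B)"
 proof -
  have "Qeq z (A @ U @ U' @ B) (A @ V @ V' @ B) (pad A f (V' @ B) \<^bold>\<circ> pad (A @ U) g B)
    ((MId A \<^bold>\<otimes> f \<^bold>\<otimes> MId (V' @ B)) \<^bold>\<circ> (MId A \<^bold>\<otimes> MId U \<^bold>\<otimes> g \<^bold>\<otimes> MId B))"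
   unfolding pad_def
   by (rule mor_cong_comp_cong[OF mor_cong_refl[OF tyI(7)[OF tyI(2) Qhom_type[OF fB]]] MId_append_tens[OF gB]])
  also have "Qeq z (A @ U @ U' @ B) (A @ V @ V' @ B) ... (MId A \<^bold>\<otimes> ((f \<^bold>\<otimes> MId (V' @ B)) \<^bold>\<circ> (MId U \<^bold>\<otimes> g \<^bold>\<otimes> MId B)))"
   by (rule MId_tens_comp[OF fB tyI(7)[OF tyI(2) gB]])
  also have "Qeq z (A @ U @ U' @ B) (A @ V @ V' @ B) ... (MId A \<^bold>\<otimes> ((f \<^bold>\<circ> MId U) \<^bold>\<otimes> (MId (V' @ B) \<^bold>\<circ> (g \<^bold>\<otimes> MId B))))"
   by (rule MId_tens_cong[OF interchange_even[OF homI(2) homI(2) t(1) gB]]) simp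
  also have "Qeq z (A @ U @ U' @ B) (A @ V @ V' @ B) ... (MId A \<^bold>\<otimes> (f \<^bold>\<otimes> (g \<^bold>\<otimes> MId B)))"
   by (rule MId_tens_cong[OF mor_cong_tens_cong[OF mor_cong_comp_id_right[OF t(1)] mor_cong_comp_id_left[OF gB]]])
  also have "Qeq z (A @ U @ U' @ B) (A @ V @ V' @ B) ... (pad A (f \<^bold>\<otimes> g) B)"
   unfolding pad_def
   by (rule MId_tens_cong[OF mor_cong_sym[OF mor_cong_tens_assoc[OF t tyI(2)]]])
  finally show ?thesis .
 qed
 have "Qeq z X (A @ V @ V' @ B) (pad A f (V' @ B) \<^bold>\<circ> pad (A @ U) g B \<^bold>\<circ> h) ((pad A f (V' @ B) \<^bold>\<circ> pad (A @ U) g B) \<^bold>\<circ> h)"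
  by (rule mor_cong_sym[OF mor_cong_comp_assoc[OF pad_type[OF t(1)] pg h]])
 also have "Qeq z X (A @ V @ V' @ B) ... (pad A (f \<^bold>\<otimes> g) B \<^bold>\<circ> h)"
  by (rule mor_cong_comp_cong[OF e mor_cong_refl[OF h]])
 finally show ?case using 1 el_cong by (metis append_assoc)
qed

theorem RZ_all:
 assumes X: "RZ X (el z X X (MId X))" and f: "Qty X Y f"
 shows "RZ Y (el z X Y f)"
proof -
 have hom: "RZ Y (el z X Y g)" if g: "Qhom p X Y g" for g p
 proof -
  note t = Qhom_type[OF g]
  have "RZ Y (el z X Y (pad [] g [] \<^bold>\<circ> MId X))"
   using RZ_mor[OF g, of X "[]" "[]" "MId X"] X by (simp add: tyI)
  moreover have "Qeq z X Y (pad [] g [] \<^bold>\<circ> MId X) g"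
   by (rule mor_cong_trans[OF mor_cong_comp_cong[OF pad_unit[OF t] MId_refl] mor_cong_comp_id_right[OF t]])
  ultimately show ?thesis using el_cong by metis
 qed
 let ?f = "mpart Q_sig f"
 have "el z X Y f = el z X Y (?f 0) + el z X Y (?f 1)"
  using el_cong[OF mpart_split[OF f]] el_add mpart_type[OF f] by metis
 thus ?thesis using RZ_lin(1) hom[OF mpart_is_homog[OF f]] by metis
qed

text \<open>A sorted word has no inversions, so \<open>k = 0\<close> and nothing beyond the given
  level has been reached.\<close>

lemma RZ_sorted: "RZ (srt a b) x ==> x \<in> E a b"
proof -
 assume x: "RZ (srt a b) x"
 show ?thesis
 proof (cases "x = 0")
  case True thus ?thesis using E_subspace Qm.subspace_0 by blast
 next
  case False
  then obtain k where k: "R k (srt a b) x" using x by (auto simp: RZ_def R'_def)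
  have "\<not> descent m (srt a b)" for m by (auto simp: descent_def nth_append split: if_splits)
  hence "k = 0" using R_descent[of _ "srt a b" x] k by (cases k) auto
  then obtain a' b' where *: "srt a b = srt a' b'" "x \<in> E a' b'" using R_0 k by blast
  have "length (filter (\<lambda>y. y = Up) (srt i j)) = i" "length (filter (\<lambda>y. y = Down) (srt i j)) = j" for i j by simp_all
  hence "a = a'" "b = b'" using * by metis+
  thus ?thesis using * by simp
 qed
qed

end

section \<open>The action of the walled Brauer--Clifford superalgebra\<close>

text \<open>Indices of the algebra start at 1, positions at 0; the down strands begin at position
  \<open>r\<close>. The generator \<open>GE\<close> becomes the cup after the right cap at the
  border.\<close>

fun gop :: "nat => BC_gen => 'k::comm_ring_1 Qf => 'k Qf" where
 "gop r (GT i) = \<u> (i - 1)"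
| "gop r (GTs j) = \<d> (r + j - 1)"
| "gop r (GPi i) = \<c> (i - 1)"
| "gop r (GPis j) = \<s> (r + j - 1)"
| "gop r GE = (\<lambda>x. \<UU> (r - 1) (\<k> (r - 1) x))"

primrec act :: "nat => 'k::comm_ring_1 BC_term => 'k Qf => 'k Qf" where
 "act r (AGen g) x = gop r g x"
| "act r AOne x = x"
| "act r AZero x = 0"
| "act r (AAdd s t) x = act r s x + act r t x"
| "act r (AScale c s) x = c *\<^sub>q act r s x"
| "act r (s \<bullet> t) x = act r s (act r t x)"

lemma gop_lin: "gop r g (x + y) = gop r g x + gop r g y" "gop r g (c *\<^sub>q x) = c *\<^sub>q gop r g x" "gop r g 0 = 0"
 by (cases g; simp)+

lemma act_lin: "act r t (x + y) = act r t x + act r t y" "act r t (c *\<^sub>q x) = c *\<^sub>q act r t x" "act r t 0 = 0"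
 by (induction t arbitrary: x y) (simp_all add: gop_lin algebra_simps Qm.scale_right_distrib mult.commute)

lemma act_rel:
 assumes "BC_rel z r t t'" "t \<in> aterms (BC_gens r n)" "t' \<in> aterms (BC_gens r n)"
  and up: "\<And>i. i < r ==> at1 Up i x" and down: "\<And>i. r \<le> i ==> i < r + n ==> at1 Down i x"
  and zh: "zhat x = z *\<^sub>q x"
 shows "act r t x = act r t' x"
proof -
 note BC_gens_iff [simp]
 show ?thesis using assms(1-3)
 proof (cases rule: BC_rel.cases)
 case (1 i)
 then obtain i' where i: "i = Suc i'" "Suc i' < r" using assms(2) by (cases i) auto
 thus ?thesis using 1 up by (simp add: u_u zh flip: Op_zhat)
next
 case (2 j)
 then obtain i' where i: "j = Suc i'" "Suc i' < n" using assms(2) by (cases j) auto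
 thus ?thesis using 2 down by (simp add: d_d zh flip: Op_zhat)
next
 case (3 i)
 then obtain i' where i: "i = Suc i'" "Suc (Suc i') < r" using assms(2) by (cases i) auto
 thus ?thesis using 3 up by (simp add: u_braid0)
next
 case (4 j)
 then obtain i' where i: "j = Suc i'" "Suc (Suc i') < n" using assms(2) by (cases j) auto
 thus ?thesis using 4 down by (simp add: d_braid)
next
 case (5 i j)
 hence "Suc i < j \<or> Suc j < i" "1 \<le> i" "1 \<le> j" using assms(2) by auto
 thus ?thesis using 5 by (auto simp: inter)
next
 case (6 i j)
 hence "Suc i < j \<or> Suc j < i" "1 \<le> i" "1 \<le> j" using assms(2) by auto
 thus ?thesis using 6 by (auto simp: inter)
next
 case (7 i j)
 hence "i < r" "1 \<le> i" "1 \<le> j" using assms(2) by auto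
 thus ?thesis using 7 by (auto simp: inter)
next
 case (8 i)
 then obtain i' where i: "i = Suc i'" "i' < r" using assms(2) by (cases i) auto
 thus ?thesis using 8 up by simp
next
 case (9 i j)
 hence "i < j \<or> j < i" "1 \<le> i" "1 \<le> j" using assms(2) by auto
 thus ?thesis using 9 by (auto simp: inter)
next
 case (10 i)
 then obtain i' where i: "i = Suc i'" "i' < n" using assms(2) by (cases i) auto
 thus ?thesis using 10 down by (simp add: ss)
next
 case (11 i j)
 hence "i < j \<or> j < i" "1 \<le> i" "1 \<le> j" using assms(2) by auto
 thus ?thesis using 11 by (auto simp: inter)
next
 case (12 i j)
 hence "i \<le> r" "1 \<le> i" "1 \<le> j" using assms(2) by auto
 thus ?thesis using 12 by (auto simp: inter)
next
 case (13 i)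
 then obtain i' where i: "i = Suc i'" "Suc i' < r" using assms(2) by (cases i) auto
 thus ?thesis using 13 up by (simp add: u_c0)
next
 case (14 i)
 then obtain i' where i: "i = Suc i'" "Suc i' < n" using assms(2) by (cases i) auto
 thus ?thesis using 14 down by (simp add: d_s0)
next
 case (15 j i)
 hence "j < i \<or> Suc i < j" "1 \<le> i" "1 \<le> j" using assms(2) by auto
 thus ?thesis using 15 by (auto simp: inter)
next
 case (16 j i)
 hence "j < i \<or> Suc i < j" "1 \<le> i" "1 \<le> j" using assms(2) by auto
 thus ?thesis using 16 by (auto simp: inter)
next
 case (17 i j)
 hence "i < r" "1 \<le> i" "1 \<le> j" using assms(2) by auto
 thus ?thesis using 17 by (auto simp: inter)
next
 case (18 i j)
 hence "j \<le> r" "1 \<le> i" "1 \<le> j" using assms(2) by auto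
 thus ?thesis using 18 by (auto simp: inter)
next
 case 19
 thus ?thesis by simp
next
 case 20
 then obtain i' where i: "r = Suc (Suc i')" using assms(2) by (cases r; cases "r - 1") auto
 have "\<k> (Suc i') (\<u> i' (\<UU> (Suc i') y)) = y" if "at1 Up i' y" for y :: "'a Qf"
  using that by (simp add: k_def flip: l_cup_u)
 thus ?thesis using 20 up i by simp
next
 case (21 j)
 hence "j < r - 1" "1 \<le> j" using assms(2) by auto
 thus ?thesis using 21 by (auto simp: inter)
next
 case 22
 then obtain i' where i: "r = Suc i'" "1 < n" using assms(2) by (cases r) auto
 have "\<k> i' (\<d> (Suc i') (\<UU> i' y)) = y" if "at1 Down i' y" for y :: "'a Qf"
  using that by (simp add: k_def d_cup)
 thus ?thesis using 22 down i by simp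
next
 case (23 j)
 hence "1 < j" "1 \<le> r" using assms(2) by auto
 thus ?thesis using 23 by (auto simp: inter)
next
 case 24
 then obtain i' where i: "r = Suc i'" using assms(2) by (cases r) auto
 thus ?thesis using 24 by (simp add: s_cup)
next
 case 25
 then obtain i' where i: "r = Suc i'" "1 \<le> n" using assms(2) by (cases r) auto
 thus ?thesis using 25 up down by (simp add: k_s)
next
 case (26 j)
 hence "1 \<le> j" "j < r" using assms(2) by auto
 thus ?thesis using 26 by (auto simp: inter)
next
 case (27 j)
 hence "1 < j" "1 \<le> r" using assms(2) by auto
 thus ?thesis using 27 by (auto simp: inter)
next
 \<comment> \<open>\<open>Y\<close> collapses the middle of both sides to two nested caps followed
   by two nested cups; the crossings left at their ends cancel by \<open>cup2_d\<close> and
   \<open>k2_d\<close>.\<close>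
 case 28
 then obtain i where r: "r = Suc (Suc i)" "1 < n" using assms(2) by (cases r; cases "r - 1") auto
 have v: "act (Suc (Suc i)) (bc_tinv z (Suc i)) y = \<v> i y" if "at1 Up i y" "at1 Up (Suc i) y" "zhat y = z *\<^sub>q y" for y
  using that by (simp add: v_eq)
 have zh_Op: "zhat (Op p j y) = z *\<^sub>q Op p j y" if "zhat y = z *\<^sub>q y" for p j and y :: "'a Qf"
  using that Op_zhat[of p j y] by simp
 have Y: "\<k> (Suc i) (\<v> i (\<d> (Suc (Suc i)) (\<UU> (Suc i) y))) = \<UU> i (\<k> i y)"
  if "at1 Up i y" "at1 Down (Suc i) y" for y :: "'a Qf"
 proof -
  have "\<k> (Suc i) (\<v> i (\<d> (Suc (Suc i)) (\<UU> (Suc i) y))) = \<k> (Suc i) (\<v> i (\<l> (Suc i) (\<UU> (Suc (Suc i)) y)))"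
   using that by (simp add: d_cup)
  also have "... = \<k> i (\<r> (Suc i) (\<l> (Suc i) (\<UU> (Suc (Suc i)) y)))"
   using that by (intro k_r[symmetric]) simp_all
  also have "... = \<UU> i (\<k> i y)" using that by (simp add: inter)
  finally show ?thesis .
 qed
 have x: "at1 Up i x" "at1 Up (Suc i) x" "at1 Down (Suc (Suc i)) x" "at1 Down (Suc (Suc (Suc i))) x"
  using up[of i] up[of "Suc i"] down[of r] down[of "Suc r"] r by simp_all
 have L: "act r t x = \<UU> (Suc i) (\<k> (Suc i) (\<v> i (\<d> (Suc (Suc i)) (\<UU> (Suc i) (\<k> (Suc i) (\<d> (Suc (Suc i)) (\<v> i x)))))))"
  using 28 x r zh by (simp add: v zh_Op del: act.simps(4))
 have "act r t' x = \<v> i (\<d> (Suc (Suc i)) (\<UU> (Suc i) (\<k> (Suc i) (\<d> (Suc (Suc i)) (\<v> i (\<UU> (Suc i) (\<k> (Suc i) x)))))))"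
  using 28 x r zh by (simp add: v zh_Op del: act.simps(4))
 also have "... = \<v> i (\<d> (Suc (Suc i)) (\<UU> (Suc i) (\<UU> i (\<k> i (\<k> (Suc i) x)))))"
  using x Y[of "\<k> (Suc i) x"] by (simp add: inter)
 also have "... = \<UU> (Suc i) (\<UU> i (\<k> i (\<k> (Suc i) x)))" by (simp add: cup2_d)
 also have "... = \<UU> (Suc i) (\<UU> i (\<k> i (\<k> (Suc i) (\<d> (Suc (Suc i)) (\<v> i x)))))"
  using x by (simp add: k2_d)
 also have "... = act r t x" unfolding L using x Y[of "\<k> (Suc i) (\<d> (Suc (Suc i)) (\<v> i x))"] by (simp add: inter)
 finally show ?thesis ..
next
 case 29
 thus ?thesis by simp
 qed
qed

text \<open>Expresses cup after cap at one level by operators of the next higher level; this links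
  the stability conditions of neighbouring levels.\<close>

lemma cup_k_k: "at1 Up i y ==> at1 Down (Suc i) y ==>
 \<k> (Suc i) (\<v> i (\<d> (Suc (Suc i)) (\<UU> (Suc i) y))) = \<UU> i (\<k> i y)"
proof -
 assume y: "at1 Up i y" "at1 Down (Suc i) y"
 have "\<k> (Suc i) (\<v> i (\<d> (Suc (Suc i)) (\<UU> (Suc i) y))) = \<k> (Suc i) (\<v> i (\<l> (Suc i) (\<UU> (Suc (Suc i)) y)))"
  using y by (simp add: d_cup)
 also have "... = \<k> i (\<r> (Suc i) (\<l> (Suc i) (\<UU> (Suc (Suc i)) y)))"
  using y by (intro k_r[symmetric]) simp_all
 also have "... = \<UU> i (\<k> i y)" using y by (simp add: inter)
 finally show ?thesis .
qed

lemma k_u_cup: "at1 Up i y ==> \<k> (Suc i) (\<u> i (\<UU> (Suc i) y)) = y"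
 by (simp add: k_def flip: l_cup_u)

lemma k_d_cup: "at1 Down i y ==> \<k> i (\<d> (Suc i) (\<UU> i y)) = y"
 by (simp add: k_def d_cup)

lemma Qat_same:
 assumes "x \<in> Qat z Y" "odom p = ocod p" "isat n (odom p) Y"
 shows "Op p n x \<in> Qat z Y"
proof -
 from assms(3) obtain A B where "Y = A @ odom p @ B" "length A = n" by (rule isatE)
 thus ?thesis using Qat_Op[of x z A p B] assms by auto
qed

lemma isat_srt:
 "Suc i < a ==> isat i [Up, Up] (srt a b)" "i < a ==> isat i [Up] (srt a b)"
 "a \<le> i ==> Suc i < a + b ==> isat i [Down, Down] (srt a b)" "a \<le> i ==> i < a + b ==> isat i [Down] (srt a b)"
 by (auto simp: isat_def take_Suc_conv_app_nth nth_append simp flip: Cons_nth_drop_Suc)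

lemma Qat_srt:
 assumes "x \<in> Qat z (srt a b)"
 shows "Suc i < a ==> \<u> i x \<in> Qat z (srt a b)" "i < a ==> \<c> i x \<in> Qat z (srt a b)"
  "a \<le> i ==> Suc i < a + b ==> \<d> i x \<in> Qat z (srt a b)" "a \<le> i ==> i < a + b ==> \<s> i x \<in> Qat z (srt a b)"
  "\<UU> a x \<in> Qat z (srt (Suc a) (Suc b))"
 using Qat_same[OF assms, of oU i] Qat_same[OF assms, of oC i] Qat_same[OF assms, of oD i] Qat_same[OF assms, of oS i]
  Qat_Op[of x z "replicate a Up" oCup "replicate b Down"] assms
 by (simp_all add: isat_srt flip: replicate_append_same)

lemma Qat_srt_k: "x \<in> Qat z (srt (Suc a) (Suc b)) ==> \<k> a x \<in> Qat z (srt a b)"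
 using Qat_Op[of x z "replicate a Up" oK "replicate b Down"] by (simp flip: replicate_append_same)

lemma Qat_srt_at1: "x \<in> Qat z (srt a b) ==> i < a ==> at1 Up i x"
 "x \<in> Qat z (srt a b) ==> a \<le> i ==> i < a + b ==> at1 Down i x"
 by (auto intro!: Qat_at1[of x z "srt a b"] simp: nth_append)

declare replicate_Suc [simp del]

definition "T1 i = \<u> (i - 1)"
definition "P1 i = \<c> (i - 1)"
text \<open>The inverse of the crossing, by \<open>d_d\<close>. With indices running from the right,
  it is the inverse that satisfies \<open>TP\<close>, and its quadratic relation has parameter
  \<open>- z\<close>. The last index then belongs to the strand at the border.\<close>

definition "T2 z m i x = \<d> (m - i - 1) x - z *\<^sub>q x"
definition "P2 m i = \<s> (m - i)"

text \<open>On the side of the down strands the indices are counted from the right, and the crossings are inverted.\<close>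

context
 fixes z :: "'k::comm_ring_1" and a b :: nat
begin

lemma up_module: "hecke_clifford_module Qscale (Qat z (srt a b)) T1 P1 z (- 1) a"
unfolding T1_def P1_def
proof unfold_locales
 note at = Qat_srt_at1(1)
 let ?T = "\<lambda>i. \<u> (i - 1)" and ?P = "\<lambda>i. \<c> (i - 1)"
 fix i j :: nat and x :: "'k Qf" assume i: "1 \<le> i" and x: "x \<in> Qat z (srt a b)"
 from i obtain i' where i': "i = Suc i'" by (cases i) auto
 show "i < a ==> ?T i x \<in> Qat z (srt a b)" "i \<le> a ==> ?P i x \<in> Qat z (srt a b)"
  using x i' by (auto intro: Qat_srt)
 show "i < a ==> ?T i (?T i x) = z *\<^sub>q ?T i x + x"
  using i' at[OF x] zhat_Qat[OF x] by (simp add: u_u flip: Op_zhat)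
 show "i + 1 < a ==> ?T i (?T (i + 1) (?T i x)) = ?T (i + 1) (?T i (?T (i + 1) x))"
  using i' at[OF x] by (simp add: u_braid0)
 show "i + 1 < j ==> j < a ==> ?T i (?T j x) = ?T j (?T i x)" using i' by (simp add: inter)
 show "i \<le> a ==> ?P i (?P i x) = - 1 *\<^sub>q x" using i' at[OF x] by simp
 show "i < a ==> ?T i (?P i x) = ?P (i + 1) (?T i x)" using i' at[OF x] by (simp add: u_c0)
 assume "1 \<le> j"
 then obtain j' where j': "j = Suc j'" by (cases j) auto
 show "i \<le> a ==> j \<le> a ==> i \<noteq> j ==> ?P i (?P j x) = - ?P j (?P i x)"
  using i' j' by (cases "i < j") (simp_all add: inter)
 show "i < a ==> j \<le> a ==> j \<noteq> i ==> j \<noteq> i + 1 ==> ?T i (?P j x) = ?P j (?T i x)"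
  using i' j' by (cases "i < j") (simp_all add: inter)
qed (simp_all add: Qat_subspace Op_hom)

lemma down_module: "hecke_clifford_module Qscale (Qat z (srt a b)) (T2 z (a + b)) (P2 (a + b)) (- z) 1 b"
unfolding T2_def P2_def
proof unfold_locales
 note at = Qat_srt_at1(2)
 note sub = Qm.subspace_diff[OF Qat_subspace] Qm.subspace_scale[OF Qat_subspace]
 let ?T = "\<lambda>i x. \<d> (a + b - i - 1) x - z *\<^sub>q x" and ?P = "\<lambda>i. \<s> (a + b - i)"
 fix i j :: nat and x :: "'k Qf" assume i: "1 \<le> i" and x: "x \<in> Qat z (srt a b)"
 have z: "zhat x = z *\<^sub>q x" using zhat_Qat[OF x] .
 show PC: "i \<le> b ==> ?P i x \<in> Qat z (srt a b)" using x i by (auto intro!: sub Qat_srt)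
 show TC: "i < b ==> ?T i x \<in> Qat z (srt a b)" using x i by (auto intro!: sub Qat_srt)
 have 1: "\<exists>k. a + b - i - 1 = k \<and> a + b - i = Suc k \<and> a \<le> k \<and> Suc k < a + b" if "i < b"
  using that i by (intro exI[of _ "a + b - i - 1"]) auto
 have at_d: "at1 Down k x" "at1 Down (Suc k) x" if "a \<le> k" "Suc k < a + b" for k using at[OF x] that by auto
 show "i < b ==> ?T i (?T i x) = - z *\<^sub>q ?T i x + x"
  using 1 at_d d_d[of _ x] z by (force simp: algebra_simps Qm.scale_right_diff_distrib simp flip: Op_zhat)
 show "i + 1 < b ==> ?T i (?T (i + 1) (?T i x)) = ?T (i + 1) (?T i (?T (i + 1) x))"
 proof -
  assume ib: "i + 1 < b"
  define k where "k = a + b - i - 2"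
  have k: "a + b - i - 1 = Suc k" "a + b - (i + 1) - 1 = k" "a \<le> k" "Suc (Suc k) < a + b" using ib i by (auto simp: k_def)
  have atk: "at1 Down k x" "at1 Down (Suc k) x" "at1 Down (Suc (Suc k)) x" using at[OF x] k by auto
  have z': "\<d> k (z *\<^sub>q x) = z *\<^sub>q \<d> k x" for k by simp
  show ?thesis unfolding k(1,2)
   using d_braid[of k x] d_d[of k x] d_d[of "Suc k" x] atk z
   by (simp add: algebra_simps Qm.scale_right_diff_distrib Qm.scale_right_distrib flip: Op_zhat)
 qed
 show "i + 1 < j ==> j < b ==> ?T i (?T j x) = ?T j (?T i x)"
  by (simp add: inter algebra_simps Qm.scale_right_diff_distrib)
 show "i \<le> b ==> ?P i (?P i x) = 1 *\<^sub>q x" using at[OF x, of "a + b - i"] i by (simp add: ss)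
 show "i < b ==> ?T i (?P i x) = ?P (i + 1) (?T i x)"
 proof -
  assume ib: "i < b"
  then obtain k where k: "a + b - i - 1 = k" "a + b - i = Suc k" "a \<le> k" "Suc k < a + b" using 1 by blast
  let ?y = "\<d> k x - z *\<^sub>q x"
  have y: "at1 Down k ?y" "at1 Down (Suc k) ?y" using at_d k by (simp_all add: at1_lin)
  have "\<d> k ?y = x" using d_d[of k x] at_d k z by (simp flip: Op_zhat)
  hence "\<d> k (\<s> k ?y) = \<s> (Suc k) x" using d_s0[OF y] by simp
  define w where "w = \<s> k ?y"
  have w: "at1 Down k w" "at1 Down (Suc k) w" "zhat w = z *\<^sub>q w" "\<d> k w = \<s> (Suc k) x"
   using y z at_d[of k] k \<open>\<d> k (\<s> k ?y) = _\<close>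
   by (simp_all add: w_def at1_lin Qm.scale_right_diff_distrib flip: Op_zhat)
  have "\<d> k (\<s> (Suc k) x) = z *\<^sub>q \<s> (Suc k) x + w"
   using d_d[OF w(1,2)] w(3,4) z by (simp flip: Op_zhat)
  moreover have "a + b - (i + 1) = k" using k by simp
  ultimately show ?thesis using k(1,2) by (simp add: w_def)
 qed
 assume "1 \<le> j"
 show "i \<le> b ==> j \<le> b ==> i \<noteq> j ==> ?P i (?P j x) = - ?P j (?P i x)"
  by (cases "i < j") (simp_all add: inter)
 show "i < b ==> j \<le> b ==> j \<noteq> i ==> j \<noteq> i + 1 ==> ?T i (?P j x) = ?P j (?T i x)"
  by (cases "i < j") (simp_all add: inter)
qed (simp_all add: Qat_subspace Op_hom Qm.scale_right_distrib Qm.scale_right_diff_distrib mult.commute)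

end

text \<open>Stability of one level on its own: the cap and the cup, which change the level, occur
  only combined.\<close>

definition good :: "'k::comm_ring_1 => nat => nat => 'k Qf set => bool" where
 "good z a b M \<longleftrightarrow> Qm.subspace M \<and> M \<subseteq> Qat z (srt a b) \<and> (\<forall>x\<in>M.
   (\<forall>i. Suc i < a --> \<u> i x \<in> M) \<and> (\<forall>i<a. \<c> i x \<in> M) \<and>
   (\<forall>i. a \<le> i \<and> Suc i < a + b --> \<d> i x \<in> M) \<and> (\<forall>i. a \<le> i \<and> i < a + b --> \<s> i x \<in> M) \<and>
   (0 < a \<and> 0 < b --> \<UU> (a - 1) (\<k> (a - 1) x) \<in> M))"

lemma goodD:
 assumes "good z a b M"
 shows "Qm.subspace M" "M \<subseteq> Qat z (srt a b)" "x \<in> M ==> Suc i < a ==> \<u> i x \<in> M" "x \<in> M ==> i < a ==> \<c> i x \<in> M"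
  "x \<in> M ==> a \<le> i ==> Suc i < a + b ==> \<d> i x \<in> M" "x \<in> M ==> a \<le> i ==> i < a + b ==> \<s> i x \<in> M"
  "x \<in> M ==> 0 < a ==> 0 < b ==> \<UU> (a - 1) (\<k> (a - 1) x) \<in> M"
 using assms unfolding good_def by blast+

text \<open>Downwards the next level is the image under the cap. Operators away from the border
  commute with the cap, cup after cap on the image is \<open>cup_k_k\<close>, and the cup leads back
  because \<open>M\<close> is stable under cup after cap.\<close>

lemma good_neg:
 assumes M: "good z (Suc a) (Suc b) M"
 shows "good z a b (\<k> a ` M)" "y \<in> \<k> a ` M ==> \<UU> a y \<in> M"
proof -
 note M = goodD[OF M]
 have com: "Op p i (\<k> a x) \<in> \<k> a ` M" if "Op p i x \<in> M" "i + length (ocod p) \<le> a" "length (odom p) = length (ocod p)" for p i x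
  using that Op_interchange_same[of p i a oK x, symmetric] by simp
 have com': "Op p i (\<k> a x) \<in> \<k> a ` M" if "Op p (Suc (Suc i)) x \<in> M" "a \<le> i" for p i x
  using that inter(8)[of a i p x] by auto
 show "y \<in> \<k> a ` M ==> \<UU> a y \<in> M" using M(7) by fastforce
 show "good z a b (\<k> a ` M)"
  unfolding good_def
 proof (intro conjI ballI allI impI; (elim conjE)?)
  show "Qm.subspace (\<k> a ` M)" using Modules.module_hom.subspace_image[OF Op_hom M(1)] .
  show "\<k> a ` M \<subseteq> Qat z (srt a b)" using M(2) Qat_srt_k by blast
  fix y assume "y \<in> \<k> a ` M"
  then obtain x where x: "x \<in> M" "y = \<k> a x" by blast
  show "Suc i < a ==> \<u> i y \<in> \<k> a ` M" for i unfolding x(2) by (rule com) (use x M(3) in auto)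
  show "i < a ==> \<c> i y \<in> \<k> a ` M" for i unfolding x(2) by (rule com) (use x M(4) in auto)
  show "a \<le> i ==> Suc i < a + b ==> \<d> i y \<in> \<k> a ` M" for i unfolding x(2) by (rule com') (use x M(5) in auto)
  show "a \<le> i ==> i < a + b ==> \<s> i y \<in> \<k> a ` M" for i unfolding x(2) by (rule com') (use x M(6) in auto)
  assume ab: "0 < a" "0 < b"
  then obtain i where a: "a = Suc i" by (cases a) auto
  have y: "y \<in> Qat z (srt a b)" using x M(2) Qat_srt_k by blast
  let ?w = "\<d> (Suc (Suc i)) (\<UU> (Suc i) y)"
  have "\<UU> (Suc i) y \<in> M" using M(7)[OF x(1)] x a by simp
  hence w: "?w \<in> M" using M(5) a ab by auto
  have "\<v> i ?w = \<u> i ?w - z *\<^sub>q ?w"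
   using v_eq[of i ?w] zhat_Qat[of ?w z] w M(2) Qat_srt_at1(1)[of ?w z "Suc a" "Suc b"] a by auto
  hence "\<v> i ?w \<in> M" using w M(1,3) a by (auto intro: Qm.subspace_diff Qm.subspace_scale)
  moreover have "\<UU> i (\<k> i y) = \<k> a (\<v> i ?w)"
   using cup_k_k[of i y] Qat_srt_at1(1)[OF y, of i] Qat_srt_at1(2)[OF y, of "Suc i"] a ab by simp
  ultimately show "\<UU> (a - 1) (\<k> (a - 1) y) \<in> \<k> a ` M" using a by auto
 qed
qed

text \<open>Upwards the next level is induced from the cups of \<open>M\<close>, first along the up
  strands to \<open>V\<close>, then along the down strands to \<open>N\<close>. The crucial point is
  that the cap sends it back into \<open>M\<close> (\<open>k_N\<close>).\<close>

locale next_level =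
 fixes z :: "'k::comm_ring_1" and a b :: nat and M :: "'k Qf set"
 assumes M: "good z a b M"
begin

interpretation up: hecke_clifford_module Qscale "Qat z (srt (Suc a) (Suc b))" T1 P1 z "- 1" "Suc a"
 by (rule up_module)
interpretation dn: hecke_clifford_module Qscale "Qat z (srt (Suc a) (Suc b))"
 "T2 z (Suc (Suc (a + b)))" "P2 (Suc (Suc (a + b)))" "- z" 1 "Suc b"
 using down_module[of z "Suc a" "Suc b"] by simp

abbreviation (input) "S \<equiv> Qat z (srt (Suc a) (Suc b))"
abbreviation (input) "P2ab \<equiv> P2 (Suc (Suc (a + b)))"
abbreviation (input) "T2ab \<equiv> T2 z (Suc (Suc (a + b)))"
definition "V = up.coset_span (\<UU> a ` M)"
definition "N = dn.coset_span V"

lemmas MD = goodD[OF M]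
lemmas sub = Qm.subspace_add Qm.subspace_diff Qm.subspace_scale Qm.subspace_0

lemma cup_M: "Qm.subspace (\<UU> a ` M)" "\<UU> a ` M \<subseteq> S"
 using Modules.module_hom.subspace_image[OF Op_hom MD(1)] MD(2) Qat_srt(5) by blast+

lemma cup_M_closed:
 "1 \<le> i ==> i + 1 < Suc a ==> y \<in> \<UU> a ` M ==> T1 i y \<in> \<UU> a ` M"
 "1 \<le> i ==> i < Suc a ==> y \<in> \<UU> a ` M ==> P1 i y \<in> \<UU> a ` M"
 "Suc (Suc a) \<le> i ==> Suc i < Suc a + Suc b ==> y \<in> \<UU> a ` M ==> \<d> i y \<in> \<UU> a ` M"
 "Suc (Suc a) \<le> i ==> i < Suc a + Suc b ==> y \<in> \<UU> a ` M ==> \<s> i y \<in> \<UU> a ` M"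
proof -
 assume "y \<in> \<UU> a ` M"
 then obtain x where x: "x \<in> M" "y = \<UU> a x" by blast
 show "1 \<le> i ==> i + 1 < Suc a ==> T1 i y \<in> \<UU> a ` M"
  using x MD(3)[OF x(1), of "i - 1"] inter(1)[of "i - 1" a oCup x, symmetric] by (simp add: T1_def P1_def)
 show "1 \<le> i ==> i < Suc a ==> P1 i y \<in> \<UU> a ` M"
  using x MD(4)[OF x(1), of "i - 1"] inter(6)[of "i - 1" a oCup x, symmetric] by (simp add: T1_def P1_def)
 show "Suc (Suc a) \<le> i ==> Suc i < Suc a + Suc b ==> \<d> i y \<in> \<UU> a ` M"
  using x MD(5)[OF x(1), of "i - 2"] inter(10)[of a i oD x] by (simp add: numeral_2_eq_2)
 show "Suc (Suc a) \<le> i ==> i < Suc a + Suc b ==> \<s> i y \<in> \<UU> a ` M"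
  using x MD(6)[OF x(1), of "i - 2"] inter(10)[of a i oS x] by (simp add: numeral_2_eq_2)
qed

lemmas upV = cup_M cup_M_closed(1,2)

lemma V_Qat: "V \<subseteq> S"
proof -
 have "up.ch j (Suc a) v \<in> S" if "v \<in> \<UU> a ` M" "1 \<le> j" for j v
  using up.ch_C[of j "Suc a" v] that cup_M by auto
 thus ?thesis unfolding V_def up.coset_span_def
  by (intro Qm.span_minimal Qat_subspace) (auto intro!: Qat_srt simp: P1_def)
qed

lemma V_subspace: "Qm.subspace V"
 unfolding V_def up.coset_span_def by simp

lemma V_least:
 assumes X: "Qm.subspace X" and "\<And>j y. 1 \<le> j ==> j \<le> Suc a ==> y \<in> M ==> up.ch j (Suc a) (\<UU> a y) \<in> X"
  and "\<And>j y. 1 \<le> j ==> j \<le> Suc a ==> y \<in> M ==> P1 j (up.ch j (Suc a) (\<UU> a y)) \<in> X"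
 shows "V \<subseteq> X"
 unfolding V_def up.coset_span_def by (rule Qm.span_minimal[OF _ X]) (use assms(2,3) in auto)

lemma ch_comm: "a < i ==> odom p = ocod p ==> Op p (Suc i) (up.ch j (Suc a) y) = up.ch j (Suc a) (Op p (Suc i) y)"
proof (induction "Suc a - j" arbitrary: j)
 case (Suc k)
 hence "Op p (Suc i) (up.ch j (Suc a) y) = Op p (Suc i) (T1 j (up.ch (j + 1) (Suc a) y))"
  by (simp add: up.ch_step)
 also have "... = T1 j (Op p (Suc i) (up.ch (j + 1) (Suc a) y))"
  using Suc unfolding T1_def by (intro inter) auto
 finally show ?case using Suc by (simp add: up.ch_step)
qed (simp add: up.ch_def)

lemma V_closed:
 assumes "x \<in> V"
 shows "Suc i < Suc a ==> \<u> i x \<in> V" "i < Suc a ==> \<c> i x \<in> V"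
  "Suc (Suc a) \<le> i ==> Suc i < Suc a + Suc b ==> \<d> i x \<in> V" "Suc (Suc a) \<le> i ==> i < Suc a + Suc b ==> \<s> i x \<in> V"
proof -
 show "Suc i < Suc a ==> \<u> i x \<in> V" using up.coset_span_T[OF upV, of "Suc i" x] assms by (simp add: V_def T1_def P1_def)
 show "i < Suc a ==> \<c> i x \<in> V" using up.coset_span_P[OF upV, of "Suc i" x] assms by (simp add: V_def T1_def P1_def)
 have key: "V \<subseteq> {x. Op p i x \<in> V}"
  if p: "odom p = ocod p" "p \<in> {oD, oS}" "Suc (Suc a) \<le> i" and cl: "\<And>y. y \<in> \<UU> a ` M ==> Op p i y \<in> \<UU> a ` M" for p
 proof (rule V_least)
  show "Qm.subspace {x. Op p i x \<in> V}"
   using V_subspace by (auto intro!: Qm.subspaceI intro: sub)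
  fix j y assume j: "1 \<le> j" "j \<le> Suc a" "y \<in> M"
  have e: "Op p i (up.ch j (Suc a) (\<UU> a y)) = up.ch j (Suc a) (Op p i (\<UU> a y))"
   using ch_comm[of "i - 1" p j "\<UU> a y"] p by simp
  have m: "Op p i (\<UU> a y) \<in> \<UU> a ` M" using cl j by blast
  show "up.ch j (Suc a) (\<UU> a y) \<in> {x. Op p i x \<in> V}"
   using up.coset_span_ch[OF upV m j(1,2)] by (simp add: e V_def)
  have "Op p i (P1 j (up.ch j (Suc a) (\<UU> a y))) = (if opar p = 1 then - 1 else 1) *\<^sub>q P1 j (up.ch j (Suc a) (Op p i (\<UU> a y)))"
   using p j by (simp add: P1_def inter(6) flip: e)
  thus "P1 j (up.ch j (Suc a) (\<UU> a y)) \<in> {x. Op p i x \<in> V}"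
   using up.coset_span_P_ch[OF upV m j(1,2)] V_subspace by (auto simp: V_def Qm.subspace_neg)
 qed
 show "Suc (Suc a) \<le> i ==> Suc i < Suc a + Suc b ==> \<d> i x \<in> V"
  using key[of oD] cup_M_closed(3)[of i] assms by auto
 show "Suc (Suc a) \<le> i ==> i < Suc a + Suc b ==> \<s> i x \<in> V"
  using key[of oS] cup_M_closed(4)[of i] assms by auto
qed

lemma dnV:
 "1 \<le> i ==> i + 1 < Suc b ==> x \<in> V ==> T2ab i x \<in> V"
 "1 \<le> i ==> i < Suc b ==> x \<in> V ==> P2ab i x \<in> V"
 using V_closed(3)[of x "Suc a + Suc b - i - 1"] V_closed(4)[of x "Suc a + Suc b - i"] V_subspace
 by (auto intro!: sub simp: T2_def P2_def)

lemmas dnV' = V_subspace V_Qat dnV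

lemma N_subspace: "Qm.subspace N"
 unfolding N_def dn.coset_span_def by simp

lemma cup_N: "y \<in> M ==> \<UU> a y \<in> N"
 using up.coset_span_V[OF upV] dn.coset_span_V[OF dnV'] by (auto simp: V_def N_def)

lemma N_least:
 assumes X: "Qm.subspace X" and "\<And>j y. 1 \<le> j ==> j \<le> Suc b ==> y \<in> V ==> dn.ch j (Suc b) y \<in> X"
  and "\<And>j y. 1 \<le> j ==> j \<le> Suc b ==> y \<in> V ==> P2ab j (dn.ch j (Suc b) y) \<in> X"
 shows "N \<subseteq> X"
 unfolding N_def dn.coset_span_def by (rule Qm.span_minimal[OF _ X]) (use assms(2,3) in auto)

lemma ch_comm': "p \<in> {oU, oC} ==> i + length (ocod p) \<le> Suc a ==> 1 \<le> j ==>
 Op p i (dn.ch j (Suc b) y) = dn.ch j (Suc b) (Op p i y)"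
proof (induction "Suc b - j" arbitrary: j)
 case (Suc k)
 hence "Op p i (dn.ch j (Suc b) y) = Op p i (T2ab j (dn.ch (j + 1) (Suc b) y))"
  by (simp add: dn.ch_step)
 also have "... = T2ab j (Op p i (dn.ch (j + 1) (Suc b) y))"
  using Suc.prems Suc.hyps(2) by (auto simp: T2_def inter)
 finally show ?case using Suc by (simp add: dn.ch_step T2_def)
qed (simp add: dn.ch_def)

lemma N_closed:
 assumes "x \<in> N"
 shows "Suc i < Suc a ==> \<u> i x \<in> N" "i < Suc a ==> \<c> i x \<in> N"
  "Suc a \<le> i ==> Suc i < Suc a + Suc b ==> \<d> i x \<in> N" "Suc a \<le> i ==> i < Suc a + Suc b ==> \<s> i x \<in> N"
proof -
 show "Suc a \<le> i ==> i < Suc a + Suc b ==> \<s> i x \<in> N"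
  using dn.coset_span_P[OF dnV', of "Suc a + Suc b - i" x] assms by (simp add: N_def P2_def)
 show "Suc a \<le> i ==> Suc i < Suc a + Suc b ==> \<d> i x \<in> N"
  using dn.coset_span_T[OF dnV', of "Suc a + Suc b - i - 1" x] assms sub(1)[OF N_subspace, of "\<d> i x - z *\<^sub>q x" "z *\<^sub>q x"] sub(3)[OF N_subspace, of x z]
  by (simp add: N_def T2_def)
 have key: "N \<subseteq> {x. Op p i x \<in> N}"
  if p: "p \<in> {oU, oC}" "i + length (ocod p) \<le> Suc a" and cl: "\<And>y. y \<in> V ==> Op p i y \<in> V" for p
 proof (rule N_least)
  show "Qm.subspace {x. Op p i x \<in> N}"
   using N_subspace by (auto intro!: Qm.subspaceI intro: sub)
  fix j y assume j: "1 \<le> j" "j \<le> Suc b" "y \<in> V"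
  note e = ch_comm'[OF p j(1), of y]
  have m: "Op p i y \<in> V" using cl j by blast
  show "dn.ch j (Suc b) y \<in> {x. Op p i x \<in> N}"
   using dn.coset_span_ch[OF dnV' m j(1,2)] by (simp add: e N_def)
  have "P2ab j (Op p i (dn.ch j (Suc b) y)) = (if opar p = 1 then - 1 else 1) *\<^sub>q Op p i (P2ab j (dn.ch j (Suc b) y))"
   using p j by (auto simp: P2_def inter)
  hence "Op p i (P2ab j (dn.ch j (Suc b) y)) = (if opar p = 1 then - 1 else 1) *\<^sub>q P2ab j (dn.ch j (Suc b) (Op p i y))"
   by (auto simp: e)
  thus "P2ab j (dn.ch j (Suc b) y) \<in> {x. Op p i x \<in> N}"
   using dn.coset_span_P_ch[OF dnV' m j(1,2)] N_subspace by (auto simp: N_def Qm.subspace_neg)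
 qed
 show "Suc i < Suc a ==> \<u> i x \<in> N" using key[of oU] V_closed(1) assms by auto
 show "i < Suc a ==> \<c> i x \<in> N" using key[of oC] V_closed(2) assms by auto
qed

lemma N_Qat: "N \<subseteq> S"
proof (rule N_least[OF Qat_subspace])
 fix j y assume j: "1 \<le> j" "j \<le> Suc b" "y \<in> V"
 thus c: "dn.ch j (Suc b) y \<in> S" using dn.ch_C[of j "Suc b" y] V_Qat by auto
 show "P2ab j (dn.ch j (Suc b) y) \<in> S" using dn.PC[OF j(1,2) c] .
qed

text \<open>Both \<open>\<k> a\<close> and \<open>\<k> a \<circ> \<d> (Suc a)\<close> map \<open>V\<close> into \<open>M\<close>; only the crossing and the Clifford generator next to the cup matter.\<close>

lemma k_V:
 assumes f: "f = \<k> a \<or> f = (\<lambda>x. \<k> a (\<d> (Suc a) x)) \<and> 0 < b" and x: "x \<in> V"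
 shows "f x \<in> M"
proof -
 have lin: "f (x + y) = f x + f y" "f (c *\<^sub>q x) = c *\<^sub>q f x" "f 0 = 0" for x y c using f by auto
 have com: "f (\<u> i x) = \<u> i (f x)" if "Suc i < a" for i x using f that by (auto simp: inter)
 have com': "f (\<c> i x) = \<c> i (f x)" if "i < a" for i x using f that by (auto simp: inter)
 have M_at: "at1 Up i y" if "y \<in> M" "i < a" for i y using that MD(2) Qat_srt_at1(1) by blast
 have M_at': "at1 Down i y" if "y \<in> M" "a \<le> i" "i < a + b" for i y using that MD(2) Qat_srt_at1(2) by blast
 have f1: "f (\<UU> a y) \<in> M" if y: "y \<in> M" for y
  using f k_d_cup[of a y] M_at'[OF y] y sub(4)[OF MD(1)] by auto
 have f2: "f (\<c> a (\<UU> a y)) \<in> M" if y: "y \<in> M" for y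
  using f
 proof
  assume "f = \<k> a" thus ?thesis using sub(4)[OF MD(1)] by simp
 next
  assume fd: "f = (\<lambda>x. \<k> a (\<d> (Suc a) x)) \<and> 0 < b"
  have "\<k> a (\<d> (Suc a) (\<c> a (\<UU> a y))) = \<k> a (\<d> (Suc a) (\<s> (Suc a) (\<UU> a y)))" by (simp add: s_cup)
  also have "... = \<k> a (\<s> (Suc (Suc a)) (\<d> (Suc a) (\<UU> a y)))"
   using M_at'[OF y, of a] fd by (simp add: d_s0)
  also have "... = \<s> a (\<k> a (\<d> (Suc a) (\<UU> a y)))" by (simp add: inter)
  also have "... = \<s> a y" using M_at'[OF y, of a] fd by (simp add: k_d_cup)
  finally show ?thesis using fd MD(6)[OF y, of a] by simp
 qed
 have f3: "f (\<u> (a - 1) (\<UU> a y)) \<in> M" if y: "y \<in> M" and a: "0 < a" for y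
 proof -
  obtain i where i: "a = Suc i" using a by (cases a) auto
  from f show ?thesis
  proof
   assume "f = \<k> a" thus ?thesis using k_u_cup[of i y] M_at[OF y, of i] i y by simp
  next
   assume fd: "f = (\<lambda>x. \<k> a (\<d> (Suc a) x)) \<and> 0 < b"
   let ?w = "\<d> (Suc a) (\<UU> a y)"
   have zy: "zhat y = z *\<^sub>q y" using zhat_Qat MD(2) y by blast
   have "\<u> i ?w = \<v> i ?w + z *\<^sub>q ?w"
    using v_eq[of i ?w] M_at[OF y, of i] i zy by (simp flip: Op_zhat)
   moreover have "\<k> a (\<v> i ?w) = \<UU> i (\<k> i y)" using cup_k_k[of i y] M_at[OF y, of i] M_at'[OF y, of a] fd i by simp
   moreover have "\<k> a ?w = y" using M_at'[OF y, of a] fd by (simp add: k_d_cup)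
   ultimately have "f (\<u> (a - 1) (\<UU> a y)) = \<UU> i (\<k> i y) + z *\<^sub>q y" using fd i by (simp add: inter)
   thus ?thesis using MD(7)[OF y a] fd i sub(1,3)[OF MD(1)] y by auto
  qed
 qed
 have f4: "f (up.ch j (Suc a) (\<UU> a y)) \<in> M" if "1 \<le> j" "j \<le> Suc a" "y \<in> M" for j y
  using that
 proof (induction "Suc a - j" arbitrary: j)
  case 0 thus ?case using f1 by (simp add: up.ch_def)
 next
  case (Suc k)
  show ?case
  proof (cases "j = a")
   case True
   hence "up.ch j (Suc a) (\<UU> a y) = \<u> (a - 1) (\<UU> a y)" using Suc by (simp add: up.ch_step T1_def)
   thus ?thesis using f3[OF Suc.prems(3)] True Suc.prems by simp
  next
   case False
   hence "f (up.ch j (Suc a) (\<UU> a y)) = \<u> (j - 1) (f (up.ch (j + 1) (Suc a) (\<UU> a y)))"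
    using Suc com by (simp add: up.ch_step T1_def)
   thus ?thesis using Suc(1)[of "j + 1"] Suc(2-) MD(3) False by simp
  qed
 qed
 have "V \<subseteq> {x. f x \<in> M}"
 proof (rule V_least)
  show "Qm.subspace {x. f x \<in> M}" using MD(1) by (auto intro!: Qm.subspaceI intro: sub simp: lin)
  fix j y assume j: "1 \<le> j" "j \<le> Suc a" "y \<in> M"
  thus "up.ch j (Suc a) (\<UU> a y) \<in> {x. f x \<in> M}" using f4 by simp
  show "P1 j (up.ch j (Suc a) (\<UU> a y)) \<in> {x. f x \<in> M}"
  proof (cases "j = Suc a")
   case True thus ?thesis using f2 j by (simp add: P1_def)
  next
   case False thus ?thesis using f4[OF j] com'[of "j - 1"] MD(4) j by (simp add: P1_def)
  qed
 qed
 thus ?thesis using x by blast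
qed

text \<open>In a chain of crossings on down strands only the innermost factor, at
  \<open>j = b\<close>, meets the cap; the others commute with it. This factor is why
  \<open>k_V\<close> also treats the cap after \<open>\<d> (Suc a)\<close>.\<close>

lemma k_N: "x \<in> N ==> \<k> a x \<in> M"
proof -
 have ch: "\<k> a (dn.ch j (Suc b) y) \<in> M" if "1 \<le> j" "j \<le> Suc b" "y \<in> V" for j y
  using that
 proof (induction "Suc b - j" arbitrary: j)
  case 0 thus ?case using k_V by (simp add: dn.ch_def)
 next
  case (Suc k)
  let ?i = "Suc a + Suc b - j - 1"
  show ?case
  proof (cases "j = b")
   case True
   hence "dn.ch j (Suc b) y = \<d> (Suc a) y - z *\<^sub>q y" using Suc by (simp add: dn.ch_step T2_def)
   moreover have "\<k> a (\<d> (Suc a) y) \<in> M" using k_V[of "\<lambda>x. \<k> a (\<d> (Suc a) x)" y] Suc True by simp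
   ultimately show ?thesis using k_V[of "\<k> a" y] Suc.prems sub(2,3)[OF MD(1)] by simp
  next
   case False
   let ?y = "dn.ch (j + 1) (Suc b) y"
   have IH: "\<k> a ?y \<in> M" using Suc(1)[of "j + 1"] Suc(2-) by simp
   have "\<k> a (\<d> ?i ?y) = \<d> (a + b - j - 1) (\<k> a ?y)"
   proof -
    have "?i = Suc (Suc (a + b - j - 1))" "a \<le> a + b - j - 1" using Suc False by auto
    thus ?thesis using inter(8)[of a "a + b - j - 1" oD ?y] by (simp only:)
   qed
   hence "\<k> a (dn.ch j (Suc b) y) = \<d> (a + b - j - 1) (\<k> a ?y) - z *\<^sub>q \<k> a ?y"
    using Suc by (simp add: dn.ch_step T2_def)
   moreover have "\<d> (a + b - j - 1) (\<k> a ?y) \<in> M" by (rule MD(5)[OF IH]) (use Suc False in auto)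
   ultimately show ?thesis using IH sub(2,3)[OF MD(1)] by simp
  qed
 qed
 have "N \<subseteq> {x. \<k> a x \<in> M}"
 proof (rule N_least)
  show "Qm.subspace {x. \<k> a x \<in> M}" using MD(1) by (auto intro!: Qm.subspaceI intro: sub)
  fix j y assume j: "1 \<le> j" "j \<le> Suc b" "y \<in> V"
  thus "dn.ch j (Suc b) y \<in> {x. \<k> a x \<in> M}" using ch by simp
  show "P2ab j (dn.ch j (Suc b) y) \<in> {x. \<k> a x \<in> M}"
  proof (cases "j = Suc b")
   case True
   have "y \<in> S" using V_Qat j by blast
   hence "\<k> a (\<s> (Suc a) y) = \<k> a (\<c> a y)" using Qat_srt_at1[of y z "Suc a" "Suc b"] by (simp add: k_s)
   thus ?thesis using k_V[of "\<k> a" "\<c> a y"] V_closed(2)[OF j(3), of a] True by (simp add: dn.ch_def P2_def)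
  next
   case False
   let ?y = "dn.ch j (Suc b) y"
   have "\<k> a (P2ab j ?y) = \<s> (a + b - j) (\<k> a ?y)"
    using inter(8)[of a "a + b - j" oS ?y] j False by (simp add: P2_def Suc_diff_le)
   moreover have "\<s> (a + b - j) (\<k> a ?y) \<in> M" by (rule MD(6)[OF ch[OF j]]) (use j False in auto)
   ultimately show ?thesis by simp
  qed
 qed
 thus "x \<in> N ==> \<k> a x \<in> M" by blast
qed

lemma good_N: "good z (Suc a) (Suc b) N"
 unfolding good_def using N_subspace N_Qat N_closed cup_N k_N by auto

end

section \<open>The levels generated by the identity\<close>

context
 fixes z :: "'k::comm_ring_1" and r n :: nat
begin

abbreviation (input) "idel \<equiv> el z (srt r n) (srt r n) (MId (srt r n))"

definition Phi :: "'k Qf set" where "Phi = (\<lambda>t. act r t idel) ` aterms (BC_gens r n)"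

lemma Phi_gop: "x \<in> Phi ==> g \<in> BC_gens r n ==> gop r g x \<in> Phi"
proof -
 assume "x \<in> Phi" "g \<in> BC_gens r n"
 then obtain t where "t \<in> aterms (BC_gens r n)" "x = act r t idel" by (auto simp: Phi_def)
 thus ?thesis using \<open>g \<in> _\<close> unfolding Phi_def by (intro image_eqI[of _ _ "AGen g \<bullet> t"]) auto
qed

lemma gop_Qat:
 assumes g: "g \<in> BC_gens r n" and x: "x \<in> Qat z (srt r n)"
 shows "gop r g x \<in> Qat z (srt r n)"
proof (cases g)
 case GE
 then obtain a b where "r = Suc a" "n = Suc b" using g by (cases r; cases n) (auto simp: BC_gens_iff)
 thus ?thesis using GE Qat_srt(5)[OF Qat_srt_k[of x z a b]] x by simp
qed (use g x in \<open>auto simp: BC_gens_iff intro!: Qat_srt\<close>)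

lemma act_Qat: "t \<in> aterms (BC_gens r n) ==> x \<in> Qat z (srt r n) ==> act r t x \<in> Qat z (srt r n)"
 by (induction t arbitrary: x)
  (simp_all add: gop_Qat Qm.subspace_0[OF Qat_subspace] Qm.subspace_add[OF Qat_subspace] Qm.subspace_scale[OF Qat_subspace])

lemma act_acong:
 assumes "acong (BC_gens r n) (BC_rel z r) t t'" "x \<in> Qat z (srt r n)"
 shows "act r t x = act r t' x"
 using assms
proof (induction arbitrary: x rule: acong.induct)
 case (acong_rel t t')
 thus ?case by (intro act_rel[of z r t t' n] zhat_Qat[of x z "srt r n"] Qat_srt_at1[of x z r n]) auto
next
 case (acong_mult_cong s s' t t')
 have "t \<in> aterms (BC_gens r n)" using acong_aterms[OF acong_mult_cong(2)] by simp
 hence "act r t x \<in> Qat z (srt r n)" using act_Qat acong_mult_cong.prems by simp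
 thus ?case using acong_mult_cong by simp
qed (simp_all add: act_lin algebra_simps Qm.scale_right_distrib Qm.scale_left_distrib)

lemma good_Phi: "good z r n Phi"
 unfolding good_def
proof (intro conjI ballI allI impI; (elim conjE)?)
 show "Qm.subspace Phi"
 proof (rule Qm.subspaceI)
  show "0 \<in> Phi" unfolding Phi_def by (intro image_eqI[of _ _ AZero]) auto
  fix x y assume "x \<in> Phi" "y \<in> Phi"
  then obtain s t where "s \<in> aterms (BC_gens r n)" "x = act r s idel" "t \<in> aterms (BC_gens r n)" "y = act r t idel" by (auto simp: Phi_def)
  thus "x + y \<in> Phi" unfolding Phi_def by (intro image_eqI[of _ _ "AAdd s t"]) auto
 next
  fix x c assume "x \<in> Phi"
  then obtain s where "s \<in> aterms (BC_gens r n)" "x = act r s idel" by (auto simp: Phi_def)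
  thus "c *\<^sub>q x \<in> Phi" unfolding Phi_def by (intro image_eqI[of _ _ "AScale c s"]) auto
 qed
 show "Phi \<subseteq> Qat z (srt r n)" unfolding Phi_def using act_Qat el_Qat by blast
 fix x assume x: "x \<in> Phi"
 show "Suc i < r ==> \<u> i x \<in> Phi" for i using Phi_gop[OF x, of "GT (Suc i)"] by (simp add: BC_gens_iff)
 show "i < r ==> \<c> i x \<in> Phi" for i using Phi_gop[OF x, of "GPi (Suc i)"] by (simp add: BC_gens_iff)
 show "r \<le> i ==> Suc i < r + n ==> \<d> i x \<in> Phi" for i
  using Phi_gop[OF x, of "GTs (Suc (i - r))"] by (auto simp: BC_gens_iff)
 show "r \<le> i ==> i < r + n ==> \<s> i x \<in> Phi" for i
  using Phi_gop[OF x, of "GPis (Suc (i - r))"] by (auto simp: BC_gens_iff)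
 show "0 < r ==> 0 < n ==> \<UU> (r - 1) (\<k> (r - 1) x) \<in> Phi" using Phi_gop[OF x, of GE] by (simp add: BC_gens_iff)
qed

primrec Pos :: "nat => 'k Qf set" where
 "Pos 0 = Phi" | "Pos (Suc k) = next_level.N z (r + k) (n + k) (Pos k)"

primrec Neg :: "nat => 'k Qf set" where
 "Neg 0 = Phi" | "Neg (Suc k) = \<k> (r - Suc k) ` Neg k"

lemma good_Pos: "good z (r + k) (n + k) (Pos k)"
proof (induction k)
 case (Suc k)
 then interpret next_level z "r + k" "n + k" "Pos k" by unfold_locales
 show ?case using good_N by simp
qed (simp add: good_Phi)

lemma good_Neg: "k \<le> r ==> k \<le> n ==> good z (r - k) (n - k) (Neg k)"
proof (induction k)
 case (Suc k)
 hence "Suc (r - Suc k) = r - k" "Suc (n - Suc k) = n - k" by auto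
 thus ?case using Suc good_neg(1)[of z "r - Suc k" "n - Suc k" "Neg k"] by simp
qed (simp add: good_Phi)

text \<open>Cups and caps change both numbers by one, so only pairs with the same difference as
  \<open>(r, n)\<close> can be connected with it; all other levels are zero.\<close>

definition Lev :: "nat => nat => 'k Qf set" where
 "Lev a b = (if r \<le> a \<and> n \<le> b \<and> a - r = b - n then Pos (a - r)
   else if a < r \<and> b < n \<and> r - a = n - b then Neg (r - a) else {0})"

lemma Lev_cases:
 obtains (pos) k where "a = r + k" "b = n + k" "Lev a b = Pos k"
 | (neg) k where "r = a + Suc k" "n = b + Suc k" "Lev a b = Neg (Suc k)"
 | (none) "Lev a b = {0}"
proof -
 consider "r \<le> a \<and> n \<le> b \<and> a - r = b - n" | "a < r \<and> b < n \<and> r - a = n - b" "\<not> (r \<le> a)"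
  | "\<not> (r \<le> a \<and> n \<le> b \<and> a - r = b - n)" "\<not> (a < r \<and> b < n \<and> r - a = n - b)" by linarith
 thus thesis
 proof cases
  case 1 thus ?thesis by (intro pos[of "a - r"]) (auto simp: Lev_def)
 next
  case 2
  hence "r - a = Suc (r - a - 1)" by auto
  thus ?thesis using 2 by (intro neg[of "r - a - 1"]) (auto simp: Lev_def)
 next
  case 3 thus ?thesis by (intro none) (auto simp: Lev_def)
 qed
qed

lemma good_Lev: "Lev a b \<noteq> {0} ==> good z a b (Lev a b)"
proof (cases rule: Lev_cases[of a b])
 case (pos k) thus ?thesis using good_Pos by simp
next
 case (neg k) thus ?thesis using good_Neg[of "Suc k"] by simp
qed simp

lemma Lev_subspace: "Qm.subspace (Lev a b)"
 using good_Lev[of a b] goodD(1) by (cases "Lev a b = {0}") auto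

lemma Lev_pos: "Lev (r + k) (n + k) = Pos k" and Lev_neg: "k \<le> r ==> k \<le> n ==> Lev (r - k) (n - k) = Neg k"
 by (auto simp: Lev_def) (cases k; auto)+

lemma levels_Lev: "levels z Lev"
proof
 fix a b i :: nat and x :: "'k Qf"
 show "Qm.subspace (Lev a b)" by (rule Lev_subspace)
 show "Lev a b \<subseteq> Qat z (srt a b)"
  using good_Lev[of a b] goodD(2)[of z a b "Lev a b"] Qm.subspace_0[OF Qat_subspace] by (cases "Lev a b = {0}") auto
 note D = goodD[OF good_Lev]
 show "x \<in> Lev a b ==> Suc i < a ==> \<u> i x \<in> Lev a b" using D(3)[of a b x i] by (cases "Lev a b = {0}") auto
 show "x \<in> Lev a b ==> i < a ==> \<c> i x \<in> Lev a b" using D(4)[of a b x i] by (cases "Lev a b = {0}") auto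
 show "x \<in> Lev a b ==> a \<le> i ==> Suc i < a + b ==> \<d> i x \<in> Lev a b" using D(5)[of a b x i] by (cases "Lev a b = {0}") auto
 have z0: "0 \<in> Lev a b" for a b by (rule Qm.subspace_0[OF Lev_subspace])
 show "\<k> a x \<in> Lev a b" if x: "x \<in> Lev (Suc a) (Suc b)"
 proof (cases rule: Lev_cases[of "Suc a" "Suc b"])
  case (pos k)
  show ?thesis
  proof (cases k)
   \<comment> \<open>At the starting level the cap enters the descending sequence.\<close>
   case 0
   hence "Lev a b = Neg 1" using Lev_neg[of 1] pos(1,2) by (metis One_nat_def add.right_neutral diff_Suc_1 le_add1 plus_1_eq_Suc)
   thus ?thesis using 0 pos x by auto
  next
   case (Suc j)
   interpret next_level z "r + j" "n + j" "Pos j" using good_Pos by unfold_locales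
   show ?thesis using Suc pos x k_N[of x] Lev_pos[of j] by simp
  qed
 next
  case (neg k)
  hence "Lev a b = Neg (Suc (Suc k))" "r - Suc (Suc k) = a" using Lev_neg[of "Suc (Suc k)"] by simp_all
  hence "Lev a b = \<k> a ` Lev (Suc a) (Suc b)" unfolding neg(3) by (simp only: Neg.simps)
  thus ?thesis using x by blast
 qed (use x z0 in auto)
 show "\<UU> a x \<in> Lev (Suc a) (Suc b)" if x: "x \<in> Lev a b"
 proof (cases rule: Lev_cases[of a b])
  case (pos k)
  interpret next_level z "r + k" "n + k" "Pos k" using good_Pos by unfold_locales
  show ?thesis using cup_N[of x] x pos Lev_pos[of "Suc k"] by simp
 next
  case (neg k)
  have "good z (Suc a) (Suc b) (Neg k)" using good_Neg[of k] neg by simp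
  moreover from neg have "Lev (Suc a) (Suc b) = Neg k" using Lev_neg[of k] by simp
  moreover have "r - Suc k = a" using neg by simp
  hence "Lev a b = \<k> a ` Neg k" unfolding neg(3) by (simp only: Neg.simps)
  ultimately show ?thesis using good_neg(2)[of z a b "Neg k" x] x by blast
 qed (use x z0 in auto)
qed

text \<open>The level at \<open>(r, n)\<close> is exactly the orbit of the identity, and
  \<open>RZ_all\<close> followed by \<open>RZ_sorted\<close> puts every endomorphism into
  it.\<close>

theorem act_surj:
 assumes "Qty (srt r n) (srt r n) f"
 shows "\<exists>t\<in>aterms (BC_gens r n). el z (srt r n) (srt r n) f = act r t idel"
proof -
 interpret levels z Lev by (rule levels_Lev)
 have L: "Lev r n = Phi" using Lev_pos[of 0] by simp
 have "idel \<in> Phi" unfolding Phi_def by (intro image_eqI[of _ _ AOne]) auto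
 hence "RZ (srt r n) idel" using R_base[of idel r n] L by (auto simp: RZ_def R'_def)
 from RZ_all[OF this assms] have "el z (srt r n) (srt r n) f \<in> Phi" using RZ_sorted L by blast
 thus ?thesis by (auto simp: Phi_def)
qed

end

section \<open>A matrix representation of the category\<close>

text \<open>
 Adjoins to \<open>'k\<close> a root \<open>q\<close> of \<open>q\<^sup>2 = z q + 1\<close>, for all \<open>z\<close> at once: the product over \<open>z\<close> of the
 rings \<open>'k[q] / (q\<^sup>2 - z q - 1)\<close>.
\<close>

typedef 'k ext = "UNIV :: ('k::comm_ring_1 => 'k \<times> 'k) set" ..

setup_lifting type_definition_ext

instantiation ext :: (comm_ring_1) comm_ring_1
begin

lift_definition zero_ext :: "'a ext" is "\<lambda>z. (0, 0)" .
lift_definition one_ext :: "'a ext" is "\<lambda>z. (1, 0)" .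
lift_definition plus_ext :: "'a ext => 'a ext => 'a ext" is "\<lambda>f g z. (fst (f z) + fst (g z), snd (f z) + snd (g z))" .
lift_definition uminus_ext :: "'a ext => 'a ext" is "\<lambda>f z. (- fst (f z), - snd (f z))" .
lift_definition minus_ext :: "'a ext => 'a ext => 'a ext" is "\<lambda>f g z. (fst (f z) - fst (g z), snd (f z) - snd (g z))" .
lift_definition times_ext :: "'a ext => 'a ext => 'a ext" is
 "\<lambda>f g z. (fst (f z) * fst (g z) + snd (f z) * snd (g z),
  fst (f z) * snd (g z) + snd (f z) * fst (g z) + z * (snd (f z) * snd (g z)))" .

instance
 by standard (transfer; auto simp: fun_eq_iff algebra_simps)+

end

lift_definition ext_of :: "'k::comm_ring_1 => 'k ext" is "\<lambda>c z. (c, 0)" .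
lift_definition ext_z :: "'k::comm_ring_1 ext" is "\<lambda>z. (z, 0)" .
lift_definition ext_q :: "'k::comm_ring_1 ext" is "\<lambda>z. (0, 1)" .
text \<open>The idempotent of the component at \<open>z\<close>. Only after multiplication by it
  does the scalar \<open>z\<close> agree with \<open>ext_z\<close>.\<close>

lift_definition ext_at :: "'k::comm_ring_1 => 'k ext" is "\<lambda>z z'. (if z' = z then 1 else 0, 0)" .
lift_definition ext_coord :: "'k::comm_ring_1 => 'k ext => 'k" is "\<lambda>z f. fst (f z)" .

lemma ext_simps:
 "ext_of (a + b) = ext_of a + ext_of b" "ext_of (a * b) = ext_of a * ext_of b" "ext_of 1 = 1" "ext_of (- a) = - ext_of a"
 "ext_q * ext_q = ext_z * ext_q + 1" "ext_at z * ext_of z = ext_at z * ext_z"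
 by (transfer; auto simp: fun_eq_iff)+

lemma ext_coord:
 "ext_at z * x = ext_at z * y ==> ext_coord z x = ext_coord z y"
 "ext_coord z (x + y) = ext_coord z x + ext_coord z y" "ext_coord z (ext_of c * x) = c * ext_coord z x"
 "ext_coord z 1 = 1" "ext_coord z 0 = 0" "ext_coord z (- x) = - ext_coord z x"
 by (transfer; auto simp: fun_eq_iff split: if_splits)+

text \<open>Basis vectors of a superspace with equally many even and odd dimensions: an index, and a
  flag for odd.\<close>

type_synonym label = "nat \<times> bool"

locale hecke_parameter =
 fixes q qi :: "'r::comm_ring_1"
 assumes q [simp]: "q * qi = 1"
begin

definition tm :: "bool => nat => nat => 'r" where "tm e a b = (if a = b then if e then qi else q else 1)"
definition sg :: "bool => 'r" where "sg e = (if e then - 1 else 1)"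
definition z0 :: "bool => 'r" where "z0 b = (if b then q - qi else 0)"

text \<open>The R-matrix on the square of the natural module of the quantum isomeric superalgebra,
  acting on functions of basis words, hence transposed; the rest of the word is carried
  along.\<close>

fun tU :: "(label list => 'r) => label list => 'r" where
 "tU F ((a, \<alpha>) # (b, \<beta>) # w) = (if \<beta>
   then sg \<alpha> * (tm True a b * F ((b, True) # (a, \<alpha>) # w) + (q - qi) * F ((a, False) # (b, \<not> \<alpha>) # w) - z0 (a < b) * F ((a, True) # (b, \<alpha>) # w))
   else tm False a b * F ((b, False) # (a, \<alpha>) # w) + z0 (a > b) * F ((a, False) # (b, \<alpha>) # w))"
| "tU F w = 0"

fun tC :: "(label list => 'r) => label list => 'r" where
 "tC F ((a, \<alpha>) # w) = (if \<alpha> then - F ((a, False) # w) else F ((a, True) # w))"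
| "tC F [] = 0"

fun t2 :: "((label list => 'r) => label list => 'r) => (label list => 'r) => label list => 'r" where
 "t2 f F (x # w) = f (\<lambda>v. F (x # v)) w" | "t2 f F [] = 0"

lemma qq [simp]: "qi * q = 1" "q * (qi * x) = x" "qi * (q * x) = x"
proof -
 show "qi * q = 1" using q by (simp only: mult.commute)
 thus "q * (qi * x) = x" "qi * (q * x) = x" by (simp_all flip: mult.assoc)
qed

lemma tU_tU: "tU (tU F) ((a, \<alpha>) # (b, \<beta>) # w) = (q - qi) * tU F ((a, \<alpha>) # (b, \<beta>) # w) + F ((a, \<alpha>) # (b, \<beta>) # w)"
proof -
 consider "a = b" | "a < b" | "b < a" by linarith
 thus ?thesis
  by cases (cases \<alpha>; cases \<beta>; simp add: tm_def sg_def z0_def algebra_simps)+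
qed

lemma tC_tU: "tC (tU F) ((a, \<alpha>) # (b, \<beta>) # w) = tU (\<lambda>v. (if snd (hd v) then - 1 else 1) * t2 tC F v) ((a, \<alpha>) # (b, \<beta>) # w)"
proof -
 consider "a = b" | "a < b" | "b < a" by linarith
 thus ?thesis
  by cases (cases \<alpha>; cases \<beta>; simp add: tm_def sg_def z0_def algebra_simps)+
qed

text \<open>Only the relative order of the three indices and their flags matters, which leaves
  finitely many polynomial identities.\<close>

lemma braid:
 "tU (t2 tU (tU F)) ((a, \<alpha>) # (b, \<beta>) # (c, \<gamma>) # w) = t2 tU (tU (t2 tU F)) ((a, \<alpha>) # (b, \<beta>) # (c, \<gamma>) # w)"
proof (cases a b rule: linorder_cases; cases b c rule: linorder_cases; cases a c rule: linorder_cases)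
qed ((simp; fail) | (cases \<alpha>; cases \<beta>; cases \<gamma>; simp add: tm_def sg_def z0_def; (simp add: algebra_simps)?; fail))+
end

section \<open>Triangular matrices for crossings of opposite strands\<close>

context hecke_parameter
begin

definition pw :: "nat => 'r" where "pw a = q ^ (2 * a)"
definition ipw :: "nat => 'r" where "ipw a = qi ^ (2 * a)"

lemma pw_simps [simp]: "pw 0 = 1" "ipw 0 = 1" "pw (Suc a) = q * (q * pw a)" "ipw (Suc a) = qi * (qi * ipw a)"
 "pw a * ipw a = 1" "ipw a * pw a = 1" "pw a * (ipw a * x) = x" "ipw a * (pw a * x) = x"
proof -
 show 1: "pw a * ipw a = 1" by (simp add: pw_def ipw_def flip: power_mult_distrib)
 thus "ipw a * pw a = 1" by (simp only: mult.commute)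
 with 1 show "pw a * (ipw a * x) = x" "ipw a * (pw a * x) = x" by (simp_all flip: mult.assoc)
qed (simp_all add: pw_def ipw_def algebra_simps)

text \<open>For two strands with the same index the opposite crossing is triangular up to a coupling
  of rank one: \<open>loA\<close>, \<open>upA\<close> and \<open>tot\<close> describe
  \<open>l\<^sup>+\<close>; \<open>loB\<close>, \<open>upB\<close> and \<open>full\<close> describe
  its inverse.\<close>

definition "loA p a = q * p a + (q - qi) * (\<Sum>b<a. p b)"
definition "loB d a = qi * d a - (q - qi) * ipw a * (\<Sum>b<a. pw b * d b)"
definition "upA L r a = - (qi * r a) + (q - qi) * (\<Sum>b\<in>{Suc a..<L}. r b)"
definition "upB L d a = - (q * d a) - (q - qi) * ipw a * (\<Sum>b\<in>{Suc a..<L}. pw b * d b)"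
definition "tot L r = (q - qi) * (\<Sum>b<L. r b)"
definition "full L d a = (q - qi) * ipw a * (\<Sum>b<L. pw b * d b)"

lemma sum_loA: "(\<Sum>b<a. pw b * loA p b) = pw a * qi * (\<Sum>b<a. p b)"
 by (induction a) (simp_all add: loA_def algebra_simps)

lemma sum_loB: "(\<Sum>b<a. loB d b) = q * ipw a * (\<Sum>b<a. pw b * d b)"
 by (induction a) (simp_all add: loB_def algebra_simps)

lemma loA_loB: "loA (loB d) a = d a" and loB_loA: "loB (loA p) a = p a"
 by (simp_all add: loA_def[of "loB d"] loB_def[of "loA p"] sum_loA sum_loB) (simp_all add: loA_def loB_def algebra_simps)

lemma sum_upB: "a \<le> L ==> (\<Sum>b\<in>{a..<L}. upB L d b) = - q * ipw a * (\<Sum>b\<in>{a..<L}. pw b * d b)"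
 by (induction rule: inc_induct) (simp_all add: sum.atLeast_Suc_lessThan upB_def algebra_simps)

lemma sum_upA: "a \<le> L ==> (\<Sum>b\<in>{a..<L}. pw b * upA L r b) = - pw a * qi * (\<Sum>b\<in>{a..<L}. r b)"
 by (induction rule: inc_induct) (simp_all add: sum.atLeast_Suc_lessThan upA_def algebra_simps)

lemma upA_upB: "a < L ==> upA L (upB L d) a = d a" and upB_upA: "a < L ==> upB L (upA L r) a = r a"
 by (simp_all add: upA_def[of L "upB L d"] upB_def[of L "upA L r"] sum_upA sum_upB) (simp_all add: upA_def upB_def algebra_simps)

lemma sum_pw: "(q - qi) * (\<Sum>b<a. pw b) = qi * (pw a - 1)"
 by (induction a) (simp_all add: algebra_simps)

lemma loB_const: "loB (\<lambda>_. c) a = qi * ipw a * c"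
proof -
 have "loB (\<lambda>_. c) a = qi * c - ipw a * ((q - qi) * (\<Sum>b<a. pw b)) * c"
  by (simp add: loB_def algebra_simps flip: sum_distrib_left)
 thus ?thesis unfolding sum_pw by (simp add: algebra_simps)
qed

text \<open>The couplings of the two crossings cancel in the composite; \<open>loA_full\<close> is
  the counterpart for the other order.\<close>

lemma loB_tot: "loB (\<lambda>_. tot L r) a + full L (upA L r) a = 0"
 using sum_upA[of 0 L r] by (simp add: loB_const tot_def full_def algebra_simps flip: lessThan_atLeast0)

lemma lo_add: "loB (\<lambda>b. d b + d' b) a = loB d a + loB d' a" "loA (\<lambda>b. d b + d' b) a = loA d a + loA d' a"
 by (simp_all add: loA_def loB_def algebra_simps sum.distrib)

lemma lo_neg: "loA (\<lambda>b. - d b) a = - loA d a"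
 by (simp add: loA_def algebra_simps sum_negf)

lemma up_neg: "upA L (\<lambda>b. - d b) a = - upA L d a" "upB L (\<lambda>b. - d b) a = - upB L d a"
 by (simp_all add: upA_def upB_def algebra_simps sum_negf)

lemma full_cong: "(\<And>b. b < L ==> d b = d' b) ==> full L d a = full L d' a"
 by (simp add: full_def)

lemma loA_full: "loA (full L d) a + tot L (upB L d) = 0"
proof -
 have "full L d b = - loB (\<lambda>_. tot L (upB L d)) b" for b
  using loB_tot[of L "upB L d" b] full_cong[of L "upA L (upB L d)" d b] upA_upB[of _ L d]
  by (simp add: eq_neg_iff_add_eq_0 add.commute)
 hence "full L d = (\<lambda>b. - loB (\<lambda>_. tot L (upB L d)) b)" by blast
 thus ?thesis by (simp add: lo_neg loA_loB)
qed

end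

definition wpar :: "label list => bool" where "wpar w = odd (length (filter snd w))"

lemma wpar_simps [simp]: "wpar [] = False" "wpar (x # w) = (snd x \<noteq> wpar w)" "wpar (v @ w) = (wpar v \<noteq> wpar w)"
 by (auto simp: wpar_def)

text \<open>\<open>\<kappa>\<close> singles out the component in which \<open>z\<close> becomes
  \<open>q - qi\<close>, and soundness is stated after multiplication by it. \<open>L\<close> bounds
  the indices of labels.\<close>

locale matrix_functor = hecke_parameter q qi
 for q qi :: "'r::comm_ring_1" +
 fixes \<iota> :: "'k::comm_ring_1 => 'r" and \<kappa> :: 'r and z :: 'k and L :: nat
 assumes \<iota>: "\<iota> (a + b) = \<iota> a + \<iota> b" "\<iota> (a * b) = \<iota> a * \<iota> b" "\<iota> 1 = 1" "\<iota> (- a) = - \<iota> a"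
  and \<kappa>: "\<kappa> * \<iota> z = \<kappa> * (q - qi)"
begin

definition lab :: "label set" where "lab = {..<L} \<times> UNIV"
definition words :: "nat => label list set" where "words k = {w. set w \<subseteq> lab \<and> length w = k}"

lemma finite_lab [simp]: "finite lab" by (simp add: lab_def)

lemma finite_words [simp]: "finite (words k)"
 unfolding words_def by (rule finite_lists_length_eq) simp

lemma words_iff: "w \<in> words k \<longleftrightarrow> set w \<subseteq> lab \<and> length w = k"
 by (simp add: words_def)

lemma sum_words_append: "(\<Sum>w\<in>words (k + l). f w) = (\<Sum>v\<in>words k. \<Sum>w\<in>words l. f (v @ w))"
proof -
 have "(\<Sum>v\<in>words k. \<Sum>w\<in>words l. f (v @ w)) = (\<Sum>p\<in>words k \<times> words l. f (fst p @ snd p))"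
  by (simp add: sum.cartesian_product split_beta)
 also have "... = (\<Sum>w\<in>words (k + l). f w)"
  by (rule sum.reindex_bij_witness[of _ "\<lambda>w. (take k w, drop k w)" "\<lambda>p. fst p @ snd p"])
   (auto simp: words_iff dest: in_set_takeD in_set_dropD)
 finally show ?thesis ..
qed

abbreviation s2 :: "bool => bool => 'r" where "s2 e d \<equiv> (if e \<and> d then - 1 else 1)"

definition dl :: "label list => label list => 'r" where "dl y x = (if x = y then 1 else 0)"

text \<open>The value of \<open>r\<^sup>-\<close> is dictated by the relations: it has to invert
  \<open>l\<^sup>+\<close>, whose matrix is computed in \<open>pull_l\<close>.\<close>

definition tR :: "(label list => 'r) => label list => 'r" where
 "tR F w = (case w of [(a, \<alpha>), (b, \<beta>)] =>
   if a \<noteq> b then s2 \<alpha> \<beta> * F [(b, \<beta>), (a, \<alpha>)]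
   else if \<not> \<beta> then loB (\<lambda>b. F [(b, False), (b, \<alpha>)]) a + full L (\<lambda>b. F [(b, True), (b, \<not> \<alpha>)]) a
   else (if \<alpha> then 1 else - 1) * upB L (\<lambda>b. F [(b, True), (b, \<alpha>)]) a
  | _ => 0)"

text \<open>Contravariant: functions on codomain words become functions on domain words. The matrix
  of a generator is read off by inserting the functions \<open>dl y\<close>.\<close>

fun ga :: "Q_gen => (label list => 'r) => label list => 'r" where
 "ga UPlus F w = tU F w"
| "ga UMinus F w = tU F w - (q - qi) * F w"
| "ga RMinus F w = tR F w"
| "ga CapL F w = (case w of [x, y] => if x = y then F [] else 0 | _ => 0)"
| "ga CupL F w = (\<Sum>x\<in>lab. F [x, x])"
| "ga Cl F w = tC F w"

lemma words_cases:
 assumes "w \<in> words (length (Q_dom g))"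
 obtains (two) a \<alpha> b \<beta> where "w = [(a, \<alpha>), (b, \<beta>)]" "g \<in> {UPlus, UMinus, RMinus, CapL}" "a < L" "b < L"
 | (one) a \<alpha> where "w = [(a, \<alpha>)]" "g = Cl" "a < L"
 | (zero) "w = []" "g = CupL"
proof (cases g)
 case UPlus thus thesis using assms two by (auto simp: words_iff length_Suc_conv numeral_2_eq_2 lab_def)
next
 case UMinus thus thesis using assms two by (auto simp: words_iff length_Suc_conv numeral_2_eq_2 lab_def)
next
 case RMinus thus thesis using assms two by (auto simp: words_iff length_Suc_conv numeral_2_eq_2 lab_def)
next
 case CapL thus thesis using assms two by (auto simp: words_iff length_Suc_conv numeral_2_eq_2 lab_def)
next
 case CupL thus thesis using assms zero by (auto simp: words_iff)
next
 case Cl thus thesis using assms one by (auto simp: words_iff length_Suc_conv lab_def)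
qed

lemma ga_sum:
 assumes "finite S"
 shows "ga g (\<lambda>v. \<Sum>y\<in>S. c y * F y v) w = (\<Sum>y\<in>S. c y * ga g (F y) w)"
proof -
 have tU: "tU (\<lambda>v. \<Sum>y\<in>S. c y * F y v) w = (\<Sum>y\<in>S. c y * tU (F y) w)" for w
  by (induction "dl []" w rule: tU.induct)
   (simp_all add: sum_distrib_left algebra_simps flip: sum.distrib sum_subtractf)
 have lo: "loB (\<lambda>b. \<Sum>y\<in>S. c y * F y (f b)) a = (\<Sum>y\<in>S. c y * loB (\<lambda>b. F y (f b)) a)" for f a
  unfolding loB_def using sum.swap[of "\<lambda>b y. pw b * (c y * F y (f b))" S "{..<a}"]
  by (simp add: sum_distrib_left algebra_simps flip: sum_subtractf)
 have up: "upB L (\<lambda>b. \<Sum>y\<in>S. c y * F y (f b)) a = (\<Sum>y\<in>S. c y * upB L (\<lambda>b. F y (f b)) a)" for f a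
  unfolding upB_def using sum.swap[of "\<lambda>b y. pw b * (c y * F y (f b))" S "{Suc a..<L}"]
  by (simp add: sum_distrib_left algebra_simps sum_negf flip: sum_subtractf sum.distrib)
 have fu: "full L (\<lambda>b. \<Sum>y\<in>S. c y * F y (f b)) a = (\<Sum>y\<in>S. c y * full L (\<lambda>b. F y (f b)) a)" for f a
  unfolding full_def using sum.swap[of "\<lambda>b y. pw b * (c y * F y (f b))" S "{..<L}"]
  by (simp add: sum_distrib_left algebra_simps)
 show ?thesis
 proof (cases g)
  case RMinus
  thus ?thesis
   by (auto simp: tR_def lo up fu sum_distrib_left algebra_simps sum_negf simp flip: sum.distrib split: list.splits)
 next
  case Cl
  have "tC (\<lambda>v. \<Sum>y\<in>S. c y * F y v) w = (\<Sum>y\<in>S. c y * tC (F y) w)"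
   by (induction "dl []" w rule: tC.induct) (simp_all add: sum_negf)
  thus ?thesis using Cl by simp
 next
  case CupL thus ?thesis using sum.swap[of "\<lambda>x y. c y * F y [x, x]" S lab] by (simp add: sum_distrib_left)
 next
  case CapL thus ?thesis by (auto split: list.splits)
 qed (simp_all add: tU sum_distrib_left algebra_simps flip: sum_subtractf)
qed

lemma ga_cong:
 assumes w: "w \<in> words (length (Q_dom g))" and F: "\<And>v. v \<in> words (length (Q_cod g)) ==> F v = F' v"
 shows "ga g F w = ga g F' w"
 using w
proof (cases rule: words_cases)
 case (two a \<alpha> b \<beta>)
 have 2: "F [(a', \<alpha>'), (b', \<beta>')] = F' [(a', \<alpha>'), (b', \<beta>')]" if "a' < L" "b' < L" "g \<noteq> CapL" for a' \<alpha>' b' \<beta>'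
  using that two(2) by (intro F) (auto simp: words_iff lab_def)
 show ?thesis
 proof (cases "g = CapL")
  case True thus ?thesis using two F[of "[]"] by (auto simp: words_iff)
 next
  case False
  thus ?thesis using two 2 by (auto simp: tR_def loB_def upB_def full_def)
 qed
next
 case (one a \<alpha>) thus ?thesis by (auto intro!: F simp: words_iff lab_def)
next
 case zero thus ?thesis by (auto intro!: sum.cong F simp: words_iff)
qed

lemma sum_dl: "finite S ==> x \<in> S ==> (\<Sum>y\<in>S. f y * dl y x) = f x"
proof -
 assume S: "finite S" "x \<in> S"
 have "(\<Sum>y\<in>S. f y * dl y x) = (\<Sum>y\<in>S. if y = x then f x else 0)" by (rule sum.cong) (auto simp: dl_def)
 thus ?thesis using S by simp
qed

lemma sum_ga: "w \<in> words (length (Q_dom g)) ==> (\<Sum>y\<in>words (length (Q_cod g)). F y * ga g (dl y) w) = ga g F w"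
proof -
 assume w: "w \<in> words (length (Q_dom g))"
 have "ga g F w = ga g (\<lambda>v. \<Sum>y\<in>words (length (Q_cod g)). F y * dl y v) w"
  by (rule ga_cong[OF w]) (simp add: sum_dl)
 thus ?thesis by (simp add: ga_sum)
qed

primrec ndom :: "'k Q_mor => nat" where
 "ndom (MGen g) = length (Q_dom g)" | "ndom (MId X) = length X" | "ndom (MZero X Y) = length X"
| "ndom (MAdd f g) = ndom f" | "ndom (MScale c f) = ndom f" | "ndom (f \<^bold>\<circ> g) = ndom g" | "ndom (f \<^bold>\<otimes> g) = ndom f + ndom g"

primrec ncod :: "'k Q_mor => nat" where
 "ncod (MGen g) = length (Q_cod g)" | "ncod (MId X) = length X" | "ncod (MZero X Y) = length Y"
| "ncod (MAdd f g) = ncod f" | "ncod (MScale c f) = ncod f" | "ncod (f \<^bold>\<circ> g) = ncod f" | "ncod (f \<^bold>\<otimes> g) = ncod f + ncod g"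

text \<open>The sign for tensor products is the Koszul sign for moving \<open>g\<close> past the
  left input. The parity of \<open>g\<close> is read off the entry, as the difference of the
  parities of output and input; \<open>mat_par\<close> justifies this for homogeneous
  \<open>g\<close>.\<close>

primrec mat :: "'k Q_mor => label list => label list => 'r" where
 "mat (MGen g) y x = ga g (dl y) x"
| "mat (MId X) y x = dl y x"
| "mat (MZero X Y) y x = 0"
| "mat (MAdd f g) y x = mat f y x + mat g y x"
| "mat (MScale c f) y x = \<iota> c * mat f y x"
| "mat (f \<^bold>\<circ> g) y x = (\<Sum>w\<in>words (ndom f). mat f y w * mat g w x)"
| "mat (f \<^bold>\<otimes> g) y x = s2 (wpar (drop (ncod f) y) \<noteq> wpar (drop (ndom f) x)) (wpar (take (ndom f) x)) *
   mat f (take (ncod f) y) (take (ndom f) x) * mat g (drop (ncod f) y) (drop (ndom f) x)"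

lemma ndom_ncod: "Qty X Y f ==> ndom f = length X \<and> ncod f = length Y"
 by (induction rule: mor_type.induct) (auto simp: Q_sig_def)

definition pull :: "'k Q_mor => (label list => 'r) => label list => 'r" where
 "pull f F x = (\<Sum>y\<in>words (ncod f). F y * mat f y x)"

lemma pull_gen: "x \<in> words (length (Q_dom g)) ==> pull (MGen g) F x = ga g F x"
 by (simp add: pull_def sum_ga)

lemma pull_id: "x \<in> words (length X) ==> pull (MId X) F x = F x"
 by (simp add: pull_def sum_dl)

lemma pull_zero: "pull (MZero X Y) F x = 0"
 by (simp add: pull_def)

lemma pull_comp: "ndom f = ncod g ==> pull (f \<^bold>\<circ> g) F x = pull g (pull f F) x"
 unfolding pull_def using sum.swap[of "\<lambda>y w. F y * (mat f y w * mat g w x)" "words (ncod g)" "words (ncod f)"]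
 by (simp add: sum_distrib_left sum_distrib_right algebra_simps)

lemma pull_scale: "pull (MScale c f) F x = \<iota> c * pull f F x"
 by (simp add: pull_def sum_distrib_left algebra_simps)

lemma pull_tens:
 "pull (f \<^bold>\<otimes> g) F x = pull f (\<lambda>y1. pull g (\<lambda>y2.
   s2 (wpar y2 \<noteq> wpar (drop (ndom f) x)) (wpar (take (ndom f) x)) * F (y1 @ y2)) (drop (ndom f) x)) (take (ndom f) x)"
 unfolding pull_def
 by (auto simp: sum_words_append sum_distrib_right words_iff intro!: sum.cong)

lemma pull_dl: "y \<in> words (ncod f) ==> pull f (dl y) x = mat f y x"
proof -
 assume y: "y \<in> words (ncod f)"
 have "pull f (dl y) x = (\<Sum>v\<in>words (ncod f). mat f v x * dl v y)"
  unfolding pull_def by (rule sum.cong) (auto simp: dl_def)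
 thus ?thesis using sum_dl[OF _ y] by simp
qed

end

section \<open>Parities, padding and the left crossing\<close>

context matrix_functor
begin

lemma dl_par: "wpar y \<noteq> wpar v ==> dl y v = 0"
 by (auto simp: dl_def)

lemma words_split:
 assumes "x \<in> words (k + l)"
 obtains x1 x2 where "x = x1 @ x2" "x1 \<in> words k" "x2 \<in> words l"
proof
 show "x = take k x @ drop k x" by simp
 show "take k x \<in> words k" "drop k x \<in> words l" using assms by (auto simp: words_iff dest: in_set_takeD in_set_dropD)
qed

lemma ga_par:
 assumes "x \<in> words (length (Q_dom g))" "(wpar y \<noteq> wpar x) \<noteq> (g = Cl)"
 shows "ga g (dl y) x = 0"
 using assms(1)
proof (cases rule: words_cases)
 case (two a \<alpha> b \<beta>)
 have [simp]: "dl y [(a', \<alpha>'), (b', \<beta>')] = 0" if "(\<alpha>' \<noteq> \<beta>') = (\<alpha> \<noteq> \<beta>)" for a' \<alpha>' b' \<beta>'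
  using two that assms(2) by (intro dl_par) auto
 have [simp]: "dl y [] = 0" if "\<alpha> = \<beta>" using two that assms(2) by (intro dl_par) auto
 show ?thesis using two(1,2) by (auto simp: tR_def loB_def upB_def full_def)
next
 case (one a \<alpha>)
 have "dl y [(a, \<not> \<alpha>)] = 0" using one assms(2) by (intro dl_par) auto
 thus ?thesis using one by auto
next
 case zero
 have "dl y [x, x] = 0" for x using zero assms(2) by (intro dl_par) auto
 thus ?thesis using zero by simp
qed

lemma mat_par:
 assumes "Qhom p X Y f" "y \<in> words (length Y)" "x \<in> words (length X)" "(wpar y \<noteq> wpar x) \<noteq> (p = 1)"
 shows "mat f y x = 0"
 using assms
proof (induction arbitrary: y x rule: mor_homog.induct)
 case (1 g)
 thus ?case using ga_par[of x g y] by (auto split: if_splits)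
next
 case (2 X) thus ?case by (simp add: dl_par)
next
 case (6 p V W f q U g)
 have pq: "(p + q = 1) = ((p = 1) \<noteq> (q = 1))" by (cases p rule: bit_cases; cases q rule: bit_cases; simp)
 have "mat f y w * mat g w x = 0" if "w \<in> words (length V)" for w
  using 6(3)[of y w] 6(4)[of w x] 6(5-) that pq by (cases "(wpar y \<noteq> wpar w) = (p = 1)") auto
 thus ?case using ndom_ncod[OF Qhom_type[OF 6(1)]] by simp
next
 case (7 p U V f q U' V' g)
 have pq: "(p + q = 1) = ((p = 1) \<noteq> (q = 1))" by (cases p rule: bit_cases; cases q rule: bit_cases; simp)
 obtain y1 y2 where y: "y = y1 @ y2" "y1 \<in> words (length V)" "y2 \<in> words (length V')" using 7(5) words_split[of y "length V" "length V'"] by auto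
 obtain x1 x2 where x: "x = x1 @ x2" "x1 \<in> words (length U)" "x2 \<in> words (length U')" using 7(6) words_split[of x "length U" "length U'"] by auto
 have "mat f y1 x1 * mat g y2 x2 = 0" using 7(3)[of y1 x1] 7(4)[of y2 x2] 7(7) x y pq
  by (cases "(wpar y1 \<noteq> wpar x1) = (p = 1)"; cases "wpar x2") auto
 thus ?case using x y ndom_ncod[OF Qhom_type[OF 7(1)]] ndom_ncod[OF Qhom_type[OF 7(2)]]
  by (auto simp: words_iff mult.assoc)
qed simp_all

lemma pull_left_even:
 assumes g: "Qhom 0 M N g" and x: "x1 \<in> words (length A)" "x2 \<in> words (length M)"
 shows "pull (MId A \<^bold>\<otimes> g) F (x1 @ x2) = pull g (\<lambda>y2. F (x1 @ y2)) x2"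
proof -
 have "pull (MId A \<^bold>\<otimes> g) F (x1 @ x2) = pull g (\<lambda>y2. s2 (wpar y2 \<noteq> wpar x2) (wpar x1) * F (x1 @ y2)) x2"
  using x by (simp add: pull_tens pull_id words_iff)
 also have "... = pull g (\<lambda>y2. F (x1 @ y2)) x2"
  unfolding pull_def using ndom_ncod[OF Qhom_type[OF g]] mat_par[OF g _ x(2)] by (intro sum.cong) auto
 finally show ?thesis .
qed

lemma pull_right:
 assumes x: "x1 \<in> words (ndom f)" "x2 \<in> words (length B)"
 shows "pull (f \<^bold>\<otimes> MId B) F (x1 @ x2) = pull f (\<lambda>y1. F (y1 @ x2)) x1"
 using x by (simp add: pull_tens pull_id words_iff)

lemma lab_words: "[] \<in> words 0" "x \<in> lab ==> w \<in> words n ==> x # w \<in> words (Suc n)"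
 by (auto simp: words_iff)

lemma sum_lab: "(\<Sum>x\<in>lab. f x) = (\<Sum>b<L. f (b, False) + f (b, True))"
 using sum.cartesian_product[of "\<lambda>a b. f (a, b)" UNIV "{..<L}"] by (simp add: lab_def UNIV_bool add.commute)

lemma sum_less: "a < L ==> (\<Sum>b<L. if b < a then f b else 0) = (\<Sum>b<a. f b)"
 "(\<Sum>b<L. if a < b then f b else 0) = (\<Sum>b\<in>{Suc a..<L}. f b)"
proof -
 show "a < L ==> (\<Sum>b<L. if b < a then f b else 0) = (\<Sum>b<a. f b)"
  by (simp add: sum.If_cases) (rule sum.cong, auto)
 show "(\<Sum>b<L. if a < b then f b else 0) = (\<Sum>b\<in>{Suc a..<L}. f b)"
  by (simp add: sum.If_cases) (rule sum.cong, auto)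
qed

definition tL :: "(label list => 'r) => label list => 'r" where
 "tL F w = (case w of [(a, \<alpha>), (b, \<beta>)] =>
   if a \<noteq> b then s2 \<alpha> \<beta> * F [(b, \<beta>), (a, \<alpha>)]
   else if \<not> \<alpha> then loA (\<lambda>b. F [(b, \<beta>), (b, False)]) a + (if \<beta> then - 1 else 1) * tot L (\<lambda>b. F [(b, \<not> \<beta>), (b, True)])
   else (if \<beta> then 1 else - 1) * upA L (\<lambda>b. F [(b, \<beta>), (b, True)]) a
  | _ => 0)"

text \<open>In the sum over the label of the cup, different indices leave one term; for equal
  indices the order of the labels produces the triangular sums.\<close>

lemma pull_l:
 assumes x: "x \<in> lab" "y \<in> lab"
 shows "pull l\<^sup>+ F [x, y] = tL F [x, y]"
proof -
 have h: "Qhom 0 [] [Up, Down] cupL" "Qhom 0 [Up] [Up, Up, Down] (1\<^sub>\<up> \<^bold>\<otimes> cupL)" "Qhom 0 [Up, Up, Down] [Up, Up, Down] (u\<^sup>+ \<^bold>\<otimes> 1\<^sub>\<down>)"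
  by ((rule mor_homogI refl | (simp; fail))+)
 have w: "w \<in> lab ==> [w] \<in> words (Suc 0)" "v \<in> lab ==> w \<in> lab ==> [v, w] \<in> words (Suc (Suc 0))" for v w
  by (auto simp: words_iff)
 have cup: "pull (1\<^sub>\<down> \<^bold>\<otimes> 1\<^sub>\<up> \<^bold>\<otimes> cupL) G [x, y] = (\<Sum>w\<in>lab. G [x, y, w, w])" for G
  using pull_left_even[OF h(2), of "[x]" "[Down]" "[y]" G] pull_left_even[OF h(1), of "[y]" "[Up]" "[]" "\<lambda>w. G (x # w)"] x
  by (simp add: words_iff pull_gen)
 have u: "pull (1\<^sub>\<down> \<^bold>\<otimes> u\<^sup>+ \<^bold>\<otimes> 1\<^sub>\<down>) G [x, y, w, w'] = tU (\<lambda>v. G (x # v @ [w'])) [y, w]" if "w \<in> lab" "w' \<in> lab" for G w w'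
  using pull_left_even[OF h(3), of "[x]" "[Down]" "[y, w, w']" G] pull_right[of "[y, w]" "u\<^sup>+" "[w']" "[Down]" "\<lambda>v. G (x # v)"] x that
  by (simp add: words_iff pull_gen)
 have c: "pull (capL \<^bold>\<otimes> 1\<^sub>\<up> \<^bold>\<otimes> 1\<^sub>\<down>) F [x, o1, o2, w] = (if x = o1 then F [o2, w] else 0)"
  if "o1 \<in> lab" "o2 \<in> lab" "w \<in> lab" for o1 o2 w
 proof -
  have "pull (1\<^sub>\<up> \<^bold>\<otimes> 1\<^sub>\<down>) G [o2, w] = G [o2, w]" for G
   using pull_right[of "[o2]" "1\<^sub>\<up>" "[w]" "[Down]" G] that by (simp add: words_iff pull_id)
  thus ?thesis using x that by (simp add: pull_tens words_iff pull_gen)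
 qed
 have "pull l\<^sup>+ F [x, y] = (\<Sum>w\<in>lab. tU (\<lambda>v. pull (capL \<^bold>\<otimes> 1\<^sub>\<up> \<^bold>\<otimes> 1\<^sub>\<down>) F (x # v @ [w])) [y, w])"
  unfolding lplus_def by (simp add: pull_comp cup u)
 also have "... = (\<Sum>w\<in>lab. tU (\<lambda>v. case v of [o1, o2] => if x = o1 then F [o2, w] else 0 | _ => 0) [y, w])"
  using x c by (intro sum.cong refl ga_cong[of _ UPlus, simplified]) (auto simp: words_iff length_Suc_conv numeral_2_eq_2)
 also have "... = tL F [x, y]"
 proof -
  obtain a \<alpha> b \<beta> where xy: "x = (a, \<alpha>)" "y = (b, \<beta>)" "a < L" "b < L" using x by (cases x; cases y) (auto simp: lab_def)
  show ?thesis
  proof (cases "a = b")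
   case True
   thus ?thesis using xy
    by (cases \<alpha>; cases \<beta>) (auto simp: tL_def sum_lab sum.distrib sum_subtractf sg_def tm_def z0_def loA_def upA_def tot_def
      sum_less if_distrib[of "\<lambda>c. c * _"] algebra_simps sum_distrib_left sum_negf cong: if_cong)
  next
   case False
   hence "tU (\<lambda>v. case v of [o1, o2] => if x = o1 then F [o2, w] else 0 | _ => 0) [y, w] = (if w = x then s2 \<alpha> \<beta> * F [y, x] else 0)" for w
    using xy by (cases w; cases \<alpha>; cases \<beta>) (auto simp: sg_def tm_def z0_def)
   thus ?thesis using x xy(1,2) False by (simp add: tL_def sum.delta)
  qed
 qed
 finally show ?thesis .
qed

end

section \<open>Verification of the defining relations\<close>

context matrix_functor
begin

lemma words2: "w \<in> words (Suc (Suc 0)) ==> \<exists>x\<in>lab. \<exists>y\<in>lab. w = [x, y]"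
 by (auto simp: words_iff length_Suc_conv)

lemma words3: "w \<in> words (Suc (Suc (Suc 0))) ==> \<exists>x\<in>lab. \<exists>y\<in>lab. \<exists>v\<in>lab. w = [x, y, v]"
 by (auto simp: words_iff length_Suc_conv)

lemma words1: "w \<in> words (Suc 0) ==> \<exists>x\<in>lab. w = [x]"
 by (auto simp: words_iff length_Suc_conv)

lemma in_words [simp]: "[] \<in> words 0" "x \<in> lab ==> [x] \<in> words (Suc 0)" "x \<in> lab ==> y \<in> lab ==> [x, y] \<in> words (Suc (Suc 0))"
 "x \<in> lab ==> y \<in> lab ==> v \<in> lab ==> [x, y, v] \<in> words (Suc (Suc (Suc 0)))"
 by (auto simp: words_iff)

lemma ga2:
 assumes "x \<in> lab" "y \<in> lab" "\<And>a b. a \<in> lab ==> b \<in> lab ==> F [a, b] = F' [a, b]"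
 shows "tU F [x, y] = tU F' [x, y]" "tR F [x, y] = tR F' [x, y]"
 using ga_cong[of "[x, y]" UPlus F F'] ga_cong[of "[x, y]" RMinus F F'] assms words2 by (force simp:)+

lemma tU3: "tU F (x # y # w) = tU (\<lambda>v. F (v @ w)) [x, y]"
 by (cases x; cases y) simp

lemma pull_u: "x \<in> lab ==> y \<in> lab ==> pull u\<^sup>+ F [x, y] = tU F [x, y]"
 by (simp add: pull_gen)

lemma tU_diff: "tU (\<lambda>v. G v - c * F v) w = tU G w - c * tU F w"
 by (induction G w rule: tU.induct) (simp_all add: algebra_simps)

lemma pull_u_left: "x \<in> lab ==> y \<in> lab ==> v \<in> lab ==> pull (u\<^sup>+ \<^bold>\<otimes> 1\<^sub>\<up>) F [x, y, v] = tU F [x, y, v]"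
 using pull_right[of "[x, y]" "u\<^sup>+" "[v]" "[Up]" F] tU3[of F x y "[v]"] by (simp add: pull_u)

lemma pull_u_right: "x \<in> lab ==> y \<in> lab ==> v \<in> lab ==> pull (1\<^sub>\<up> \<^bold>\<otimes> u\<^sup>+) F [x, y, v] = t2 tU F [x, y, v]"
 using pull_left_even[OF Qhom_ops(1), of "[x]" "[Up]" "[y, v]" F] by (simp add: pull_u)

lemma tU_cong3:
 assumes "x \<in> lab" "y \<in> lab" "v \<in> lab" "\<And>a b d. a \<in> lab ==> b \<in> lab ==> d \<in> lab ==> F [a, b, d] = F' [a, b, d]"
 shows "tU F [x, y, v] = tU F' [x, y, v]" "t2 tU F [x, y, v] = t2 tU F' [x, y, v]"
 using ga2(1)[OF assms(1,2), of "\<lambda>w. F (w @ [v])" "\<lambda>w. F' (w @ [v])"] ga2(1)[OF assms(2,3), of "\<lambda>w. F (x # w)" "\<lambda>w. F' (x # w)"] assms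
 by (simp_all add: tU3[of _ x y "[v]"])

lemma pull_capR: "x \<in> lab ==> y \<in> lab ==> pull capR F [x, y] = tR (\<lambda>v. if hd v = hd (tl v) then F [] else 0) [x, y]"
 unfolding capR_def by (auto simp: pull_comp pull_gen intro!: ga2(2))

text \<open>The closed circle vanishes for each index separately, the even and the odd contribution
  cancelling.\<close>

lemma upB_lin: "upB L (\<lambda>b. c) a + loB (\<lambda>b. c) a + full L (\<lambda>b. c) a = 0" if "a < L"
proof -
 have "(\<Sum>b<L. pw b * c) = (\<Sum>b=0..<Suc a. pw b * c) + (\<Sum>b\<in>{Suc a..<L}. pw b * c)"
  using that by (simp add: sum.atLeastLessThan_concat lessThan_atLeast0 del: sum.op_ivl_Suc)
 hence "(\<Sum>b<L. pw b * c) = (\<Sum>b<a. pw b * c) + (pw a * c + (\<Sum>b\<in>{Suc a..<L}. pw b * c))"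
  by (simp add: lessThan_atLeast0 add.assoc)
 thus ?thesis unfolding upB_def loB_def full_def by (simp only:) (simp add: algebra_simps)
qed

lemma lo_sub: "loB (\<lambda>b. d b - d' b) a = loB d a - loB d' a" "loA (\<lambda>b. d b - d' b) a = loA d a - loA d' a"
 by (simp_all add: loA_def loB_def algebra_simps sum_subtractf)

lemma pull_rel:
 assumes "Q_rel z f g" "Qty X Y f" "Qty X Y g" "x \<in> words (length X)"
 shows "\<kappa> * pull f F x = \<kappa> * pull g F x"
proof -
 have w: "x \<in> words (ndom f)" using assms(4) ndom_ncod[OF assms(2)] by simp
 show ?thesis using assms(1)
proof (cases rule: Q_rel.cases)
 case 1
 obtain a b where x: "x = [a, b]" "a \<in> lab" "b \<in> lab" using words2[of x] w 1 by auto
 have "tU (pull u\<^sup>- F) [a, b] = tU (\<lambda>v. tU F v - (q - qi) * F v) [a, b]"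
  using x by (intro ga2(1)) (auto simp: pull_gen)
 hence "pull (u\<^sup>- \<^bold>\<circ> u\<^sup>+) F x = F x" using x by (cases a; cases b) (simp add: pull_comp pull_u tU_diff tU_tU del: tU.simps)
 thus ?thesis using 1 x by (simp add: pull_id)
next
 case 2
 obtain a b where x: "x = [a, b]" "a \<in> lab" "b \<in> lab" using words2[of x] w 2 by auto
 have "tU (pull u\<^sup>+ F) [a, b] = tU (tU F) [a, b]"
  using x by (intro ga2(1)) (auto simp: pull_gen)
 hence "pull (u\<^sup>+ \<^bold>\<circ> u\<^sup>-) F x = F x" using x by (cases a; cases b) (simp add: pull_comp pull_gen tU_tU del: tU.simps)
 thus ?thesis using 2 x by (simp add: pull_id)
next
 case 3
 obtain x1 x2 where x: "x = [x1, x2]" "x1 \<in> lab" "x2 \<in> lab" using words2[of x] w 3 by (auto simp: lplus_def)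
 obtain a \<alpha> b \<beta> where ab: "x1 = (a, \<alpha>)" "x2 = (b, \<beta>)" "a < L" "b < L" using x by (cases x1; cases x2) (auto simp: lab_def)
 have "pull (l\<^sup>+ \<^bold>\<circ> r\<^sup>-) F x = tR (pull l\<^sup>+ F) [x1, x2]" using x by (simp add: pull_comp pull_gen lplus_def)
 also have "... = tR (tL F) [x1, x2]" using x by (intro ga2(2)) (auto simp: pull_l)
 also have "... = F x"
 proof (cases "a = b")
  case False thus ?thesis using ab x by (auto simp: tR_def tL_def)
 next
  case True
  have t: "loB (\<lambda>b. tot L r) c = - full L (upA L r) c" for r c using loB_tot[of L r c] by (simp add: eq_neg_iff_add_eq_0)
  have tn: "loB (\<lambda>b. - tot L r) c = full L (upA L r) c" for r c
   using t[of "\<lambda>b. - r b" c] by (simp add: tot_def up_neg full_def sum_negf)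
  have fn: "full L (\<lambda>b. - d b) c = - full L d c" for d c by (simp add: full_def sum_negf)
  have up: "upB L (upA L r) c = r c" if "c < L" for r c using upB_upA[of c L r] that by simp
  show ?thesis using ab x True
   by (cases \<alpha>; cases \<beta>) (auto simp: tR_def tL_def lo_add lo_sub loB_loA loA_loB t tn fn up up_neg)
 qed
 finally show ?thesis using 3 x by (simp add: pull_id)
next
 case 4
 obtain x1 x2 where x: "x = [x1, x2]" "x1 \<in> lab" "x2 \<in> lab" using words2[of x] w 4 by (auto simp: lplus_def)
 obtain a \<alpha> b \<beta> where ab: "x1 = (a, \<alpha>)" "x2 = (b, \<beta>)" "a < L" "b < L" using x by (cases x1; cases x2) (auto simp: lab_def)
 have "pull (r\<^sup>- \<^bold>\<circ> l\<^sup>+) F x = tL (pull r\<^sup>- F) [x1, x2]" using x pull_l by (simp add: pull_comp lplus_def)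
 also have "... = tL (tR F) [x1, x2]"
  using ab by (auto simp: tL_def pull_gen lab_def loA_def upA_def tot_def intro!: arg_cong2[of _ _ _ _ "(+)"] sum.cong)
 also have "... = F x"
 proof (cases "a = b")
  case False thus ?thesis using ab x by (auto simp: tR_def tL_def)
 next
  case True
  have t: "loA (full L d) c = - tot L (upB L d)" for d c using loA_full[of L d c] by (simp add: eq_neg_iff_add_eq_0)
  have tn: "tot L (\<lambda>b. - d b) = - tot L d" for d by (simp add: tot_def sum_negf)
  have up: "upA L (upB L r) c = r c" if "c < L" for r c using upA_upB[of c L r] that by simp
  show ?thesis using ab x True
   by (cases \<alpha>; cases \<beta>) (auto simp: tR_def tL_def lo_add lo_sub lo_neg loB_loA loA_loB t tn up up_neg)
 qed
 finally show ?thesis using 4 x by (simp add: pull_id)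
next
 case 5
 obtain a b v where x: "x = [a, b, v]" "a \<in> lab" "b \<in> lab" "v \<in> lab" using words3[of x] w 5 by auto
 have "pull f F x = tU (t2 tU (tU F)) [a, b, v]"
 proof -
  have "pull f F x = tU (pull (1\<^sub>\<up> \<^bold>\<otimes> u\<^sup>+) (pull (u\<^sup>+ \<^bold>\<otimes> 1\<^sub>\<up>) F)) [a, b, v]" using 5 x by (simp add: pull_comp pull_u_left del: t2.simps tU.simps)
  also have "... = tU (t2 tU (tU F)) [a, b, v]"
   using x by (intro tU_cong3(1)) (simp_all add: pull_u_right pull_u_left tU_cong3(2)[of _ _ _ "pull (u\<^sup>+ \<^bold>\<otimes> 1\<^sub>\<up>) F" "tU F"] del: t2.simps tU.simps)
  finally show ?thesis .
 qed
 moreover have "pull g F x = t2 tU (tU (t2 tU F)) [a, b, v]"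
 proof -
  have "pull g F x = t2 tU (pull (u\<^sup>+ \<^bold>\<otimes> 1\<^sub>\<up>) (pull (1\<^sub>\<up> \<^bold>\<otimes> u\<^sup>+) F)) [a, b, v]" using 5 x by (simp add: pull_comp pull_u_right del: t2.simps tU.simps)
  also have "... = t2 tU (tU (t2 tU F)) [a, b, v]"
   using x by (intro tU_cong3(2)) (simp_all add: pull_u_left pull_u_right tU_cong3(1)[of _ _ _ "pull (1\<^sub>\<up> \<^bold>\<otimes> u\<^sup>+) F" "t2 tU F"] del: t2.simps tU.simps)
  finally show ?thesis .
 qed
 ultimately show ?thesis by (cases a; cases b; cases v) (simp only: braid)
next
 \<comment> \<open>Here \<open>\<kappa>\<close> enters: multiplication by it turns the scalar
   \<open>z\<close> into \<open>q - qi\<close>.\<close>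
 case 6
 obtain a b where x: "x = [a, b]" "a \<in> lab" "b \<in> lab" using words2[of x] w 6 by auto
 have "pull f F x = (q - qi) * F x"
  using 6 x sum_dl[of "words (Suc (Suc 0))" x "\<lambda>y. (q - qi) * F y"]
  by (simp add: pull_def algebra_simps \<iota>)
 moreover have "\<kappa> * pull g F x = \<kappa> * (q - qi) * F x" using 6 x \<kappa> by (simp add: pull_scale pull_id flip: mult.assoc)
 ultimately show ?thesis by (simp add: mult.assoc)
next
 case 7
 obtain a where x: "x = [a]" "a \<in> lab" using words1[of x] w 7 by auto
 have ab: "(fst a, \<not> snd a) \<in> lab" "(fst a, snd a) \<in> lab" using x by (auto simp: lab_def)
 show ?thesis using 7 x ab by (cases a) (auto simp: pull_comp pull_gen pull_scale pull_id \<iota>)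
next
 case 8
 obtain a b where x: "x = [a, b]" "a \<in> lab" "b \<in> lab" using words2[of x] w 8 by auto
 have lab: "(fst c, e) \<in> lab" if "c \<in> lab" for c e using that by (auto simp: lab_def)
 have c1: "pull (cl \<^bold>\<otimes> 1\<^sub>\<up>) G [c, d] = tC G [c, d]" if "c \<in> lab" "d \<in> lab" for G c d
  using pull_right[of "[c]" cl "[d]" "[Up]" G] that by (cases c) (simp add: pull_gen)
 have c2: "pull (1\<^sub>\<up> \<^bold>\<otimes> cl) G [c, d] = (if snd c then - 1 else 1) * t2 tC G [c, d]" if "c \<in> lab" "d \<in> lab" for G c d
  using that lab[OF that(2)] by (cases c; cases d) (auto simp: pull_tens pull_id pull_gen)
 have "pull f F x = tC (tU F) [a, b]"
  using 8 x lab[OF x(2)] by (cases a) (auto simp: pull_comp c1 pull_u simp del: tU.simps)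
 also have "... = tU (\<lambda>v. (if snd (hd v) then - 1 else 1) * t2 tC F v) [a, b]"
  by (cases a; cases b) (simp only: tC_tU)
 also have "... = tU (pull (1\<^sub>\<up> \<^bold>\<otimes> cl) F) [a, b]"
  using x by (intro ga2(1)) (auto simp: c2 simp del: t2.simps)
 also have "... = pull g F x" using 8 x by (simp add: pull_comp pull_u del: tU.simps)
 finally show ?thesis by simp
next
 case 9
 have x: "x = []" using w 9 by (simp add: words_iff capR_def)
 have c1: "pull (cl \<^bold>\<otimes> 1\<^sub>\<down>) G [c, d] = tC G [c, d]" if "c \<in> lab" "d \<in> lab" for G c d
  using pull_right[of "[c]" cl "[d]" "[Down]" G] that by (cases c) (simp add: pull_gen)
 have "pull f F x = (\<Sum>c\<in>lab. pull (cl \<^bold>\<otimes> 1\<^sub>\<down>) (pull capR F) [c, c])"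
  using 9 x by (simp add: pull_comp pull_gen capR_def)
 also have "... = (\<Sum>c\<in>lab. tC (pull capR F) [c, c])" by (rule sum.cong) (simp_all add: c1)
 also have "... = 0"
 proof (rule sum.neutral, rule ballI)
  fix c assume c: "c \<in> lab"
  obtain a \<alpha> where a: "c = (a, \<alpha>)" by (cases c)
  have "(a, \<not> \<alpha>) \<in> lab" using c a by (auto simp: lab_def)
  hence "pull capR F [(a, \<not> \<alpha>), (a, \<alpha>)] = 0" using c a by (cases \<alpha>) (auto simp: pull_capR tR_def loB_def upB_def full_def)
  thus "tC (pull capR F) [c, c] = 0" using a by auto
 qed
 finally show ?thesis using 9 by (simp add: pull_zero)
next
 case 10
 have x: "x = []" using w 10 by (simp add: words_iff capR_def)
 have "pull f F x = (\<Sum>c\<in>lab. pull capR F [c, c])" using 10 x by (simp add: pull_comp pull_gen capR_def)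
 also have "... = (\<Sum>b<L. pull capR F [(b, False), (b, False)] + pull capR F [(b, True), (b, True)])" by (rule sum_lab)
 also have "... = 0"
 proof (rule sum.neutral, rule ballI)
  fix b assume "b \<in> {..<L}"
  thus "pull capR F [(b, False), (b, False)] + pull capR F [(b, True), (b, True)] = 0"
   using upB_lin[of b "F []"] by (simp add: lab_def pull_capR tR_def algebra_simps)
 qed
 finally show ?thesis using 10 by (simp add: pull_zero)
next
 case 11
 obtain a where x: "x = [a]" "a \<in> lab" using words1[of x] w 11 by auto
 have "pull f F x = (\<Sum>c\<in>lab. pull (1\<^sub>\<up> \<^bold>\<otimes> capL) F [c, c, a])"
  using 11 x by (simp add: pull_comp pull_tens pull_id pull_gen)
 also have "... = (\<Sum>c\<in>lab. if c = a then F [a] else 0)"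
  using x pull_left_even[OF Qhom_ops(5), of "[c]" "[Up]" "[d, a]" F for c d]
  by (intro sum.cong refl) (simp add: pull_gen)
 finally show ?thesis using 11 x by (simp add: pull_id)
next
 case 12
 obtain a where x: "x = [a]" "a \<in> lab" using words1[of x] w 12 by auto
 have "pull f F x = (\<Sum>c\<in>lab. pull (capL \<^bold>\<otimes> 1\<^sub>\<down>) F [a, c, c])"
  using 12 x pull_left_even[OF Qhom_ops(6), of "[a]" "[Down]" "[]"] by (simp add: pull_comp pull_gen)
 also have "... = (\<Sum>c\<in>lab. if c = a then F [a] else 0)"
  using x by (intro sum.cong refl) (simp add: pull_tens pull_id pull_gen)
 finally show ?thesis using 12 x by (simp add: pull_id)
qed
qed

end

section \<open>Soundness for the congruence\<close>

context matrix_functor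
begin

lemma mat_tens:
 assumes "Qty X Y f" "x1 \<in> words (length X)" "y1 \<in> words (length Y)"
 shows "mat (f \<^bold>\<otimes> g) (y1 @ y2) (x1 @ x2) = s2 (wpar y2 \<noteq> wpar x2) (wpar x1) * mat f y1 x1 * mat g y2 x2"
 using ndom_ncod[OF assms(1)] assms(2,3) by (simp add: words_iff)

lemma dl_append: "length y1 = length x1 ==> dl (y1 @ y2) (x1 @ x2) = dl y1 x1 * dl y2 x2"
 by (auto simp: dl_def)

text \<open>Comparison term by term: when the entries of \<open>f\<close> and \<open>g\<close> have
  the parities \<open>p\<close> and \<open>p'\<close>, the Koszul signs agree up to the sign of the
  interchange law; all other terms vanish by \<open>mat_par\<close>.\<close>

lemma mat_interchange:
 assumes f: "Qhom p X Y f" and g: "Qhom p' V V' g" and f': "Qty Y Z f'" and g': "Qty U V g'"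
  and x: "x1 \<in> words (length X)" "x2 \<in> words (length U)" and y: "y1 \<in> words (length Z)" "y2 \<in> words (length V')"
 shows "mat ((f' \<^bold>\<otimes> g) \<^bold>\<circ> (f \<^bold>\<otimes> g')) (y1 @ y2) (x1 @ x2) =
  s2 (p = 1) (p' = 1) * mat ((f' \<^bold>\<circ> f) \<^bold>\<otimes> (g \<^bold>\<circ> g')) (y1 @ y2) (x1 @ x2)"
proof -
 note tf = Qhom_type[OF f] and tg = Qhom_type[OF g]
 note n = ndom_ncod[OF tf] ndom_ncod[OF tg] ndom_ncod[OF f'] ndom_ncod[OF g']
 note n1 = n[THEN conjunct1]
 have "mat ((f' \<^bold>\<otimes> g) \<^bold>\<circ> (f \<^bold>\<otimes> g')) (y1 @ y2) (x1 @ x2) = (\<Sum>w1\<in>words (length Y). \<Sum>w2\<in>words (length V).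
   s2 (p = 1) (p' = 1) * s2 (wpar y2 \<noteq> wpar x2) (wpar x1) * ((mat f' y1 w1 * mat f w1 x1) * (mat g y2 w2 * mat g' w2 x2)))"
  unfolding mat.simps(6) ndom.simps n1 sum_words_append
 proof (intro sum.cong refl)
  fix w1 w2 assume w: "w1 \<in> words (length Y)" "w2 \<in> words (length V)"
  have e: "mat (f' \<^bold>\<otimes> g) (y1 @ y2) (w1 @ w2) * mat (f \<^bold>\<otimes> g') (w1 @ w2) (x1 @ x2) =
   s2 (wpar y2 \<noteq> wpar w2) (wpar w1) * s2 (wpar w2 \<noteq> wpar x2) (wpar x1) * ((mat f' y1 w1 * mat f w1 x1) * (mat g y2 w2 * mat g' w2 x2))"
   unfolding mat_tens[OF f' w(1) y(1)] mat_tens[OF tf x(1) w(1)] by (simp only: mult_ac)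
  show "mat (f' \<^bold>\<otimes> g) (y1 @ y2) (w1 @ w2) * mat (f \<^bold>\<otimes> g') (w1 @ w2) (x1 @ x2) =
   s2 (p = 1) (p' = 1) * s2 (wpar y2 \<noteq> wpar x2) (wpar x1) * ((mat f' y1 w1 * mat f w1 x1) * (mat g y2 w2 * mat g' w2 x2))"
  proof (cases "(wpar w1 \<noteq> wpar x1) = (p = 1) \<and> (wpar y2 \<noteq> wpar w2) = (p' = 1)")
   case True
   hence "s2 (wpar y2 \<noteq> wpar w2) (wpar w1) * s2 (wpar w2 \<noteq> wpar x2) (wpar x1) = s2 (p = 1) (p' = 1) * s2 (wpar y2 \<noteq> wpar x2) (wpar x1)"
    by auto
   thus ?thesis unfolding e by simp
  next
   case False
   hence "mat f w1 x1 = 0 \<or> mat g y2 w2 = 0"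
    using mat_par[OF f w(1) x(1)] mat_par[OF g y(2) w(2)] by blast
   thus ?thesis unfolding e by auto
  qed
 qed
 also have "... = s2 (p = 1) (p' = 1) * s2 (wpar y2 \<noteq> wpar x2) (wpar x1) *
   ((\<Sum>w1\<in>words (length Y). mat f' y1 w1 * mat f w1 x1) * (\<Sum>w2\<in>words (length V). mat g y2 w2 * mat g' w2 x2))"
  unfolding sum_product by (simp only: sum_distrib_left)
 also have "... = s2 (p = 1) (p' = 1) * mat ((f' \<^bold>\<circ> f) \<^bold>\<otimes> (g \<^bold>\<circ> g')) (y1 @ y2) (x1 @ x2)"
  using x y n by (simp add: words_iff)
 finally show ?thesis .
qed

lemma \<iota>0: "\<iota> 0 = 0" using \<iota>(1)[of 0 0] by simp

theorem mat_sound: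
 assumes "Qeq z X Y f g" "y \<in> words (length Y)" "x \<in> words (length X)"
 shows "\<kappa> * mat f y x = \<kappa> * mat g y x"
 using assms
proof (induction arbitrary: y x rule: mor_cong.induct)
 case (mor_cong_rel f g X Y)
 note n = ndom_ncod[OF mor_cong_rel(2)] ndom_ncod[OF mor_cong_rel(3)]
 have "\<kappa> * pull f (dl y) x = \<kappa> * pull g (dl y) x" by (rule pull_rel[OF mor_cong_rel(1-3,5)])
 thus ?case using mor_cong_rel(4) n by (simp add: pull_dl)
next
 case (mor_cong_comp_cong Y Z f f' X g g')
 have n: "ndom f = length Y" "ndom f' = length Y"
  using mor_cong_type[OF mor_cong_comp_cong(1)] ndom_ncod by blast+
 have "\<kappa> * mat (f \<^bold>\<circ> g) y x = (\<Sum>w\<in>words (length Y). (\<kappa> * mat f y w) * mat g w x)"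
  by (simp add: n sum_distrib_left mult.assoc)
 also have "... = (\<Sum>w\<in>words (length Y). mat f' y w * (\<kappa> * mat g' w x))"
 proof (intro sum.cong refl)
  fix w assume w: "w \<in> words (length Y)"
  have "\<kappa> * mat f y w * mat g w x = mat f' y w * (\<kappa> * mat g w x)"
   unfolding mor_cong_comp_cong(3)[OF mor_cong_comp_cong(5) w] by (simp only: mult_ac)
  thus "\<kappa> * mat f y w * mat g w x = mat f' y w * (\<kappa> * mat g' w x)"
   unfolding mor_cong_comp_cong(4)[OF w mor_cong_comp_cong(6)] .
 qed
 also have "... = \<kappa> * mat (f' \<^bold>\<circ> g') y x" by (simp add: n sum_distrib_left mult_ac)
 finally show ?case .
next
 case (mor_cong_tens_cong X Y f f' X' Y' g g')
 obtain y1 y2 where y: "y = y1 @ y2" "y1 \<in> words (length Y)" "y2 \<in> words (length Y')"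
  using mor_cong_tens_cong(5) words_split[of y "length Y" "length Y'"] by auto
 obtain x1 x2 where x: "x = x1 @ x2" "x1 \<in> words (length X)" "x2 \<in> words (length X')"
  using mor_cong_tens_cong(6) words_split[of x "length X" "length X'"] by auto
 have t: "Qty X Y f" "Qty X Y f'" using mor_cong_type[OF mor_cong_tens_cong(1)] by auto
 have "\<kappa> * (c * (mat f y1 x1 * mat g y2 x2)) = \<kappa> * (c * (mat f' y1 x1 * mat g' y2 x2))" for c
 proof -
  have "\<kappa> * (c * (mat f y1 x1 * mat g y2 x2)) = c * ((\<kappa> * mat f y1 x1) * mat g y2 x2)" by (simp only: mult_ac)
  also have "... = c * (mat f' y1 x1 * (\<kappa> * mat g y2 x2))"
   unfolding mor_cong_tens_cong(3)[OF y(2) x(2)] by (simp only: mult_ac)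
  also have "... = \<kappa> * (c * (mat f' y1 x1 * mat g' y2 x2))"
   unfolding mor_cong_tens_cong(4)[OF y(3) x(3)] by (simp only: mult_ac)
  finally show ?thesis .
 qed
 thus ?case unfolding x(1) y(1) mat_tens[OF t(1) x(2) y(2)] mat_tens[OF t(2) x(2) y(2)] by (simp only: mult.assoc)
next
 case (mor_cong_comp_assoc Y Z f X g W h)
 note n = mor_cong_comp_assoc(1-3)[THEN ndom_ncod]
 have "mat ((f \<^bold>\<circ> g) \<^bold>\<circ> h) y x = mat (f \<^bold>\<circ> (g \<^bold>\<circ> h)) y x"
  using sum.swap[of "\<lambda>w v. mat f y v * (mat g v w * mat h w x)" "words (length Y)" "words (length X)"] n
  by (simp add: sum_distrib_left sum_distrib_right mult.assoc)
 thus ?case by simp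
next
 case (mor_cong_comp_id_left X Y f)
 have "mat (MId Y \<^bold>\<circ> f) y x = (\<Sum>v\<in>words (length Y). mat f v x * dl v y)"
  by (auto simp: dl_def intro!: sum.cong)
 thus ?case using sum_dl[of "words (length Y)" y "\<lambda>v. mat f v x"] mor_cong_comp_id_left by simp
next
 case (mor_cong_comp_id_right X Y f)
 thus ?case using sum_dl[of "words (length X)" x "\<lambda>v. mat f y v"] ndom_ncod[OF mor_cong_comp_id_right(1)] by simp
next
 case (mor_cong_tens_assoc X Y f X' Y' g X'' Y'' h)
 obtain y1 y' where y': "y = y1 @ y'" "y1 \<in> words (length Y)" "y' \<in> words (length Y' + length Y'')"
  using mor_cong_tens_assoc(4) words_split[of y "length Y" "length Y' + length Y''"] by auto
 obtain y2 y3 where y: "y' = y2 @ y3" "y2 \<in> words (length Y')" "y3 \<in> words (length Y'')"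
  using y'(3) words_split by blast
 obtain x1 x' where x': "x = x1 @ x'" "x1 \<in> words (length X)" "x' \<in> words (length X' + length X'')"
  using mor_cong_tens_assoc(5) words_split[of x "length X" "length X' + length X''"] by auto
 obtain x2 x3 where x: "x' = x2 @ x3" "x2 \<in> words (length X')" "x3 \<in> words (length X'')"
  using x'(3) words_split by blast
 note n = mor_cong_tens_assoc(1-3)[THEN ndom_ncod]
 have "mat ((f \<^bold>\<otimes> g) \<^bold>\<otimes> h) y x = mat (f \<^bold>\<otimes> (g \<^bold>\<otimes> h)) y x"
  using x y x' y' n by (cases "wpar x1"; cases "wpar x2"; cases "wpar y2"; cases "wpar y3"; cases "wpar x3") (simp_all add: words_iff mult_ac)
 thus ?case by simp
next
 case (mor_cong_tens_unit_left X Y f)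
 thus ?case by (simp add: dl_def)
next
 case (mor_cong_tens_unit_right X Y f)
 thus ?case using ndom_ncod[OF mor_cong_tens_unit_right(1)] by (simp add: dl_def words_iff)
next
 case (mor_cong_tens_id X Y)
 obtain y1 y2 where y: "y = y1 @ y2" "y1 \<in> words (length X)" "y2 \<in> words (length Y)"
  using mor_cong_tens_id(1) words_split[of y "length X" "length Y"] by auto
 obtain x1 x2 where x: "x = x1 @ x2" "x1 \<in> words (length X)" "x2 \<in> words (length Y)"
  using mor_cong_tens_id(2) words_split[of x "length X" "length Y"] by auto
 show ?case using x y by (auto simp: dl_def words_iff)
next
 case (mor_cong_super_interchange p X Y f p' V W g Z f' U g')
 obtain y1 y2 where y: "y = y1 @ y2" "y1 \<in> words (length Z)" "y2 \<in> words (length W)"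
  using mor_cong_super_interchange(5) words_split[of y "length Z" "length W"] by auto
 obtain x1 x2 where x: "x = x1 @ x2" "x1 \<in> words (length X)" "x2 \<in> words (length U)"
  using mor_cong_super_interchange(6) words_split[of x "length X" "length U"] by auto
 show ?case unfolding x(1) y(1) mat_interchange[OF mor_cong_super_interchange(1-4) x(2,3) y(2,3)] by (simp del: mat.simps add: mat.simps(5) \<iota>)
next
 case (mor_cong_tens_add_left X Y f g X' Y' h)
 note n = mor_cong_tens_add_left(1-3)[THEN ndom_ncod]
 thus ?case by (simp add: algebra_simps)
next
 case (mor_cong_comp_add_left Y Z f g X h)
 note n = mor_cong_comp_add_left(1-3)[THEN ndom_ncod]
 thus ?case by (simp add: algebra_simps sum.distrib)
next
 case (mor_cong_comp_scale_left Y Z f X g a)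
 thus ?case by (simp add: sum_distrib_left mult_ac)
next
 case (mor_cong_scale_cong X Y f f' c)
 have "\<kappa> * (\<iota> c * mat f y x) = \<iota> c * (\<kappa> * mat f y x)" by (simp only: mult_ac)
 also have "... = \<kappa> * (\<iota> c * mat f' y x)"
  unfolding mor_cong_scale_cong(2)[OF mor_cong_scale_cong(3,4)] by (simp only: mult_ac)
 finally show ?case by simp
qed (simp_all add: algebra_simps \<iota> sum.distrib sum_distrib_left)

end

section \<open>Separation of endomorphisms\<close>

text \<open>The indices below \<open>n\<close>, each occurring once with a free flag; the largest is
  inserted at an arbitrary place, which yields \<open>2 ^ n * fact n\<close> words.\<close>

primrec dwords :: "nat => label list set" where
 "dwords 0 = {[]}"
| "dwords (Suc n) = (\<lambda>(w, k, e). take k w @ (n, e) # drop k w) ` (dwords n \<times> {..n} \<times> UNIV)"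

lemma dwords_word: "w \<in> dwords n ==> length w = n \<and> fst ` set w \<subseteq> {..<n}"
proof (induction n arbitrary: w)
 case (Suc n)
 then obtain v k e where v: "v \<in> dwords n" "k \<le> n" "w = take k v @ (n, e) # drop k v" by auto
 have "set w = insert (n, e) (set v)"
  unfolding v(3) by (subst (3) append_take_drop_id[of k v, symmetric]) (simp only: set_append set_simps, blast)
 thus ?case using Suc.IH[OF v(1)] v by (auto simp: less_Suc_eq)
qed simp

lemma card_dwords: "finite (dwords n) \<and> card (dwords n) = 2 ^ n * fact n"
proof (induction n)
 case (Suc n)
 have "inj_on (\<lambda>(w, k, e). take k w @ (n, e) # drop k w) (dwords n \<times> {..n} \<times> UNIV)"
 proof (rule inj_onI, clarsimp)
  fix w k and e :: bool and w' k' and e' :: bool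
  assume w: "w \<in> dwords n" "k \<le> n" and w': "w' \<in> dwords n" "k' \<le> n"
   and eq: "take k w @ (n, e) # drop k w = take k' w' @ (n, e') # drop k' w'"
  have neq: "x \<in> set v ==> fst x \<noteq> n" if "v \<in> dwords n" for x v using dwords_word[OF that] by auto
  have l: "length (takeWhile (\<lambda>x. fst x \<noteq> n) (take k v @ (n, e) # drop k v)) = k"
   "filter (\<lambda>x. fst x \<noteq> n) (take k v @ (n, e) # drop k v) = v"
   if "v \<in> dwords n" "k \<le> n" for k v and e :: bool
  proof -
   have "takeWhile (\<lambda>x. fst x \<noteq> n) (take k v @ (n, e) # drop k v) = take k v"
    by (subst takeWhile_append2) (auto dest: in_set_takeD neq[OF that(1)])
   thus "length (takeWhile (\<lambda>x. fst x \<noteq> n) (take k v @ (n, e) # drop k v)) = k"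
    using dwords_word[OF that(1)] that(2) by simp
   have "filter (\<lambda>x. fst x \<noteq> n) v = v" using neq[OF that(1)] by simp
   thus "filter (\<lambda>x. fst x \<noteq> n) (take k v @ (n, e) # drop k v) = v"
    by (metis (mono_tags, lifting) append_take_drop_id filter.simps(2) filter_append fst_conv)
  qed
  have "k = k'" "w = w'" using l[OF w, of e] l[OF w', of e'] eq by metis+
  thus "w = w' \<and> k = k' \<and> e = e'" using eq by simp
 qed
 from card_image[OF this] Suc show ?case by (simp add: card_cartesian_product algebra_simps)
qed simp

definition functional :: "'k::comm_ring_1 => Q_obj list => Q_obj list => ('k Q_mor => 'k) => bool" where
 "functional z X Y \<phi> \<longleftrightarrow> (\<forall>f g. Qeq z X Y f g --> \<phi> f = \<phi> g) \<and>
   (\<forall>f g. Qty X Y f --> Qty X Y g --> \<phi> (MAdd f g) = \<phi> f + \<phi> g) \<and> (\<forall>c f. Qty X Y f --> \<phi> (MScale c f) = c * \<phi> f)"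

text \<open>A family of homogeneous morphisms with a dual family of functionals: independence in a
  form that survives over an arbitrary ground ring and transfers along maps.\<close>

definition separated :: "'k::comm_ring_1 => Q_obj list => Q_obj list => nat => bool" where
 "separated z X Y N \<longleftrightarrow> (\<exists>fs \<phi>. (\<forall>i<N. (\<exists>p. Qhom p X Y (fs i)) \<and> functional z X Y (\<phi> i)) \<and>
   (\<forall>i<N. \<forall>j<N. \<phi> j (fs i) = (if i = j then 1 else 0)))"

abbreviation ups :: "nat => Q_obj list" where "ups n \<equiv> replicate n Up"

lemma ups_append: "ups a @ ups b = ups (a + b)" by (simp add: replicate_add)

context matrix_functor
begin

definition x0 :: "nat => label list" where "x0 n = map (\<lambda>i. (i, False)) [0..<n]"

text \<open>\<open>f\<close> sends the basis vector \<open>x0 n\<close>, with increasing indices and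
  all flags even, to plus or minus the basis vector \<open>w\<close>, without further terms.\<close>

definition detects :: "nat => 'k Q_mor => label list => bool" where
 "detects n f w \<longleftrightarrow> (\<exists>p. Qhom p (ups n) (ups n) f) \<and> w \<in> words n \<and> (\<exists>s\<in>{1, - 1}. \<forall>y\<in>words n. mat f y (x0 n) = s * dl w y)"

lemma dl_sym: "dl x y = dl y x" by (auto simp: dl_def)

lemma detects_step:
 assumes d: "detects n f (A @ v @ B)" and g: "Qhom p (ups m) (ups m) g" and v: "length v = m" "v' \<in> words m"
  and s: "s \<in> {1, - 1}" and gv: "\<And>F. pull (pad (ups (length A)) g (ups (length B))) F (A @ v @ B) = s * F (A @ v' @ B)"
 shows "\<exists>h. detects n h (A @ v' @ B)"
proof -
 let ?g = "pad (ups (length A)) g (ups (length B))" and ?w = "A @ v @ B" and ?w' = "A @ v' @ B"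
 obtain q s' where f: "Qhom q (ups n) (ups n) f" "?w \<in> words n" "s' \<in> {1, - 1}" "\<And>y. y \<in> words n ==> mat f y (x0 n) = s' * dl ?w y"
  using d unfolding detects_def by blast
 have n: "length A + (m + length B) = n" using f(2) v by (simp add: words_iff)
 have X: "ups (length A) @ ups m @ ups (length B) = ups n" by (simp add: ups_append n)
 have hg: "Qhom p (ups n) (ups n) ?g"
  using mor_homogI(4)[OF homI(2) mor_homogI(4)[OF g homI(2) refl refl refl] refl refl refl, of "ups (length A)" "ups (length B)"]
  unfolding pad_def X by simp
 note ng = ndom_ncod[OF Qhom_type[OF hg]]
 have w': "?w' \<in> words n" using f(2) v by (auto simp: words_iff)
 have "mat (?g \<^bold>\<circ> f) y (x0 n) = s * s' * dl ?w' y" if y: "y \<in> words n" for y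
 proof -
  have "mat (?g \<^bold>\<circ> f) y (x0 n) = (\<Sum>w\<in>words n. mat ?g y w * mat f w (x0 n))" using ng by simp
  also have "... = (\<Sum>w\<in>words n. (s' * mat ?g y w) * dl w ?w)"
   by (rule sum.cong) (auto simp: f(4) dl_sym mult_ac)
  also have "... = s' * mat ?g y ?w" using f(2) by (simp add: sum_dl)
  also have "mat ?g y ?w = pull ?g (dl y) ?w" using ng y by (simp add: pull_dl)
  also have "... = s * dl y ?w'" by (rule gv)
  finally show ?thesis by (simp add: dl_sym mult_ac)
 qed
 moreover have "s * s' \<in> {1, - 1}" using s f(3) by auto
 moreover have "Qhom (p + q) (ups n) (ups n) (?g \<^bold>\<circ> f)" by (rule mor_homogI(3)[OF hg f(1) refl])
 ultimately have "detects n (?g \<^bold>\<circ> f) ?w'" unfolding detects_def using w' by blast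
 thus ?thesis by blast
qed

text \<open>Moving a larger even letter to the left is a case in which the R-matrix has no
  correction term.\<close>

lemma detects_u:
 assumes d: "detects n f (A @ [(a, \<alpha>), (b, False)] @ B)" and ab: "a < b"
 shows "\<exists>h. detects n h (A @ [(b, False), (a, \<alpha>)] @ B)"
proof (rule detects_step[OF d, of 0 2 "u\<^sup>+" _ 1])
 have lab: "A \<in> words (length A)" "B \<in> words (length B)" "(a, \<alpha>) \<in> lab" "(b, False) \<in> lab"
  using d by (auto simp: detects_def words_iff)
 show "Qhom 0 (ups 2) (ups 2) u\<^sup>+" using Qhom_ops(1) by (simp add: numeral_2_eq_2 replicate_Suc)
 show "[(b, False), (a, \<alpha>)] \<in> words 2" using lab by (simp add: words_iff)
 have h: "Qhom 0 (ups (2 + length B)) (ups (2 + length B)) (u\<^sup>+ \<^bold>\<otimes> MId (ups (length B)))"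
  by (rule mor_homogI(4)[OF Qhom_ops(1) homI(2)]) (simp_all add: numeral_2_eq_2 replicate_Suc)
 show "pull (pad (ups (length A)) u\<^sup>+ (ups (length B))) F (A @ [(a, \<alpha>), (b, False)] @ B) = 1 * F (A @ [(b, False), (a, \<alpha>)] @ B)" for F
 proof -
  have "pull (pad (ups (length A)) u\<^sup>+ (ups (length B))) F (A @ [(a, \<alpha>), (b, False)] @ B)
   = pull (u\<^sup>+ \<^bold>\<otimes> MId (ups (length B))) (\<lambda>v. F (A @ v)) ([(a, \<alpha>), (b, False)] @ B)"
   unfolding pad_def by (rule pull_left_even[OF h]) (use lab in \<open>auto simp: words_iff\<close>)
  also have "... = pull u\<^sup>+ (\<lambda>v. F (A @ v @ B)) [(a, \<alpha>), (b, False)]"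
   by (rule pull_right) (use lab in \<open>auto simp: words_iff\<close>)
  also have "... = F (A @ [(b, False), (a, \<alpha>)] @ B)"
   using lab ab by (simp add: pull_gen tm_def z0_def)
  finally show ?thesis by simp
 qed
qed simp_all

lemma detects_c:
 assumes d: "detects n f (A @ [(a, False)] @ B)"
 shows "\<exists>h. detects n h (A @ [(a, True)] @ B)"
proof (rule detects_step[OF d, of 1 1 cl _ "if wpar A then - 1 else 1"])
 have lab: "A \<in> words (length A)" "B \<in> words (length B)" "(a, False) \<in> lab" "(a, True) \<in> lab"
  using d by (auto simp: detects_def words_iff lab_def)
 show "Qhom 1 (ups 1) (ups 1) cl" using Qhom_ops(4) by (simp add: replicate_Suc)
 show "[(a, True)] \<in> words 1" using lab by (simp add: words_iff)
 show "pull (pad (ups (length A)) cl (ups (length B))) F (A @ [(a, False)] @ B) = (if wpar A then - 1 else 1) * F (A @ [(a, True)] @ B)" for F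
  using lab pull_right[of "[(a, False)]" cl B "ups (length B)"]
  by (simp add: pad_def pull_tens[of "MId (ups (length A))"] pull_id words_iff pull_gen)
qed auto

text \<open>The new letter has the largest index. It is appended on the right and moved to its place
  while still even; its flag is set afterwards by \<open>detects_c\<close>.\<close>

lemma detects_insert:
 assumes d: "detects n f w" and w: "fst ` set w \<subseteq> {..<n}" and n: "n < L"
 shows "k \<le> n ==> \<exists>h. detects (Suc n) h (take (n - k) w @ [(n, False)] @ drop (n - k) w)"
proof (induction k)
 case 0
 obtain p s where f: "Qhom p (ups n) (ups n) f" "w \<in> words n" "s \<in> {1, - 1}" "\<And>y. y \<in> words n ==> mat f y (x0 n) = s * dl w y"
  using d unfolding detects_def by blast
 have x: "x0 n \<in> words n" "\<not> wpar (x0 n)" "x0 (Suc n) = x0 n @ [(n, False)]"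
  using n by (auto simp: x0_def words_iff lab_def wpar_def filter_map)
 have "mat (f \<^bold>\<otimes> 1\<^sub>\<up>) y (x0 (Suc n)) = s * dl (w @ [(n, False)]) y" if "y \<in> words (Suc n)" for y
 proof -
  have "y \<in> words (n + 1)" using that by simp
  then obtain y1 y2 where y: "y = y1 @ y2" "y1 \<in> words n" "y2 \<in> words 1" by (rule words_split)
  show ?thesis unfolding y(1) x(3) using mat_tens[OF Qhom_type[OF f(1)], of "x0 n" y1 "1\<^sub>\<up>" y2 "[(n, False)]"] x y f(2,4)
   by (simp add: dl_append words_iff dl_sym)
 qed
 moreover have "Qhom p (ups (Suc n)) (ups (Suc n)) (f \<^bold>\<otimes> 1\<^sub>\<up>)"
  by (rule mor_homogI(4)[OF f(1) homI(2)]) (simp_all add: replicate_append_same replicate_Suc)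
 moreover have "w @ [(n, False)] \<in> words (Suc n)" using f(2) n by (simp add: words_iff lab_def)
 ultimately have "detects (Suc n) (f \<^bold>\<otimes> 1\<^sub>\<up>) (w @ [(n, False)])" unfolding detects_def using f(3) by blast
 thus ?case using f(2) by (auto simp: words_iff)
next
 case (Suc k)
 let ?i = "n - Suc k"
 have lw: "length w = n" using d by (simp add: detects_def words_iff)
 have i: "?i < n" "n - k = Suc ?i" using Suc.prems by auto
 have t: "take (n - k) w = take ?i w @ [w ! ?i]" "drop ?i w = w ! ?i # drop (n - k) w"
  using i lw by (simp_all add: take_Suc_conv_app_nth Cons_nth_drop_Suc)
 obtain a \<alpha> where a: "w ! ?i = (a, \<alpha>)" by force
 have "w ! ?i \<in> set w" using i lw by simp
 hence "a < n" using w a by force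
 from Suc obtain h where "detects (Suc n) h (take ?i w @ [(a, \<alpha>), (n, False)] @ drop (n - k) w)"
  unfolding t(1) a by auto
 from detects_u[OF this \<open>a < n\<close>] show ?case unfolding t(2) a by simp
qed

theorem detects_dwords: "n \<le> L ==> w \<in> dwords n ==> \<exists>f. detects n f w"
proof (induction n arbitrary: w)
 case 0
 have "detects 0 (MId []) []" unfolding detects_def
  by (auto simp: words_iff x0_def intro: homI(2))
 thus ?case using 0 by auto
next
 case (Suc n)
 then obtain v k e where v: "v \<in> dwords n" "k \<le> n" "w = take k v @ (n, e) # drop k v" by auto
 obtain f where f: "detects n f v" using Suc v by auto
 have "\<exists>h. detects (Suc n) h (take (n - (n - k)) v @ [(n, False)] @ drop (n - (n - k)) v)"
  by (rule detects_insert[OF f]) (use dwords_word[OF v(1)] Suc.prems in auto)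
 then obtain h where h: "detects (Suc n) h (take k v @ [(n, False)] @ drop k v)" using v(2) by auto
 show ?case using h detects_c[OF h] v(3) by (cases e) auto
qed

end

lemma sign_ext_coord: "s = 1 \<or> s = - 1 ==> (if s = 1 then 1 else - 1) * ext_coord z s = 1"
 by (cases "s = 1") (simp_all add: ext_coord)

text \<open>The functional dual to the morphism producing \<open>w i\<close> is the matrix entry at
  \<open>w i\<close> and \<open>x0 n\<close>, made linear over \<open>'k\<close> by
  \<open>ext_coord\<close> and corrected by the sign \<open>?c i\<close>.\<close>

lemma separated_ups: "separated z (ups n) (ups n) (2 ^ n * fact n)"
proof -
 \<comment> \<open>By \<open>q * q = z * q + 1\<close> the inverse of \<open>ext_q\<close> is
   \<open>ext_q - ext_z\<close>. Taking \<open>L = n\<close> provides just enough indices.\<close>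
 interpret matrix_functor ext_q "ext_q - ext_z" ext_of "ext_at z" z n
  by unfold_locales (simp_all add: ext_simps algebra_simps)
 obtain w where w: "bij_betw w {..<2 ^ n * fact n :: nat} (dwords n)"
  using ex_bij_betw_nat_finite[of "dwords n"] card_dwords[of n] unfolding atLeast0LessThan by auto
 have "\<forall>i. \<exists>f s. i < 2 ^ n * fact n --> (\<exists>p. Qhom p (ups n) (ups n) f) \<and> w i \<in> words n \<and> s \<in> {1, - 1} \<and>
   (\<forall>y\<in>words n. mat f y (x0 n) = s * dl (w i) y)"
  using detects_dwords[of n] bij_betwE[OF w] unfolding detects_def by fast
 then obtain f s where f: "\<And>i. i < 2 ^ n * fact n ==> (\<exists>p. Qhom p (ups n) (ups n) (f i)) \<and> w i \<in> words n \<and> s i \<in> {1, - 1} \<and>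
   (\<forall>y\<in>words n. mat (f i) y (x0 n) = s i * dl (w i) y)" by metis
 let ?c = "\<lambda>i. if s i = 1 then 1 else - 1 :: 'a"
 define \<phi> where "\<phi> i g = ?c i * ext_coord z (mat g (w i) (x0 n))" for i g
 have x: "x0 n \<in> words n" by (auto simp: x0_def words_iff lab_def)
 have "functional z (ups n) (ups n) (\<phi> i)" if "i < 2 ^ n * fact n" for i
  unfolding functional_def \<phi>_def mat.simps ext_coord ring_distribs
  using ext_coord(1)[OF mat_sound[of "ups n" "ups n" _ _ "w i" "x0 n"]] f[OF that] x by (simp add: mult.left_commute)
 moreover have "\<phi> j (f i) = (if i = j then 1 else 0)" if "i < 2 ^ n * fact n" "j < 2 ^ n * fact n" for i j
 proof -
  have "w j = w i \<longleftrightarrow> i = j" using w that by (auto simp: bij_betw_def inj_on_def)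
  hence "\<phi> j (f i) = ?c j * ext_coord z (s i * (if i = j then 1 else 0))"
   using f[OF that(1)] f[OF that(2)] by (simp add: \<phi>_def dl_def)
  moreover have "s i = 1 \<or> s i = - 1" using f[OF that(1)] by simp
  ultimately show ?thesis using sign_ext_coord[of "s i" z] ext_coord(5)[of z] by (cases "i = j") (simp_all only: mult_1_right mult_zero_right simp_thms if_True if_False)
 qed
 ultimately show ?thesis unfolding separated_def using f by - (rule exI[of _ f], rule exI[of _ \<phi>], blast)
qed

section \<open>Bending strands and sorting words\<close>

lemma Qat_W:
 assumes "Qty M N f" "x \<in> Qat z (A @ M @ B)"
 shows "W f M N (length A) x \<in> Qat z (A @ N @ B)"
 using assms(2) unfolding Qat_def by (rule supp_W[OF assms(1)]) auto

lemma W_el: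
 assumes f: "Qty M N f" and h: "Qty X (A @ M @ B) h"
 shows "W f M N (length A) (el z X (A @ M @ B) h) = el z X (A @ N @ B) (pad A f B \<^bold>\<circ> h)"
 by (rule el_eqI[OF supp_W[OF f el_supp] cmp_W[OF f cmp_el[OF h]]]) simp

lemma Qat_ats: "x \<in> Qat z (A @ B @ C) ==> n = length A ==> x \<in> ats n B"
 unfolding Qat_def ats_def by (erule supp_mono) simp

lemma W_pad:
 assumes f: "Qty M N f" and x: "x \<in> Qat z (A @ M @ B @ C)"
 shows "W (pad A f B) (A @ M @ B) (A @ N @ B) 0 x = W f M N (length A) x"
proof -
 have t: "Qty (M @ B) (N @ B) (f \<^bold>\<otimes> MId B)" by (intro tyI f)
 have "W (pad A f B) (A @ M @ B) (A @ N @ B) 0 x = W (f \<^bold>\<otimes> MId B) (M @ B) (N @ B) (length A) x"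
  unfolding pad_def using W_tens_MId_left[OF t, of x 0 A] Qat_ats[of x z "[]" A] x by simp
 also have "... = W f M N (length A) x"
  by (rule W_tens_MId_right[OF f]) (rule Qat_ats[of x z "A @ M" B C], use x in simp_all)
 finally show ?thesis .
qed

lemma Qhom_pad: "Qhom p M N f ==> X = A @ M @ B ==> Y = A @ N @ B ==> Qhom p X Y (pad A f B)"
 unfolding pad_def using homI(7)[OF homI(2) homI(7)[OF _ homI(2)], of Q_sig p M N f A B] by simp

text \<open>Morphisms are pushed along \<open>F\<close> and functionals pulled back along
  \<open>G\<close>, so duality survives as soon as \<open>G\<close> after \<open>F\<close> is the
  identity.\<close>

lemma separated_transfer:
 assumes "separated z X Y N"
  and F: "\<And>p g. Qhom p X Y g ==> Qhom p X' Y' (F g) \<and> Qeq z X Y (G (F g)) g"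
  and G: "\<And>f. Qty X' Y' f ==> Qty X Y (G f)" "\<And>f g. Qeq z X' Y' f g ==> Qeq z X Y (G f) (G g)"
   "\<And>f g. Qty X' Y' f ==> Qty X' Y' g ==> Qeq z X Y (G (MAdd f g)) (MAdd (G f) (G g))"
   "\<And>c f. Qty X' Y' f ==> Qeq z X Y (G (MScale c f)) (MScale c (G f))"
 shows "separated z X' Y' N"
proof -
 obtain fs \<phi> where s: "\<And>i. i < N ==> (\<exists>p. Qhom p X Y (fs i)) \<and> functional z X Y (\<phi> i)"
  "\<And>i j. i < N ==> j < N ==> \<phi> j (fs i) = (if i = j then 1 else 0)"
  using assms(1) unfolding separated_def by blast
 have "functional z X' Y' (\<lambda>f. \<phi> i (G f))" if "i < N" for i
  using s(1)[OF that] G unfolding functional_def by metis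
 moreover have "\<phi> j (G (F (fs i))) = (if i = j then 1 else 0)" if "i < N" "j < N" for i j
  using s(1)[OF that(1)] s(1)[OF that(2)] s(2)[OF that] F unfolding functional_def by metis
 ultimately show ?thesis unfolding separated_def using s(1) F
  by (intro exI[of _ "\<lambda>i. F (fs i)"] exI[of _ "\<lambda>i f. \<phi> i (G f)"]) blast
qed

lemma k_r_cup: "at1 Up n x ==> \<k> n (\<r> (Suc n) (\<UU> (Suc n) x)) = x"
 by (simp add: k_r v_eq k_u_cup k_cup)

text \<open>\<open>F\<close> turns the last strand around with a cup at the input and a right cap at
  the output. The crossing \<open>r\<^sup>-\<close> makes the output of \<open>g\<close> meet the
  original down strand instead of the other end of the cup. \<open>G\<close> undoes this, by
  \<open>k_r_cup\<close> and the zigzag relation.\<close>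

lemma separated_bend:
 assumes "separated z (Y @ [Up]) (Z @ [Up]) N"
 shows "separated z (Y @ [Down]) (Z @ [Down]) N"
proof -
 let ?m = "length Z" and ?n = "length Y" and ?Y = "Y @ [Up]" and ?Z = "Z @ [Up]" and ?Y' = "Y @ [Down]" and ?Z' = "Z @ [Down]"
 let ?Y3 = "Y @ [Down, Up, Up]" and ?Z3 = "Z @ [Down, Up, Up]" and ?Y4 = "Y @ [Up, Down, Down]" and ?Z4 = "Z @ [Up, Down, Down]"
 define F :: "'a Q_mor => 'a Q_mor" where
  "F g = pad ?Z' capR [] \<^bold>\<circ> pad Z r\<^sup>- [Down] \<^bold>\<circ> pad [] g [Down, Down] \<^bold>\<circ> pad Y cupL [Down]" for g
 define H :: "'a Q_mor" where "H = pad Y r\<^sup>- [Up] \<^bold>\<circ> pad Y cupL [Up] \<^bold>\<circ> MId ?Y"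
 define G where "G f = pad ?Z capL [] \<^bold>\<circ> pad Z l\<^sup>+ [Up] \<^bold>\<circ> pad [] f [Up, Up] \<^bold>\<circ> H" for f
 define e where "e = el z ?Y ?Y (MId ?Y)"
 have h1: "Qhom 0 ?Y (Y @ [Up, Down, Up]) (pad Y cupL [Up])" "Qhom 0 (Y @ [Up, Down, Up]) ?Y3 (pad Y r\<^sup>- [Up])"
  "Qhom 0 ?Z3 (Z @ [Up, Down, Up]) (pad Z l\<^sup>+ [Up])" "Qhom 0 (Z @ [Up, Down, Up]) ?Z (pad ?Z capL [])"
  by (rule Qhom_pad, rule Qhom_ops; simp)+
 have h2: "Qhom 0 ?Y' ?Y4 (pad Y cupL [Down])"
  "Qhom 0 ?Z4 (Z @ [Down, Up, Down]) (pad Z r\<^sup>- [Down])" "Qhom 0 (Z @ [Down, Up, Down]) ?Z' (pad ?Z' capR [])"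
  by (rule Qhom_pad, rule Qhom_ops; simp)+
 have hF: "Qhom p ?Y' ?Z' (F g)" if "Qhom p ?Y ?Z g" for p g
  unfolding F_def by (rule mor_homogI(3) h2 Qhom_pad[OF that] | simp)+
 have tH: "Qty ?Y ?Y3 H"
  unfolding H_def by (rule tyI(2,6) h1[THEN Qhom_type])+
 have tf: "Qty ?Y3 ?Z3 (pad [] f [Up, Up])" if "Qty ?Y' ?Z' f" for f
  using pad_type[OF that, of "[]" "[Up, Up]"] by simp
 have tG: "Qty ?Y ?Z (G f)" if "Qty ?Y' ?Z' f" for f
  unfolding G_def by (rule tyI(6) h1(3,4)[THEN Qhom_type] tf[OF that] tH)+
 have eG: "el z ?Y ?Z (G f) = \<CC> (Suc ?m) (\<l> ?m (el z ?Y ?Z3 (pad [] f [Up, Up] \<^bold>\<circ> H)))"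
  if "Qty ?Y' ?Z' f" for f
 proof -
  have t: "Qty ?Y ?Z3 (pad [] f [Up, Up] \<^bold>\<circ> H)" by (rule tyI(6) tf[OF that] tH)+
  hence t': "Qty ?Y (Z @ [Up, Down, Up]) (pad Z l\<^sup>+ [Up] \<^bold>\<circ> pad [] f [Up, Up] \<^bold>\<circ> H)"
   by (intro tyI(6)[OF h1(3)[THEN Qhom_type]])
  show ?thesis
   using Op_el[of ?Y Z oL "[Up]" "pad [] f [Up, Up] \<^bold>\<circ> H" z] Op_el[of ?Y ?Z oCap "[]" "pad Z l\<^sup>+ [Up] \<^bold>\<circ> pad [] f [Up, Up] \<^bold>\<circ> H" z] t t'
   by (simp add: G_def)
 qed
 have e: "e \<in> Qat z ?Y" unfolding e_def by (rule el_Qat)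
 have eH: "el z ?Y ?Y3 H = \<r> ?n (\<UU> ?n e)"
 proof -
  have "Qty ?Y (Y @ [Up, Down, Up]) (pad Y cupL [Up] \<^bold>\<circ> MId ?Y :: 'a Q_mor)"
   by (rule tyI(2,6) h1(1)[THEN Qhom_type])+
  thus ?thesis
   using Op_el[of ?Y Y oCup "[Up]" "MId ?Y" z] Op_el[of ?Y Y oR "[Up]" "pad Y cupL [Up] \<^bold>\<circ> MId ?Y" z]
   by (simp add: H_def e_def tyI(2))
 qed
 have GF: "Qeq z ?Y ?Z (G (F g)) g" if g: "Qhom p ?Y ?Z g" for p g
 proof (rule el_eqD)
  let ?w = "\<r> ?n (\<UU> ?n e)" and ?W = "W g ?Y ?Z 0"
  have tF: "Qty ?Y' ?Z' (F g)" by (rule Qhom_type[OF hF[OF g]])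
  have tg: "Qty ?Y ?Z g" by (rule Qhom_type[OF g])
  have hg: "Qhom p ?Y4 ?Z4 (pad [] g [Down, Down])"
   by (rule Qhom_pad[OF g]) simp_all
  note ha = mor_homogI(3)[OF hg h2(1) refl]
  note hb = mor_homogI(3)[OF h2(2) ha refl]
  have w: "?w \<in> Qat z ?Y3" unfolding eH[symmetric] by (rule el_Qat)
  have Wat: "?W x \<in> Qat z (Z @ [Up] @ C)" if "x \<in> Qat z (Y @ [Up] @ C)" for x C
   using Qat_W[OF tg, of x z "[]" C] that by simp
  have x1: "\<UU> ?n ?w \<in> Qat z (Y @ [Up] @ [Down, Down, Up, Up])"
   using Qat_Op[of ?w z Y oCup "[Down, Up, Up]"] w by simp
  note x2 = Wat[OF x1]
  have x3: "\<r> ?m (?W (\<UU> ?n ?w)) \<in> Qat z (Z @ [Down, Up, Down, Up, Up])"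
   using Qat_Op[of "?W (\<UU> ?n ?w)" z Z oR "[Down, Up, Up]"] x2 by simp
  have "W (F g) ?Y' ?Z' 0 ?w = \<k> (Suc ?m) (\<r> ?m (?W (\<UU> ?n ?w)))"
  proof -
   have "W (F g) ?Y' ?Z' 0 ?w =
    W (pad ?Z' capR []) (Z @ [Down, Up, Down]) ?Z' 0 (W (pad Z r\<^sup>- [Down]) ?Z4 (Z @ [Down, Up, Down]) 0
    (W (pad [] g [Down, Down]) ?Y4 ?Z4 0 (W (pad Y cupL [Down]) ?Y' ?Y4 0 ?w)))"
    unfolding F_def W_comp[OF h2(3) hb] W_comp[OF h2(2) ha] W_comp[OF hg h2(1)] ..
   also have "W (pad Y cupL [Down]) ?Y' ?Y4 0 ?w = \<UU> ?n ?w"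
    using W_pad[OF Qty_op[of oCup], of ?w z Y "[Down]" "[Up, Up]"] w by (simp add: Op_def)
   also have "W (pad [] g [Down, Down]) ?Y4 ?Z4 0 (\<UU> ?n ?w) = ?W (\<UU> ?n ?w)"
    using W_pad[OF tg, of "\<UU> ?n ?w" z "[]" "[Down, Down]" "[Up, Up]"] x1 by simp
   also have "W (pad Z r\<^sup>- [Down]) ?Z4 (Z @ [Down, Up, Down]) 0 (?W (\<UU> ?n ?w)) = \<r> ?m (?W (\<UU> ?n ?w))"
    using W_pad[OF Qty_op[of oR], of "?W (\<UU> ?n ?w)" z Z "[Down]" "[Up, Up]"] x2 by (simp add: Op_def)
   also have "W (pad ?Z' capR []) (Z @ [Down, Up, Down]) ?Z' 0 (\<r> ?m (?W (\<UU> ?n ?w))) = \<k> (Suc ?m) (\<r> ?m (?W (\<UU> ?n ?w)))"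
    using W_pad[OF Qty_op[of oK], of "\<r> ?m (?W (\<UU> ?n ?w))" z ?Z' "[]" "[Up, Up]"] x3 by (simp add: Op_def)
   finally show ?thesis .
  qed
  moreover have "el z ?Y ?Z3 (pad [] (F g) [Up, Up] \<^bold>\<circ> H) = W (F g) ?Y' ?Z' 0 ?w"
   using W_el[OF tF, of ?Y "[]" "[Up, Up]" H z] tH eH by simp
  ultimately have "el z ?Y ?Z (G (F g)) = \<CC> (Suc ?m) (\<l> ?m (\<k> (Suc ?m) (\<r> ?m (?W (\<UU> ?n ?w)))))"
   using eG[OF tF] by simp
  also have "... = el z ?Y ?Z g"
  proof -
   have ev: "?W (Op p (?n + k) x) = Op p (?m + k) (?W x)" if "opar p = 0" "k \<ge> 1" for p k x
    using W_interchange[OF g Qhom_op[of p], of 0 "?m + k" x] that by (simp add: Op_def add.commute)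
   have We: "?W e = el z ?Y ?Z g"
    using W_el[OF tg, of ?Y "[]" "[]" "MId ?Y" z]
     el_cong[OF mor_cong_trans[OF mor_cong_comp_cong[OF pad_unit[OF tg] MId_refl] mor_cong_comp_id_right[OF tg]]]
    by (simp add: e_def tyI)
   define y where "y = ?W (\<UU> ?n e)"
   have Ue: "\<UU> ?n e \<in> Qat z (Y @ [Up] @ [Down, Up])" using Qat_Op[of e z Y oCup "[Up]"] e by simp
   have yq: "y \<in> Qat z (Z @ [Up, Down, Up])" using Wat[OF Ue] by (simp add: y_def)
   have y: "at1 Up ?m y" "at1 Down (Suc ?m) y"
    by (rule Qat_at1[OF yq]; simp add: nth_append)+
   have "\<UU> ?n ?w = \<r> (?n + 2) (\<UU> (?n + 2) (\<UU> ?n e))" by (simp add: inter)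
   hence "?W (\<UU> ?n ?w) = \<r> (?m + 2) (\<UU> (?m + 2) y)" by (simp only: ev opar_simps y_def Q_op.distinct not_False_eq_True one_le_numeral)
   hence "\<r> ?m (?W (\<UU> ?n ?w)) = \<r> (Suc (Suc ?m)) (\<UU> (Suc (Suc ?m)) (\<r> ?m y))" by (simp add: inter)
   hence "\<k> (Suc ?m) (\<r> ?m (?W (\<UU> ?n ?w))) = \<r> ?m y" using y by (simp add: k_r_cup)
   hence "\<CC> (Suc ?m) (\<l> ?m (\<k> (Suc ?m) (\<r> ?m (?W (\<UU> ?n ?w))))) = \<CC> (?m + 1) y" using y by simp
   also have "... = ?W (\<CC> (?n + 1) (\<UU> ?n e))" unfolding y_def by (subst ev) (simp_all only: opar_simps Q_op.distinct not_False_eq_True order_refl)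
   also have "\<CC> (?n + 1) (\<UU> ?n e) = e" using Qat_at1[OF e, of ?n Up] by simp
   finally show ?thesis unfolding We .
  qed
  finally show "el z ?Y ?Z (G (F g)) = el z ?Y ?Z g" .
  show "Qty ?Y ?Z (G (F g))" "Qty ?Y ?Z g" by (fact tG[OF tF] tg)+
 qed
 have tP: "Qty ?Y ?Z3 (pad [] f [Up, Up] \<^bold>\<circ> H)" if "Qty ?Y' ?Z' f" for f
  by (rule tyI(6) tf[OF that] tH)+
 have cH: "Qeq z ?Y ?Y3 H H" by (rule mor_cong_refl[OF tH])
 have eP: "el z ?Y ?Z3 (pad [] (MAdd f g) [Up, Up] \<^bold>\<circ> H) =
   el z ?Y ?Z3 (pad [] f [Up, Up] \<^bold>\<circ> H) + el z ?Y ?Z3 (pad [] g [Up, Up] \<^bold>\<circ> H)"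
  if t: "Qty ?Y' ?Z' f" "Qty ?Y' ?Z' g" for f g
  using el_cong[OF mor_cong_trans[OF mor_cong_comp_cong[OF pad_add[OF t, of z "[]" "[Up, Up]", simplified] cH] mor_cong_comp_add_left[OF tf[OF t(1)] tf[OF t(2)] tH]]]
  unfolding el_add[OF tP[OF t(1)] tP[OF t(2)]] .
 have eS: "el z ?Y ?Z3 (pad [] (MScale c f) [Up, Up] \<^bold>\<circ> H) =
   c *\<^sub>q el z ?Y ?Z3 (pad [] f [Up, Up] \<^bold>\<circ> H)"
  if t: "Qty ?Y' ?Z' f" for c f
  using el_cong[OF mor_cong_trans[OF mor_cong_comp_cong[OF pad_scaled[OF t, of z "[]" "[Up, Up]", simplified] cH] mor_cong_comp_scale_left[OF tf[OF t] tH]]]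
  unfolding el_scale[OF tP[OF t]] .
 show ?thesis
 proof (rule separated_transfer[OF assms, of ?Y' ?Z' F G])
  show "Qhom p ?Y' ?Z' (F g) \<and> Qeq z ?Y ?Z (G (F g)) g"
   if "Qhom p ?Y ?Z g" for p g using hF[OF that] GF[OF that] ..
  show "Qeq z ?Y ?Z (G f) (G g)" if "Qeq z ?Y' ?Z' f g" for f g
   unfolding G_def by (rule mor_cong_comp_cong h1(3,4)[THEN Qhom_type, THEN mor_cong_refl] cH pad_cong[OF that, of "[]" "[Up, Up]", simplified])+
  show "Qeq z ?Y ?Z (G (MAdd f g)) (MAdd (G f) (G g))"
   if t: "Qty ?Y' ?Z' f" "Qty ?Y' ?Z' g" for f g
   using t tG eG[OF t(1)] eG[OF t(2)] eG[OF tyI(4)[OF t]]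
   by (intro el_eqD) (auto simp: el_add eP intro: tyI)
  show "Qeq z ?Y ?Z (G (MScale c f)) (MScale c (G f))"
   if t: "Qty ?Y' ?Z' f" for c f
   using t tG eG[OF t] eG[OF tyI(5)[OF t]]
   by (intro el_eqD) (auto simp: el_scale eS intro: tyI)
 qed (rule tG)
qed

definition Qiso :: "'k::comm_ring_1 => Q_obj list => Q_obj list => 'k Q_mor => 'k Q_mor => bool" where
 "Qiso z X Y f g \<longleftrightarrow> Qhom 0 X Y f \<and> Qhom 0 Y X g \<and> Qeq z X X (g \<^bold>\<circ> f) (MId X) \<and> Qeq z Y Y (f \<^bold>\<circ> g) (MId Y)"

lemma Qiso_refl: "Qiso z X X (MId X) (MId X)"
 unfolding Qiso_def by (auto intro: homI(2) mor_cong_comp_id_left tyI)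

lemma Qiso_sym: "Qiso z X Y f g ==> Qiso z Y X g f"
 unfolding Qiso_def by blast

lemma comp_cancel:
 assumes "Qty X Y f" "Qty Y X g" "Qeq z X X (g \<^bold>\<circ> f) (MId X)" "Qty V X h"
 shows "Qeq z V X (g \<^bold>\<circ> f \<^bold>\<circ> h) h"
proof -
 have "Qeq z V X (g \<^bold>\<circ> f \<^bold>\<circ> h) ((g \<^bold>\<circ> f) \<^bold>\<circ> h)" by (rule mor_cong_sym[OF mor_cong_comp_assoc[OF assms(2,1,4)]])
 also have "Qeq z V X ... (MId X \<^bold>\<circ> h)" by (rule mor_cong_comp_cong[OF assms(3) mor_cong_refl[OF assms(4)]])
 also have "Qeq z V X ... h" by (rule mor_cong_comp_id_left[OF assms(4)])
 finally show ?thesis .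
qed

lemma Qiso_trans:
 assumes "Qiso z X Y f g" "Qiso z Y V f' g'"
 shows "Qiso z X V (f' \<^bold>\<circ> f) (g \<^bold>\<circ> g')"
proof -
 have *: "Qeq z X X ((g \<^bold>\<circ> g') \<^bold>\<circ> (f' \<^bold>\<circ> f)) (MId X)" if "Qiso z X Y f g" "Qiso z Y V f' g'" for X V f f' g g'
 proof -
  have t: "Qty X Y f" "Qty Y X g" "Qty Y V f'" "Qty V Y g'" using that by (auto simp: Qiso_def dest: Qhom_type)
  have "Qeq z X X ((g \<^bold>\<circ> g') \<^bold>\<circ> (f' \<^bold>\<circ> f)) (g \<^bold>\<circ> g' \<^bold>\<circ> f' \<^bold>\<circ> f)"
   by (rule mor_cong_comp_assoc t tyI(6))+
  also have "Qeq z X X ... (g \<^bold>\<circ> f)"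
   using that by (intro mor_cong_comp_cong[OF mor_cong_refl[OF t(2)]] t comp_cancel[OF t(3,4)]) (simp add: Qiso_def)
  also have "Qeq z X X ... (MId X)" using that by (simp add: Qiso_def)
  finally show ?thesis .
 qed
 show ?thesis using *[OF assms] *[OF assms(2,1)[THEN Qiso_sym]] assms unfolding Qiso_def
  by (auto intro: mor_homogI(3))
qed

lemma Qiso_pad:
 assumes "Qiso z X Y f g"
 shows "Qiso z (A @ X @ B) (A @ Y @ B) (pad A f B) (pad A g B)"
proof -
 have *: "Qeq z (A @ X @ B) (A @ X @ B) (pad A g B \<^bold>\<circ> pad A f B) (MId (A @ X @ B))" if "Qiso z X Y f g" for X Y f g
  using that pad_comp[of 0 Y X g 0 X f z A B] pad_cong[of z X X "g \<^bold>\<circ> f" "MId X" A B] pad_MId[of z A X B] unfolding Qiso_def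
  by (blast intro: mor_cong_trans)
 thus ?thesis using *[OF assms] *[OF Qiso_sym[OF assms]] assms unfolding Qiso_def by (auto intro: Qhom_pad)
qed

lemma Qiso_swap: "Qiso z [Down, Up] [Up, Down] l\<^sup>+ r\<^sup>-"
 unfolding Qiso_def using Qhom_ops by (auto intro!: mor_cong_rel Q_rel.intros tyI dest: Qhom_type)

lemma Qiso_move: "\<exists>f g. Qiso z (Down # ups a @ B) (ups a @ Down # B) f g"
proof (induction a)
 case 0 show ?case using Qiso_refl[of z "Down # B"] by auto
next
 case (Suc a)
 then obtain f g where "Qiso z (Down # ups a @ B) (ups a @ Down # B) f g" by blast
 from Qiso_trans[OF Qiso_pad[OF Qiso_swap, of z "[]" "ups a @ B", simplified] Qiso_pad[OF this, of "[Up]" "[]", simplified]]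
 show ?case by (auto simp: replicate_Suc)
qed

lemma Qiso_srt: "\<exists>f g. Qiso z X (srt (count_list X Up) (count_list X Down)) f g"
proof (induction X)
 case Nil show ?case using Qiso_refl[of z "[]"] by auto
next
 case (Cons x X)
 then obtain f g where fg: "Qiso z X (srt (count_list X Up) (count_list X Down)) f g" by blast
 note * = Qiso_pad[OF fg, of "[x]" "[]", simplified]
 show ?case
 proof (cases x)
  case Up thus ?thesis using * by (auto simp: replicate_Suc)
 next
  case Down
  obtain f' g' where "Qiso z (Down # srt (count_list X Up) (count_list X Down)) (ups (count_list X Up) @ Down # replicate (count_list X Down) Down) f' g'"
   using Qiso_move by blast
  from Qiso_trans[OF *[unfolded Down] this] show ?thesis using Down by (auto simp: replicate_Suc)
 qed
qed

lemma Qiso_conj: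
 fixes f g :: "'a::comm_ring_1 Q_mor"
 assumes i: "Qiso z X Y f g" and u: "Qty X X u"
 shows "Qeq z X X (g \<^bold>\<circ> (f \<^bold>\<circ> u \<^bold>\<circ> g) \<^bold>\<circ> f) u"
proof -
 have t: "Qty X Y f" "Qty Y X g" using i by (auto simp: Qiso_def dest: Qhom_type)
 have "Qeq z X X (g \<^bold>\<circ> (f \<^bold>\<circ> u \<^bold>\<circ> g) \<^bold>\<circ> f) (g \<^bold>\<circ> f \<^bold>\<circ> (u \<^bold>\<circ> g) \<^bold>\<circ> f)"
  by (rule mor_cong_comp_cong[OF mor_cong_refl[OF t(2)]], rule mor_cong_comp_assoc[OF t(1) _ t(1)]) (rule tyI(6) u t)+
 also have "Qeq z X X ... ((u \<^bold>\<circ> g) \<^bold>\<circ> f)"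
  by (rule comp_cancel[OF t]) (use i u t in \<open>auto simp: Qiso_def intro!: tyI\<close>)
 also have "Qeq z X X ... (u \<^bold>\<circ> g \<^bold>\<circ> f)" by (rule mor_cong_comp_assoc[OF u t(2,1)])
 also have "Qeq z X X ... (u \<^bold>\<circ> MId X)" using i by (intro mor_cong_comp_cong[OF mor_cong_refl[OF u]]) (simp add: Qiso_def)
 also have "Qeq z X X ... u" by (rule mor_cong_comp_id_right[OF u])
 finally show ?thesis .
qed

lemma comp_middle_linear:
 fixes f g u v :: "'a::comm_ring_1 Q_mor"
 assumes t: "Qty X Y f" "Qty Y' X' g" and u: "Qty Y Y' u" and v: "Qty Y Y' v"
 shows "Qeq z X X' (g \<^bold>\<circ> MAdd u v \<^bold>\<circ> f) (MAdd (g \<^bold>\<circ> u \<^bold>\<circ> f) (g \<^bold>\<circ> v \<^bold>\<circ> f))"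
  and "Qeq z X X' (g \<^bold>\<circ> MScale c u \<^bold>\<circ> f) (MScale c (g \<^bold>\<circ> u \<^bold>\<circ> f))"
proof -
 have "Qeq z X X' (g \<^bold>\<circ> MAdd u v \<^bold>\<circ> f) (g \<^bold>\<circ> MAdd (u \<^bold>\<circ> f) (v \<^bold>\<circ> f))"
  by (rule mor_cong_comp_cong[OF mor_cong_refl[OF t(2)]] mor_cong_comp_add_left u v t)+
 also have "Qeq z X X' ... (MAdd (g \<^bold>\<circ> u \<^bold>\<circ> f) (g \<^bold>\<circ> v \<^bold>\<circ> f))"
  by (rule mor_cong_comp_add_right tyI(6) u v t)+
 finally show "Qeq z X X' (g \<^bold>\<circ> MAdd u v \<^bold>\<circ> f) (MAdd (g \<^bold>\<circ> u \<^bold>\<circ> f) (g \<^bold>\<circ> v \<^bold>\<circ> f))" .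
 have "Qeq z X X' (g \<^bold>\<circ> MScale c u \<^bold>\<circ> f) (g \<^bold>\<circ> MScale c (u \<^bold>\<circ> f))"
  by (rule mor_cong_comp_cong[OF mor_cong_refl[OF t(2)]] mor_cong_comp_scale_left u t)+
 also have "Qeq z X X' ... (MScale c (g \<^bold>\<circ> u \<^bold>\<circ> f))"
  by (rule mor_cong_comp_scale_right tyI(6) u t)+
 finally show "Qeq z X X' (g \<^bold>\<circ> MScale c u \<^bold>\<circ> f) (MScale c (g \<^bold>\<circ> u \<^bold>\<circ> f))" .
qed

lemma separated_iso:
 assumes s: "separated z X X N" and i: "Qiso z X Y f g"
 shows "separated z Y Y N"
proof -
 have t: "Qty X Y f" "Qty Y X g" and h: "Qhom 0 X Y f" "Qhom 0 Y X g" using i by (auto simp: Qiso_def dest: Qhom_type)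
 show ?thesis
 proof (rule separated_transfer[OF s, of Y Y "\<lambda>u. f \<^bold>\<circ> u \<^bold>\<circ> g" "\<lambda>u. g \<^bold>\<circ> u \<^bold>\<circ> f"])
  show "Qhom p Y Y (f \<^bold>\<circ> u \<^bold>\<circ> g) \<and> Qeq z X X (g \<^bold>\<circ> (f \<^bold>\<circ> u \<^bold>\<circ> g) \<^bold>\<circ> f) u" if u: "Qhom p X X u" for p u
   using mor_homogI(3)[OF h(1) mor_homogI(3)[OF u h(2) refl] refl] Qiso_conj[OF i Qhom_type[OF u]] by simp
 qed (use t in \<open>auto intro: tyI mor_cong_comp_cong mor_cong_refl comp_middle_linear\<close>)
qed

text \<open>Induction on the number of down strands: sorting moves one of them to the end, where
  \<open>separated_bend\<close> exchanges it for an up strand.\<close>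

theorem separated_End: "separated z X X (2 ^ length X * fact (length X))"
proof (induction "count_list X Down" arbitrary: X)
 case 0
 hence "x = Up" if "x \<in> set X" for x using that by (cases x) (auto simp: count_list_0_iff)
 hence "X = ups (length X)" by (intro replicate_eqI) auto
 thus ?case using separated_ups[of z "length X"] by simp
next
 case (Suc k)
 let ?a = "count_list X Up"
 have len: "length X = ?a + count_list X Down" by (induction X) (auto intro: Q_obj.exhaust)
 have cl: "count_list (replicate i a) b = (if a = b then i else 0)" for i and a b :: Q_obj
  by (induction i) (auto simp: replicate_Suc)
 have "separated z (srt ?a k @ [Up]) (srt ?a k @ [Up]) (2 ^ length X * fact (length X))"
  using Suc(1)[of "srt ?a k @ [Up]"] Suc(2) len by (simp add: cl)
 from separated_bend[OF this] have "separated z (srt ?a (count_list X Down)) (srt ?a (count_list X Down)) (2 ^ length X * fact (length X))"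
  using Suc(2)[symmetric] by (simp add: replicate_append_same replicate_Suc)
 thus ?case using Qiso_srt[of z X] separated_iso Qiso_sym by blast
qed

text \<open>The determinant of \<open>A\<close> is a unit, so the adjugate provides a two-sided
  inverse over any commutative ring.\<close>

lemma right_inverse_imp_left_inverse:
 fixes A B :: "nat => nat => 'k::comm_ring_1"
 assumes AB: "\<And>i k. i < N ==> k < N ==> (\<Sum>j<N. A i j * B j k) = (if i = k then 1 else 0)"
 shows "j < N ==> l < N ==> (\<Sum>k<N. B j k * A k l) = (if j = l then 1 else 0)"
proof -
 assume jl: "j < N" "l < N"
 define M where "M = mat N N (\<lambda>(i, j). A i j)"
 define K where "K = mat N N (\<lambda>(i, j). B i j)"
 have c: "M \<in> carrier_mat N N" "K \<in> carrier_mat N N" "adj_mat M \<in> carrier_mat N N"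
  by (auto simp: M_def K_def adj_mat_def)
 have MK: "M * K = 1\<^sub>m N"
  by (rule eq_matI) (auto simp: M_def K_def scalar_prod_def AB simp flip: lessThan_atLeast0)
 have d: "det M * det K = 1" using det_mult[OF c(1,2)] MK by simp
 have "det M \<cdot>\<^sub>m K = (det M \<cdot>\<^sub>m 1\<^sub>m N) * K" using mult_smult_assoc_mat[OF one_carrier_mat c(2)] c(2) by simp
 also have "... = (adj_mat M * M) * K" using adj_mat(3)[OF c(1)] by simp
 also have "... = adj_mat M * (M * K)" by (rule assoc_mult_mat[OF c(3,1,2)])
 also have "... = adj_mat M" using MK c by simp
 finally have K: "det M \<cdot>\<^sub>m K = adj_mat M" .
 have "K = (det K * det M) \<cdot>\<^sub>m K" using d by (intro eq_matI) (simp_all add: mult.commute[of "det K"])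
 also have "... = det K \<cdot>\<^sub>m (det M \<cdot>\<^sub>m K)" by (rule eq_matI) auto
 finally have K': "K = det K \<cdot>\<^sub>m adj_mat M" unfolding K .
 have "K * M = det K \<cdot>\<^sub>m (adj_mat M * M)" using mult_smult_assoc_mat[OF c(3,1), of "det K"] K' by simp
 also have "... = 1\<^sub>m N" using adj_mat(3)[OF c(1)] d by (auto intro!: eq_matI simp: mult.commute[of "det K"])
 finally have "(K * M) $$ (j, l) = 1\<^sub>m N $$ (j, l)" by simp
 thus ?thesis using jl by (auto simp: M_def K_def scalar_prod_def simp flip: lessThan_atLeast0)
qed

primrec lincomb :: "(nat => 'k) => (nat => 'k BC_term) => nat => 'k BC_term" where
 "lincomb c s 0 = AZero"
| "lincomb c s (Suc N) = AAdd (lincomb c s N) (AScale (c N) (s N))"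

lemma lincomb_aterms: "(\<And>i. i < N ==> s i \<in> aterms G) ==> lincomb c s N \<in> aterms G"
 by (induction N) auto

lemma em_lincomb:
 "(\<And>i. i < N ==> s i \<in> aterms (BC_gens r n)) ==>
  em z r n (lincomb c s N) = (\<Sum>i<N. BC_scale (c i) (em z r n (s i)))"
 by (induction N) (simp_all add: em_zero em_simps em_scale lincomb_aterms)

lemma act_lincomb: "act r (lincomb c s N) x = (\<Sum>i<N. c i *\<^sub>q act r (s i) x)"
 by (induction N) simp_all

lemma functional_sum:
 fixes N :: nat
 assumes \<phi>: "functional z X Y \<phi>"
 shows "\<phi> (cmp (\<Sum>i<N. c i *\<^sub>q x i) z X Y) = (\<Sum>i<N. c i * \<phi> (cmp (x i) z X Y))"
proof (induction N)
 case 0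
 have "Qeq z X Y (cmp (0 :: 'a Qf) z X Y) (MScale 0 (MZero X Y))"
  by (rule mor_cong_trans[OF cmp_ab(1)], rule mor_cong_sym, rule m_scale_zero)
 thus ?case using \<phi> by (auto simp: functional_def tyI)
next
 case (Suc N)
 have "\<phi> (cmp (y + c N *\<^sub>q x N) z X Y) = \<phi> (cmp y z X Y) + c N * \<phi> (cmp (x N) z X Y)" for y
  using cmp_ab(2)[OF cmp_refl cmp_scale(1)[OF cmp_refl], of z X Y y "c N" "x N"] \<phi> cmp_type[of X Y]
  unfolding functional_def by (metis tyI(5))
 thus ?case using Suc by simp
qed

section \<open>Injectivity of the action\<close>

context
 fixes z :: "'k::comm_ring_1" and r n :: nat
begin

text \<open>\<open>A\<close> holds the coefficients of the separated endomorphisms in the spanning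
  elements, \<open>B\<close> the values of the functionals on these elements. Then
  \<open>A B = 1\<close>, hence \<open>B A = 1\<close>, and the coefficients of a term are recovered
  from its action.\<close>

theorem act_inj:
 assumes t: "t \<in> aterms (BC_gens r n)" "u \<in> aterms (BC_gens r n)"
  and eq: "act r t (el z (srt r n) (srt r n) (MId (srt r n))) = act r u (el z (srt r n) (srt r n) (MId (srt r n)))"
 shows "acong (BC_gens r n) (BC_rel z r) t u"
proof -
 let ?P = "srt r n" and ?T = "aterms (BC_gens r n) :: 'k BC_term set" and ?em = "em z r n"
 let ?e = "el z ?P ?P (MId ?P)"
 define N :: nat where "N = 2 ^ (r + n) * fact (r + n)"
 obtain ts where ts: "length ts \<le> N" "set ts \<subseteq> ?T"
  "\<And>t. t \<in> ?T ==> \<exists>c. ?em t = (\<Sum>i<length ts. BC_scale (c i) (?em (ts ! i)))"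
  using BC_spanned[of r n z] unfolding N_def by blast
 \<comment> \<open>Padding with zeros to exactly \<open>N\<close> elements, since the matrices have
   to be square.\<close>
 define s where "s i = (if i < length ts then ts ! i else AZero)" for i
 have s: "s i \<in> ?T" for i using ts(2) by (auto simp: s_def)
 have span: "\<exists>c. ?em t = (\<Sum>i<N. BC_scale (c i) (?em (s i)))" if "t \<in> ?T" for t
 proof -
  obtain c where "?em t = (\<Sum>i<length ts. BC_scale (c i) (?em (ts ! i)))" using ts(3)[OF \<open>t \<in> ?T\<close>] by blast
  also have "... = (\<Sum>i<length ts. BC_scale (c i) (?em (s i)))" by (simp add: s_def)
  also have "... = (\<Sum>i<N. BC_scale (c i) (?em (s i)))"
   using ts(1) by (intro sum.mono_neutral_left) (auto simp: s_def em_zero BCf.scale_zero_right)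
  finally show ?thesis by blast
 qed
 have act_eq: "act r t ?e = (\<Sum>i<N. c i *\<^sub>q act r (s i) ?e)" if "t \<in> ?T" "?em t = (\<Sum>i<N. BC_scale (c i) (?em (s i)))" for t c
 proof -
  have "?em t = ?em (lincomb c s N)" using em_lincomb[of N s r n z c] s that(2) by simp
  hence "acong (BC_gens r n) (BC_rel z r) t (lincomb c s N)"
   using em_eq_iff[of t r n "lincomb c s N" z] that(1) lincomb_aterms[of N s "BC_gens r n" c] s by simp
  from act_acong[OF this el_Qat] show ?thesis by (simp add: act_lincomb)
 qed
 have "separated z ?P ?P N" using separated_End[of z ?P] by (simp add: N_def)
 then obtain fs \<phi> where fs: "\<And>i. i < N ==> (\<exists>p. Qhom p ?P ?P (fs i)) \<and> functional z ?P ?P (\<phi> i)"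
  "\<And>i j. i < N ==> j < N ==> \<phi> j (fs i) = (if i = j then 1 else 0)"
  unfolding separated_def by metis
 have "\<forall>i. \<exists>a. i < N --> el z ?P ?P (fs i) = (\<Sum>j<N. a j *\<^sub>q act r (s j) ?e)"
 proof
  fix i
  show "\<exists>a. i < N --> el z ?P ?P (fs i) = (\<Sum>j<N. a j *\<^sub>q act r (s j) ?e)"
  proof (cases "i < N")
   case True
   hence "Qty ?P ?P (fs i)" using fs(1) Qhom_type by blast
   then obtain t where t: "t \<in> ?T" "el z ?P ?P (fs i) = act r t ?e" using act_surj by blast
   obtain c where "?em t = (\<Sum>i<N. BC_scale (c i) (?em (s i)))" using span[OF t(1)] by blast
   from act_eq[OF t(1) this] t(2) show ?thesis by (intro exI[of _ c]) simp
  qed simp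
 qed
 from choice[OF this] obtain A where A: "\<And>i. i < N ==> el z ?P ?P (fs i) = (\<Sum>j<N. A i j *\<^sub>q act r (s j) ?e)"
  by blast
 define B where "B j k = \<phi> k (cmp (act r (s j) ?e) z ?P ?P)" for j k
 have AB: "(\<Sum>j<N. A i j * B j k) = (if i = k then 1 else 0)" if ik: "i < N" "k < N" for i k
 proof -
  have "Qty ?P ?P (fs i)" using fs(1)[OF ik(1)] Qhom_type by blast
  hence "\<phi> k (cmp (el z ?P ?P (fs i)) z ?P ?P) = \<phi> k (fs i)"
   using cmp_el fs(1)[OF ik(2)] unfolding functional_def by blast
  moreover have "\<phi> k (cmp (el z ?P ?P (fs i)) z ?P ?P) = (\<Sum>j<N. A i j * B j k)"
   unfolding A[OF ik(1)] B_def using fs(1)[OF ik(2)] by (intro functional_sum) simp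
  ultimately show ?thesis using fs(2)[OF ik] by simp
 qed
 have coeff: "c l = (\<Sum>k<N. \<phi> k (cmp (act r t ?e) z ?P ?P) * A k l)"
  if "t \<in> ?T" "?em t = (\<Sum>i<N. BC_scale (c i) (?em (s i)))" "l < N" for t c l
 proof -
  have "(\<Sum>k<N. \<phi> k (cmp (act r t ?e) z ?P ?P) * A k l) = (\<Sum>k<N. (\<Sum>j<N. c j * B j k) * A k l)"
   unfolding act_eq[OF that(1,2)] B_def
   by (intro sum.cong refl arg_cong[of _ _ "\<lambda>x. x * _"] functional_sum) (use fs(1) in simp)
  also have "... = (\<Sum>j<N. c j * (\<Sum>k<N. B j k * A k l))"
   unfolding sum_distrib_left sum_distrib_right by (subst sum.swap) (simp add: mult.assoc)
  also have "... = (\<Sum>j<N. c j * (if j = l then 1 else 0))"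
   using right_inverse_imp_left_inverse[of N A B, OF AB _ that(3)] by (intro sum.cong refl) simp
  also have "... = c l" using that(3) by (simp add: if_distrib[of "\<lambda>x. _ * x"] cong: if_cong)
  finally show ?thesis by simp
 qed
 obtain c d where c: "?em t = (\<Sum>i<N. BC_scale (c i) (?em (s i)))" and d: "?em u = (\<Sum>i<N. BC_scale (d i) (?em (s i)))"
  using span[OF t(1)] span[OF t(2)] by auto
 have "c l = d l" if "l < N" for l using coeff[OF t(1) c that] coeff[OF t(2) d that] eq by simp
 hence "?em t = ?em u" unfolding c d by simp
 thus ?thesis using em_eq_iff t by blast
qed

end

section \<open>The isomorphism\<close>

text \<open>
 The correspondence between terms is a relation: neither side has to choose representatives.
\<close>

lemma superalg_iso_by_correspondence:
 fixes sc :: "'k::comm_ring_1 => 't => 't" and sc' :: "'k => 'u => 'u"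
 assumes "graded_congruence T r pl ze sc mu on hg" "graded_congruence T' r' pl' ze' sc' mu' on' hg'"
  and tot: "\<And>f. f \<in> T ==> \<exists>t\<in>T'. \<rho> f t" "\<And>t. t \<in> T' ==> \<exists>f\<in>T. \<rho> f t"
  and eq: "\<And>f g t u. f \<in> T ==> g \<in> T ==> t \<in> T' ==> u \<in> T' ==> \<rho> f t ==> \<rho> g u ==> (f, g) \<in> r \<longleftrightarrow> (t, u) \<in> r'"
  and ops: "\<And>f g t u. f \<in> T ==> g \<in> T ==> t \<in> T' ==> u \<in> T' ==> \<rho> f t ==> \<rho> g u ==> \<rho> (pl f g) (pl' t u) \<and> \<rho> (mu f g) (mu' t u)"
   "\<And>c f t. f \<in> T ==> t \<in> T' ==> \<rho> f t ==> \<rho> (sc c f) (sc' c t)" "\<rho> on on'"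
  and hom: "\<And>p t. t \<in> hg' p ==> \<exists>f\<in>hg p. \<rho> f t"
 shows "quotient_superalgebra T r pl ze sc mu on hg \<cong>\<^sub>s quotient_superalgebra T' r' pl' ze' sc' mu' on' hg'"
proof -
 interpret a: graded_congruence T r pl ze sc mu on hg by fact
 interpret b: graded_congruence T' r' pl' ze' sc' mu' on' hg' by fact
 define h where "h x = (THE y. \<exists>f\<in>T. \<exists>t\<in>T'. x = a.cl f \<and> y = b.cl t \<and> \<rho> f t)" for x
 have h: "h (a.cl f) = b.cl t" if "f \<in> T" "t \<in> T'" "\<rho> f t" for f t
  unfolding h_def
 proof (rule the_equality)
  show "\<exists>f'\<in>T. \<exists>t'\<in>T'. a.cl f = a.cl f' \<and> b.cl t = b.cl t' \<and> \<rho> f' t'" using that by blast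
  fix y assume "\<exists>f'\<in>T. \<exists>t'\<in>T'. a.cl f = a.cl f' \<and> y = b.cl t' \<and> \<rho> f' t'"
  thus "y = b.cl t" using that eq a.cl_eq_iff b.cl_eq_iff by metis
 qed
 have hT: "\<exists>t\<in>T'. \<rho> f t \<and> h (a.cl f) = b.cl t" if "f \<in> T" for f using tot(1)[OF that] h[OF that] by blast
 have "inj_on h (carrier a.A)"
 proof (rule inj_onI)
  fix x y assume "x \<in> carrier a.A" "y \<in> carrier a.A" and xy: "h x = h y"
  then obtain f g where f: "f \<in> T" "x = a.cl f" and g: "g \<in> T" "y = a.cl g" by (auto simp: a.carrier_A)
  thus "x = y" using hT[OF f(1)] hT[OF g(1)] xy eq[OF f(1) g(1)] a.cl_eq_iff b.cl_eq_iff by metis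
 qed
 moreover have "h ` carrier a.A = carrier b.A"
 proof (intro subset_antisym subsetI)
  fix y assume "y \<in> carrier b.A"
  then obtain t where t: "t \<in> T'" "y = b.cl t" by (auto simp: b.carrier_A)
  then obtain f where "f \<in> T" "\<rho> f t" using tot(2) by blast
  thus "y \<in> h ` carrier a.A" using h[of f t] t by (auto simp: a.carrier_A)
 qed (use hT in \<open>auto simp: a.carrier_A b.carrier_A\<close>)
 moreover have "h \<in> Ring.ring_hom a.A b.A"
 proof (rule ring_hom_memI)
  show "h x \<in> carrier b.A" if "x \<in> carrier a.A" for x using that hT by (auto simp: a.carrier_A b.carrier_A)
  show "h \<one>\<^bsub>a.A\<^esub> = \<one>\<^bsub>b.A\<^esub>" using h[OF a.on b.on ops(3)] by (simp add: a.one_A b.one_A)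
  fix x y assume "x \<in> carrier a.A" "y \<in> carrier a.A"
  then obtain f g where f: "f \<in> T" "x = a.cl f" and g: "g \<in> T" "y = a.cl g" by (auto simp: a.carrier_A)
  obtain t u where t: "t \<in> T'" "\<rho> f t" and u: "u \<in> T'" "\<rho> g u" using tot(1) f g by blast
  note o = ops(1)[OF f(1) g(1) t(1) u(1) t(2) u(2)]
  show "h (x \<otimes>\<^bsub>a.A\<^esub> y) = h x \<otimes>\<^bsub>b.A\<^esub> h y" "h (x \<oplus>\<^bsub>a.A\<^esub> y) = h x \<oplus>\<^bsub>b.A\<^esub> h y"
   using o h[of f t] h[of g u] h[of "mu f g" "mu' t u"] h[of "pl f g" "pl' t u"] f g t u by simp_all
 qed
 moreover have "h (c \<odot>\<^bsub>a.A\<^esub> x) = c \<odot>\<^bsub>b.A\<^esub> h x" if x: "x \<in> carrier a.A" for c x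
 proof -
  obtain f where f: "f \<in> T" "x = a.cl f" using x by (auto simp: a.carrier_A)
  obtain t where t: "t \<in> T'" "\<rho> f t" using tot(1) f by blast
  show ?thesis using ops(2)[of f t c] h[of f t] h[of "sc c f" "sc' c t"] f t by simp
 qed
 moreover have "h ` part a.A p = part b.A p" for p
 proof (intro subset_antisym subsetI)
  fix y assume "y \<in> part b.A p"
  then obtain t where t: "t \<in> hg' p" "y = b.cl t" by (auto simp: b.part_A)
  then obtain f where "f \<in> hg p" "\<rho> f t" using hom by blast
  thus "y \<in> h ` part a.A p" using h[of f t] t a.hg_T b.hg_T unfolding a.part_A by (metis image_eqI)
 next
  fix y assume "y \<in> h ` part a.A p"
  then obtain f where f: "f \<in> hg p" "y = h (a.cl f)" by (auto simp: a.part_A)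
  note fT = a.hg_T[OF f(1)]
  obtain t where t: "t \<in> T'" "\<rho> f t" using tot(1)[OF fT] by blast
  \<comment> \<open>Only homogeneous terms are assumed to lift. For the converse, the parts of
    \<open>t\<close> are lifted and compared with \<open>f\<close> by uniqueness of homogeneous
    parts.\<close>
  obtain t0 t1 where s: "t0 \<in> hg' 0" "t1 \<in> hg' 1" "(t, pl' t0 t1) \<in> r'" using b.split[OF t(1)] by blast
  note sT = b.hg_T[OF s(1)] b.hg_T[OF s(2)]
  obtain f0 f1 where g: "f0 \<in> hg 0" "\<rho> f0 t0" "f1 \<in> hg 1" "\<rho> f1 t1" using hom s by blast
  note gT = a.hg_T[OF g(1)] a.hg_T[OF g(3)]
  have "\<rho> (pl f0 f1) (pl' t0 t1)" using ops(1)[OF gT sT g(2,4)] by blast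
  hence e: "a.cl f = a.cl (pl f0 f1)"
   using eq[OF fT a.pl_T[OF gT] t(1) b.pl_T[OF sT] t(2)] s(3) a.cl_eqI by blast
  show "y \<in> part b.A p"
  proof (cases p rule: bit_cases)
   case even
   have "a.cl (pl f ze) = a.cl f" using a.pl_commute[OF fT a.ze] a.pl_ze[OF fT] a.cl_eqI by metis
   hence "a.cl f = a.cl f0" using a.decomp_unique[of f f0 ze f1] f(1) g even a.hg_ze e by simp
   thus ?thesis using f(2) h[OF gT(1) sT(1) g(2)] s(1) even by (auto simp: b.part_A)
  next
   case odd
   have "a.cl (pl ze f) = a.cl f" using a.pl_ze[OF fT] a.cl_eqI by metis
   hence "a.cl f = a.cl f1" using a.decomp_unique[of ze f0 f f1] f(1) g odd a.hg_ze e by simp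
   thus ?thesis using f(2) h[OF gT(2) sT(2) g(4)] s(2) odd by (auto simp: b.part_A)
  qed
 qed
 ultimately have "h \<in> superalg_iso a.A b.A"
  unfolding superalg_iso_def ring_iso_def bij_betw_def by blast
 thus ?thesis unfolding a.A_def b.A_def is_superalg_iso_def by blast
qed

lemma gop_el:
 fixes z :: "'k::comm_ring_1"
 assumes g: "g \<in> BC_gens r n"
 shows "\<exists>f. Qhom (BC_par g) (srt r n) (srt r n) f \<and>
  (\<forall>X h. Qty X (srt r n) h --> gop r g (el z X (srt r n) h) = el z X (srt r n) (f \<^bold>\<circ> h))"
proof -
 let ?P = "srt r n"
 have op: "\<exists>f. Qhom (opar p) ?P ?P f \<and> (\<forall>X h. Qty X ?P h --> Op p k (el z X ?P h) = el z X ?P (f \<^bold>\<circ> h))"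
  if k: "isat k (odom p) ?P" and p: "ocod p = odom p" for p k
 proof -
  obtain A B where AB: "length A = k" "?P = A @ odom p @ B" using isat_repl_ex[OF k] by blast
  thus ?thesis using Op_el[of _ A p B _ z] Qhom_pad[OF Qhom_op[of p] AB(2), of ?P] p
   by (intro exI[of _ "pad A (omor p) B"]) auto
 qed
 have isat: "Suc k < r ==> isat k [Up, Up] ?P" "k < r ==> isat k [Up] ?P" "r \<le> k ==> Suc k < r + n ==> isat k [Down, Down] ?P"
  "r \<le> k ==> k < r + n ==> isat k [Down] ?P" for k
  by (simp_all add: isat_Cons nth_append) (simp_all add: isat_def)
 show ?thesis
 proof (cases g)
  case (GT i) thus ?thesis using op[of "i - 1" oU] isat(1)[of "i - 1"] g by (auto simp: BC_gens_iff)
 next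
  case (GTs i) thus ?thesis using op[of "r + i - 1" oD] isat(3)[of "r + i - 1"] g by (auto simp: BC_gens_iff)
 next
  case (GPi i) thus ?thesis using op[of "i - 1" oC] isat(2)[of "i - 1"] g by (auto simp: BC_gens_iff)
 next
  case (GPis i) thus ?thesis using op[of "r + i - 1" oS] isat(4)[of "r + i - 1"] g by (auto simp: BC_gens_iff)
 next
  case GE
  then obtain a b where ab: "r = Suc a" "n = Suc b" using g by (cases r; cases n) (auto simp: BC_gens_iff)
  let ?A = "replicate a Up" and ?B = "replicate b Down"
  have P: "?P = ?A @ [Up, Down] @ ?B" using ab by (simp add: replicate_append_same replicate_Suc flip: append_assoc)
  let ?f = "pad ?A cupL ?B" and ?g = "pad ?A capR ?B"
  have h: "Qhom 0 (?A @ ?B) ?P ?f" "Qhom 0 ?P (?A @ ?B) ?g"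
   using Qhom_pad[OF Qhom_op[of oCup], of "?A @ ?B" ?A ?B ?P] Qhom_pad[OF Qhom_op[of oK], of ?P ?A ?B "?A @ ?B"] unfolding P by simp_all
  have "gop r g (el z X ?P u) = el z X ?P ((?f \<^bold>\<circ> ?g) \<^bold>\<circ> u)" if u: "Qty X ?P u" for X u
  proof -
   have "\<k> a (el z X ?P u) = el z X (?A @ ?B) (?g \<^bold>\<circ> u)"
    using Op_el[of X ?A oK ?B u z] u unfolding P by simp
   moreover have "\<UU> a (el z X (?A @ ?B) (?g \<^bold>\<circ> u)) = el z X ?P (?f \<^bold>\<circ> ?g \<^bold>\<circ> u)"
    using Op_el[of X ?A oCup ?B "?g \<^bold>\<circ> u" z] tyI(6)[OF h(2)[THEN Qhom_type] u] unfolding P by simp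
   moreover have "el z X ?P (?f \<^bold>\<circ> ?g \<^bold>\<circ> u) = el z X ?P ((?f \<^bold>\<circ> ?g) \<^bold>\<circ> u)"
    by (rule el_cong[OF mor_cong_sym[OF mor_cong_comp_assoc[OF h[THEN Qhom_type] u]]])
   ultimately show ?thesis using GE ab by simp
  qed
  thus ?thesis using mor_homogI(3)[OF h refl] GE by auto
 qed
qed

context
 fixes z :: "'k::comm_ring_1" and r n :: nat
begin

abbreviation (input) P where "P \<equiv> srt r n"

text \<open>A term acts as postcomposition with one morphism, for all domains at once; the parity
  clause provides homogeneous preimages of homogeneous terms.\<close>

definition represents :: "'k BC_term => 'k Q_mor => bool" where
 "represents t f \<longleftrightarrow> Qty P P f \<and> (\<forall>p. ahomog BC_par p t --> Qhom p P P f) \<and>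
   (\<forall>X h. Qty X P h --> act r t (el z X P h) = el z X P (f \<^bold>\<circ> h))"

lemma representsD:
 assumes "represents t f"
 shows "Qty P P f" "ahomog BC_par p t ==> Qhom p P P f" "Qty X P h ==> act r t (el z X P h) = el z X P (f \<^bold>\<circ> h)"
 using assms by (auto simp: represents_def)

lemma represents_ops:
 assumes s: "represents s f" and t: "represents t g"
 shows "represents (AAdd s t) (MAdd f g)" "represents (AScale c s) (MScale c f)" "represents (s \<bullet> t) (f \<^bold>\<circ> g)"
proof -
 note f = representsD(1)[OF s] and g = representsD(1)[OF t]
 have "Qhom p P P (MAdd f g)" if "ahomog BC_par p (AAdd s t)" for p
  using that by cases (auto intro: homI s t representsD)
 moreover have "act r (AAdd s t) (el z X P h) = el z X P (MAdd f g \<^bold>\<circ> h)" if "Qty X P h" for X h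
  using el_cong[OF mor_cong_comp_add_left[OF f g that]] el_add[OF tyI(6)[OF f that] tyI(6)[OF g that]]
   representsD(3)[OF s that] representsD(3)[OF t that] by simp
 ultimately show "represents (AAdd s t) (MAdd f g)" using tyI(4)[OF f g] by (simp add: represents_def)
 have "Qhom p P P (MScale c f)" if "ahomog BC_par p (AScale c s)" for p
  using that by cases (auto intro: homI s representsD)
 moreover have "act r (AScale c s) (el z X P h) = el z X P (MScale c f \<^bold>\<circ> h)" if "Qty X P h" for X h
  using el_cong[OF mor_cong_comp_scale_left[OF f that]] el_scale[OF tyI(6)[OF f that]] representsD(3)[OF s that] by simp
 ultimately show "represents (AScale c s) (MScale c f)" using tyI(5)[OF f] by (simp add: represents_def)
 have "Qhom p P P (f \<^bold>\<circ> g)" if "ahomog BC_par p (s \<bullet> t)" for p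
  using that by cases (auto intro: homI s t representsD)
 moreover have "act r (s \<bullet> t) (el z X P h) = el z X P ((f \<^bold>\<circ> g) \<^bold>\<circ> h)" if "Qty X P h" for X h
  using el_cong[OF mor_cong_comp_assoc[OF f g that]] representsD(3)[OF s tyI(6)[OF g that]] representsD(3)[OF t that] by simp
 ultimately show "represents (s \<bullet> t) (f \<^bold>\<circ> g)" using tyI(6)[OF f g] by (simp add: represents_def)
qed

lemma act_el: "t \<in> aterms (BC_gens r n) ==> \<exists>f. represents t f"
proof (induction t)
 case (AGen g)
 then obtain f where f: "Qhom (BC_par g) P P f" "\<And>X h. Qty X P h ==> gop r g (el z X P h) = el z X P (f \<^bold>\<circ> h)"
  using gop_el[of g r n z] by auto
 have "Qhom p P P f" if "ahomog BC_par p (AGen g)" for p using that f(1) by cases auto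
 thus ?case using f Qhom_type[OF f(1)] by (auto simp: represents_def)
next
 case AOne
 have "Qhom p P P (MId P)" if "ahomog BC_par p AOne" for p using that by cases (auto intro: homI)
 thus ?case
  by (intro exI[of _ "MId P"]) (auto simp: represents_def intro: tyI el_cong mor_cong_sym mor_cong_comp_id_left)
next
 case AZero
 have "el z X P (MZero P P \<^bold>\<circ> h) = 0" if "Qty X P h" for X h
  using el_cong[OF m_comp_zero_left[OF that]] by (simp add: el_zero)
 thus ?case by (intro exI[of _ "MZero P P"]) (auto simp: represents_def intro: tyI homI)
qed (auto intro: represents_ops)

end

lemma count_list_card: "count_list X a = card {i. i < length X \<and> X ! i = a}"
 unfolding count_list_eq_length_filter length_filter_conv_card by (rule arg_cong[of _ _ card]) auto

theorem corollary4p9: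
  fixes z :: "'k::comm_ring_1" and Xs :: "Q_obj list" and m r :: nat
  assumes "CHAR('k) \<noteq> 2"
    and "length Xs = m"
    and "r = card {i. i < m \<and> Xs ! i = Up}"
  shows "End_Q z Xs \<cong>\<^sub>s BC z r (m - r)"
proof -
 define n where "n = m - r"
 define P where "P = srt r n"
 have r: "r = count_list Xs Up" using assms by (simp add: count_list_card)
 have "length Xs = count_list Xs Up + count_list Xs Down" by (induction Xs) (auto intro: Q_obj.exhaust)
 hence n: "n = count_list Xs Down" using assms(2) r by (simp add: n_def)
 obtain \<theta> \<theta>' where iso: "Qiso z Xs P \<theta> \<theta>'" using Qiso_srt[of z Xs] by (auto simp: P_def r n)
 have t: "Qty Xs P \<theta>" "Qty P Xs \<theta>'" and h: "Qhom 0 Xs P \<theta>" "Qhom 0 P Xs \<theta>'"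
  and c: "Qeq z Xs Xs (\<theta>' \<^bold>\<circ> \<theta>) (MId Xs)" "Qeq z P P (\<theta> \<^bold>\<circ> \<theta>') (MId P)"
  using iso by (auto simp: Qiso_def dest: Qhom_type)
 define conj where "conj f = \<theta> \<^bold>\<circ> f \<^bold>\<circ> \<theta>'" for f
 define idel where "idel = el z P P (MId P)"
 \<comment> \<open>An endomorphism of \<open>Xs\<close>, transported to the sorted word, corresponds
   to every term that produces it from the identity.\<close>
 define \<rho> where "\<rho> f t \<longleftrightarrow> el z P P (conj f) = act r t idel" for f t
 have conj_type: "Qty P P (conj f)" if "Qty Xs Xs f" for f
  unfolding conj_def by (rule tyI(6) t that)+
 have conj_back: "Qeq z P P (conj (\<theta>' \<^bold>\<circ> g \<^bold>\<circ> \<theta>)) g" if "Qty P P g" for g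
  unfolding conj_def by (rule Qiso_conj[OF Qiso_sym[OF iso] that])
 have conj_comp: "Qeq z P P (conj f \<^bold>\<circ> conj g) (conj (f \<^bold>\<circ> g))" if f: "Qty Xs Xs f" and g: "Qty Xs Xs g" for f g
 proof -
  have g': "Qty P Xs (g \<^bold>\<circ> \<theta>')" "Qty P Xs (f \<^bold>\<circ> \<theta>')" by (rule tyI(6) t f g)+
  have "Qeq z P P (conj f \<^bold>\<circ> conj g) (\<theta> \<^bold>\<circ> (f \<^bold>\<circ> \<theta>') \<^bold>\<circ> conj g)"
   unfolding conj_def[of f] by (rule mor_cong_comp_assoc[OF t(1) g'(2) conj_type[OF g]])
  also have "Qeq z P P ... (\<theta> \<^bold>\<circ> f \<^bold>\<circ> \<theta>' \<^bold>\<circ> conj g)"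
   by (rule mor_cong_comp_cong[OF mor_cong_refl[OF t(1)] mor_cong_comp_assoc[OF f t(2) conj_type[OF g]]])
  also have "Qeq z P P ... (\<theta> \<^bold>\<circ> f \<^bold>\<circ> g \<^bold>\<circ> \<theta>')"
   unfolding conj_def by (rule mor_cong_comp_cong[OF mor_cong_refl[OF t(1)] mor_cong_comp_cong[OF mor_cong_refl[OF f] comp_cancel[OF t c(1) g'(1)]]])
  also have "Qeq z P P ... (conj (f \<^bold>\<circ> g))"
   unfolding conj_def by (rule mor_cong_comp_cong[OF mor_cong_refl[OF t(1)] mor_cong_sym[OF mor_cong_comp_assoc[OF f g t(2)]]])
  finally show ?thesis .
 qed
 have conj_add: "Qeq z P P (conj (MAdd f g)) (MAdd (conj f) (conj g))" if "Qty Xs Xs f" "Qty Xs Xs g" for f g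
  unfolding conj_def by (rule comp_middle_linear(1)[OF t(2,1) that])
 have conj_scale: "Qeq z P P (conj (MScale a f)) (MScale a (conj f))" if "Qty Xs Xs f" for a f
  unfolding conj_def by (rule comp_middle_linear(2)[OF t(2,1) that that])
 have conj_iff: "Qeq z P P (conj f) (conj g) \<longleftrightarrow> Qeq z Xs Xs f g" if "Qty Xs Xs f" "Qty Xs Xs g" for f g
 proof
  assume "Qeq z P P (conj f) (conj g)"
  hence "Qeq z Xs Xs (\<theta>' \<^bold>\<circ> conj f \<^bold>\<circ> \<theta>) (\<theta>' \<^bold>\<circ> conj g \<^bold>\<circ> \<theta>)"
   using t by (intro mor_cong_comp_cong[OF mor_cong_refl[OF t(2)] mor_cong_comp_cong[OF _ mor_cong_refl[OF t(1)]]])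
  thus "Qeq z Xs Xs f g"
   using Qiso_conj[OF iso that(1)] Qiso_conj[OF iso that(2)] unfolding conj_def by (blast intro: mor_cong_trans mor_cong_sym)
 next
  show "Qeq z Xs Xs f g ==> Qeq z P P (conj f) (conj g)"
   unfolding conj_def by (rule mor_cong_comp_cong[OF mor_cong_refl[OF t(1)] mor_cong_comp_cong[OF _ mor_cong_refl[OF t(2)]]])
 qed
 have "quotient_superalgebra {f. Qty Xs Xs f} {(f, g). Qeq z Xs Xs f g} MAdd (MZero Xs Xs) MScale MComp (MId Xs)
   (\<lambda>p. {f. Qhom p Xs Xs f}) \<cong>\<^sub>s
  quotient_superalgebra (aterms (BC_gens r n)) {(s, t). acong (BC_gens r n) (BC_rel z r) s t} AAdd AZero AScale AMult AOne
   (\<lambda>p. {t \<in> aterms (BC_gens r n). ahomog BC_par p t})"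
 proof (rule superalg_iso_by_correspondence[where \<rho> = \<rho>])
  show "graded_congruence {f. Qty Xs Xs f} {(f, g). Qeq z Xs Xs f g} MAdd (MZero Xs Xs) MScale MComp (MId Xs) (\<lambda>p. {f. Qhom p Xs Xs f})"
   by (rule graded_congruence_mor) (rule Q_rel_homog)
  show "graded_congruence (aterms (BC_gens r n)) {(s, t). acong (BC_gens r n) (BC_rel z r) s t} AAdd AZero AScale AMult AOne
   (\<lambda>p. {t \<in> aterms (BC_gens r n). ahomog BC_par p t})"
   by (rule graded_congruence_acong) (rule BC_rel_homog)
  show "\<exists>t\<in>aterms (BC_gens r n). \<rho> f t" if "f \<in> {f. Qty Xs Xs f}" for f
   using act_surj[of r n "conj f" z] conj_type that unfolding \<rho>_def idel_def P_def by simp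
  have mk: "\<exists>f. Qty Xs Xs f \<and> \<rho> f t \<and> (\<forall>p. ahomog BC_par p t --> Qhom p Xs Xs f)" if tT: "t \<in> aterms (BC_gens r n)" for t
  proof -
   obtain g where g: "Qty P P g" "\<And>p. ahomog BC_par p t ==> Qhom p P P g"
    "\<And>X h. Qty X P h ==> act r t (el z X P h) = el z X P (g \<^bold>\<circ> h)" using act_el[OF tT, of z] unfolding represents_def P_def by blast
   have "\<rho> (\<theta>' \<^bold>\<circ> g \<^bold>\<circ> \<theta>) t"
    unfolding \<rho>_def idel_def using el_cong[OF conj_back[OF g(1)]] g(3)[OF tyI(2)] el_cong[OF mor_cong_comp_id_right[OF g(1)]] by simp
   moreover have "Qhom p Xs Xs (\<theta>' \<^bold>\<circ> g \<^bold>\<circ> \<theta>)" if "ahomog BC_par p t" for p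
    using mor_homogI(3)[OF h(2) mor_homogI(3)[OF g(2)[OF that] h(1) refl] refl] by simp
   moreover have "Qty Xs Xs (\<theta>' \<^bold>\<circ> g \<^bold>\<circ> \<theta>)" by (rule tyI(6) t g(1))+
   ultimately show ?thesis by blast
  qed
  show "\<exists>f\<in>{f. Qty Xs Xs f}. \<rho> f t" if "t \<in> aterms (BC_gens r n)" for t using mk[OF that] by blast
  show "\<exists>f\<in>{f. Qhom p Xs Xs f}. \<rho> f t" if "t \<in> {t \<in> aterms (BC_gens r n). ahomog BC_par p t}" for p t
   using mk[of t] that by blast
  show "(f, g) \<in> {(f, g). Qeq z Xs Xs f g} \<longleftrightarrow> (t, u) \<in> {(s, t). acong (BC_gens r n) (BC_rel z r) s t}"
   if "f \<in> {f. Qty Xs Xs f}" "g \<in> {f. Qty Xs Xs f}" "t \<in> aterms (BC_gens r n)" "u \<in> aterms (BC_gens r n)" "\<rho> f t" "\<rho> g u" for f g t u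
  proof -
   have "Qeq z Xs Xs f g \<longleftrightarrow> act r t idel = act r u idel"
    using that conj_iff[of f g] conj_type el_cong[of z P P "conj f" "conj g"] el_eqD[of z P P "conj f" "conj g"] by (auto simp: \<rho>_def)
   also have "... \<longleftrightarrow> acong (BC_gens r n) (BC_rel z r) t u"
    using act_inj[OF that(3,4)] act_acong[of r n z t u, OF _ el_Qat] unfolding idel_def P_def by blast
   finally show ?thesis by simp
  qed
  show "\<rho> (MAdd f g) (AAdd t u) \<and> \<rho> (f \<^bold>\<circ> g) (t \<bullet> u)"
   if fg: "f \<in> {f. Qty Xs Xs f}" "g \<in> {f. Qty Xs Xs f}" "t \<in> aterms (BC_gens r n)" "u \<in> aterms (BC_gens r n)" "\<rho> f t" "\<rho> g u" for f g t u
  proof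
   show "\<rho> (MAdd f g) (AAdd t u)"
    using fg el_cong[OF conj_add[of f g]] el_add[of P P "conj f" "conj g" z] conj_type by (simp add: \<rho>_def)
   \<comment> \<open>\<open>\<rho> f t\<close> describes the action of \<open>t\<close> on the
     identity only. As postcomposition with \<open>k\<close> it is determined on
     \<open>conj g\<close> as well, and \<open>k\<close> agrees with \<open>conj f\<close>.\<close>
   obtain k where k: "Qty P P k" "\<And>X h. Qty X P h ==> act r t (el z X P h) = el z X P (k \<^bold>\<circ> h)"
    using act_el[OF fg(3), of z] unfolding represents_def P_def by blast
   have "el z P P (conj f) = el z P P k"
    using fg(5) k(2)[OF tyI(2)] el_cong[OF mor_cong_comp_id_right[OF k(1)]] by (simp add: \<rho>_def idel_def)
   hence "Qeq z P P (conj f) k" by (rule el_eqD) (use conj_type k(1) fg(1) in auto)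
   hence "el z P P (k \<^bold>\<circ> conj g) = el z P P (conj (f \<^bold>\<circ> g))"
    using fg conj_comp[of f g] conj_type[of g] by (intro el_cong) (blast intro: mor_cong_trans mor_cong_sym mor_cong_comp_cong mor_cong_refl)
   thus "\<rho> (f \<^bold>\<circ> g) (t \<bullet> u)" using fg k(2)[OF conj_type[of g]] by (simp add: \<rho>_def)
  qed
  show "\<rho> (MScale a f) (AScale a t)" if "f \<in> {f. Qty Xs Xs f}" "t \<in> aterms (BC_gens r n)" "\<rho> f t" for a f t
   using that el_cong[OF conj_scale[of f a]] el_scale[of P P "conj f" z a] conj_type by (simp add: \<rho>_def)
  have "Qeq z P P (conj (MId Xs)) (MId P)"
   unfolding conj_def by (rule mor_cong_trans[OF mor_cong_comp_cong[OF mor_cong_refl[OF t(1)] mor_cong_comp_id_left[OF t(2)]] c(2)])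
  thus "\<rho> (MId Xs) AOne" unfolding \<rho>_def idel_def using el_cong by auto
 qed
 thus ?thesis
  by (simp add: End_Q_def End_superalgebra_def BC_def presented_superalgebra_def n_def)
qed

end
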